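(* Let $q$ be a prime power, $n\in\mathbb{N}$, and let $G$ be either $\mathrm{SL}_n(\mathbb{F}_q)$ or $\mathrm{GL}_n(\mathbb{F}_q)$. Let $1\le d\le n$, $t>0$, and let $f:G\to\{0,1\}$ be $(d,\epsilon)$-global with $\epsilon\ge q^{-t^2}$. Then $$\|f_{\le d}\|_2^2\le q^{926dt}\,\mathbb{E}[f]\,\epsilon.$$
   Context: For a finite set $X$, $L^2(X)$ is the space of functions $X\to\mathbb{C}$ with $\|f\|_2^2=\mathbb{E}_{x\in X}|f(x)|^2$ and $\mathbb{E}[f]=\mathbb{E}_{x\in X}f(x)$ (uniform $x$). In the claim, norm and expectation are over $G$. Levels: let $\omega$ be the permutation representation of $G$ on $L^2(\mathbb{F}_q^n)$, $\omega(g)f(x)=f(g^{-1}x)$. An irreducible complex representation of $G$ has strict tensor rank $d$ if it is a subrepresentation of $\omega^{\otimes d}$ but not of $\omega^{\otimes(d-1)}$ ($\omega^{\otimes0}$ is the trivial representation). It has tensor rank $d$ if $d$ is the smallest integer such that it can be written as $\rho'\otimes\chi$ with $\rho'$ of strict tensor rank $d$ and $\chi:G\to\mathbb{C}^\times$ a homomorphism. $L^2(G)_{\le d}$ is the span of the matrix coefficients $g\mapsto\langle\rho(g)v,u\rangle$ of the irreducible representations $\rho$ of tensor rank $\le d$, and $f_{\le d}$ is the orthogonal projection of $f$ onto $L^2(G)_{\le d}$. Globalness: let $V=\mathbb{F}_q^n$ and $\mathcal{L}(V,V)\supset G$ the space of linear maps $V\to V$. Let $j(f)$ be the extension of $f$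 to $\mathcal{L}(V,V)$ by zero outside $G$. For $V',W'\le V$, identify $\mathcal{L}(V/V',W')$ with $\{S\in\mathcal{L}(V,V):V'\le\ker S,\ \mathrm{im}\,S\le W'\}$. $f$ is $(d,\epsilon)$-global if for all $V',W'\le V$ with $\dim V'+\mathrm{codim}\,W'=d$ and all $T\in\mathcal{L}(V,V)$, the function $S\mapsto j(f)(S+T)$ on $\mathcal{L}(V/V',W')$ satisfies $\mathbb{E}_{S\in\mathcal{L}(V/V',W')}|j(f)(S+T)|^2\le\epsilon$. *)

theory Defs
  imports
    "Jordan_Normal_Form.VS_Connect"
    "HOL-Library.Function_Algebras"
    "HOL-Analysis.Analysis"
begin

section \<open>The groups\<close>

definition general_linear :: "('a::field^'n^'n) monoid" where
  "general_linear =
     \<lparr>carrier = {A. invertible A}, monoid.mult = (**), one = Finite_Cartesian_Product.mat 1\<rparr>"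

definition special_linear :: "('a::field^'n^'n) monoid" where
  "special_linear =
     \<lparr>carrier = {A. Determinants.det A = 1}, monoid.mult = (**), one = Finite_Cartesian_Product.mat 1\<rparr>"

lemma group_general_linear: "Group.group (general_linear :: ('a::field^'n^'n) monoid)"
proof (rule groupI)
  fix A :: "'a^'n^'n"
  assume "A \<in> carrier general_linear"
  then show "\<exists>B\<in>carrier general_linear. B \<otimes>\<^bsub>general_linear\<^esub> A = \<one>\<^bsub>general_linear\<^esub>"
    by (auto simp: general_linear_def invertible_def)
qed (auto simp: general_linear_def matrix_mul_assoc invertible_det_nz det_mul)

lemma group_special_linear: "Group.group (special_linear :: ('a::field^'n^'n) monoid)"
proof (rule groupI)
  fix A :: "'a^'n^'n"
  assume "A \<in> carrier special_linear"
  then have A: "Determinants.det A = 1"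
    by (simp add: special_linear_def)
  then obtain B where B: "B ** A = Finite_Cartesian_Product.mat 1"
    using invertible_det_nz[of A] by (auto simp: invertible_def)
  then have "Determinants.det B = 1"
    using A det_mul[of B A] by simp
  then show "\<exists>B\<in>carrier special_linear. B \<otimes>\<^bsub>special_linear\<^esub> A = \<one>\<^bsub>special_linear\<^esub>"
    using B by (auto simp: special_linear_def)
qed (auto simp: special_linear_def det_mul matrix_mul_assoc)

section \<open>Functions on finite sets\<close>

text \<open>
  \<open>L\<^sup>2(X)\<close> for a finite set \<open>X\<close> consists of the functions on the
  ambient type that vanish outside \<open>X\<close>.
\<close>

definition mean :: "'x set \<Rightarrow> ('x \<Rightarrow> 'c) \<Rightarrow> 'c::field_char_0" where
  "mean X f = (\<Sum>x\<in>X. f x) / of_nat (card X)"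

definition L2 :: "'x set \<Rightarrow> ('x \<Rightarrow> complex) set" where
  "L2 X = {f. \<forall>x. x \<notin> X \<longrightarrow> f x = 0}"

definition L2_inner :: "'x set \<Rightarrow> ('x \<Rightarrow> complex) \<Rightarrow> ('x \<Rightarrow> complex) \<Rightarrow> complex" where
  "L2_inner X f h = mean X (\<lambda>x. f x * cnj (h x))"

definition L2_norm :: "'x set \<Rightarrow> ('x \<Rightarrow> complex) \<Rightarrow> real" where
  "L2_norm X f = sqrt (mean X (\<lambda>x. (cmod (f x))\<^sup>2))"

definition fscale :: "complex \<Rightarrow> ('x \<Rightarrow> complex) \<Rightarrow> ('x \<Rightarrow> complex)" where
  "fscale c f = (\<lambda>x. c * f x)"

global_interpretation fun_space: vector_space fscale
  by unfold_locales (simp_all add: fscale_def fun_eq_iff algebra_simps)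

definition orth_proj ::
    "'x set \<Rightarrow> ('x \<Rightarrow> complex) set \<Rightarrow> ('x \<Rightarrow> complex) \<Rightarrow> ('x \<Rightarrow> complex)" where
  "orth_proj X L f = (THE h. h \<in> L \<and> (\<forall>u\<in>L. L2_inner X (f - h) u = 0))"

section \<open>Representations\<close>

text \<open>
  Up to isomorphism every finite-dimensional complex representation acts on some
  \<open>\<complex>\<^sup>N\<close>, that is, it is a homomorphism into the unit group of the ring of
  \<open>N \<times> N\<close> matrices.
\<close>

definition representation :: "'g monoid \<Rightarrow> nat \<Rightarrow> ('g \<Rightarrow> complex Matrix.mat) \<Rightarrow> bool" where
  "representation G N \<rho> \<longleftrightarrow> \<rho> \<in> hom G (units_of (ring_mat TYPE(complex) N ()))"

definition irreducible_rep :: "'g monoid \<Rightarrow> nat \<Rightarrow> ('g \<Rightarrow> complex Matrix.mat) \<Rightarrow> bool" where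
  "irreducible_rep G N \<rho> \<longleftrightarrow>
     representation G N \<rho> \<and> N > 0 \<and>
     (\<forall>W. VectorSpace.subspace class_ring W (module_vec TYPE(complex) N) \<and>
          (\<forall>g\<in>carrier G. \<forall>w\<in>W. \<rho> g *\<^sub>v w \<in> W) \<longrightarrow>
          W = {0\<^sub>v N} \<or> W = carrier_vec N)"

definition linear_character :: "'g monoid \<Rightarrow> ('g \<Rightarrow> complex) \<Rightarrow> bool" where
  "linear_character G \<psi> \<longleftrightarrow> \<psi> \<in> hom G (units_of (class_ring :: complex ring))"

text \<open>
  The representation \<open>\<rho>\<close> on \<open>\<complex>\<^sup>N\<close> is (isomorphic to) a subrepresentation of the action
  \<open>\<tau>\<close> on the space \<open>U\<close> of functions: there is a linear injective intertwiner.
\<close>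

definition subrepresentation ::
    "'g monoid \<Rightarrow> nat \<Rightarrow> ('g \<Rightarrow> complex Matrix.mat) \<Rightarrow>
     ('x \<Rightarrow> complex) set \<Rightarrow> ('g \<Rightarrow> ('x \<Rightarrow> complex) \<Rightarrow> ('x \<Rightarrow> complex)) \<Rightarrow> bool" where
  "subrepresentation G N \<rho> U \<tau> \<longleftrightarrow>
     (\<exists>T. T \<in> carrier_vec N \<rightarrow> U \<and>
          (\<forall>v\<in>carrier_vec N. \<forall>w\<in>carrier_vec N. T (v + w) = T v + T w) \<and>
          (\<forall>c. \<forall>v\<in>carrier_vec N. T (c \<cdot>\<^sub>v v) = fscale c (T v)) \<and>
          inj_on T (carrier_vec N) \<and>
          (\<forall>g\<in>carrier G. \<forall>v\<in>carrier_vec N. T (\<rho> g *\<^sub>v v) = \<tau> g (T v)))"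

section \<open>Tensor powers of the permutation representation\<close>

definition perm_rep :: "'a::field^'n^'n \<Rightarrow> ('a^'n \<Rightarrow> complex) \<Rightarrow> ('a^'n \<Rightarrow> complex)" where
  "perm_rep g f = (\<lambda>x. f (matrix_inv g *v x))"

definition tuples :: "nat \<Rightarrow> 'x list set" where
  "tuples d = {xs. length xs = d}"

text \<open>
  \<open>L\<^sup>2(X)\<^sup>\<otimes>\<^sup>d\<close> is \<open>L\<^sup>2(X\<^sup>d)\<close>, where \<open>u\<^sub>1 \<otimes> \<dots> \<otimes> u\<^sub>d\<close> is the function
  \<open>(x\<^sub>1, \<dots>, x\<^sub>d) \<mapsto> u\<^sub>1(x\<^sub>1) \<cdots> u\<^sub>d(x\<^sub>d)\<close>.  In the basis of point masses, the entry of
  \<open>A\<^sup>\<otimes>\<^sup>d\<close> at \<open>(xs, ys)\<close> is the product of the entries of \<open>A\<close> at \<open>(x\<^sub>i, y\<^sub>i)\<close>.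
\<close>

definition simple_tensor :: "('x \<Rightarrow> complex) list \<Rightarrow> ('x list \<Rightarrow> complex)" where
  "simple_tensor us =
     (\<lambda>xs. if xs \<in> tuples (length us) then \<Prod>i<length us. (us ! i) (xs ! i) else 0)"

definition tensor_power ::
    "nat \<Rightarrow> (('x \<Rightarrow> complex) \<Rightarrow> ('x \<Rightarrow> complex)) \<Rightarrow> ('x list \<Rightarrow> complex) \<Rightarrow> ('x list \<Rightarrow> complex)"
  where
  "tensor_power d A F =
     (\<lambda>xs. if xs \<in> tuples d
           then \<Sum>ys\<in>tuples d. (\<Prod>i<d. A (indicator {ys ! i}) (xs ! i)) * F ys
           else 0)"

lemma tuples_0: "tuples 0 = {[]}"
  by (auto simp: tuples_def)

lemma tuples_Suc: "tuples (Suc d) = (\<lambda>(x, xs). x # xs) ` (UNIV \<times> tuples d)"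
  by (auto simp: tuples_def length_Suc_conv image_iff)

lemma finite_tuples: "finite (tuples d :: 'x::finite list set)"
  by (induction d) (simp_all add: tuples_0 tuples_Suc)

lemma sum_tuples_prod:
  fixes k :: "nat \<Rightarrow> 'x::finite \<Rightarrow> complex"
  shows "(\<Sum>ys\<in>tuples d. \<Prod>i<d. k i (ys ! i)) = (\<Prod>i<d. \<Sum>y\<in>UNIV. k i y)"
proof (induction d arbitrary: k)
  case 0
  show ?case by (simp add: tuples_0)
next
  case (Suc d)
  have inj: "inj_on (\<lambda>(x, xs). x # xs) (UNIV \<times> tuples d :: ('x \<times> 'x list) set)"
    by (auto simp: inj_on_def)
  have "(\<Sum>ys\<in>tuples (Suc d). \<Prod>i<Suc d. k i (ys ! i)) =
      (\<Sum>(y, ys)\<in>UNIV \<times> tuples d. k 0 y * (\<Prod>i<d. k (Suc i) (ys ! i)))"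
    unfolding tuples_Suc
    by (subst sum.reindex[OF inj])
       (simp add: prod.lessThan_Suc_shift case_prod_beta del: prod.lessThan_Suc)
  also have "\<dots> = (\<Sum>y\<in>UNIV. k 0 y) * (\<Sum>ys\<in>tuples d. \<Prod>i<d. k (Suc i) (ys ! i))"
    by (simp add: sum_product sum.cartesian_product)
  also have "\<dots> = (\<Prod>i<Suc d. \<Sum>y\<in>UNIV. k i y)"
    by (subst Suc.IH) (simp only: prod.lessThan_Suc_shift)
  finally show ?case .
qed

lemma sum_fun_apply: "(\<Sum>y\<in>S. h y) x = (\<Sum>y\<in>S. h y x :: complex)"
  by (induction S rule: infinite_finite_induct) simp_all

lemma fun_space_point_masses:
  fixes u :: "'x::finite \<Rightarrow> complex"
  shows "u = (\<Sum>y\<in>UNIV. fscale (u y) (indicator {y}))"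
proof
  fix x
  have "u y * indicator {y} x = (if y = x then u x else 0)" for y
    by (auto simp: indicator_def)
  then show "u x = (\<Sum>y\<in>UNIV. fscale (u y) (indicator {y})) x"
    by (simp add: sum_fun_apply fscale_def)
qed

lemma tensor_power_simple_tensor:
  fixes A :: "('x::finite \<Rightarrow> complex) \<Rightarrow> ('x \<Rightarrow> complex)"
  assumes A: "Vector_Spaces.linear fscale fscale A"
  shows "tensor_power (length us) A (simple_tensor us) = simple_tensor (map A us)"
proof
  fix xs :: "'x list"
  interpret A: Vector_Spaces.linear fscale fscale A by (fact A)
  have *: "A u x = (\<Sum>y\<in>UNIV. A (indicator {y}) x * u y)" for u x
  proof -
    have "A u = (\<Sum>y\<in>UNIV. fscale (u y) (A (indicator {y})))"
      using arg_cong[OF fun_space_point_masses[of u], of A] by (simp only: A.sum A.scale)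
    then have "A u x = (\<Sum>y\<in>UNIV. fscale (u y) (A (indicator {y}))) x"
      by (rule fun_cong)
    then show ?thesis by (simp only: sum_fun_apply fscale_def mult.commute)
  qed
  show "tensor_power (length us) A (simple_tensor us) xs = simple_tensor (map A us) xs"
  proof (cases "xs \<in> tuples (length us)")
    case True
    have "tensor_power (length us) A (simple_tensor us) xs =
        (\<Sum>ys\<in>tuples (length us). \<Prod>i<length us. A (indicator {ys ! i}) (xs ! i) * (us ! i) (ys ! i))"
      using True by (simp add: tensor_power_def simple_tensor_def prod.distrib)
    also have "\<dots> = (\<Prod>i<length us. A (us ! i) (xs ! i))"
      unfolding *[of "us ! _"]
      by (rule sum_tuples_prod[where k = "\<lambda>i y. A (indicator {y}) (xs ! i) * (us ! i) y"])
    finally show ?thesis using True by (simp add: simple_tensor_def)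
  qed (simp add: tensor_power_def simple_tensor_def)
qed

lemma tensor_power_perm_rep:
  fixes g :: "'a::{field,finite}^'n^'n"
  assumes "xs \<in> tuples d"
  shows "tensor_power d (perm_rep g) F xs = F (map ((*v) (matrix_inv g)) xs)"
proof -
  let ?zs = "map ((*v) (matrix_inv g)) xs"
  have len: "length xs = d" using assms by (simp add: tuples_def)
  have "(\<Prod>i<d. perm_rep g (indicator {ys ! i}) (xs ! i)) * F ys =
      (if ys = ?zs then F ?zs else 0)" if "ys \<in> tuples d" for ys
  proof (cases "ys = ?zs")
    case True
    then show ?thesis using len by (simp add: perm_rep_def)
  next
    case False
    have "length ys = length ?zs"
      using that len by (simp add: tuples_def)
    with False obtain i where "i < length ys" "ys ! i \<noteq> ?zs ! i"
      using nth_equalityI by blast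
    then have "i < d" "matrix_inv g *v (xs ! i) \<noteq> ys ! i"
      using that len by (auto simp: tuples_def)
    then have "(\<Prod>i<d. perm_rep g (indicator {ys ! i}) (xs ! i)) = 0"
      by (intro prod_zero bexI[of _ i]) (simp_all add: perm_rep_def)
    then show ?thesis using False by simp
  qed
  then have "tensor_power d (perm_rep g) F xs =
      (\<Sum>ys\<in>tuples d. if ys = ?zs then F ?zs else 0)"
    using assms by (simp add: tensor_power_def cong: sum.cong)
  then show ?thesis
    using len by (simp add: finite_tuples) (simp add: tuples_def)
qed

section \<open>Tensor rank and the level projection\<close>

definition in_perm_tensor_power ::
    "('a::{field,finite}^'n^'n) monoid \<Rightarrow> nat \<Rightarrow> nat \<Rightarrow> ('a^'n^'n \<Rightarrow> complex Matrix.mat) \<Rightarrow> bool" where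
  "in_perm_tensor_power G d N \<rho> \<longleftrightarrow>
     subrepresentation G N \<rho> (L2 (tuples d)) (\<lambda>g. tensor_power d (perm_rep g))"

text \<open>For \<open>d = 0\<close> there is no preceding tensor power to exclude.\<close>

definition strict_tensor_rank ::
    "('a::{field,finite}^'n^'n) monoid \<Rightarrow> nat \<Rightarrow> ('a^'n^'n \<Rightarrow> complex Matrix.mat) \<Rightarrow> nat \<Rightarrow> bool" where
  "strict_tensor_rank G N \<rho> d \<longleftrightarrow>
     irreducible_rep G N \<rho> \<and> in_perm_tensor_power G d N \<rho> \<and>
     (d > 0 \<longrightarrow> \<not> in_perm_tensor_power G (d - 1) N \<rho>)"

definition twist_of_strict_tensor_rank ::
    "('a::{field,finite}^'n^'n) monoid \<Rightarrow> nat \<Rightarrow> ('a^'n^'n \<Rightarrow> complex Matrix.mat) \<Rightarrow> nat \<Rightarrow> bool" where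
  "twist_of_strict_tensor_rank G N \<rho> d \<longleftrightarrow>
     (\<exists>\<rho>' \<psi>. strict_tensor_rank G N \<rho>' d \<and> linear_character G \<psi> \<and>
             (\<forall>g\<in>carrier G. \<rho> g = \<psi> g \<cdot>\<^sub>m \<rho>' g))"

definition tensor_rank ::
    "('a::{field,finite}^'n^'n) monoid \<Rightarrow> nat \<Rightarrow> ('a^'n^'n \<Rightarrow> complex Matrix.mat) \<Rightarrow> nat \<Rightarrow> bool" where
  "tensor_rank G N \<rho> d \<longleftrightarrow>
     irreducible_rep G N \<rho> \<and> twist_of_strict_tensor_rank G N \<rho> d \<and>
     (\<forall>k<d. \<not> twist_of_strict_tensor_rank G N \<rho> k)"

text \<open>
  The inner product on \<open>\<complex>\<^sup>N\<close> need not be \<open>\<rho>\<close>-invariant: for any inner product, the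
  \<open>\<langle>\<sqdot>, u\<rangle>\<close> range over all linear functionals, so the span of the coefficients is the same.
\<close>

definition matrix_coeff ::
    "'g monoid \<Rightarrow> ('g \<Rightarrow> complex Matrix.mat) \<Rightarrow> complex Matrix.vec \<Rightarrow> complex Matrix.vec \<Rightarrow> 'g \<Rightarrow> complex"
  where
  "matrix_coeff G \<rho> v u = (\<lambda>g. if g \<in> carrier G then (\<rho> g *\<^sub>v v) \<bullet>c u else 0)"

definition L2_le :: "('a::{field,finite}^'n^'n) monoid \<Rightarrow> nat \<Rightarrow> ('a^'n^'n \<Rightarrow> complex) set" where
  "L2_le G d =
     fun_space.span {matrix_coeff G \<rho> v u | N \<rho> v u.
       (\<exists>k\<le>d. tensor_rank G N \<rho> k) \<and> v \<in> carrier_vec N \<and> u \<in> carrier_vec N}"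

definition level_proj ::
    "('a::{field,finite}^'n^'n) monoid \<Rightarrow> nat \<Rightarrow> ('a^'n^'n \<Rightarrow> complex) \<Rightarrow> ('a^'n^'n \<Rightarrow> complex)" where
  "level_proj G d f = orth_proj (carrier G) (L2_le G d) f"

section \<open>Globalness\<close>

definition zero_extension :: "'g monoid \<Rightarrow> ('g \<Rightarrow> complex) \<Rightarrow> 'g \<Rightarrow> complex" where
  "zero_extension G f = (\<lambda>A. if A \<in> carrier G then f A else 0)"

text \<open>\<open>\<L>(V/V', W')\<close> as a subspace of \<open>\<L>(V, V)\<close>.\<close>

definition maps_quotient_into :: "('a::field^'n) set \<Rightarrow> ('a^'n) set \<Rightarrow> ('a^'n^'n) set" where
  "maps_quotient_into V' W' = {S. (\<forall>v\<in>V'. S *v v = 0) \<and> range ((*v) S) \<subseteq> W'}"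

definition is_global ::
    "('a::{field,finite}^'n^'n) monoid \<Rightarrow> nat \<Rightarrow> real \<Rightarrow> ('a^'n^'n \<Rightarrow> complex) \<Rightarrow> bool" where
  "is_global G d \<epsilon> f \<longleftrightarrow>
     (\<forall>V' W' :: ('a^'n) set.
        vec.subspace V' \<and> vec.subspace W' \<and> vec.dim V' + (CARD('n) - vec.dim W') = d \<longrightarrow>
        (\<forall>T. mean (maps_quotient_into V' W') (\<lambda>S. (cmod (zero_extension G f (S + T)))\<^sup>2) \<le> \<epsilon>))"

end

theory Submission
  imports Defs
begin

text \<open>
  Extend \<open>f\<close> by zero to the space of all \<open>n \<times> n\<close> matrices and use the characters
  \<open>A \<mapsto> chi (tr (B A))\<close>, graded by the rank of the frequency \<open>B\<close>. For functions of degree at most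
  \<open>d\<close> (frequencies of rank at most \<open>d\<close>) all of whose restrictions \<open>A \<mapsto> g (T + S A P)\<close> are small,
  the fourth moment is controlled by the second: a Moebius inversion over the subspaces contained in
  the column and row spaces of the frequencies splits \<open>g\<close> into a part that Cauchy-Schwarz handles and
  parts that drop in rank under a restriction. Applied to the powers \<open>g ^ (2 ^ j)\<close>, this bounds the
  moments of order \<open>p = 2 ^ (j + 1)\<close>. The rank-\<open>r\<close> part of a global \<open>f\<close> is again global, by induction
  on \<open>r\<close>, and Hoelder's inequality with \<open>p\<close> of size \<open>t / d\<close> bounds its norm.

  To return to the group: for \<open>n \<ge> 3\<close> every linear character is trivial on \<open>SL\<^sub>n\<close>, so a function of
  level at most \<open>d\<close> agrees on each coset of \<open>SL\<^sub>n\<close> with a function of degree at most \<open>d\<close> on matrices.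
  A function on \<open>SL\<^sub>n\<close> of degree \<open>r\<close> and orthogonal to lower degrees is recovered from its
  correlations with the events \<open>g x = y\<close> for \<open>n \<times> r\<close> matrices \<open>x\<close> and \<open>y\<close>, and these correlations
  extend to functions of pure rank \<open>r\<close> on all matrices. If \<open>n\<close> is not large compared to \<open>d\<close>, then
  \<open>q\<^bsup>926dt\<^esup> \<epsilon> \<ge> 1\<close> and the bound is trivial.
\<close>

text \<open>Averages of translates of a function keep its restrictions small, so every projection
  that has to respect globalness is written with such averages: rank-r parts are interpolated from
  \<open>psi\<close>, and the frequencies whose column space contains a given vector are isolated by
  \<open>theta\<close>. Each use costs a power of q; most exponents of the form C d^2 come from
  this. They are harmless in the end: the moment of order p costs about q^(9 p^2 d^2), but only its
  p-th root enters the final bound, and so does the loss 1/\<epsilon> <= q^(t^2). With p d close to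
  t both roots are q^(O(d t)). The obstacle is that globalness of the rank-r part already asks for
  the inequality to be proved. Restrictions either see a smaller rank, where induction applies, or
  have at most the unknown norm itself, so the moment bound becomes an inequality in that norm. On
  the group the level-d space enters only through its inclusion, coset by coset, into the functions
  of degree at most d. There f and its degree-d projection u have the same inner product with the
  level projection h of f, and the energy of u is what gets bounded.\<close>

no_notation Matrix.vec_index (infixl "$" 100)
hide_const (open) Matrix.mat Determinant.det

section \<open>Additive characters\<close>

lemma finite_field_unit_power:
  fixes a :: "'a::{field,finite}"
  assumes "a \<noteq> 0"
  obtains j where "a ^ j * a = 1"
proof -
  have "\<not> inj (\<lambda>j::nat. a ^ j)"
    using finite_imageD[of "\<lambda>j::nat. a ^ j" UNIV] finite[of "range (\<lambda>j::nat. a ^ j)"] infinite_UNIV_nat by blast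
  then obtain i k :: nat where "a ^ i = a ^ k" "i < k"
    unfolding inj_def by (metis linorder_neqE_nat)
  then have "a ^ (i + (k - i)) = a ^ i" by simp
  then have "a ^ i * a ^ (k - i) = a ^ i * 1" unfolding power_add by simp
  then have "a ^ (k - i) = 1" using assms by simp
  then have "a ^ (k - i - 1) * a = 1"
    using \<open>i < k\<close> by (cases "k - i") (auto simp: mult.commute)
  then show ?thesis using that by blast
qed

text \<open>A subgroup \<open>H\<close> of the additive group that is maximal among those avoiding 1
  satisfies F = H + Z 1, and F/H is cyclic of order \<open>CHAR\<close>. Reading the residue class
  as an exponent gives a character that is nontrivial at 1.\<close>

lemma exists_additive_character:
  "\<exists>\<psi> :: 'a::{field,finite} \<Rightarrow> complex.
     (\<forall>x y. \<psi> (x + y) = \<psi> x * \<psi> y) \<and> (\<forall>x. cmod (\<psi> x) = 1) \<and> (\<exists>x. \<psi> x \<noteq> 1)"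
proof -
  define sub where "sub H \<longleftrightarrow> (0::'a) \<in> H \<and> (\<forall>x\<in>H. \<forall>y\<in>H. x - y \<in> H) \<and> 1 \<notin> H" for H
  have "sub {0}" by (simp add: sub_def)
  then have "{H. sub H} \<noteq> {}" by blast
  moreover have "finite {H. sub H}" by simp
  ultimately have "\<exists>H\<in>{H. sub H}. \<forall>H'\<in>{H. sub H}. H \<subseteq> H' \<longrightarrow> H = H'"
    by (intro finite_has_maximal)
  then obtain H where H: "sub H" and max: "\<And>H'. sub H' \<Longrightarrow> H \<subseteq> H' \<Longrightarrow> H' = H"
    by blast
  have H0: "0 \<in> H" using H unfolding sub_def by (elim conjE)
  have Hd: "\<And>x y. x \<in> H \<Longrightarrow> y \<in> H \<Longrightarrow> x - y \<in> H" using H unfolding sub_def by simp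
  have H1: "1 \<notin> H" using H unfolding sub_def by (elim conjE)
  have Hn: "- x \<in> H" if "x \<in> H" for x using Hd[OF H0 that] by simp
  have Ha: "x + y \<in> H" if "x \<in> H" "y \<in> H" for x y using Hd[OF that(1) Hn[OF that(2)]] by simp
  have Hnat: "of_nat k * x \<in> H" if "x \<in> H" for k x
  proof (induction k)
    case 0
    show ?case using H0 by simp
  next
    case (Suc k)
    from Ha[OF that this] show ?case by (simp add: distrib_right)
  qed
  have Hint: "of_int k * x \<in> H" if "x \<in> H" for k x
  proof -
    obtain n where "k = int n \<or> k = - int n" by (cases k rule: int_cases2) auto
    then show ?thesis using Hnat[OF that, of n] Hn[OF Hnat[OF that, of n]] by (elim disjE) simp_all
  qed
  \<comment> \<open>The inverse is a power of the element itself, hence again the image of an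
    integer.\<close>
  have inv: "\<exists>m. of_int m * (of_int k :: 'a) = 1" if k0: "(of_int k :: 'a) \<noteq> 0" for k
  proof -
    obtain j where "(of_int k :: 'a) ^ j * of_int k = 1" by (rule finite_field_unit_power[OF k0])
    then show ?thesis by (intro exI[of _ "k ^ j"]) simp
  qed
  have ex: "\<exists>j. x - of_int j \<in> H" for x
  proof (cases "x \<in> H")
    case True then show ?thesis by (intro exI[of _ 0]) simp
  next
    case False
    \<comment> \<open>By maximality the larger subgroup contains 1, so 1 = h + k x. Here k is
      nonzero in the field, and multiplying by its integer inverse m gives x = m modulo
      \<open>H\<close>.\<close>
    define H' where "H' = {h + of_int k * x | h k. h \<in> H}"
    have "h \<in> H'" if "h \<in> H" for h
    proof -
      have "h = h + of_int 0 * x" by simp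
      then show ?thesis using that unfolding H'_def by blast
    qed
    then have "H \<subseteq> H'" by blast
    moreover have "x \<in> H'"
    proof -
      have "x = 0 + of_int 1 * x" by simp
      then show ?thesis using H0 unfolding H'_def by blast
    qed
    ultimately have nsub: "\<not> sub H'" using max False by blast
    have diff: "u - v \<in> H'" if uv: "u \<in> H'" "v \<in> H'" for u v
    proof -
      obtain h k h' k' where "u = h + of_int k * x" "v = h' + of_int k' * x" "h \<in> H" "h' \<in> H"
        using uv unfolding H'_def by blast
      then have "u - v = (h - h') + of_int (k - k') * x" "h - h' \<in> H"
        using Hd by (simp_all add: algebra_simps)
      then show ?thesis unfolding H'_def by blast
    qed
    have "1 \<in> H'"
    proof (rule ccontr)
      assume "1 \<notin> H'"
      then have "sub H'" unfolding sub_def using diff \<open>H \<subseteq> H'\<close> H0 by (intro conjI ballI) auto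
      with nsub show False by simp
    qed
    then obtain h k where hk: "1 = h + of_int k * x" "h \<in> H" unfolding H'_def by blast
    have "(of_int k :: 'a) \<noteq> 0"
    proof
      assume "(of_int k :: 'a) = 0"
      then show False using hk H1 by simp
    qed
    then have "\<exists>m. of_int m * (of_int k :: 'a) = 1" by (rule inv)
    then obtain m where m: "of_int m * (of_int k :: 'a) = 1" ..
    have h: "h = 1 - of_int k * x" unfolding eq_diff_eq by (rule hk(1)[symmetric])
    have "of_int (- m) * h = (of_int m * of_int k) * x - of_int m"
      unfolding h by (simp add: right_diff_distrib mult.assoc)
    then have "x - of_int m = of_int (- m) * h" unfolding m by simp
    then show ?thesis using Hint[OF hk(2), of "- m"] by (intro exI[of _ m]) simp
  qed
  define m where "m = CHAR('a)"
  have m0: "m > 0" unfolding m_def by (rule finite_imp_CHAR_pos) simp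
  define j where "j x = (SOME j. x - of_int j \<in> H)" for x
  have j: "x - of_int (j x) \<in> H" for x unfolding j_def by (rule someI_ex[OF ex])
  define \<psi> where "\<psi> x = cis (2 * pi * of_int (j x) / m)" for x
  \<comment> \<open>Independence of the representative: two candidates differ by an integer lying in
    \<open>H\<close>. It is 0 in the field, since a multiple of an invertible integer would put 1
    into \<open>H\<close>.\<close>
  have uniq: "\<psi> x = cis (2 * pi * of_int k / m)" if "x - of_int k \<in> H" for x k
  proof -
    have "of_int (j x - k) \<in> H" using Hd[OF that j[of x]] by simp
    have "(of_int (j x - k) :: 'a) = 0"
    proof (rule ccontr)
      assume "(of_int (j x - k) :: 'a) \<noteq> 0"
      then obtain l where "of_int l * (of_int (j x - k) :: 'a) = 1" using inv[OF \<open>of_int (j x - k) \<noteq> 0\<close>] by (elim exE)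
      then show False using Hint[OF \<open>of_int (j x - k) \<in> H\<close>, of l] H1 by simp
    qed
    obtain n where n: "j x - k = int n \<or> j x - k = - int n" by (cases "j x - k" rule: int_cases2) auto
    then have "(of_int (j x - k) :: 'a) = of_nat n \<or> (of_int (j x - k) :: 'a) = - of_nat n"
      by (metis of_int_minus of_int_of_nat_eq)
    then have "(of_nat n :: 'a) = 0" unfolding \<open>(of_int (j x - k) :: 'a) = 0\<close> by (elim disjE) simp_all
    then have "m dvd n" unfolding m_def by (simp add: of_nat_eq_0_iff_char_dvd)
    then have "int m dvd (j x - k)" using n by auto
    then obtain l where "j x - k = int m * l" by (rule dvdE)
    then have l: "j x = k + int m * l" by simp
    have "2 * pi * of_int (j x) / m = 2 * pi * of_int k / m + of_int l * (2 * pi)"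
      using m0 by (simp add: l field_simps)
    then show ?thesis unfolding \<psi>_def by (simp add: cis.ctr complex_eq_iff sin_add cos_add cos_int_2pin sin_int_2pin mult.commute[of _ "2 * pi"])
  qed
  have "\<psi> (x + y) = \<psi> x * \<psi> y" for x y
  proof -
    have eq: "(x + y) - of_int (j x + j y) = (x - of_int (j x)) + (y - of_int (j y))" by simp
    have "(x + y) - of_int (j x + j y) \<in> H" unfolding eq by (rule Ha[OF j j])
    from uniq[OF this] show ?thesis
      unfolding \<psi>_def by (simp add: cis_mult algebra_simps add_divide_distrib)
  qed
  moreover have "cmod (\<psi> x) = 1" for x by (simp add: \<psi>_def)
  moreover have "\<psi> 1 \<noteq> 1"
  proof
    assume *: "\<psi> 1 = 1"
    have "\<psi> 1 = cis (2 * pi * of_int 1 / m)" by (rule uniq) (simp add: H0)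
    with * have "cis (2 * pi / m) = 1" by simp
    then have c: "cos (2 * pi / m) = 1" by (metis cis.sel(1) one_complex.sel(1))
    have "m \<noteq> 1" unfolding m_def by simp
    then have "m \<ge> 2" using m0 by simp
    have "2 * pi / m \<le> pi" using \<open>m \<ge> 2\<close> by (simp add: field_simps)
    moreover have "2 * pi / m > 0" using m0 by simp
    ultimately have "cos (2 * pi / m) < cos 0" by (intro cos_monotone_0_pi) auto
    then show False using c by simp
  qed
  ultimately show ?thesis by blast
qed

definition chi :: "'a::{field,finite} \<Rightarrow> complex" where
  "chi = (SOME \<psi>. (\<forall>x y. \<psi> (x + y) = \<psi> x * \<psi> y) \<and> (\<forall>x. cmod (\<psi> x) = 1) \<and> (\<exists>x. \<psi> x \<noteq> 1))"

lemma chi_add: "chi (x + y) = chi x * chi y"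
  and norm_chi [simp]: "cmod (chi x) = 1"
  and chi_nontrivial: "\<exists>x :: 'a::{field,finite}. chi x \<noteq> 1"
  using someI_ex[OF exists_additive_character] unfolding chi_def by blast+

lemma chi_nonzero [simp]: "chi x \<noteq> 0"
  using norm_chi[of x] by (metis norm_zero zero_neq_one)

lemma chi_0 [simp]: "chi 0 = 1"
  using chi_add[of 0 0] by simp

lemma chi_mult_cnj [simp]: "chi x * cnj (chi x) = 1" "cnj (chi x) * chi x = 1"
  using complex_norm_square[of "chi x"] by (simp_all add: mult.commute)

lemma sum_character:
  fixes \<psi> :: "'b::{finite,ab_group_add} \<Rightarrow> complex"
  assumes add: "\<And>x y. \<psi> (x + y) = \<psi> x * \<psi> y" and "\<psi> c \<noteq> 1"
  shows "(\<Sum>x\<in>UNIV. \<psi> x) = 0"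
proof -
  have "(\<Sum>x\<in>UNIV. \<psi> x) = (\<Sum>x\<in>UNIV. \<psi> (c + x))"
    by (rule sum.reindex_bij_witness[of _ "\<lambda>x. c + x" "\<lambda>x. x - c"]) auto
  also have "\<dots> = \<psi> c * (\<Sum>x\<in>UNIV. \<psi> x)" by (simp add: add sum_distrib_left)
  finally show ?thesis using assms(2) by simp
qed

section \<open>Dot products and rank-one matrices\<close>

definition dot :: "'a::comm_ring_1^'n \<Rightarrow> 'a^'n \<Rightarrow> 'a" where
  "dot x y = (\<Sum>i\<in>UNIV. x $ i * y $ i)"

definition outer :: "'a::comm_ring_1^'m \<Rightarrow> 'a^'n \<Rightarrow> 'a^'n^'m" where
  "outer u l = (\<chi> i j. u $ i * l $ j)"

lemma dot_add_left: "dot (x + y) z = dot x z + dot y z"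
  and dot_add_right: "dot z (x + y) = dot z x + dot z y"
  and dot_diff_left: "dot (x - y) z = dot x z - dot y z"
  and dot_diff_right: "dot z (x - y) = dot z x - dot z y"
  and dot_scale_left: "dot (c *s x) z = c * dot x z"
  and dot_scale_right: "dot z (c *s x) = c * dot z x"
  and dot_zero_left [simp]: "dot 0 z = 0"
  and dot_zero_right [simp]: "dot z 0 = 0"
  and dot_commute: "dot x z = dot z x"
  by (simp_all add: dot_def algebra_simps sum.distrib sum_subtractf sum_distrib_left)

lemma dot_axis [simp]: "dot (axis i c) x = c * x $ i" "dot x (axis i c) = x $ i * c"
proof -
  have "dot (axis i c) x = (\<Sum>j\<in>UNIV. if j = i then c * x $ i else 0)" for x :: "'a^'b"
    unfolding dot_def axis_def by (rule sum.cong) auto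
  then show "dot (axis i c) x = c * x $ i" by simp
  then show "dot x (axis i c) = x $ i * c" by (simp add: dot_def mult.commute)
qed

lemma dot_transpose: "dot l (A *v u) = dot (transpose A *v l) u"
proof -
  have "dot l (A *v u) = (\<Sum>i\<in>UNIV. \<Sum>j\<in>UNIV. l $ i * (A $ i $ j * u $ j))"
    by (simp add: dot_def matrix_vector_mult_def sum_distrib_left)
  also have "\<dots> = (\<Sum>j\<in>UNIV. \<Sum>i\<in>UNIV. l $ i * (A $ i $ j * u $ j))" by (rule sum.swap)
  also have "\<dots> = dot (transpose A *v l) u"
    unfolding dot_def matrix_vector_mult_def transpose_def
    by (simp add: sum_distrib_right sum_distrib_left mult_ac)
  finally show ?thesis .
qed

lemma outer_mult_vec: "outer u l *v x = dot l x *s u"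
  by (simp add: outer_def dot_def matrix_vector_mult_def vec_eq_iff sum_distrib_left sum_distrib_right mult_ac)

lemma mat_vec_scale: "A *v (c *s x) = c *s (A *v (x::'a::comm_ring_1^'n))"
  by (simp add: matrix_vector_mult_def vec_eq_iff sum_distrib_left mult_ac)

lemma mult_outer: "A ** outer u l = outer (A *v u) l"
  by (simp add: matrix_eq outer_mult_vec mat_vec_scale flip: matrix_vector_mul_assoc)

lemma outer_mult: "outer u l ** A = outer u (transpose A *v l)"
  by (simp add: matrix_eq outer_mult_vec dot_transpose[symmetric] flip: matrix_vector_mul_assoc del: transpose_matrix_vector)
 
lemma outer_add_left: "outer (u + v) l = outer u l + outer v l"
  and outer_add_right: "outer u (l + k) = outer u l + outer u k"
  and outer_diff_left: "outer (u - v) l = outer u l - outer v l"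
  and outer_scale: "outer (c *s u) l = outer u (c *s l)"
  and transpose_outer: "transpose (outer u l) = outer l u"
  by (simp_all add: outer_def vec_eq_iff algebra_simps transpose_def)

lemma trace_outer: "trace (outer u l) = dot l u"
  by (simp add: trace_def outer_def dot_def mult.commute)

lemma trace_mult_outer: "trace (B ** outer u l) = dot l (B *v u)"
  by (simp add: mult_outer trace_outer)

lemma matrix_add_rdistrib_gen: "(B + C) ** A = B ** A + C ** (A::'a::comm_ring_1^'n^'m)"
  by (simp add: matrix_matrix_mult_def vec_eq_iff distrib_right sum.distrib)

lemma trace_transpose: "trace (transpose A) = trace A"
  by (simp add: trace_def transpose_def)

lemma dot_all_zero: "(\<forall>l. dot l x = 0) \<longleftrightarrow> x = 0"
  by (metis dot_axis(1) dot_zero_right mult_1 vec_eq_iff zero_index)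

lemma sum_chi_dot:
  fixes x :: "'a::{field,finite}^'n"
  shows "(\<Sum>l\<in>UNIV. chi (dot l x)) = (if x = 0 then of_nat CARD('a^'n) else 0)"
proof (cases "x = 0")
  case False
  then obtain i where i: "x $ i \<noteq> 0" by (auto simp: vec_eq_iff)
  obtain c :: 'a where c: "chi c \<noteq> 1" using chi_nontrivial by blast
  have "chi (dot (axis i (c / x $ i)) x) \<noteq> 1" using i c by simp
  then have "(\<Sum>l\<in>UNIV. chi (dot l x)) = 0"
    by (rule sum_character[rotated]) (simp add: dot_add_left chi_add)
  then show ?thesis using False by simp
qed simp

section \<open>Fourier analysis on square matrices\<close>

abbreviation EE :: "('x::finite \<Rightarrow> 'c) \<Rightarrow> 'c::field_char_0" where
  "EE f \<equiv> mean UNIV f"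

definition ch :: "'a::{field,finite}^'n^'n \<Rightarrow> 'a^'n^'n \<Rightarrow> complex" where
  "ch B A = chi (trace (B ** A))"

lemma ch_add_right: "ch B (A + A') = ch B A * ch B A'"
  by (simp add: ch_def matrix_add_ldistrib trace_add chi_add)

lemma ch_add_left: "ch (B + B') A = ch B A * ch B' A"
  by (simp add: ch_def matrix_add_rdistrib_gen trace_add chi_add)

lemma ch_commute: "ch B A = ch A B"
  unfolding ch_def by (subst trace_mul_sym) (rule refl)

text \<open>By cyclicity of the trace, substituting S A P for A moves the frequency B to P B S,
  whose rank is at most that of B. The rank bookkeeping for restrictions rests on this.\<close>

lemma ch_mult: "ch B (S ** A ** P) = ch (P ** B ** S) A"
proof -
  have "trace (B ** (S ** A ** P)) = trace ((B ** S ** A) ** P)" by (simp only: matrix_mul_assoc)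
  also have "\<dots> = trace (P ** (B ** S ** A))" by (rule trace_mul_sym)
  finally show ?thesis by (simp only: ch_def matrix_mul_assoc)
qed

lemma ch_transpose: "ch (transpose B) (transpose A) = ch B A"
proof -
  have "trace (transpose B ** transpose A) = trace (transpose (A ** B))" by (simp only: matrix_transpose_mul)
  also have "\<dots> = trace (B ** A)" by (simp only: trace_transpose trace_mul_sym[of A])
  finally show ?thesis by (simp only: ch_def)
qed

lemma ch_outer: "ch B (outer u l) = chi (dot l (B *v u))"
  by (simp add: ch_def trace_mult_outer)

lemma ch_0 [simp]: "ch 0 A = 1" "ch B 0 = 1"
  by (simp_all add: ch_def trace_def)

lemma norm_ch [simp]: "cmod (ch B A) = 1"
  by (simp add: ch_def)

lemma ch_mult_cnj [simp]: "ch B A * cnj (ch B A) = 1" "cnj (ch B A) * ch B A = 1"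
  by (simp_all add: ch_def)

lemma ch_minus_left: "ch (- B) A = cnj (ch B A)"
proof -
  have "ch (- B) A * ch B A = cnj (ch B A) * ch B A"
    using ch_add_left[of "-B" B A] by simp
  then show ?thesis by (metis ch_def chi_nonzero mult_right_cancel)
qed

lemma ch_diff_left: "ch (B - B') A = ch B A * cnj (ch B' A)"
  using ch_add_left[of B "- B'" A] by (simp add: ch_minus_left)

lemma ch_diff_right: "ch B (A - A') = ch B A * cnj (ch B A')"
  by (metis ch_commute ch_diff_left)

lemma sum_ch:
  fixes B :: "'a::{field,finite}^'n^'n"
  shows "(\<Sum>A\<in>UNIV. ch B A) = (if B = 0 then of_nat CARD('a^'n^'n) else 0)"
proof (cases "B = 0")
  case False
  then obtain u where "B *v u \<noteq> 0" by (metis matrix_eq matrix_vector_mult_0)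
  then obtain i where i: "(B *v u) $ i \<noteq> 0" by (auto simp: vec_eq_iff)
  obtain c :: 'a where c: "chi c \<noteq> 1" using chi_nontrivial by blast
  have "ch B (outer u (axis i (c / (B *v u) $ i))) \<noteq> 1" using i c by (simp add: ch_outer)
  then have "(\<Sum>A\<in>UNIV. ch B A) = 0"
    by (rule sum_character[rotated]) (simp add: ch_add_right)
  then show ?thesis using False by simp
qed simp

definition fc :: "('a::{field,finite}^'n^'n \<Rightarrow> complex) \<Rightarrow> 'a^'n^'n \<Rightarrow> complex" where
  "fc g B = EE (\<lambda>A. g A * cnj (ch B A))"

definition synth :: "('a::{field,finite}^'n^'n \<Rightarrow> complex) \<Rightarrow> 'a^'n^'n \<Rightarrow> complex" where
  "synth a A = (\<Sum>B\<in>UNIV. a B * ch B A)"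

lemma mult_if_zero: "x * (if P then y else 0) = (if P then x * y else (0::'b::mult_zero))"
  by simp

lemma fc_synth [simp]: "fc (synth a) = a"
proof
  fix B
  have "fc (synth a) B = (\<Sum>A\<in>UNIV. \<Sum>B'\<in>UNIV. a B' * ch (B' - B) A) / of_nat CARD('a^'b^'b)"
    by (simp add: fc_def synth_def mean_def sum_distrib_right ch_diff_left mult.assoc)
  also have "\<dots> = (\<Sum>B'\<in>UNIV. a B' * (\<Sum>A\<in>UNIV. ch (B' - B) A)) / of_nat CARD('a^'b^'b)"
    by (subst sum.swap) (simp add: sum_distrib_left)
  also have "\<dots> = a B"
    by (simp add: sum_ch mult_if_zero)
  finally show "fc (synth a) B = a B" .
qed

lemma synth_fc [simp]: "synth (fc g) = g"
proof
  fix A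
  have "synth (fc g) A = (\<Sum>B\<in>UNIV. \<Sum>A'\<in>UNIV. g A' * ch B (A - A')) / of_nat CARD('a^'b^'b)"
    unfolding fc_def synth_def mean_def ch_diff_right
    by (simp only: sum_distrib_right sum_divide_distrib) (simp add: mult_ac)
  also have "\<dots> = (\<Sum>A'\<in>UNIV. g A' * (\<Sum>B\<in>UNIV. ch (A - A') B)) / of_nat CARD('a^'b^'b)"
    by (subst sum.swap) (simp only: sum_distrib_left ch_commute[of "A - _"])
  also have "\<dots> = g A"
    by (simp add: sum_ch mult_if_zero)
  finally show "synth (fc g) A = g A" .
qed

lemma fourier_inversion: "g A = (\<Sum>B\<in>UNIV. fc g B * ch B A)"
  by (metis synth_def synth_fc)

lemma fc_inject: "fc g = fc h \<Longrightarrow> g = h"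
  by (metis synth_fc)

lemma mean_sum: "mean X (\<lambda>x. \<Sum>i\<in>I. f i x) = (\<Sum>i\<in>I. mean X (f i))"
  by (simp add: mean_def sum_divide_distrib) (subst sum.swap, simp)

lemma mean_add: "mean X (\<lambda>x. f x + g x) = mean X f + mean X g"
  by (simp add: mean_def sum.distrib add_divide_distrib)

lemma mean_diff: "mean X (\<lambda>x. f x - g x) = mean X f - mean X g"
  by (simp add: mean_def sum_subtractf diff_divide_distrib)

lemma mean_cmult: "mean X (\<lambda>x. c * f x) = c * mean X f"
  by (simp add: mean_def flip: sum_distrib_left)

lemma mean_multc: "mean X (\<lambda>x. f x * c) = mean X f * c"
  by (simp add: mean_def flip: sum_distrib_right)

lemma mean_const [simp]: "EE (\<lambda>x. c) = c"
  by (simp add: mean_def)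

lemma mean_mono: "(\<And>x. x \<in> X \<Longrightarrow> f x \<le> g x) \<Longrightarrow> mean X f \<le> (mean X g :: real)"
  by (simp add: mean_def divide_right_mono sum_mono)

lemma mean_nonneg: "(\<And>x. x \<in> X \<Longrightarrow> 0 \<le> f x) \<Longrightarrow> 0 \<le> (mean X f :: real)"
  by (simp add: mean_def sum_nonneg)

lemma mean_swap: "mean X (\<lambda>x. mean Y (\<lambda>y. f x y)) = mean Y (\<lambda>y. mean X (\<lambda>x. f x y))"
proof -
  have "mean X (\<lambda>x. mean Y (\<lambda>y. f x y)) = (\<Sum>x\<in>X. \<Sum>y\<in>Y. f x y) / of_nat (card Y) / of_nat (card X)"
    by (simp only: mean_def flip: sum_divide_distrib)
  also have "\<dots> = (\<Sum>y\<in>Y. \<Sum>x\<in>X. f x y) / of_nat (card X) / of_nat (card Y)"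
    by (subst sum.swap) (simp add: mult.commute)
  also have "\<dots> = mean Y (\<lambda>y. mean X (\<lambda>x. f x y))"
    by (simp only: mean_def flip: sum_divide_distrib)
  finally show ?thesis .
qed

lemma mean_cnj: "cnj (mean X f) = mean X (\<lambda>x. cnj (f x))"
  by (simp add: mean_def)

lemma mean_of_real: "of_real (mean X f) = (mean X (\<lambda>x. of_real (f x)) :: complex)"
  by (simp add: mean_def)

lemma mean_bij:
  assumes "bij (\<phi> :: 'x::finite \<Rightarrow> 'x)"
  shows "EE (\<lambda>x. f (\<phi> x)) = EE f"
  unfolding mean_def by (simp add: sum.reindex_bij_betw[OF assms])

lemma mean_translate: "EE (\<lambda>A. f (A + (c::'b::{finite,group_add}))) = EE f"
  by (rule mean_bij) (rule bij_betw_byWitness[where f' = "\<lambda>x. x - c"], auto)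

lemma parseval_inner: "(\<Sum>B\<in>UNIV. fc g B * cnj (fc h B)) = EE (\<lambda>A. g A * cnj (h A))"
proof -
  have "EE (\<lambda>A. g A * cnj (h A)) = EE (\<lambda>A. \<Sum>B\<in>UNIV. g A * cnj (ch B A) * cnj (fc h B))"
    by (subst fourier_inversion[of h]) (simp add: sum_distrib_left mult_ac)
  also have "\<dots> = (\<Sum>B\<in>UNIV. EE (\<lambda>A. g A * cnj (ch B A)) * cnj (fc h B))"
    by (simp add: mean_sum mean_multc)
  finally show ?thesis by (simp add: fc_def)
qed

definition sq :: "('x::finite \<Rightarrow> complex) \<Rightarrow> real" where
  "sq g = EE (\<lambda>A. (cmod (g A))\<^sup>2)"

lemma sq_complex: "complex_of_real (sq g) = EE (\<lambda>A. g A * cnj (g A))"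
  unfolding sq_def mean_of_real by (simp only: complex_norm_square)

lemma parseval: "(\<Sum>B\<in>UNIV. (cmod (fc g B))\<^sup>2) = sq g"
proof -
  have "complex_of_real (\<Sum>B\<in>UNIV. (cmod (fc g B))\<^sup>2) = complex_of_real (sq g)"
    unfolding sq_complex parseval_inner[symmetric] of_real_sum by (simp only: complex_norm_square)
  then show ?thesis by (simp only: of_real_eq_iff)
qed

lemma sq_nonneg [simp]: "0 \<le> sq g"
  by (simp add: sq_def mean_nonneg)

definition fproj :: "('a::{field,finite}^'n^'n) set \<Rightarrow> ('a^'n^'n \<Rightarrow> complex) \<Rightarrow> 'a^'n^'n \<Rightarrow> complex" where
  "fproj S g = synth (\<lambda>B. if B \<in> S then fc g B else 0)"

lemma fc_fproj: "fc (fproj S g) B = (if B \<in> S then fc g B else 0)"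
  by (simp add: fproj_def)

lemma fc_add: "fc (\<lambda>A. g A + h A) B = fc g B + fc h B"
  and fc_diff: "fc (\<lambda>A. g A - h A) B = fc g B - fc h B"
  and fc_cmult: "fc (\<lambda>A. c * g A) B = c * fc g B"
  by (simp_all add: fc_def algebra_simps mean_add mean_diff mean_cmult)

lemma fc_sum: "fc (\<lambda>A. \<Sum>i\<in>I. g i A) B = (\<Sum>i\<in>I. fc (g i) B)"
  by (simp add: fc_def sum_distrib_right mean_sum)

lemma fc_mean: "fc (\<lambda>A. mean I (\<lambda>i. g i A)) B = mean I (\<lambda>i. fc (g i) B)"
  unfolding fc_def by (simp only: mean_swap[of I] flip: mean_multc)

lemma fc_shift: "fc (\<lambda>A. g (A + D)) B = fc g B * ch B D"
proof -
  have "fc g B = EE (\<lambda>A. g (A + D) * cnj (ch B (A + D)))"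
    unfolding fc_def by (rule mean_translate[symmetric])
  also have "\<dots> = fc (\<lambda>A. g (A + D)) B * cnj (ch B D)"
    by (simp add: ch_add_right mult.assoc[symmetric] mean_multc fc_def)
  finally show ?thesis
    by (simp add: mult.assoc ch_def)
qed

declare transpose_matrix_vector [simp del]

section \<open>Rank and cardinality\<close>

definition ran :: "'a::field^'n^'m \<Rightarrow> ('a^'m) set" where
  "ran B = range ((*v) B)"

definition kern :: "'a::field^'n^'m \<Rightarrow> ('a^'n) set" where
  "kern B = {w. B *v w = 0}"

text \<open>Over a finite field the column space has q^rk elements, so the rank inequalities below
  are obtained by comparing cardinalities of the form q^a and q^b.\<close>

definition rk :: "'a::field^'n^'m \<Rightarrow> nat" where
  "rk B = vec.dim (ran B)"

definition corank :: "'a::field^'n^'n \<Rightarrow> nat" where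
  "corank B = CARD('n) - rk B"

lemma subspace_ran: "vec.subspace (ran B)"
  unfolding ran_def by (rule vec.subspace_UNIV[THEN vec.subspace_image])

lemma mem_ran [simp, intro]: "B *v w \<in> ran B"
  by (simp add: ran_def)

lemma subspace_kern: "vec.subspace (kern B)"
  by (auto simp: vec.subspace_def kern_def matrix_vector_right_distrib mat_vec_scale)

lemma card_subspace:
  fixes S :: "('a::{field,finite}^'n) set"
  assumes S: "vec.subspace S"
  shows "card S = CARD('a) ^ vec.dim S"
proof -
  obtain B where B: "B \<subseteq> S" "vec.independent B" "S \<subseteq> vec.span B" "card B = vec.dim S"
    by (rule vec.basis_exists[of S])
  have fin: "finite B" by simp
  have span: "vec.span B = S"
    using B(3) vec.span_minimal[OF B(1) S] by (rule antisym[rotated])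
  let ?f = "\<lambda>u. \<Sum>v\<in>B. u v *s v"
  have inj: "inj_on ?f (B \<rightarrow>\<^sub>E UNIV)"
  proof (rule inj_onI)
    fix u w assume uw: "u \<in> B \<rightarrow>\<^sub>E UNIV" "w \<in> B \<rightarrow>\<^sub>E UNIV" "?f u = ?f w"
    then have "(\<Sum>v\<in>B. (u v - w v) *s v) = 0"
      by (simp add: vec.scale_left_diff_distrib sum_subtractf)
    then have "u v - w v = 0" if "v \<in> B" for v
      using vec.independentD[OF B(2) fin order_refl, of "\<lambda>v. u v - w v"] that by blast
    then show "u = w" using uw(1,2) by (intro PiE_ext) auto
  qed
  have img: "?f ` (B \<rightarrow>\<^sub>E UNIV) = S"
  proof -
    have "?f u \<in> ?f ` (B \<rightarrow>\<^sub>E UNIV)" for u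
      by (rule image_eqI[of _ _ "restrict u B"]) auto
    then have "range ?f \<subseteq> ?f ` (B \<rightarrow>\<^sub>E UNIV)" by (rule image_subsetI)
    moreover have "?f ` (B \<rightarrow>\<^sub>E UNIV) \<subseteq> range ?f" by (rule image_mono) simp
    ultimately have "?f ` (B \<rightarrow>\<^sub>E UNIV) = range ?f" by (rule antisym[rotated])
    then show ?thesis unfolding vec.span_finite[OF fin, symmetric] span .
  qed
  have "card S = card (B \<rightarrow>\<^sub>E (UNIV :: 'a set))" unfolding img[symmetric] by (rule card_image[OF inj])
  also have "\<dots> = CARD('a) ^ card B" by (simp add: card_PiE fin)
  finally show ?thesis using B(4) by simp
qed

lemma card_field_ge_2: "CARD('a::{field,finite}) \<ge> 2"
proof -
  have "card {0, 1 :: 'a} \<le> CARD('a)" by (rule card_mono) auto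
  then show ?thesis by simp
qed

lemma card_field_gt_1 [simp]: "1 < CARD('a::{field,finite})" "Suc 0 < CARD('a)"
  using card_field_ge_2[where 'a='a] by linarith+

lemma card_ran: "card (ran B) = CARD('a) ^ rk B" for B :: "'a::{field,finite}^'n^'m"
  unfolding rk_def by (rule card_subspace[OF subspace_ran])

lemma card_fiber:
  fixes B :: "'a::{field,finite}^'n^'m"
  shows "card {w. B *v w = B *v x} = card (kern B)"
proof -
  have "bij_betw (\<lambda>w. w + x) (kern B) {w. B *v w = B *v x}"
    by (rule bij_betw_byWitness[where f' = "\<lambda>w. w - x"])
       (auto simp: kern_def matrix_vector_right_distrib matrix_vector_mult_diff_distrib)
  then show ?thesis by (simp add: bij_betw_same_card)
qed

lemma card_kern_ran:
  fixes B :: "'a::{field,finite}^'n^'m"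
  shows "card (kern B) * CARD('a) ^ rk B = CARD('a) ^ CARD('n)"
proof -
  have "CARD('a^'n) = card (\<Union>y\<in>ran B. {w. B *v w = y})"
    by (rule arg_cong[of _ _ card]) (auto simp: ran_def)
  also have "\<dots> = (\<Sum>y\<in>ran B. card {w. B *v w = y})"
    by (rule card_UN_disjoint) auto
  also have "\<dots> = (\<Sum>y\<in>ran B. card (kern B))"
    by (rule sum.cong) (auto simp: ran_def card_fiber)
  finally show ?thesis by (simp add: card_ran)
qed

lemma rk_le: "rk B \<le> CARD('n)" for B :: "'a::{field,finite}^'n^'m"
proof -
  have "kern B \<noteq> {}" by (auto simp: kern_def intro!: exI[of _ 0])
  then have "card (kern B) \<ge> 1" by (metis One_nat_def Suc_leI card_gt_0_iff finite)
  then have "CARD('a) ^ rk B \<le> card (kern B) * CARD('a) ^ rk B" by simp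
  then have "CARD('a) ^ rk B \<le> CARD('a) ^ CARD('n)" unfolding card_kern_ran .
  then show ?thesis by (rule power_le_imp_le_exp[rotated]) simp
qed

lemma card_kern: "card (kern B) = CARD('a) ^ corank B" for B :: "'a::{field,finite}^'n^'n"
proof -
  have "card (kern B) * CARD('a) ^ rk B = CARD('a) ^ corank B * CARD('a) ^ rk B"
    using rk_le[of B] by (simp add: card_kern_ran corank_def flip: power_add)
  then show ?thesis by simp
qed

text \<open>Summing chi (l . B u) over all u and l, in the two possible orders, counts the kernel of
  B and the kernel of its transpose, both times q^n.\<close>

lemma rk_transpose: "rk (transpose B) = rk B" for B :: "'a::{field,finite}^'n^'n"
proof -
  let ?N = "of_nat CARD('a^'n) :: complex"
  have 1: "(\<Sum>u\<in>UNIV. \<Sum>l\<in>UNIV. chi (dot l (A *v u))) = of_nat (card (kern A)) * ?N" for A :: "'a^'n^'n"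
    by (simp only: sum_chi_dot) (simp add: sum.If_cases kern_def)
  have "(\<Sum>u\<in>UNIV. \<Sum>l\<in>UNIV. chi (dot l (B *v u))) = (\<Sum>l\<in>UNIV. \<Sum>u\<in>UNIV. chi (dot u (transpose B *v l)))"
    by (subst sum.swap) (simp only: dot_transpose[of _ B] dot_commute)
  then have "of_nat (card (kern B)) * ?N = of_nat (card (kern (transpose B))) * ?N" unfolding 1 .
  then have "card (kern B) = card (kern (transpose B))" by simp
  then have "corank B = corank (transpose B)" by (simp add: card_kern)
  then show ?thesis using rk_le[of B] rk_le[of "transpose B"] by (simp add: corank_def)
qed

lemma rk_le_iff: "rk A \<le> rk B \<longleftrightarrow> card (ran A) \<le> card (ran B)" for A B :: "'a::{field,finite}^'n^'m"
  by (simp add: card_ran)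

lemma rk_mult_left: "rk (A ** B) \<le> rk A" for A B :: "'a::{field,finite}^'n^'n"
  unfolding rk_le_iff by (rule card_mono) (auto simp: ran_def simp flip: matrix_vector_mul_assoc)

lemma rk_mult_right: "rk (A ** B) \<le> rk B" for A B :: "'a::{field,finite}^'n^'n"
  using rk_mult_left[of "transpose B" "transpose A"] by (simp add: rk_transpose flip: matrix_transpose_mul)

lemma matrix_vector_add_left: "(A + B) *v x = A *v x + B *v (x::'a::comm_ring_1^'n)"
  by (simp add: matrix_vector_mult_def vec_eq_iff distrib_right sum.distrib)

lemma matrix_vector_diff_left: "(A - B) *v x = A *v x - B *v (x::'a::comm_ring_1^'n)"
  by (simp add: matrix_vector_mult_def vec_eq_iff left_diff_distrib sum_subtractf)

lemma rk_add: "rk (A + B) \<le> rk A + rk B" for A B :: "'a::{field,finite}^'n^'m"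
proof -
  have "card (ran (A + B)) \<le> card ((\<lambda>(x, y). x + y) ` (ran A \<times> ran B))"
    by (rule card_mono) (auto simp: ran_def matrix_vector_add_left image_iff)
  also have "\<dots> \<le> card (ran A \<times> ran B)" by (rule card_image_le) simp
  finally have "CARD('a) ^ rk (A + B) \<le> CARD('a) ^ (rk A + rk B)"
    by (simp add: card_cartesian_product card_ran power_add)
  then show ?thesis by (rule power_le_imp_le_exp[rotated]) simp
qed

lemma ran_minus: "ran (- B) = ran (B :: 'a::{field,finite}^'n^'m)"
proof -
  have "(- B) *v x = B *v (- x)" for x
    by (simp add: matrix_vector_mult_def vec_eq_iff)
  moreover have "B *v x = (- B) *v (- x)" for x
    by (simp add: matrix_vector_mult_def vec_eq_iff)
  ultimately show ?thesis unfolding ran_def by blast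
qed

lemma rk_minus: "rk (- B) = rk (B :: 'a::{field,finite}^'n^'m)"
  by (simp add: rk_def ran_minus)

lemma rk_diff: "rk (A - B) \<le> rk A + rk (B :: 'a::{field,finite}^'n^'m)"
  using rk_add[of A "- B"] by (simp add: rk_minus)

lemma rk_zero [simp]: "rk (0 :: 'a::{field,finite}^'n^'m) = 0"
proof -
  have "ran (0 :: 'a^'n^'m) = {0}" by (auto simp: ran_def)
  then show ?thesis by (simp add: rk_def)
qed

lemma rk_eq_0: "rk B = 0 \<longleftrightarrow> B = 0" for B :: "'a::{field,finite}^'n^'m"
proof
  assume "rk B = 0"
  then have "card (ran B) = 1" by (simp add: card_ran)
  moreover have "0 \<in> ran B" by (metis matrix_vector_mult_0_right mem_ran)
  ultimately have "ran B = {0}" by (metis card_1_singletonE singletonD)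
  then have "B *v x = 0" for x using mem_ran by blast
  then show "B = 0" by (simp add: matrix_eq)
qed simp

lemma rk_outer: "rk (outer u l) \<le> 1" for u :: "'a::{field,finite}^'m"
proof -
  have "ran (outer u l) \<subseteq> range (\<lambda>c. c *s u)" by (auto simp: ran_def outer_mult_vec)
  then have "card (ran (outer u l)) \<le> card (range (\<lambda>c::'a. c *s u))" by (intro card_mono) auto
  also have "\<dots> \<le> CARD('a) ^ 1" using card_image_le[of UNIV "\<lambda>c::'a. c *s u"] by simp
  finally have "CARD('a) ^ rk (outer u l) \<le> CARD('a) ^ 1" by (simp only: card_ran)
  then show ?thesis by (rule power_le_imp_le_exp[rotated]) simp
qed

lemma corank_mult: "corank (A ** B) \<le> corank A + corank B" for A B :: "'a::{field,finite}^'n^'n"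
proof -
  have "kern (A ** B) = (\<Union>y\<in>kern A. {w. B *v w = y})"
    by (auto simp: kern_def simp flip: matrix_vector_mul_assoc)
  then have "card (kern (A ** B)) \<le> (\<Sum>y\<in>kern A. card {w. B *v w = y})"
    by (simp add: card_UN_le)
  also have "\<dots> \<le> (\<Sum>y\<in>kern A. card (kern B))"
  proof (rule sum_mono)
    fix y
    show "card {w. B *v w = y} \<le> card (kern B)"
    proof (cases "\<exists>x. y = B *v x")
      case True then show ?thesis using card_fiber by (metis order_refl)
    next
      case False
      then have "{w. B *v w = y} = {}" by blast
      then show ?thesis by simp
    qed
  qed
  finally have "CARD('a) ^ corank (A ** B) \<le> CARD('a) ^ (corank A + corank B)"
    by (simp add: card_kern power_add)
  then show ?thesis by (rule power_le_imp_le_exp[rotated]) simp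
qed

lemma corank_transpose: "corank (transpose B) = corank B" for B :: "'a::{field,finite}^'n^'n"
  by (simp add: corank_def rk_transpose)

lemma corank_eq_0: "corank B = 0 \<longleftrightarrow> kern B = {0}" for B :: "'a::{field,finite}^'n^'n"
proof -
  have 0: "0 \<in> kern B" by (simp add: kern_def)
  have "CARD('a) \<noteq> 1" using card_field_gt_1(1)[where 'a='a] by linarith
  then have 1: "corank B = 0 \<longleftrightarrow> card (kern B) = 1" unfolding card_kern by simp
  have 2: "kern B = {0}" if k: "card (kern B) = 1"
  proof -
    obtain y where "kern B = {y}" using k by (rule card_1_singletonE)
    then show ?thesis using 0 by simp
  qed
  show ?thesis unfolding 1 by (rule iffI, erule 2, simp)
qed

lemma corank_eq_0_invertible: "corank B = 0 \<longleftrightarrow> invertible B" for B :: "'a::{field,finite}^'n^'n"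
proof -
  have "kern B = {0} \<longleftrightarrow> (\<forall>x. B *v x = 0 \<longrightarrow> x = 0)" by (auto simp: kern_def)
  then show ?thesis unfolding corank_eq_0 invertible_left_inverse matrix_left_invertible_ker .
qed

lemma card_vec_space: "CARD('a::finite^'n) = CARD('a) ^ CARD('n)"
  by simp

lemma rk_full_ran: "ran B = UNIV \<longleftrightarrow> corank B = 0" for B :: "'a::{field,finite}^'n^'n"
proof
  assume "ran B = UNIV"
  then have "card (ran B) = CARD('a^'n)" by (rule arg_cong)
  then have "CARD('a) ^ rk B = CARD('a) ^ CARD('n)" unfolding card_ran card_vec_space .
  then have "rk B = CARD('n)" by (rule power_inject_exp[THEN iffD1, rotated]) (rule card_field_gt_1)
  then show "corank B = 0" by (simp add: corank_def)
next
  assume "corank B = 0"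
  then have "rk B = CARD('n)" using rk_le[of B] unfolding corank_def by linarith
  then have "card (ran B) = CARD('a^'n)" unfolding card_ran card_vec_space by (rule arg_cong)
  then show "ran B = UNIV" by (rule card_subset_eq[OF finite subset_UNIV])
qed

section \<open>Functionals, annihilators and projections\<close>

lemma separate_subspace:
  fixes S :: "('a::field^'n) set"
  assumes S: "vec.subspace S" and x: "x \<notin> S"
  obtains l where "\<forall>s\<in>S. dot l s = 0" "dot l x = 1"
proof -
  obtain B where B: "B \<subseteq> S" "vec.independent B" "S \<subseteq> vec.span B" "card B = vec.dim S"
    by (rule vec.basis_exists[of S])
  have span: "vec.span B = S" using B(3) vec.span_minimal[OF B(1) S] by (rule antisym[rotated])
  have ins: "vec.independent (insert x B)"
    using B(2) x span by (simp add: vec.independent_insert)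
  obtain i :: 'n where True by simp
  obtain g where g: "Vector_Spaces.linear (*s) (*s) g" "\<forall>v\<in>insert x B. g v = (if v = x then axis i (1::'a) else 0)"
    using vec.linear_independent_extend[OF ins, of "\<lambda>v. if v = x then axis i 1 else 0"] by blast
  interpret g: Vector_Spaces.linear "(*s)" "(*s)" g by (rule g(1))
  define l where "l = matrix g $ i"
  have l: "dot l y = g y $ i" for y
    using matrix_works[OF g(1), of y] by (simp add: l_def dot_def matrix_vector_mult_def vec_eq_iff)
  have "g s = 0" if "s \<in> vec.span B" for s
    by (rule g.eq_0_on_span[OF _ that]) (use g(2) x B(1) in auto)
  then have "\<forall>s\<in>S. dot l s = 0" using span by (simp add: l)
  moreover have "dot l x = 1" using g(2) by (simp add: l)
  ultimately show ?thesis using that by blast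
qed

text \<open>The row space is the annihilator of the kernel. For the nontrivial inclusion a vector k
  separates l from the row space; pairing it with all of the row space shows B k = 0, so l must
  vanish at k.\<close>

lemma mem_ran_transpose:
  fixes B :: "'a::field^'n^'m"
  shows "l \<in> ran (transpose B) \<longleftrightarrow> (\<forall>w\<in>kern B. dot l w = 0)"
proof
  assume "l \<in> ran (transpose B)"
  then obtain m where m: "l = transpose B *v m" by (auto simp: ran_def)
  show "\<forall>w\<in>kern B. dot l w = 0"
    by (simp add: m kern_def flip: dot_transpose)
next
  assume *: "\<forall>w\<in>kern B. dot l w = 0"
  show "l \<in> ran (transpose B)"
  proof (rule ccontr)
    assume "l \<notin> ran (transpose B)"
    then obtain k where k: "\<forall>s\<in>ran (transpose B). dot k s = 0" "dot k l = 1"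
      by (rule separate_subspace[OF subspace_ran])
    have "dot m (B *v k) = 0" for m
      using bspec[OF k(1) mem_ran[of "transpose B" m]] by (simp add: dot_transpose[of m] dot_commute[of k])
    then have "B *v k = 0" using dot_all_zero[of "B *v k"] by simp
    then have "dot l k = 0" using * by (simp add: kern_def)
    then show False using k(2) by (simp add: dot_commute[of k])
  qed
qed

text \<open>Each such subspace is the span of a list of i of its vectors. The count is crude, but
  the weights it is later combined with decay faster.\<close>

lemma card_subspaces_dim:
  fixes I :: "('a::{field,finite}^'n) set"
  assumes I: "vec.subspace I"
  shows "card {K. vec.subspace K \<and> K \<subseteq> I \<and> vec.dim K = i} \<le> card I ^ i"
proof -
  let ?X = "{K. vec.subspace K \<and> K \<subseteq> I \<and> vec.dim K = i}"
  let ?L = "{xs. set xs \<subseteq> I \<and> length xs = i}"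
  have "?X \<subseteq> (\<lambda>xs. vec.span (set xs)) ` ?L"
  proof
    fix K assume K: "K \<in> ?X"
    obtain B where B: "B \<subseteq> K" "vec.independent B" "K \<subseteq> vec.span B" "card B = vec.dim K"
      by (rule vec.basis_exists[of K])
    obtain xs where xs: "set xs = B" "distinct xs" using finite_distinct_list[of B] by auto
    have "vec.subspace K" "K \<subseteq> I" "vec.dim K = i" using K by simp_all
    have "vec.span B = K" using B(3) vec.span_minimal[OF B(1) \<open>vec.subspace K\<close>] by (rule antisym[rotated])
    moreover have "length xs = i" using distinct_card[OF xs(2)] xs(1) B(4) \<open>vec.dim K = i\<close> by simp
    ultimately show "K \<in> (\<lambda>xs. vec.span (set xs)) ` ?L"
      using xs B(1) \<open>K \<subseteq> I\<close> by (intro image_eqI[of _ _ xs]) auto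
  qed
  then have "card ?X \<le> card ((\<lambda>xs. vec.span (set xs)) ` ?L)"
    by (intro card_mono finite_imageI finite_lists_length_eq) auto
  also have "\<dots> \<le> card ?L" by (intro card_image_le finite_lists_length_eq) auto
  also have "\<dots> = card I ^ i" by (rule card_lists_length_eq) simp
  finally show ?thesis .
qed

lemma exists_functional:
  fixes x :: "'a::field^'n"
  assumes "x \<noteq> 0"
  obtains l where "dot l x = 1"
  using separate_subspace[of "{0}" x] assms by auto

text \<open>Supplies, for a prescribed subspace K, a restriction whose right factor collapses
  exactly K.\<close>

lemma exists_projection:
  fixes K :: "('a::{field,finite}^'n) set"
  assumes K: "vec.subspace K"
  obtains P where "kern P = K" "P ** P = P" "corank P = vec.dim K"
proof -
  obtain B where B: "B \<subseteq> K" "vec.independent B" "K \<subseteq> vec.span B" "card B = vec.dim K"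
    by (rule vec.basis_exists[of K])
  have span: "vec.span B = K" using B(3) vec.span_minimal[OF B(1) K] by (rule antisym[rotated])
  obtain C where C: "B \<subseteq> C" "vec.independent C" "UNIV \<subseteq> vec.span C"
    using vec.maximal_independent_subset_extend[OF _ B(2), of UNIV] by auto
  obtain g where g: "Vector_Spaces.linear (*s) (*s) g" "\<forall>v\<in>C. g v = (if v \<in> B then 0 else v)"
    using vec.linear_independent_extend[OF C(2), of "\<lambda>v. if v \<in> B then 0 else v"] by blast
  interpret g: Vector_Spaces.linear "(*s)" "(*s)" g by (rule g(1))
  define P where "P = matrix g"
  have P: "P *v y = g y" for y using matrix_works[OF g(1)] by (simp add: P_def)
  have gK: "g s = 0" if "s \<in> K" for s
    by (rule g.eq_0_on_span[of B]) (use g(2) C(1) that span in auto)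
  have diff: "y - g y \<in> K" for y
  proof -
    have "y \<in> vec.span C" using C(3) by auto
    then show ?thesis
    proof (induction rule: vec.span_induct_alt)
      case base
      show ?case using K by (simp add: g.zero vec.subspace_0)
    next
      case (step c v y)
      have "v - g v \<in> K" using g(2) step(1) B(1) K by (auto simp: vec.subspace_0)
      then have "c *s (v - g v) + (y - g y) \<in> K"
        using K step(2) by (intro vec.subspace_add vec.subspace_scale) auto
      then show ?case by (simp add: g.add g.scale vec.scale_right_diff_distrib algebra_simps)
    qed
  qed
  have ker: "kern P = K"
  proof
    show "kern P \<subseteq> K"
    proof
      fix y assume "y \<in> kern P"
      then have "g y = 0" by (simp add: kern_def P)
      then show "y \<in> K" using diff[of y] by simp
    qed
    show "K \<subseteq> kern P" using gK by (auto simp: kern_def P)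
  qed
  have "g (g y) = g y" for y using gK[OF diff[of y]] by (simp add: g.diff)
  then have "P ** P = P" by (simp add: matrix_eq P flip: matrix_vector_mul_assoc)
  moreover have "CARD('a) ^ corank P = CARD('a) ^ vec.dim K"
    using card_kern[of P] card_subspace[OF K] ker by simp
  ultimately show ?thesis using that ker by (simp add: power_inject_exp)
qed

section \<open>Restrictions and globalness\<close>

definition n2 :: "('x::finite \<Rightarrow> complex) \<Rightarrow> real" where
  "n2 g = sqrt (sq g)"

lemma n2_nonneg [simp]: "0 \<le> n2 g"
  by (simp add: n2_def)

lemma n2_squared: "(n2 g)\<^sup>2 = sq g"
  by (simp add: n2_def)

lemma n2_L2_set: "n2 (g :: 'x::finite \<Rightarrow> complex) = L2_set (\<lambda>A. cmod (g A)) UNIV / sqrt CARD('x)"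
  by (simp add: n2_def sq_def mean_def L2_set_def real_sqrt_divide)

lemma n2_triangle: "n2 (\<lambda>A. g A + h A) \<le> n2 g + n2 (h :: 'x::finite \<Rightarrow> complex)"
proof -
  have "L2_set (\<lambda>A. cmod (g A + h A)) UNIV \<le> L2_set (\<lambda>A. cmod (g A) + cmod (h A)) UNIV"
    by (rule L2_set_mono) (auto simp: norm_triangle_ineq)
  also have "\<dots> \<le> L2_set (\<lambda>A. cmod (g A)) UNIV + L2_set (\<lambda>A. cmod (h A)) UNIV"
    by (rule L2_set_triangle_ineq)
  finally show ?thesis unfolding n2_L2_set by (simp add: divide_right_mono flip: add_divide_distrib)
qed

lemma n2_cmult: "n2 (\<lambda>A. c * g A) = cmod c * n2 g"
  by (simp add: n2_def sq_def norm_mult power_mult_distrib mean_cmult real_sqrt_mult)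

lemma n2_diff: "n2 (\<lambda>A. g A - h A) \<le> n2 g + n2 (h :: 'x::finite \<Rightarrow> complex)"
  using n2_triangle[of g "\<lambda>A. - 1 * h A"] n2_cmult[of "-1" h] by simp

lemma cmod_mean_squared_le:
  assumes "finite I" "I \<noteq> {}"
  shows "(cmod (mean I f))\<^sup>2 \<le> mean I (\<lambda>i. (cmod (f i))\<^sup>2)"
proof -
  have c: "real (card I) > 0" using assms by (simp add: card_gt_0_iff)
  have "cmod (mean I f) \<le> (\<Sum>i\<in>I. cmod (f i)) / card I"
    by (simp add: mean_def norm_divide divide_right_mono norm_sum)
  then have "(cmod (mean I f))\<^sup>2 \<le> ((\<Sum>i\<in>I. cmod (f i)) / card I)\<^sup>2"
    by (rule power_mono) simp
  also have "\<dots> = (\<Sum>i\<in>I. cmod (f i))\<^sup>2 / (card I)\<^sup>2" by (simp add: power_divide)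
  also have "\<dots> \<le> ((\<Sum>i\<in>I. (cmod (f i))\<^sup>2) * card I) / (card I)\<^sup>2"
    by (rule divide_right_mono[OF sum_squared_le_sum_of_squares]) simp
  also have "\<dots> = mean I (\<lambda>i. (cmod (f i))\<^sup>2)" using c by (simp add: mean_def power2_eq_square)
  finally show ?thesis .
qed

lemma sq_mean_le:
  assumes "finite I" "I \<noteq> {}"
  shows "sq (\<lambda>A. mean I (\<lambda>i. g i A)) \<le> mean I (\<lambda>i. sq (g i))"
proof -
  have "sq (\<lambda>A. mean I (\<lambda>i. g i A)) \<le> EE (\<lambda>A. mean I (\<lambda>i. (cmod (g i A))\<^sup>2))"
    unfolding sq_def by (rule mean_mono) (rule cmod_mean_squared_le[OF assms])
  then show ?thesis unfolding sq_def by (subst mean_swap)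
qed

lemma mean_le_const:
  assumes "finite I" "I \<noteq> {}" "\<And>i. i \<in> I \<Longrightarrow> f i \<le> (c::real)"
  shows "mean I f \<le> c"
proof -
  have "mean I f \<le> mean I (\<lambda>i. c)" by (rule mean_mono) (rule assms(3))
  also have "mean I (\<lambda>i. c) = c" using assms(1,2) by (simp add: mean_def)
  finally show ?thesis .
qed

lemma n2_mean_le:
  assumes "finite I" "I \<noteq> {}" "\<And>i. i \<in> I \<Longrightarrow> n2 (g i) \<le> c"
  shows "n2 (\<lambda>A. mean I (\<lambda>i. g i A)) \<le> c"
proof -
  obtain i where "i \<in> I" using assms(2) by blast
  have c: "0 \<le> c" using assms(3)[OF \<open>i \<in> I\<close>] n2_nonneg[of "g i"] by linarith
  have "sq (\<lambda>A. mean I (\<lambda>i. g i A)) \<le> mean I (\<lambda>i. sq (g i))" by (rule sq_mean_le[OF assms(1,2)])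
  also have "\<dots> \<le> c\<^sup>2"
  proof (rule mean_le_const[OF assms(1,2)])
    fix i assume "i \<in> I"
    then show "sq (g i) \<le> c\<^sup>2" unfolding n2_squared[symmetric] by (intro power_mono assms(3)) simp_all
  qed
  finally show ?thesis unfolding n2_def using c by (simp add: real_le_lsqrt)
qed

text \<open>
  With \<open>ker P = V'\<close> and \<open>im S = W'\<close>, the matrices \<open>S A P\<close> range uniformly over \<open>\<L>(V/V', W')\<close>, so
  every restriction is again a function on the full matrix space.
\<close>

definition rst :: "'a::{field,finite}^'n^'n \<Rightarrow> 'a^'n^'n \<Rightarrow> 'a^'n^'n \<Rightarrow> ('a^'n^'n \<Rightarrow> 'c) \<Rightarrow> 'a^'n^'n \<Rightarrow> 'c" where
  "rst S P T g = (\<lambda>A. g (T + S ** A ** P))"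

text \<open>All coranks up to k are included so that restrictions can be composed and k lowered. The
  norm is left unsquared so that sums and averages follow from the triangle inequality.\<close>

definition glob :: "nat \<Rightarrow> real \<Rightarrow> ('a::{field,finite}^'n^'n \<Rightarrow> complex) \<Rightarrow> bool" where
  "glob k c g \<longleftrightarrow> (\<forall>S P T. corank S + corank P \<le> k \<longrightarrow> n2 (rst S P T g) \<le> c)"

lemma globD: "glob k c g \<Longrightarrow> corank S + corank P \<le> k \<Longrightarrow> n2 (rst S P T g) \<le> c"
  by (simp add: glob_def)

lemma rst_rst: "rst S' P' T' (rst S P T g) = rst (S ** S') (P' ** P) (T + S ** T' ** P) g"
  by (simp add: rst_def fun_eq_iff matrix_add_ldistrib matrix_add_rdistrib_gen matrix_mul_assoc add.assoc)

lemma glob_rst: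
  assumes "glob (k + corank S + corank P) c g"
  shows "glob k c (rst S P T g)"
  unfolding glob_def rst_rst
proof (intro allI impI)
  fix S' P' T' :: "'a^'b^'b" assume "corank S' + corank P' \<le> k"
  then have "corank (S ** S') + corank (P' ** P) \<le> k + corank S + corank P"
    using corank_mult[of S S'] corank_mult[of P' P] by linarith
  then show "n2 (rst (S ** S') (P' ** P) (T + S ** T' ** P) g) \<le> c" by (rule globD[OF assms])
qed

lemma glob_mono: "glob k c g \<Longrightarrow> k' \<le> k \<Longrightarrow> c \<le> c' \<Longrightarrow> glob k' c' g"
  unfolding glob_def by (meson order_trans)

lemma corank_one [simp]: "corank (mat 1 :: 'a::{field,finite}^'n^'n) = 0"
  by (simp add: corank_eq_0 kern_def)

lemma rst_id [simp]: "rst (mat 1) (mat 1) 0 g = g"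
  by (simp add: rst_def)

lemma glob_n2: "glob k c g \<Longrightarrow> n2 g \<le> c"
  using globD[of k c g "mat 1" "mat 1" 0] by simp

lemma glob_nonneg: "glob k c g \<Longrightarrow> 0 \<le> c"
  using glob_n2[of k c g] n2_nonneg[of g] by linarith

lemma bij_transpose: "bij (transpose :: 'a^'n^'n \<Rightarrow> 'a^'n^'n)"
  by (rule bij_betw_byWitness[where f' = transpose]) auto

lemma sq_transpose: "sq (\<lambda>A. g (transpose A)) = sq (g :: 'a::{field,finite}^'n^'n \<Rightarrow> complex)"
  unfolding sq_def by (rule mean_bij[OF bij_transpose])

lemma n2_transpose: "n2 (\<lambda>A. g (transpose A)) = n2 (g :: 'a::{field,finite}^'n^'n \<Rightarrow> complex)"
  by (simp add: n2_def sq_transpose)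

lemma transpose_add: "transpose (A + B) = transpose A + transpose B"
  by (simp add: transpose_def vec_eq_iff)

lemma rst_transpose:
  "rst S P T (\<lambda>A. g (transpose A)) = (\<lambda>A. rst (transpose P) (transpose S) (transpose T) g (transpose A))"
  by (simp add: rst_def fun_eq_iff transpose_add matrix_transpose_mul matrix_mul_assoc)

lemma glob_transpose:
  assumes "glob k c g"
  shows "glob k c (\<lambda>A. g (transpose A))"
  unfolding glob_def rst_transpose n2_transpose
  by (intro allI impI globD[OF assms]) (simp add: corank_transpose add.commute)

lemma glob_shift: "glob k c g \<Longrightarrow> glob k c (\<lambda>A. g (A + D))"
proof -
  assume g: "glob k c g"
  have "rst S P T (\<lambda>A. g (A + D)) = rst S P (T + D) g" for S P T
    by (simp add: rst_def fun_eq_iff add_ac)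
  then show ?thesis using g unfolding glob_def by simp
qed

lemma glob_diff: "glob k c g \<Longrightarrow> glob k c' h \<Longrightarrow> glob k (c + c') (\<lambda>A. g A - h A)"
  unfolding glob_def rst_def
  by (intro allI impI order_trans[OF n2_diff] add_mono) blast+

lemma glob_cmult: "glob k c g \<Longrightarrow> glob k (cmod a * c) (\<lambda>A. a * g A)"
  unfolding glob_def rst_def by (simp add: n2_cmult mult_left_mono)

lemma glob_mean:
  fixes g :: "'i \<Rightarrow> 'a::{field,finite}^'n^'n \<Rightarrow> complex"
  assumes "finite I" "I \<noteq> {}" "\<And>i. i \<in> I \<Longrightarrow> glob k c (g i)"
  shows "glob k c (\<lambda>A. mean I (\<lambda>i. g i A))"
  unfolding glob_def
proof (intro allI impI)
  fix S P T :: "'a^'n^'n" assume *: "corank S + corank P \<le> k"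
  show "n2 (rst S P T (\<lambda>A. mean I (\<lambda>i. g i A))) \<le> c"
    unfolding rst_def
  proof (rule n2_mean_le[OF assms(1,2)])
    fix i assume "i \<in> I"
    from globD[OF assms(3)[OF this] *, of T] show "n2 (\<lambda>A. g i (T + S ** A ** P)) \<le> c"
      unfolding rst_def .
  qed
qed

text \<open>For fixed A the point T + S A P is uniform in T. Hence a bound proved for every
  restriction averages to a bound for the function itself.\<close>

lemma mean_rst: "EE (\<lambda>T. EE (\<lambda>A. f (T + S ** A ** P))) = EE (f :: 'a::{field,finite}^'n^'n \<Rightarrow> 'c::field_char_0)"
  by (subst mean_swap) (simp add: mean_translate)

lemma fc_rst:
  "fc (rst S P T g) B = (\<Sum>B'\<in>{B'. P ** B' ** S = B}. fc g B' * ch B' T)"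
proof -
  have "rst S P T g = synth (\<lambda>B. \<Sum>B'\<in>{B'. P ** B' ** S = B}. fc g B' * ch B' T)"
  proof
    fix A
    have "rst S P T g A = (\<Sum>B'\<in>UNIV. (fc g B' * ch B' T) * ch (P ** B' ** S) A)"
      unfolding rst_def by (subst fourier_inversion) (simp add: ch_add_right ch_mult mult.assoc)
    also have "\<dots> = (\<Sum>B\<in>UNIV. \<Sum>B'\<in>{B'. B' \<in> UNIV \<and> P ** B' ** S = B}. (fc g B' * ch B' T) * ch (P ** B' ** S) A)"
      by (rule sum.group[symmetric]) auto
    also have "\<dots> = synth (\<lambda>B. \<Sum>B'\<in>{B'. P ** B' ** S = B}. fc g B' * ch B' T) A"
      unfolding synth_def by (rule sum.cong) (auto simp: sum_distrib_right intro!: sum.cong)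
    finally show "rst S P T g A = synth (\<lambda>B. \<Sum>B'\<in>{B'. P ** B' ** S = B}. fc g B' * ch B' T) A" .
  qed
  then show ?thesis by simp
qed

lemma fproj_rst: "fproj X (rst S P T g) = rst S P T (fproj {B. P ** B ** S \<in> X} g)"
proof (rule fc_inject, rule ext)
  fix B
  show "fc (fproj X (rst S P T g)) B = fc (rst S P T (fproj {B. P ** B ** S \<in> X} g)) B"
    unfolding fc_fproj fc_rst by (auto intro!: sum.cong)
qed

lemma fproj_fproj: "fproj X (fproj Y g) = fproj (X \<inter> Y) g"
  by (rule fc_inject) (auto simp: fc_fproj fun_eq_iff)

lemma sq_fproj: "sq (fproj X g) = (\<Sum>B\<in>X. (cmod (fc g B))\<^sup>2)"
proof -
  have "(\<Sum>B\<in>UNIV. (cmod (fc (fproj X g) B))\<^sup>2) = (\<Sum>B\<in>X. (cmod (fc g B))\<^sup>2)"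
    by (rule sum.mono_neutral_cong_right) (auto simp: fc_fproj)
  then show ?thesis by (simp add: parseval)
qed

lemma fc_transpose: "fc (\<lambda>A. g (transpose A)) B = fc g (transpose B)"
proof -
  have "fc g (transpose B) = EE (\<lambda>A. g (transpose A) * cnj (ch (transpose B) (transpose A)))"
    unfolding fc_def by (rule mean_bij[OF bij_transpose, symmetric])
  then show ?thesis by (simp add: fc_def ch_transpose)
qed

section \<open>Averaging operators\<close>

definition pure :: "nat \<Rightarrow> ('a::{field,finite}^'n^'n \<Rightarrow> complex) \<Rightarrow> bool" where
  "pure r g \<longleftrightarrow> (\<forall>B. fc g B \<noteq> 0 \<longrightarrow> rk B = r)"

text \<open>Being an average of translates, this preserves \<open>glob\<close>. The constraint on l
  is chosen so that the Fourier multiplier vanishes exactly at the frequencies whose column space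
  contains x.\<close>

definition theta :: "'a::{field,finite}^'n \<Rightarrow> ('a^'n^'n \<Rightarrow> complex) \<Rightarrow> 'a^'n^'n \<Rightarrow> complex" where
  "theta x g A = mean {l. dot l x = 1} (\<lambda>l. EE (\<lambda>u. g (A + outer u l)))"

text \<open>Without a constraint on v the multiplier is q^(-rk B). It depends on the rank alone, as
  interpolation over ranks requires.\<close>

definition psi :: "('a::{field,finite}^'n^'n \<Rightarrow> complex) \<Rightarrow> 'a^'n^'n \<Rightarrow> complex" where
  "psi g A = EE (\<lambda>u. EE (\<lambda>v. g (A + outer u v)))"

lemma card_affine_slice:
  fixes S :: "('a::{field,finite}^'n) set"
  assumes S: "vec.subspace S" and l0: "l0 \<in> S" "dot l0 x = 1"
  shows "CARD('a) * card {l\<in>S. dot l x = 1} = card S"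
proof -
  have eq: "card {l\<in>S. dot l x = c} = card {l\<in>S. dot l x = 1}" for c
  proof -
    have "bij_betw (\<lambda>l. l + (c - 1) *s l0) {l\<in>S. dot l x = 1} {l\<in>S. dot l x = c}"
      by (rule bij_betw_byWitness[where f' = "\<lambda>l. l - (c - 1) *s l0"])
         (auto simp: dot_add_left dot_diff_left dot_scale_left l0 vec.subspace_add[OF S] vec.subspace_diff[OF S] vec.subspace_scale[OF S])
    then show ?thesis by (simp add: bij_betw_same_card)
  qed
  have "card S = card (\<Union>c\<in>UNIV. {l\<in>S. dot l x = c})"
    by (rule arg_cong[of _ _ card]) auto
  also have "\<dots> = (\<Sum>c\<in>UNIV. card {l\<in>S. dot l x = c})"
    by (rule card_UN_disjoint) auto
  also have "\<dots> = (\<Sum>c\<in>(UNIV::'a set). card {l\<in>S. dot l x = 1})"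
    by (rule sum.cong[OF refl eq])
  finally show ?thesis by simp
qed

lemma mean_chi_dot: "EE (\<lambda>u. chi (dot u x)) = (if x = 0 then 1 else 0)"
  for x :: "'a::{field,finite}^'n"
  unfolding mean_def sum_chi_dot by simp

text \<open>Averaging over u leaves those l that annihilate \<open>ran B\<close>. If x lies in
  \<open>ran B\<close>, none of them satisfies \<open>dot l x = 1\<close>. Otherwise this condition
  cuts out a fraction 1/q both of \<open>kern (transpose B)\<close> and of the whole space, so the
  surviving proportion of l is q^(-rk B).\<close>

lemma fc_theta:
  fixes x :: "'a::{field,finite}^'n"
  assumes x: "x \<noteq> 0"
  shows "fc (theta x g) B = (if x \<in> ran B then 0 else fc g B / of_nat CARD('a) ^ rk B)"
proof -
  let ?L = "{l. dot l x = 1}"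
  have "fc (theta x g) B = mean ?L (\<lambda>l. EE (\<lambda>u. fc g B * ch B (outer u l)))"
    unfolding theta_def fc_mean fc_shift ..
  also have "\<dots> = fc g B * mean ?L (\<lambda>l. EE (\<lambda>u. chi (dot u (transpose B *v l))))"
    by (simp only: mean_cmult ch_outer dot_transpose[of _ B] dot_commute[of "transpose B *v _"])
  also have "mean ?L (\<lambda>l. EE (\<lambda>u. chi (dot u (transpose B *v l)))) = of_nat (card {l \<in> kern (transpose B). dot l x = 1}) / of_nat (card ?L)"
    unfolding mean_chi_dot unfolding mean_def
    by (simp add: sum.If_cases kern_def Collect_conj_eq Int_commute)
  finally have 1: "fc (theta x g) B = fc g B * (of_nat (card {l \<in> kern (transpose B). dot l x = 1}) / of_nat (card ?L))" .
  obtain l1 where l1: "dot l1 x = 1" by (rule exists_functional[OF x])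
  then have cL: "CARD('a) * card ?L = CARD('a) ^ CARD('n)"
    using card_affine_slice[of UNIV l1 x] by simp
  show ?thesis
  proof (cases "x \<in> ran B")
    case True
    then obtain w where w: "x = B *v w" by (auto simp: ran_def)
    have "dot l x = 0" if "l \<in> kern (transpose B)" for l
      using that by (simp add: w dot_transpose kern_def)
    then have "{l \<in> kern (transpose B). dot l x = 1} = {}" by auto
    then have "card {l \<in> kern (transpose B). dot l x = 1} = 0" by (simp only: card.empty)
    then show ?thesis unfolding 1 using True by simp
  next
    case False
    obtain l0 where l0: "\<forall>s\<in>ran B. dot l0 s = 0" "dot l0 x = 1"
      by (rule separate_subspace[OF subspace_ran False])
    have "dot (transpose B *v l0) u = 0" for u
      using l0(1) by (simp flip: dot_transpose)
    then have "transpose B *v l0 = 0" using dot_all_zero[of "transpose B *v l0"] by (simp add: dot_commute)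
    then have "l0 \<in> kern (transpose B)" by (simp add: kern_def)
    from card_affine_slice[OF subspace_kern this l0(2)]
    have 2: "CARD('a) * card {l \<in> kern (transpose B). dot l x = 1} = card (kern (transpose B))" .
    have "card (kern (transpose B)) * CARD('a) ^ rk B = CARD('a) ^ CARD('n)"
      using card_kern_ran[of "transpose B"] unfolding rk_transpose .
    then have "CARD('a) * (card {l \<in> kern (transpose B). dot l x = 1} * CARD('a) ^ rk B) = CARD('a) * card ?L"
      unfolding cL 2[symmetric] by (simp only: mult.assoc)
    then have "card {l \<in> kern (transpose B). dot l x = 1} * CARD('a) ^ rk B = card ?L"
      by (rule mult_left_cancel[THEN iffD1, rotated]) simp
    moreover have "card ?L \<noteq> 0" using l1 by (auto simp: card_eq_0_iff)
    moreover have "(of_nat m :: complex) / of_nat N = 1 / of_nat CARD('a) ^ rk B"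
      if "m * CARD('a) ^ rk B = N" "N \<noteq> 0" for m N :: nat
    proof -
      have "m \<noteq> 0" using that by auto
      then show ?thesis unfolding that(1)[symmetric] of_nat_mult of_nat_power by simp
    qed
    ultimately have "of_nat (card {l \<in> kern (transpose B). dot l x = 1}) / of_nat (card ?L) = (1 / of_nat CARD('a) ^ rk B :: complex)"
      by blast
    then show ?thesis unfolding 1 using False by (simp only: if_False times_divide_eq_right mult_1_right)
  qed
qed

lemma glob_theta:
  fixes x :: "'a::{field,finite}^'n"
  assumes x: "x \<noteq> 0" and g: "glob k c g"
  shows "glob k c (theta x g)"
proof -
  obtain l1 where l1: "dot l1 x = 1" by (rule exists_functional[OF x])
  show ?thesis unfolding theta_def
    by (intro glob_mean glob_shift[OF g]) (use l1 in auto)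
qed

lemma fc_psi: "fc (psi g) B = fc g B / of_nat CARD('a) ^ rk B" for g :: "'a::{field,finite}^'n^'n \<Rightarrow> complex"
proof -
  have "fc (psi g) B = EE (\<lambda>u. EE (\<lambda>v. fc g B * ch B (outer u v)))"
    unfolding psi_def fc_mean fc_shift ..
  also have "\<dots> = fc g B * EE (\<lambda>u. if B *v u = 0 then 1 else 0)"
    by (simp only: mean_cmult ch_outer mean_chi_dot)
  also have "EE (\<lambda>u. if B *v u = 0 then 1 else 0) = (of_nat (card (kern B)) / of_nat (CARD('a) ^ CARD('n)) :: complex)"
    by (simp add: mean_def sum.If_cases kern_def)
  also have "\<dots> = 1 / of_nat CARD('a) ^ rk B"
    unfolding card_kern_ran[of B, symmetric] by (simp add: card_kern)
  finally show ?thesis by simp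
qed

lemma glob_psi: "glob k c g \<Longrightarrow> glob k c (psi g)"
  unfolding psi_def by (intro glob_mean glob_shift) auto

text \<open>On a function of pure rank r the multiplier of \<open>theta\<close> is the constant
  q^(-r) wherever it is nonzero, so after rescaling it is the projection to the frequencies whose
  column space misses x.\<close>

lemma fproj_contains:
  fixes x :: "'a::{field,finite}^'n"
  assumes "pure r g" "x \<noteq> 0"
  shows "fproj {B. x \<in> ran B} g = (\<lambda>A. g A - of_nat CARD('a) ^ r * theta x g A)"
proof (rule fc_inject, rule ext)
  fix B
  show "fc (fproj {B. x \<in> ran B} g) B = fc (\<lambda>A. g A - of_nat CARD('a) ^ r * theta x g A) B"
    using assms(1) by (cases "fc g B = 0") (auto simp: fc_fproj fc_diff fc_cmult fc_theta[OF assms(2)] pure_def)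
qed

lemma glob_fproj_contains:
  fixes x :: "'a::{field,finite}^'n"
  assumes "pure r g" "x \<noteq> 0" "glob k c g"
  shows "glob k ((1 + real CARD('a) ^ r) * c) (fproj {B. x \<in> ran B} g)"
proof -
  have "glob k (c + cmod (of_nat CARD('a) ^ r) * c) (fproj {B. x \<in> ran B} g)"
    unfolding fproj_contains[OF assms(1,2)]
    by (rule glob_diff[OF assms(3) glob_cmult[OF glob_theta[OF assms(2,3)]]])
  then show ?thesis by (simp add: algebra_simps norm_power)
qed

lemma pure_fproj: "pure r g \<Longrightarrow> pure r (fproj X g)"
  by (auto simp: pure_def fc_fproj)

lemma glob_fproj_contains_list:
  fixes g :: "'a::{field,finite}^'n^'n \<Rightarrow> complex"
  assumes "pure r g" "0 \<notin> set xs" "glob k c g"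
  shows "glob k ((1 + real CARD('a) ^ r) ^ length xs * c) (fproj {B. set xs \<subseteq> ran B} g)"
  using assms(2)
proof (induction xs)
  case Nil
  have "fproj {B. set [] \<subseteq> ran B} g = g" by (rule fc_inject) (simp add: fc_fproj fun_eq_iff)
  then show ?case using assms(3) by simp
next
  case (Cons x xs)
  have "fproj {B. set (x # xs) \<subseteq> ran B} g = fproj {B. x \<in> ran B} (fproj {B. set xs \<subseteq> ran B} g)"
    unfolding fproj_fproj by (rule arg_cong[of _ _ "\<lambda>X. fproj X g"]) auto
  moreover have "glob k ((1 + real CARD('a) ^ r) ^ length xs * c) (fproj {B. set xs \<subseteq> ran B} g)"
    using Cons by simp
  from glob_fproj_contains[OF pure_fproj[OF assms(1)] _ this, of x]
  have "glob k ((1 + real CARD('a) ^ r) * ((1 + real CARD('a) ^ r) ^ length xs * c)) (fproj {B. x \<in> ran B} (fproj {B. set xs \<subseteq> ran B} g))"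
    using Cons(2) by simp
  ultimately show ?case by (simp only: length_Cons power_Suc mult.assoc)
qed

text \<open>A column space contains K as soon as it contains a basis of K, so the price 1 + q^r is
  paid once per dimension.\<close>

lemma glob_fproj_subspace:
  fixes g :: "'a::{field,finite}^'n^'n \<Rightarrow> complex"
  assumes "pure r g" "vec.subspace K" "glob k c g"
  shows "glob k ((1 + real CARD('a) ^ r) ^ vec.dim K * c) (fproj {B. K \<subseteq> ran B} g)"
proof -
  obtain C where C: "C \<subseteq> K" "vec.independent C" "K \<subseteq> vec.span C" "card C = vec.dim K"
    by (rule vec.basis_exists[of K])
  obtain xs where xs: "set xs = C" "distinct xs" using finite_distinct_list[of C] by auto
  have nz: "0 \<notin> set xs" using C(2) xs(1) vec.dependent_zero by auto
  have "C \<subseteq> ran B \<longleftrightarrow> K \<subseteq> ran B" for B :: "'a^'n^'n"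
    using vec.span_minimal[OF _ subspace_ran[of B], of C] C by auto
  then have eq: "{B :: 'a^'n^'n. set xs \<subseteq> ran B} = {B. K \<subseteq> ran B}" by (simp add: xs(1))
  have len: "length xs = vec.dim K" using distinct_card[OF xs(2)] xs(1) C(4) by simp
  show ?thesis using glob_fproj_contains_list[OF assms(1) nz assms(3)] unfolding eq len .
qed

lemma pure_transpose: "pure r g \<Longrightarrow> pure r (\<lambda>A. g (transpose A))"
  by (simp add: pure_def fc_transpose) (metis rk_transpose)

lemma fproj_transpose:
  "fproj X (\<lambda>A. g (transpose A)) = (\<lambda>A. fproj {B. transpose B \<in> X} g (transpose A))"
  by (rule fc_inject) (auto simp: fc_fproj fc_transpose fun_eq_iff)

lemma glob_fproj_subspace_row:
  fixes g :: "'a::{field,finite}^'n^'n \<Rightarrow> complex"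
  assumes "pure r g" "vec.subspace K" "glob k c g"
  shows "glob k ((1 + real CARD('a) ^ r) ^ vec.dim K * c) (fproj {B. K \<subseteq> ran (transpose B)} g)"
proof -
  have "glob k ((1 + real CARD('a) ^ r) ^ vec.dim K * c) (fproj {B. K \<subseteq> ran B} (\<lambda>A. g (transpose A)))"
    by (rule glob_fproj_subspace[OF pure_transpose[OF assms(1)] assms(2) glob_transpose[OF assms(3)]])
  from glob_transpose[OF this] show ?thesis by (simp add: fproj_transpose)
qed

section \<open>Moebius weights on the lattice of subspaces\<close>

definition subs :: "('a::field^'n) set \<Rightarrow> ('a^'n) set set" where
  "subs L = {K. vec.subspace K \<and> K \<subseteq> L}"

text \<open>
  The numbers \<open>z b\<close> will be the numbers \<open>q\<^sup>k - 1\<close> of nonzero vectors in a subspace; expanding the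
  product over lists of nonzero vectors, grouped by their span, produces the weights.
\<close>

lemma product_coefficients:
  fixes z :: "nat \<Rightarrow> real"
  assumes "\<And>b. 1 \<le> z b"
  shows "\<exists>p :: nat \<Rightarrow> real. (\<forall>x. (\<Sum>s\<le>m. p s * x ^ s) = (\<Prod>b<m. 1 - x / z b)) \<and>
           (\<forall>x\<ge>0. (\<Sum>s\<le>m. \<bar>p s\<bar> * x ^ s) \<le> (1 + x) ^ m)"
proof (induction m)
  case 0
  show ?case by (rule exI[of _ "\<lambda>s. 1"]) simp
next
  case (Suc m)
  then obtain p where p: "\<And>x. (\<Sum>s\<le>m. p s * x ^ s) = (\<Prod>b<m. 1 - x / z b)"
      "\<And>x. 0 \<le> x \<Longrightarrow> (\<Sum>s\<le>m. \<bar>p s\<bar> * x ^ s) \<le> (1 + x) ^ m" by blast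
  \<comment> \<open>\<open>p1\<close> lists the coefficients of the old product and
    \<open>p2\<close> those of the old product times x / z m. Their difference belongs to the
    product with one more factor.\<close>
  define p1 where "p1 s = (if s \<le> m then p s else 0)" for s
  define p2 where "p2 s = (if s = 0 then 0 else p (s - 1) / z m)" for s
  have s1: "(\<Sum>s\<le>Suc m. c (p1 s) * x ^ s) = (\<Sum>s\<le>m. c (p s) * x ^ s)" if "c 0 = 0" for c :: "real \<Rightarrow> real" and x
    using that by (simp add: p1_def)
  have s2: "(\<Sum>s\<le>Suc m. c (p2 s) * x ^ s) = x * (\<Sum>s\<le>m. c (p s / z m) * x ^ s)" if "c 0 = 0" for c :: "real \<Rightarrow> real" and x
    using that by (simp add: p2_def sum.atMost_Suc_shift sum_distrib_left mult_ac del: sum.atMost_Suc)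
  have zm: "1 \<le> z m" by (rule assms)
  show ?case
  proof (intro exI[of _ "\<lambda>s. p1 s - p2 s"] conjI allI impI)
    fix x
    have "(\<Sum>s\<le>Suc m. (p1 s - p2 s) * x ^ s) = (\<Sum>s\<le>Suc m. p1 s * x ^ s) - (\<Sum>s\<le>Suc m. p2 s * x ^ s)"
      by (simp only: left_diff_distrib sum_subtractf)
    also have "\<dots> = (\<Sum>s\<le>m. p s * x ^ s) - x * (\<Sum>s\<le>m. p s / z m * x ^ s)"
      using s1[of "\<lambda>y. y" x] s2[of "\<lambda>y. y" x] by simp
    also have "(\<Sum>s\<le>m. p s / z m * x ^ s) = (\<Sum>s\<le>m. p s * x ^ s) / z m"
      by (simp add: sum_divide_distrib)
    finally show "(\<Sum>s\<le>Suc m. (p1 s - p2 s) * x ^ s) = (\<Prod>b<Suc m. 1 - x / z b)"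
      by (simp add: p(1) algebra_simps)
  next
    fix x :: real assume x: "0 \<le> x"
    have "(\<Sum>s\<le>Suc m. \<bar>p1 s - p2 s\<bar> * x ^ s) \<le> (\<Sum>s\<le>Suc m. \<bar>p1 s\<bar> * x ^ s + \<bar>p2 s\<bar> * x ^ s)"
    proof (rule sum_mono)
      fix s
      have "\<bar>p1 s - p2 s\<bar> * x ^ s \<le> (\<bar>p1 s\<bar> + \<bar>p2 s\<bar>) * x ^ s"
        by (rule mult_right_mono) (use x in auto)
      then show "\<bar>p1 s - p2 s\<bar> * x ^ s \<le> \<bar>p1 s\<bar> * x ^ s + \<bar>p2 s\<bar> * x ^ s" by (simp only: distrib_right)
    qed
    also have "\<dots> = (\<Sum>s\<le>m. \<bar>p s\<bar> * x ^ s) + x * (\<Sum>s\<le>m. \<bar>p s / z m\<bar> * x ^ s)"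
      using s1[of abs x] s2[of abs x] by (simp only: sum.distrib abs_zero)
    also have "\<dots> \<le> (\<Sum>s\<le>m. \<bar>p s\<bar> * x ^ s) + x * (\<Sum>s\<le>m. \<bar>p s\<bar> * x ^ s)"
    proof (intro add_left_mono mult_left_mono sum_mono mult_right_mono)
      fix s
      have "\<bar>p s\<bar> / z m \<le> \<bar>p s\<bar> / 1" by (rule divide_left_mono) (use zm in auto)
      then show "\<bar>p s / z m\<bar> \<le> \<bar>p s\<bar>" using zm by (simp add: abs_divide)
    qed (use x in auto)
    also have "\<dots> = (1 + x) * (\<Sum>s\<le>m. \<bar>p s\<bar> * x ^ s)" by (simp add: algebra_simps)
    also have "\<dots> \<le> (1 + x) * (1 + x) ^ m" by (rule mult_left_mono[OF p(2)[OF x]]) (use x in simp)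
    finally show "(\<Sum>s\<le>Suc m. \<bar>p1 s - p2 s\<bar> * x ^ s) \<le> (1 + x) ^ Suc m" by simp
  qed
qed

lemma finite_subs [simp]: "finite (subs (L :: ('a::{field,finite}^'n) set))"
  by (rule finite_subset[of _ "UNIV"]) auto

definition span_count :: "('a::{field,finite}^'n) set \<Rightarrow> nat \<Rightarrow> nat" where
  "span_count K s = card {xs. length xs = s \<and> 0 \<notin> set xs \<and> vec.span (set xs) = K}"

text \<open>Every list of nonzero vectors of L has exactly one span. This turns sums over the
  subspace lattice into polynomials in card L - 1.\<close>

lemma sum_span_count:
  fixes L :: "('a::{field,finite}^'n) set"
  assumes L: "vec.subspace L"
  shows "(\<Sum>K\<in>subs L. span_count K s) = (card L - 1) ^ s"
proof -
  let ?X = "{xs. set xs \<subseteq> L - {0} \<and> length xs = s}"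
  have fin: "finite ?X" by (rule finite_lists_length_eq) simp
  have "card ?X = card (L - {0}) ^ s" by (rule card_lists_length_eq) simp
  moreover have "card (L - {0}) = card L - 1" by (rule card_Diff_singleton) (rule vec.subspace_0[OF L])
  moreover have "card ?X = (\<Sum>K\<in>subs L. card {xs \<in> ?X. vec.span (set xs) = K})"
  proof -
    have "(\<Sum>K\<in>subs L. \<Sum>xs\<in>{xs \<in> ?X. vec.span (set xs) = K}. 1) = (\<Sum>xs\<in>?X. (1::nat))"
      by (rule sum.group[OF fin finite_subs]) (auto simp: subs_def vec.subspace_span intro: vec.span_minimal[OF _ L, THEN subsetD])
    then show ?thesis by simp
  qed
  moreover have "card {xs \<in> ?X. vec.span (set xs) = K} = span_count K s" if K: "K \<in> subs L" for K
    unfolding span_count_def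
    by (rule arg_cong[of _ _ card]) (use K vec.span_superset in \<open>auto simp: subs_def\<close>)
  ultimately show ?thesis by simp
qed

lemma span_count_le: "span_count K s \<le> card K ^ s" for K :: "('a::{field,finite}^'n) set"
proof -
  have "span_count K s \<le> card {xs. set xs \<subseteq> K \<and> length xs = s}"
    unfolding span_count_def
    by (intro card_mono finite_lists_length_eq) (use vec.span_superset in auto)
  also have "\<dots> = card K ^ s" by (rule card_lists_length_eq) simp
  finally show ?thesis .
qed

lemma card_subspace_ge_1: "vec.subspace L \<Longrightarrow> 1 \<le> card L" for L :: "('a::{field,finite}^'n) set"
  by (simp add: card_subspace)

lemma subspace_dim_0: "vec.subspace L \<Longrightarrow> vec.dim L = 0 \<longleftrightarrow> L = {0}" for L :: "('a::{field,finite}^'n) set"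
  using vec.subspace_0[of L] by auto

text \<open>The sum over the subspaces of L becomes the product of 1 - (card L - 1) / (q^(b+1) - 1)
  over b < m. It is 1 for L = {0} and has a vanishing factor when 1 <= dim L <= m. These weights
  stand in for the Moebius function of the lattice, and the coefficient bound of the polynomial
  controls their size.\<close>

lemma moebius_weights:
  obtains \<mu> :: "('a::{field,finite}^'n) set \<Rightarrow> real" where
    "\<And>L. vec.subspace L \<Longrightarrow> vec.dim L \<le> m \<Longrightarrow> (\<Sum>K\<in>subs L. \<mu> K) = (if L = {0} then 1 else 0)"
    "\<And>K. \<bar>\<mu> K\<bar> \<le> (1 + real (card K)) ^ m"
proof -
  have q2: "2 \<le> real CARD('a)" using card_field_ge_2[where 'a='a] by linarith
  have ge: "1 \<le> real CARD('a) ^ Suc b - 1" for b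
  proof -
    have "2 * 1 \<le> real CARD('a) * real CARD('a) ^ b"
      by (rule mult_mono[OF q2 one_le_power]) (use q2 in linarith)+
    then show ?thesis by simp
  qed
  obtain p :: "nat \<Rightarrow> real" where p: "\<And>x. (\<Sum>s\<le>m. p s * x ^ s) = (\<Prod>b<m. 1 - x / (real CARD('a) ^ Suc b - 1))"
      "\<And>x. 0 \<le> x \<Longrightarrow> (\<Sum>s\<le>m. \<bar>p s\<bar> * x ^ s) \<le> (1 + x) ^ m"
    using product_coefficients[of "\<lambda>b. real CARD('a) ^ Suc b - 1" m, OF ge] by blast
  define \<mu> :: "('a^'n) set \<Rightarrow> real" where "\<mu> K = (\<Sum>s\<le>m. p s * real (span_count K s))" for K
  have 1: "(\<Sum>K\<in>subs L. \<mu> K) = (if L = {0} then 1 else 0)" if L: "vec.subspace L" and d: "vec.dim L \<le> m" for L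
  proof -
    have "(\<Sum>K\<in>subs L. \<mu> K) = (\<Sum>s\<le>m. p s * real (\<Sum>K\<in>subs L. span_count K s))"
      unfolding \<mu>_def of_nat_sum sum_distrib_left by (rule sum.swap)
    also have "\<dots> = (\<Sum>s\<le>m. p s * (real (card L) - 1) ^ s)"
      unfolding sum_span_count[OF L] using card_subspace_ge_1[OF L] by (simp add: of_nat_diff)
    also have "\<dots> = (\<Prod>b<m. 1 - (real CARD('a) ^ vec.dim L - 1) / (real CARD('a) ^ Suc b - 1))"
      unfolding p(1) card_subspace[OF L] of_nat_power ..
    also have "\<dots> = (if L = {0} then 1 else 0)"
    proof (cases "L = {0}")
      case True
      then show ?thesis by simp
    next
      case False
      then obtain b where b: "vec.dim L = Suc b" using subspace_dim_0[OF L] by (cases "vec.dim L") auto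
      have "1 - (real CARD('a) ^ vec.dim L - 1) / (real CARD('a) ^ Suc b - 1) = 0"
        using ge[of b] unfolding b by simp
      then have "(\<Prod>b<m. 1 - (real CARD('a) ^ vec.dim L - 1) / (real CARD('a) ^ Suc b - 1)) = 0"
        using d b by (intro prod_zero) (auto intro!: bexI[of _ b])
      then show ?thesis using False by simp
    qed
    finally show ?thesis .
  qed
  have 2: "\<bar>\<mu> K\<bar> \<le> (1 + real (card K)) ^ m" for K
  proof -
    have "\<bar>\<mu> K\<bar> \<le> (\<Sum>s\<le>m. \<bar>p s\<bar> * real (span_count K s))"
      unfolding \<mu>_def by (rule order_trans[OF sum_abs]) (simp add: abs_mult)
    also have "\<dots> \<le> (\<Sum>s\<le>m. \<bar>p s\<bar> * real (card K) ^ s)"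
    proof (intro sum_mono mult_left_mono)
      fix s
      show "real (span_count K s) \<le> real (card K) ^ s"
        using span_count_le[of K s] by (metis of_nat_le_iff of_nat_power)
    qed auto
    also have "\<dots> \<le> (1 + real (card K)) ^ m" by (rule p(2)) simp
    finally show ?thesis .
  qed
  show ?thesis by (rule that[OF 1 2])
qed

lemma sum_subs_le:
  fixes I :: "('a::{field,finite}^'n) set" and w :: "nat \<Rightarrow> real"
  assumes I: "vec.subspace I" and w: "\<And>i. 0 \<le> w i"
  shows "(\<Sum>K\<in>subs I. w (vec.dim K)) \<le> (\<Sum>i\<le>CARD('n). real (card I) ^ i * w i)"
proof -
  have "(\<Sum>K\<in>subs I. w (vec.dim K)) = (\<Sum>i\<le>CARD('n). \<Sum>K\<in>{K \<in> subs I. vec.dim K = i}. w (vec.dim K))"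
    by (rule sum.group[symmetric]) (auto simp: dim_subset_UNIV_cart_gen)
  also have "\<dots> = (\<Sum>i\<le>CARD('n). real (card {K. vec.subspace K \<and> K \<subseteq> I \<and> vec.dim K = i}) * w i)"
  proof (rule sum.cong[OF refl])
    fix i
    have eq: "{K \<in> subs I. vec.dim K = i} = {K. vec.subspace K \<and> K \<subseteq> I \<and> vec.dim K = i}"
      by (auto simp only: subs_def mem_Collect_eq)
    have "(\<Sum>K\<in>{K \<in> subs I. vec.dim K = i}. w (vec.dim K)) = (\<Sum>K\<in>{K \<in> subs I. vec.dim K = i}. w i)"
      by (rule sum.cong[OF refl]) (simp only: mem_Collect_eq)
    then show "(\<Sum>K\<in>{K \<in> subs I. vec.dim K = i}. w (vec.dim K)) = real (card {K. vec.subspace K \<and> K \<subseteq> I \<and> vec.dim K = i}) * w i"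
      unfolding eq by (simp only: sum_constant)
  qed
  also have "\<dots> \<le> (\<Sum>i\<le>CARD('n). real (card I) ^ i * w i)"
  proof (intro sum_mono mult_right_mono w)
    fix i
    show "real (card {K. vec.subspace K \<and> K \<subseteq> I \<and> vec.dim K = i}) \<le> real (card I) ^ i"
      unfolding of_nat_power[symmetric] of_nat_le_iff by (rule card_subspaces_dim[OF I])
  qed
  finally show ?thesis .
qed

lemma geometric_half: "0 \<le> x \<Longrightarrow> x \<le> 1/2 \<Longrightarrow> (\<Sum>i\<le>m. x ^ i) \<le> (2::real)"
proof -
  assume x: "0 \<le> x" "x \<le> 1/2"
  have "(\<Sum>i\<le>m. x ^ i) \<le> (\<Sum>i\<le>m. (1/2) ^ i)" by (intro sum_mono power_mono x)
  also have "\<dots> = 2 - (1/2) ^ m" by (induction m) (auto simp: field_simps)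
  also have "\<dots> \<le> 2" by simp
  finally show ?thesis .
qed

section \<open>The combinatorial decomposition of a pair of matrices\<close>

text \<open>The inclusion of kernels says that the row space of B' lies in the row space of B, so
  rows and columns are treated alike.\<close>

definition under :: "'a::field^'n^'n \<Rightarrow> 'a^'n^'n \<Rightarrow> bool" where
  "under B' B \<longleftrightarrow> ran B' \<subseteq> ran B \<and> kern B \<subseteq> kern B'"

text \<open>B' kills \<open>kern B\<close>, so it is determined by its values at preimages of a
  basis of \<open>ran B\<close>. These are rk B vectors, each lying in \<open>ran B\<close>.\<close>

lemma card_under:
  fixes B :: "'a::{field,finite}^'n^'n"
  shows "card {B'. under B' B} \<le> CARD('a) ^ (rk B)\<^sup>2"
proof -
  obtain C where C: "C \<subseteq> ran B" "vec.independent C" "ran B \<subseteq> vec.span C" "card C = vec.dim (ran B)"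
    by (rule vec.basis_exists[of "ran B"])
  have fin: "finite C" by simp
  have "\<forall>y\<in>C. \<exists>x. B *v x = y" using C(1) by (auto simp: ran_def)
  then obtain h where h: "\<And>y. y \<in> C \<Longrightarrow> B *v h y = y" by metis
  let ?f = "\<lambda>B'. \<lambda>y\<in>C. B' *v h y"
  have "inj_on ?f {B'. under B' B}"
  proof (rule inj_onI)
    fix X Y assume XY: "X \<in> {B'. under B' B}" "Y \<in> {B'. under B' B}" "?f X = ?f Y"
    have "X *v w = Y *v w" for w
    proof -
      have "B *v w \<in> vec.span C" using C(3) mem_ran by blast
      then obtain u where u: "B *v w = (\<Sum>v\<in>C. u v *s v)" using vec.span_finite[OF fin] by auto
      define w' where "w' = (\<Sum>v\<in>C. u v *s h v)"
      have lin: "Z *v w' = (\<Sum>v\<in>C. u v *s (Z *v h v))" for Z :: "'a^'n^'n"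
        unfolding w'_def by (simp add: vec.sum mat_vec_scale)
      have "B *v (w - w') = 0"
        by (simp add: matrix_vector_mult_diff_distrib u lin h cong: sum.cong)
      then have "X *v (w - w') = 0" "Y *v (w - w') = 0" using XY(1,2) by (auto simp: under_def kern_def)
      moreover have "X *v w' = Y *v w'"
        unfolding lin by (rule sum.cong) (use fun_cong[OF XY(3)] in \<open>auto split: if_splits simp: restrict_def\<close>, metis)
      ultimately show ?thesis by (simp add: matrix_vector_mult_diff_distrib)
    qed
    then show "X = Y" by (simp add: matrix_eq)
  qed
  moreover have "?f ` {B'. under B' B} \<subseteq> C \<rightarrow>\<^sub>E ran B"
    by (auto simp: under_def ran_def)
  ultimately have "card {B'. under B' B} \<le> card (C \<rightarrow>\<^sub>E ran B)"
    by (rule card_inj_on_le) (rule finite_PiE[OF fin], simp)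
  also have "\<dots> = (CARD('a) ^ rk B) ^ rk B"
    by (simp add: card_PiE[OF fin] card_ran) (simp add: C(4) rk_def)
  finally show ?thesis by (simp add: power2_eq_square power_mult)
qed

text \<open>B' is defined to be B1 on Z, the vectors that B1 maps into \<open>ran E\<close>, and 0
  on \<open>kern E\<close>. The row hypothesis makes Z and \<open>kern E\<close> span everything: a
  functional vanishing on both vanishes on the kernels of B1, B2 and E. The column hypothesis makes
  B' well defined: on the intersection of Z and \<open>kern E\<close> the maps B1 and B2 agree, so
  the common value lies in all three column spaces.\<close>

lemma common_part:
  fixes B1 B2 :: "'a::{field,finite}^'n^'n"
  defines "E \<equiv> B1 - B2"
  assumes L0: "ran B1 \<inter> ran B2 \<inter> ran E = {0}"
    and N0: "ran (transpose B1) \<inter> ran (transpose B2) \<inter> ran (transpose E) = {0}"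
  shows "\<exists>B'. under B' E \<and> under B' B1 \<and> under (B' - E) B2"
proof -
  define Z where "Z = {w. B1 *v w \<in> ran E}"
  have Zs: "vec.subspace Z"
    using subspace_ran[of E] unfolding Z_def vec.subspace_def
    by (auto simp: matrix_vector_right_distrib mat_vec_scale)
  have Ev: "E *v w = B1 *v w - B2 *v w" for w by (simp add: E_def matrix_vector_diff_left)
  have B2Z: "B2 *v w \<in> ran E" if w: "w \<in> Z" for w
  proof -
    have "B2 *v w = B1 *v w - E *v w" by (simp add: Ev)
    then show ?thesis using w vec.subspace_diff[OF subspace_ran, of _ E "E *v w"] by (simp add: Z_def)
  qed
  have zero: "0 \<in> ran E" by (rule vec.subspace_0[OF subspace_ran])
  have k1: "kern B1 \<subseteq> Z" using zero by (auto simp: kern_def Z_def)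
  have k2: "kern B2 \<subseteq> Z"
  proof
    fix w assume "w \<in> kern B2"
    then have "B1 *v w = E *v w" by (simp add: Ev kern_def)
    then show "w \<in> Z" by (simp add: Z_def)
  qed
  have sub: "vec.subspace {x + y | x y. x \<in> Z \<and> y \<in> kern E}"
    by (rule vec.subspace_sums[OF Zs subspace_kern])
  have dec: "\<exists>z k. z \<in> Z \<and> k \<in> kern E \<and> v = z + k" for v
  proof (rule ccontr)
    assume "\<nexists>z k. z \<in> Z \<and> k \<in> kern E \<and> v = z + k"
    then have "v \<notin> {x + y | x y. x \<in> Z \<and> y \<in> kern E}" by blast
    then obtain l where l: "\<forall>s\<in>{x + y | x y. x \<in> Z \<and> y \<in> kern E}. dot l s = 0" "dot l v = 1"
      by (rule separate_subspace[OF sub])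
    have lZ: "dot l z = 0" if z: "z \<in> Z" for z
    proof -
      have "z + 0 \<in> {x + y | x y. x \<in> Z \<and> y \<in> kern E}" using z vec.subspace_0[OF subspace_kern] by blast
      from bspec[OF l(1) this] show ?thesis by (simp only: add_0_right)
    qed
    have lE: "dot l k = 0" if k: "k \<in> kern E" for k
    proof -
      have "0 + k \<in> {x + y | x y. x \<in> Z \<and> y \<in> kern E}"
        using k vec.subspace_0[OF Zs] unfolding mem_Collect_eq by (intro exI conjI) (rule refl)
      from bspec[OF l(1) this] show ?thesis by (simp only: add_0_left)
    qed
    have "l \<in> ran (transpose B1) \<inter> ran (transpose B2) \<inter> ran (transpose E)"
      unfolding Int_iff mem_ran_transpose
      by (intro conjI ballI lE lZ subsetD[OF k1] subsetD[OF k2])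
    then have "l = 0" unfolding N0 by simp
    then show False using l(2) by simp
  qed
  \<comment> \<open>An arbitrary Z-component of v is chosen; the next fact shows that its image
    under B1 does not depend on the choice.\<close>
  define \<phi> where "\<phi> v = B1 *v (SOME z. z \<in> Z \<and> v - z \<in> kern E)" for v
  have \<phi>: "\<phi> (z + k) = B1 *v z" if zk: "z \<in> Z" "k \<in> kern E" for z k
  proof -
    define z' where "z' = (SOME z'. z' \<in> Z \<and> (z + k) - z' \<in> kern E)"
    have "z' \<in> Z \<and> (z + k) - z' \<in> kern E"
      unfolding z'_def
      by (rule someI[of "\<lambda>z'. z' \<in> Z \<and> (z + k) - z' \<in> kern E" z]) (simp add: zk)
    then have z': "z' \<in> Z" "(z + k) - z' \<in> kern E" by auto
    have d: "z - z' \<in> kern E"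
      using vec.subspace_diff[OF subspace_kern z'(2) zk(2)] by (simp add: algebra_simps)
    have "B1 *v (z - z') = B2 *v (z - z')" using d Ev[of "z - z'"] by (simp add: kern_def)
    moreover have "z - z' \<in> Z" by (rule vec.subspace_diff[OF Zs zk(1) z'(1)])
    ultimately have "B1 *v (z - z') \<in> ran B1 \<inter> ran B2 \<inter> ran E" by (simp add: Z_def) (metis mem_ran)
    then have "B1 *v (z - z') = 0" unfolding L0 by simp
    then show ?thesis unfolding \<phi>_def z'_def[symmetric] by (simp add: matrix_vector_mult_diff_distrib)
  qed
  have add: "\<phi> (v + w) = \<phi> v + \<phi> w" for v w
  proof -
    obtain z k z' k' where zk: "z \<in> Z" "k \<in> kern E" "v = z + k" "z' \<in> Z" "k' \<in> kern E" "w = z' + k'"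
      using dec[of v] dec[of w] by blast
    have "v + w = (z + z') + (k + k')" using zk by simp
    moreover have "z + z' \<in> Z" "k + k' \<in> kern E"
      using zk by (auto intro: vec.subspace_add[OF Zs] vec.subspace_add[OF subspace_kern])
    ultimately have "\<phi> (v + w) = B1 *v (z + z')" using \<phi> by presburger
    then show ?thesis using zk \<phi> by (simp add: matrix_vector_right_distrib)
  qed
  have scale: "\<phi> (c *s v) = c *s \<phi> v" for c v
  proof -
    obtain z k where zk: "z \<in> Z" "k \<in> kern E" "v = z + k" using dec[of v] by blast
    have "c *s v = c *s z + c *s k" by (simp add: zk vector_add_ldistrib)
    moreover have "c *s z \<in> Z" "c *s k \<in> kern E"
      using zk by (auto intro: vec.subspace_scale[OF Zs] vec.subspace_scale[OF subspace_kern])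
    ultimately have "\<phi> (c *s v) = B1 *v (c *s z)" using \<phi> by presburger
    then show ?thesis using zk \<phi> by (simp add: mat_vec_scale)
  qed
  have lin: "Vector_Spaces.linear (*s) (*s) \<phi>"
    by (unfold_locales) (simp_all only: add scale)
  define B' where "B' = matrix \<phi>"
  have B': "B' *v (z + k) = B1 *v z" if "z \<in> Z" "k \<in> kern E" for z k
    using matrix_works[OF lin, of "z + k"] \<phi>[OF that] by (simp add: B'_def)
  have B'Z: "B' *v z = B1 *v z" if "z \<in> Z" for z
    using B'[OF that vec.subspace_0[OF subspace_kern]] by simp
  have B'E: "B' *v k = 0" if "k \<in> kern E" for k
    using B'[OF vec.subspace_0[OF Zs] that] by simp
  have ranB': "\<exists>z\<in>Z. B' *v v = B1 *v z" for v
    using dec[of v] B' by metis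
  have "ran B' \<subseteq> ran E"
  proof
    fix y assume "y \<in> ran B'"
    then obtain v where "y = B' *v v" by (auto simp: ran_def)
    then obtain z where "z \<in> Z" "y = B1 *v z" using ranB'[of v] by auto
    then show "y \<in> ran E" by (simp add: Z_def)
  qed
  moreover have "kern E \<subseteq> kern B'" using B'E by (auto simp: kern_def)
  moreover have "ran B' \<subseteq> ran B1"
  proof
    fix y assume "y \<in> ran B'"
    then obtain v where "y = B' *v v" by (auto simp: ran_def)
    then obtain z where "z \<in> Z" "y = B1 *v z" using ranB'[of v] by auto
    then show "y \<in> ran B1" by simp
  qed
  moreover have "kern B1 \<subseteq> kern B'" using k1 B'Z by (auto simp: kern_def)
  moreover have "ran (B' - E) \<subseteq> ran B2"
  proof
    fix y assume "y \<in> ran (B' - E)"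
    then obtain v where y: "y = B' *v v - E *v v" by (auto simp: ran_def matrix_vector_diff_left)
    obtain z k where zk: "z \<in> Z" "k \<in> kern E" "v = z + k" using dec[of v] by blast
    have "E *v v = E *v z" using zk by (simp add: kern_def matrix_vector_right_distrib)
    then have "y = B2 *v z" using y B'[OF zk(1,2)] Ev[of z] zk(3) by simp
    then show "y \<in> ran B2" by simp
  qed
  moreover have "kern B2 \<subseteq> kern (B' - E)"
  proof
    fix w assume w: "w \<in> kern B2"
    then have "w \<in> Z" using k2 by blast
    then have "(B' - E) *v w = B2 *v w" by (simp add: matrix_vector_diff_left B'Z Ev)
    then show "w \<in> kern (B' - E)" using w by (simp add: kern_def)
  qed
  ultimately show ?thesis unfolding under_def by blast
qed

section \<open>The fourth moment\<close>

definition q4 :: "('x::finite \<Rightarrow> complex) \<Rightarrow> real" where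
  "q4 g = EE (\<lambda>A. (cmod (g A)) ^ 4)"

text \<open>These are the Fourier coefficients of the squared modulus of g, so by Parseval the
  fourth moment is the energy of \<open>ac g\<close>.\<close>

definition ac :: "('a::{field,finite}^'n^'n \<Rightarrow> complex) \<Rightarrow> 'a^'n^'n \<Rightarrow> complex" where
  "ac g E = (\<Sum>B\<in>UNIV. fc g B * cnj (fc g (B - E)))"

lemma fc_mult_cnj: "fc (\<lambda>A. g A * cnj (h A)) E = (\<Sum>B\<in>UNIV. fc g B * cnj (fc h (B - E)))"
proof -
  have "fc (\<lambda>A. h A * ch E A) B = fc h (B - E)" for B
    unfolding fc_def ch_diff_left by (simp add: mult_ac)
  moreover have "fc (\<lambda>A. g A * cnj (h A)) E = EE (\<lambda>A. g A * cnj (h A * ch E A))"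
    unfolding fc_def by (simp add: mult_ac)
  ultimately show ?thesis by (simp only: parseval_inner[symmetric])
qed

lemma q4_eq_sq: "q4 g = sq (\<lambda>A. g A * cnj (g A))"
proof -
  have "(cmod (z * cnj z))\<^sup>2 = (cmod z) ^ 4" for z
    by (simp add: norm_mult power2_eq_square power4_eq_xxxx)
  then show ?thesis by (simp add: q4_def sq_def)
qed

lemma q4_ac: "q4 g = (\<Sum>E\<in>UNIV. (cmod (ac g E))\<^sup>2)"
  unfolding q4_eq_sq parseval[symmetric] fc_mult_cnj ac_def ..

lemma q4_nonneg [simp]: "0 \<le> q4 g"
  by (simp add: q4_def mean_nonneg)

definition deg_le :: "nat \<Rightarrow> ('a::{field,finite}^'n^'n \<Rightarrow> complex) \<Rightarrow> bool" where
  "deg_le r g \<longleftrightarrow> (\<forall>B. fc g B \<noteq> 0 \<longrightarrow> rk B \<le> r)"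

text \<open>The condition under which \<open>common_part\<close> applies to the pair B and B -
  E.\<close>

definition good :: "'a::field^'n^'n \<Rightarrow> 'a^'n^'n \<Rightarrow> bool" where
  "good E B \<longleftrightarrow> ran B \<inter> ran (B - E) \<inter> ran E = {0} \<and>
     ran (transpose B) \<inter> ran (transpose (B - E)) \<inter> ran (transpose E) = {0}"

definition rem :: "('a::{field,finite}^'n^'n \<Rightarrow> complex) \<Rightarrow> 'a^'n^'n \<Rightarrow> complex" where
  "rem g E = (\<Sum>B\<in>{B. good E B}. fc g B * cnj (fc g (B - E)))"

lemma cauchy_schwarz_card:
  "(\<Sum>i\<in>I. y i)\<^sup>2 \<le> real (card I) * (\<Sum>i\<in>I. (y i)\<^sup>2)"
  using sum_squared_le_sum_of_squares[of y I] by (simp add: mult.commute)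

lemma rk_pair: "rk E \<le> rk B + rk (B - E)" for B E :: "'a::{field,finite}^'n^'n"
  using rk_diff[of B "B - E"] by simp

text \<open>Nonzero terms force rk E <= 2 r, and for a good pair \<open>common_part\<close> yields
  one of at most q^(4 r^2) matrices B' under E. Cauchy-Schwarz over B' and then over B separates B
  from B - E and leaves w B' times w (B' - E), where w collects the energy above B'. By
  \<open>card_under\<close> the total of w is at most q^(r^2) sq g, which adds 2 to the 4 in the
  exponent.\<close>

lemma rem_bound:
  fixes g :: "'a::{field,finite}^'n^'n \<Rightarrow> complex"
  assumes g: "deg_le r g"
  shows "(\<Sum>E\<in>UNIV. (cmod (rem g E))\<^sup>2) \<le> real CARD('a) ^ (6 * r\<^sup>2) * (sq g)\<^sup>2"
proof -
  define a where "a B = cmod (fc g B)" for B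
  define w where "w B' = (\<Sum>B\<in>{B. under B' B}. (a B)\<^sup>2)" for B'
  have a0: "0 \<le> a B" for B by (simp add: a_def)
  have w0: "0 \<le> w B" for B by (simp add: w_def sum_nonneg)
  have q1: "1 \<le> real CARD('a)" using card_field_gt_1(1)[where 'a='a] by linarith
  have pt: "(cmod (rem g E))\<^sup>2 \<le> real CARD('a) ^ (4 * r\<^sup>2) * (\<Sum>B'\<in>UNIV. w B' * w (B' - E))" for E
  proof (cases "rk E \<le> 2 * r")
    case False
    have "fc g B * cnj (fc g (B - E)) = 0" for B
    proof (rule ccontr)
      assume "fc g B * cnj (fc g (B - E)) \<noteq> 0"
      then have "rk B \<le> r" "rk (B - E) \<le> r" using g by (auto simp: deg_le_def)
      then show False using rk_pair[of E B] False by linarith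
    qed
    then have "rem g E = 0" unfolding rem_def by (simp only: sum.neutral_const)
    moreover have "0 \<le> (\<Sum>B'\<in>UNIV. w B' * w (B' - E))" by (intro sum_nonneg mult_nonneg_nonneg w0)
    ultimately show ?thesis by simp
  next
    case True
    define U where "U = {B'. under B' E}"
    define X where "X B' = {B. under B' B \<and> under (B' - E) (B - E)}" for B'
    define y where "y B' = (\<Sum>B\<in>X B'. a B * a (B - E))" for B'
    have "cmod (rem g E) \<le> (\<Sum>B\<in>{B. good E B}. a B * a (B - E))"
      unfolding rem_def a_def by (rule order_trans[OF norm_sum]) (simp add: norm_mult)
    also have "\<dots> \<le> (\<Sum>B\<in>{B. good E B}. \<Sum>B'\<in>U. if B \<in> X B' then a B * a (B - E) else 0)"
    proof (rule sum_mono)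
      fix B assume "B \<in> {B. good E B}"
      then have "ran B \<inter> ran (B - E) \<inter> ran (B - (B - E)) = {0}"
        "ran (transpose B) \<inter> ran (transpose (B - E)) \<inter> ran (transpose (B - (B - E))) = {0}"
        by (simp_all add: good_def)
      from common_part[OF this] obtain B' where "B' \<in> U" "B \<in> X B'"
        by (auto simp: U_def X_def)
      then have "a B * a (B - E) = (if B \<in> X B' then a B * a (B - E) else 0)" by simp
      also have "\<dots> \<le> (\<Sum>B'\<in>U. if B \<in> X B' then a B * a (B - E) else 0)"
        by (rule member_le_sum[OF \<open>B' \<in> U\<close>]) (simp_all add: a0)
      finally show "a B * a (B - E) \<le> (\<Sum>B'\<in>U. if B \<in> X B' then a B * a (B - E) else 0)" .
    qed
    also have "\<dots> \<le> (\<Sum>B\<in>UNIV. \<Sum>B'\<in>U. if B \<in> X B' then a B * a (B - E) else 0)"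
      by (rule sum_mono2) (auto intro!: sum_nonneg simp: a0)
    also have "\<dots> = (\<Sum>B'\<in>U. \<Sum>B\<in>UNIV. if B \<in> X B' then a B * a (B - E) else 0)" by (rule sum.swap)
    also have "\<dots> = (\<Sum>B'\<in>U. y B')"
      unfolding y_def by (rule sum.cong[OF refl]) (simp add: sum.If_cases)
    finally have 1: "cmod (rem g E) \<le> (\<Sum>B'\<in>U. y B')" .
    have y2: "(y B')\<^sup>2 \<le> w B' * w (B' - E)" for B'
    proof -
      have "(y B')\<^sup>2 \<le> (\<Sum>B\<in>X B'. (a B)\<^sup>2) * (\<Sum>B\<in>X B'. (a (B - E))\<^sup>2)"
        unfolding y_def by (rule Cauchy_Schwarz_ineq_sum)
      also have "\<dots> \<le> w B' * w (B' - E)"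
      proof (rule mult_mono)
        show "(\<Sum>B\<in>X B'. (a B)\<^sup>2) \<le> w B'"
          unfolding w_def by (rule sum_mono2) (auto simp: X_def)
        have "(\<Sum>B\<in>X B'. (a (B - E))\<^sup>2) = (\<Sum>C\<in>(\<lambda>B. B - E) ` X B'. (a C)\<^sup>2)"
          by (rule sum.reindex[symmetric, unfolded o_def]) (auto simp: inj_on_def)
        also have "\<dots> \<le> w (B' - E)"
          unfolding w_def by (rule sum_mono2) (auto simp: X_def)
        finally show "(\<Sum>B\<in>X B'. (a (B - E))\<^sup>2) \<le> w (B' - E)" .
      qed (auto simp: w0 intro!: sum_nonneg)
      finally show ?thesis .
    qed
    have "(cmod (rem g E))\<^sup>2 \<le> (\<Sum>B'\<in>U. y B')\<^sup>2" by (rule power_mono[OF 1]) simp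
    also have "\<dots> \<le> real (card U) * (\<Sum>B'\<in>U. (y B')\<^sup>2)" by (rule cauchy_schwarz_card)
    also have "\<dots> \<le> real CARD('a) ^ (4 * r\<^sup>2) * (\<Sum>B'\<in>UNIV. w B' * w (B' - E))"
    proof (rule mult_mono)
      have "card U \<le> CARD('a) ^ (rk E)\<^sup>2" unfolding U_def by (rule card_under)
      also have "\<dots> \<le> CARD('a) ^ (2 * r)\<^sup>2" by (intro power_increasing power_mono True) simp_all
      finally have "real (card U) \<le> real (CARD('a) ^ (2 * r)\<^sup>2)" by (rule of_nat_mono)
      then show "real (card U) \<le> real CARD('a) ^ (4 * r\<^sup>2)" by (simp add: power_mult_distrib)
      have "(\<Sum>B'\<in>U. (y B')\<^sup>2) \<le> (\<Sum>B'\<in>U. w B' * w (B' - E))" by (rule sum_mono) (rule y2)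
      also have "\<dots> \<le> (\<Sum>B'\<in>UNIV. w B' * w (B' - E))" by (rule sum_mono2) (auto simp: w0)
      finally show "(\<Sum>B'\<in>U. (y B')\<^sup>2) \<le> (\<Sum>B'\<in>UNIV. w B' * w (B' - E))" .
    qed (auto intro!: sum_nonneg)
    finally show ?thesis .
  qed
  have sw: "(\<Sum>B'\<in>UNIV. w B') \<le> real CARD('a) ^ r\<^sup>2 * sq g"
  proof -
    have "(\<Sum>B'\<in>UNIV. w B') = (\<Sum>B'\<in>UNIV. \<Sum>B\<in>UNIV. if under B' B then (a B)\<^sup>2 else 0)"
      unfolding w_def by (rule sum.cong[OF refl]) (simp add: sum.If_cases)
    also have "\<dots> = (\<Sum>B\<in>UNIV. \<Sum>B'\<in>UNIV. if under B' B then (a B)\<^sup>2 else 0)" by (rule sum.swap)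
    also have "\<dots> = (\<Sum>B\<in>UNIV. real (card {B'. under B' B}) * (a B)\<^sup>2)"
      by (rule sum.cong[OF refl]) (simp add: sum.If_cases)
    also have "\<dots> \<le> (\<Sum>B\<in>UNIV. real CARD('a) ^ r\<^sup>2 * (a B)\<^sup>2)"
    proof (rule sum_mono)
      fix B
      show "real (card {B'. under B' B}) * (a B)\<^sup>2 \<le> real CARD('a) ^ r\<^sup>2 * (a B)\<^sup>2"
      proof (cases "fc g B = 0")
        case False
        then have "rk B \<le> r" using g by (simp add: deg_le_def)
        then have "CARD('a) ^ (rk B)\<^sup>2 \<le> CARD('a) ^ r\<^sup>2" by (intro power_increasing power_mono) simp_all
        then have "real (card {B'. under B' B}) \<le> real (CARD('a) ^ r\<^sup>2)"
          using card_under[of B] by (intro of_nat_mono) linarith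
        then show ?thesis by (intro mult_right_mono) simp_all
      qed (simp add: a_def)
    qed
    also have "\<dots> = real CARD('a) ^ r\<^sup>2 * sq g"
      unfolding parseval[symmetric] a_def by (simp only: sum_distrib_left)
    finally show ?thesis .
  qed
  have shift: "(\<Sum>E\<in>UNIV. w (B' - E)) = (\<Sum>E\<in>UNIV. w E)" for B'
    by (rule sum.reindex_bij_witness[of _ "\<lambda>E. B' - E" "\<lambda>E. B' - E"]) auto
  have "(\<Sum>E\<in>UNIV. (cmod (rem g E))\<^sup>2) \<le> (\<Sum>E\<in>UNIV. real CARD('a) ^ (4 * r\<^sup>2) * (\<Sum>B'\<in>UNIV. w B' * w (B' - E)))"
    by (rule sum_mono) (rule pt)
  also have "\<dots> = real CARD('a) ^ (4 * r\<^sup>2) * (\<Sum>B'\<in>UNIV. w B' * (\<Sum>E\<in>UNIV. w (B' - E)))"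
    unfolding sum_distrib_left by (subst sum.swap) (simp only: mult.assoc)
  also have "\<dots> = real CARD('a) ^ (4 * r\<^sup>2) * (\<Sum>B'\<in>UNIV. w B')\<^sup>2"
    by (simp only: shift sum_distrib_right[symmetric] power2_eq_square)
  also have "\<dots> \<le> real CARD('a) ^ (4 * r\<^sup>2) * (real CARD('a) ^ r\<^sup>2 * sq g)\<^sup>2"
    by (intro mult_left_mono power_mono sw sum_nonneg w0) simp_all
  also have "\<dots> = real CARD('a) ^ (6 * r\<^sup>2) * (sq g)\<^sup>2"
  proof -
    have "6 * r\<^sup>2 = 4 * r\<^sup>2 + r\<^sup>2 * 2" by simp
    then show ?thesis by (simp only: power_add power_mult power_mult_distrib mult.assoc)
  qed
  finally show ?thesis .
qed

definition LKN :: "('a::{field,finite}^'n) set \<Rightarrow> ('a^'n) set \<Rightarrow> ('a^'n^'n \<Rightarrow> complex) \<Rightarrow> 'a^'n^'n \<Rightarrow> complex" where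
  "LKN K N g = fproj {B. K \<subseteq> ran B \<and> N \<subseteq> ran (transpose B)} g"

lemma fc_LKN: "fc (LKN K N g) B = (if K \<subseteq> ran B \<and> N \<subseteq> ran (transpose B) then fc g B else 0)"
  by (simp add: LKN_def fc_fproj)

text \<open>There are at most q^(d i) subspaces of dimension i, so the sum is dominated by a
  geometric series of ratio 1/2.\<close>

lemma sum_subs_inverse:
  fixes I :: "('a::{field,finite}^'n) set"
  assumes I: "vec.subspace I" "vec.dim I \<le> d" and Z: "2 * real CARD('a) ^ d \<le> Z"
  shows "(\<Sum>K\<in>subs I. 1 / Z ^ vec.dim K) \<le> 2"
proof -
  have q1: "1 \<le> real CARD('a)" using card_field_gt_1(1)[where 'a='a] by linarith
  have Zpos: "0 < Z" using Z q1 by (smt (verit) one_le_power)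
  have cI: "real (card I) \<le> real CARD('a) ^ d"
    unfolding card_subspace[OF I(1)] of_nat_power by (rule power_increasing[OF I(2) q1])
  have "(\<Sum>K\<in>subs I. 1 / Z ^ vec.dim K) \<le> (\<Sum>i\<le>CARD('n). real (card I) ^ i * (1 / Z ^ i))"
    by (rule sum_subs_le[OF I(1)]) (use Zpos in simp)
  also have "\<dots> = (\<Sum>i\<le>CARD('n). (real (card I) / Z) ^ i)" by (simp add: power_divide)
  also have "\<dots> \<le> 2"
  proof (rule geometric_half)
    have "real (card I) \<le> 1 / 2 * Z" using cI Z by linarith
    then show "real (card I) / Z \<le> 1 / 2" using Zpos by (simp only: pos_divide_le_eq)
  qed (use Zpos in simp)
  finally show ?thesis .
qed

text \<open>The pair B, B - E survives in \<open>ac (LKN K N g) E\<close> exactly when K lies in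
  both column spaces and N in both row spaces. Summing the weights over K inside
  \<open>ran E\<close> therefore runs over the subspaces of the triple intersection and leaves the
  indicator that it is trivial; rows behave in the same way. The intersection lies in
  \<open>ran B\<close>, so weights that are correct up to dimension r suffice.\<close>

lemma rem_identity:
  fixes g :: "'a::{field,finite}^'n^'n \<Rightarrow> complex" and \<mu> :: "('a^'n) set \<Rightarrow> real"
  assumes g: "deg_le r g"
    and \<mu>: "\<And>L. vec.subspace L \<Longrightarrow> vec.dim L \<le> r \<Longrightarrow> (\<Sum>K\<in>subs L. \<mu> K) = (if L = {0} then 1 else 0)"
  shows "(\<Sum>(K, N)\<in>subs (ran E) \<times> subs (ran (transpose E)). of_real (\<mu> K * \<mu> N) * ac (LKN K N g) E) = rem g E"
proof -
  define t where "t B = fc g B * cnj (fc g (B - E))" for B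
  define P where "P K B \<longleftrightarrow> K \<subseteq> ran B \<and> K \<subseteq> ran (B - E)" for K and B :: "'a^'n^'n"
  define Q where "Q N B \<longleftrightarrow> N \<subseteq> ran (transpose B) \<and> N \<subseteq> ran (transpose (B - E))" for N and B :: "'a^'n^'n"
  have ac: "of_real (\<mu> K * \<mu> N) * ac (LKN K N g) E = (\<Sum>B\<in>UNIV. t B * (of_real (if P K B then \<mu> K else 0) * of_real (if Q N B then \<mu> N else 0)))" for K N
    unfolding ac_def sum_distrib_left fc_LKN t_def P_def Q_def by (rule sum.cong) auto
  have red: "(\<Sum>K\<in>subs (ran Y). if K \<subseteq> ran A \<and> K \<subseteq> ran A' then \<mu> K else 0) = (if ran A \<inter> ran A' \<inter> ran Y = {0} then 1 else 0)"
    if A: "rk A \<le> r" for A A' Y :: "'a^'n^'n"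
  proof -
    have "(\<Sum>K\<in>subs (ran Y). if K \<subseteq> ran A \<and> K \<subseteq> ran A' then \<mu> K else 0) = (\<Sum>K\<in>{K\<in>subs (ran Y). K \<subseteq> ran A \<and> K \<subseteq> ran A'}. \<mu> K)"
      by (rule sum.inter_filter[symmetric]) simp
    also have "{K\<in>subs (ran Y). K \<subseteq> ran A \<and> K \<subseteq> ran A'} = subs (ran A \<inter> ran A' \<inter> ran Y)"
      by (auto simp: subs_def)
    also have "(\<Sum>K\<in>subs (ran A \<inter> ran A' \<inter> ran Y). \<mu> K) = (if ran A \<inter> ran A' \<inter> ran Y = {0} then 1 else 0)"
    proof (rule \<mu>)
      show "vec.subspace (ran A \<inter> ran A' \<inter> ran Y)" by (intro vec.subspace_inter subspace_ran)
      have "vec.dim (ran A \<inter> ran A' \<inter> ran Y) \<le> vec.dim (ran A)" by (rule vec.dim_subset) blast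
      then show "vec.dim (ran A \<inter> ran A' \<inter> ran Y) \<le> r" using A unfolding rk_def by linarith
    qed
    finally show ?thesis .
  qed
  have "(\<Sum>(K, N)\<in>subs (ran E) \<times> subs (ran (transpose E)). of_real (\<mu> K * \<mu> N) * ac (LKN K N g) E)
      = (\<Sum>K\<in>subs (ran E). \<Sum>N\<in>subs (ran (transpose E)). \<Sum>B\<in>UNIV. t B * (of_real (if P K B then \<mu> K else 0) * of_real (if Q N B then \<mu> N else 0)))"
    unfolding sum.cartesian_product[symmetric] ac ..
  also have "\<dots> = (\<Sum>B\<in>UNIV. \<Sum>K\<in>subs (ran E). \<Sum>N\<in>subs (ran (transpose E)). t B * (of_real (if P K B then \<mu> K else 0) * of_real (if Q N B then \<mu> N else 0)))"
  proof -
    have "(\<Sum>N\<in>subs (ran (transpose E)). \<Sum>B\<in>UNIV. f N B) = (\<Sum>B\<in>UNIV. \<Sum>N\<in>subs (ran (transpose E)). f N B)" for f :: "_ \<Rightarrow> 'a^'n^'n \<Rightarrow> complex"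
      by (rule sum.swap)
    then show ?thesis by (simp only:) (rule sum.swap)
  qed
  also have "\<dots> = (\<Sum>B\<in>UNIV. t B * (of_real (\<Sum>K\<in>subs (ran E). if P K B then \<mu> K else 0) * of_real (\<Sum>N\<in>subs (ran (transpose E)). if Q N B then \<mu> N else 0)))"
    by (simp only: of_real_sum sum_distrib_left[symmetric] sum_distrib_right[symmetric])
  also have "\<dots> = (\<Sum>B\<in>UNIV. if good E B then t B else 0)"
  proof (rule sum.cong[OF refl])
    fix B
    show "t B * (of_real (\<Sum>K\<in>subs (ran E). if P K B then \<mu> K else 0) * of_real (\<Sum>N\<in>subs (ran (transpose E)). if Q N B then \<mu> N else 0)) = (if good E B then t B else 0)"
    proof (cases "fc g B = 0")
      case True
      then show ?thesis by (simp add: t_def)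
    next
      case False
      then have "rk B \<le> r" using g by (simp add: deg_le_def)
      then have "rk B \<le> r" "rk (transpose B) \<le> r" by (simp_all add: rk_transpose)
      then show ?thesis
        unfolding P_def Q_def good_def red[OF \<open>rk B \<le> r\<close>] red[OF \<open>rk (transpose B) \<le> r\<close>] by simp
    qed
  qed
  also have "\<dots> = rem g E" unfolding rem_def t_def by (simp add: sum.If_cases)
  finally show ?thesis .
qed

text \<open>In \<open>rem_identity\<close> the term K = N = {0} is \<open>ac g E\<close> itself, so
  \<open>ac g E\<close> is the good part minus the other terms. A weighted Cauchy-Schwarz inequality
  treats these, with the inverse squared weights summing to at most 4; the factor 8 is this 4 times
  the 2 from squaring a sum of two terms.\<close>

lemma four_norm:
  fixes g :: "'a::{field,finite}^'n^'n \<Rightarrow> complex"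
  assumes g: "deg_le r g"
  shows "q4 g \<le> 2 * (real CARD('a) ^ (6 * r\<^sup>2) * (sq g)\<^sup>2) +
     8 * (\<Sum>(K, N)\<in>subs UNIV \<times> subs UNIV - {({0}, {0})}.
            real CARD('a) ^ ((6 * r + 2) * (vec.dim K + vec.dim N)) * q4 (LKN K N g))"
proof -
  let ?q = "real CARD('a)"
  have q2: "2 \<le> ?q" using card_field_ge_2[where 'a='a] by linarith
  then have q1: "1 \<le> ?q" by linarith
  obtain \<mu> :: "('a^'n) set \<Rightarrow> real" where
    \<mu>1: "\<And>L. vec.subspace L \<Longrightarrow> vec.dim L \<le> r \<Longrightarrow> (\<Sum>K\<in>subs L. \<mu> K) = (if L = {0} then 1 else 0)"
    and \<mu>2: "\<And>K. \<bar>\<mu> K\<bar> \<le> (1 + real (card K)) ^ r"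
    by (rule moebius_weights[where m = r and 'a = 'a and 'n = 'n]) blast
  have subs0: "subs {0} = {{0 :: 'a^'n}}"
    using vec.subspace_single_0 vec.subspace_0 by (auto simp: subs_def)
  have "(\<Sum>K\<in>subs {0 :: 'a^'n}. \<mu> K) = 1" using \<mu>1[of "{0}"] by simp
  then have \<mu>0: "\<mu> {0} = 1" unfolding subs0 by simp
  \<comment> \<open>For k = dim K >= 1 one has 1 + q^k <= q^(2 k), so the weight at K is at most
    q^(2 r k). Its square adds 4 r to the exponent 2 r + 2.\<close>
  have v: "?q ^ ((2 * r + 2) * vec.dim K) * (\<mu> K)\<^sup>2 \<le> ?q ^ ((6 * r + 2) * vec.dim K)" if K: "vec.subspace K" for K
  proof (cases "vec.dim K")
    case 0
    then have "K = {0}" using subspace_dim_0[OF K] by simp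
    then show ?thesis using \<mu>0 by simp
  next
    case (Suc i)
    have "1 + real (card K) \<le> ?q ^ (2 * vec.dim K)"
    proof -
      have c: "real (card K) = ?q ^ vec.dim K" by (simp add: card_subspace[OF K])
      have "1 \<le> ?q ^ vec.dim K" by (rule one_le_power[OF q1])
      then have "1 + real (card K) \<le> 2 * ?q ^ vec.dim K" by (simp add: c)
      also have "\<dots> \<le> ?q ^ vec.dim K * ?q ^ vec.dim K"
      proof (rule mult_right_mono)
        have "?q ^ 1 \<le> ?q ^ vec.dim K" by (rule power_increasing) (use Suc q1 in auto)
        then have "?q \<le> ?q ^ vec.dim K" by (simp only: power_one_right)
        then show "2 \<le> ?q ^ vec.dim K" by (rule order_trans[OF q2])
      qed simp
      finally show ?thesis by (simp add: mult_2 power_add)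
    qed
    then have "(1 + real (card K)) ^ r \<le> (?q ^ (2 * vec.dim K)) ^ r" by (intro power_mono) simp_all
    then have "\<bar>\<mu> K\<bar> \<le> ?q ^ (2 * vec.dim K * r)" using \<mu>2[of K] by (simp add: power_mult)
    then have "\<bar>\<mu> K\<bar>\<^sup>2 \<le> (?q ^ (2 * vec.dim K * r))\<^sup>2" by (intro power_mono) simp_all
    then have "?q ^ ((2 * r + 2) * vec.dim K) * (\<mu> K)\<^sup>2 \<le> ?q ^ ((2 * r + 2) * vec.dim K) * (?q ^ (2 * vec.dim K * r))\<^sup>2"
      by (intro mult_left_mono) simp_all
    also have "\<dots> = ?q ^ ((6 * r + 2) * vec.dim K)"
    proof -
      have "(6 * r + 2) * vec.dim K = (2 * r + 2) * vec.dim K + (2 * vec.dim K * r) * 2"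
        by (simp add: algebra_simps)
      then show ?thesis by (simp only: power_add power_mult)
    qed
    finally show ?thesis .
  qed
  define SE where "SE E = subs (ran E) \<times> subs (ran (transpose E)) - {({0}, {0})}" for E :: "'a^'n^'n"
  define SA where "SA = subs (UNIV :: ('a^'n) set) \<times> subs (UNIV :: ('a^'n) set) - {({0}, {0})}"
  define W where "W \<kappa> = ?q ^ ((6 * r + 2) * (vec.dim (fst \<kappa>) + vec.dim (snd \<kappa>)))" for \<kappa> :: "('a^'n) set \<times> ('a^'n) set"
  define z where "z E \<kappa> = ac (LKN (fst \<kappa>) (snd \<kappa>) g) E" for E \<kappa>
  have pt: "(cmod (ac g E))\<^sup>2 \<le> 2 * (cmod (rem g E))\<^sup>2 + 8 * (\<Sum>\<kappa>\<in>SA. W \<kappa> * (cmod (z E \<kappa>))\<^sup>2)" for E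
  proof (cases "rk E \<le> 2 * r")
    case False
    have "fc g B * cnj (fc g (B - E)) = 0" for B
    proof (rule ccontr)
      assume "fc g B * cnj (fc g (B - E)) \<noteq> 0"
      then have "rk B \<le> r" "rk (B - E) \<le> r" using g by (auto simp: deg_le_def)
      then show False using rk_pair[of E B] False by linarith
    qed
    then have "ac g E = 0" unfolding ac_def by (simp only: sum.neutral_const)
    moreover have "0 \<le> (\<Sum>\<kappa>\<in>SA. W \<kappa> * (cmod (z E \<kappa>))\<^sup>2)" by (intro sum_nonneg) (simp add: W_def)
    ultimately show ?thesis by simp
  next
    case True
    define m where "m \<kappa> = \<mu> (fst \<kappa>) * \<mu> (snd \<kappa>)" for \<kappa>
    \<comment> \<open>The squared weight is q^(2 r + 2) per dimension. As rk E <= 2 r there are at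
      most q^(2 r i) subspaces of dimension i on either side, and the two extra powers of q bring
      the geometric ratio below 1/2.\<close>
    define h where "h \<kappa> = ?q ^ ((r + 1) * (vec.dim (fst \<kappa>) + vec.dim (snd \<kappa>)))" for \<kappa> :: "('a^'n) set \<times> ('a^'n) set"
    have hpos: "0 < h \<kappa>" for \<kappa> using q1 by (simp add: h_def)
    have hne: "h \<kappa> \<noteq> 0" for \<kappa> using hpos[of \<kappa>] by (rule less_imp_neq[symmetric])
    have finSE: "finite (SE E)" by (simp add: SE_def)
    have r0: "ran X \<noteq> {} \<and> {0} \<in> subs (ran X)" for X :: "'a^'n^'n"
      using vec.subspace_0[OF subspace_ran[of X]] vec.subspace_single_0 by (auto simp: subs_def)
    have "(\<Sum>(K, N)\<in>subs (ran E) \<times> subs (ran (transpose E)). of_real (\<mu> K * \<mu> N) * ac (LKN K N g) E) = rem g E"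
      by (rule rem_identity[OF g]) (rule \<mu>1)
    then have "rem g E = (\<Sum>\<kappa>\<in>subs (ran E) \<times> subs (ran (transpose E)). of_real (m \<kappa>) * z E \<kappa>)"
      unfolding m_def z_def by (simp only: case_prod_unfold)
    also have "\<dots> = of_real (m ({0}, {0})) * z E ({0}, {0}) + (\<Sum>\<kappa>\<in>SE E. of_real (m \<kappa>) * z E \<kappa>)"
      unfolding SE_def by (rule sum.remove) (use r0 in auto)
    also have "of_real (m ({0}, {0})) * z E ({0}, {0}) = ac g E"
    proof -
      have "LKN {0} {0} g = g"
        by (rule fc_inject) (use r0 in \<open>auto simp: fun_eq_iff fc_LKN subs_def\<close>)
      then show ?thesis by (simp add: m_def z_def \<mu>0)
    qed
    finally have acE: "ac g E = rem g E - (\<Sum>\<kappa>\<in>SE E. of_real (m \<kappa>) * z E \<kappa>)" by simp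
    have "cmod (ac g E) \<le> cmod (rem g E) + (\<Sum>\<kappa>\<in>SE E. \<bar>m \<kappa>\<bar> * cmod (z E \<kappa>))"
    proof -
      have "cmod (\<Sum>\<kappa>\<in>SE E. of_real (m \<kappa>) * z E \<kappa>) \<le> (\<Sum>\<kappa>\<in>SE E. \<bar>m \<kappa>\<bar> * cmod (z E \<kappa>))"
        by (rule order_trans[OF norm_sum]) (simp add: norm_mult)
      then show ?thesis unfolding acE by (rule order_trans[OF norm_triangle_ineq4 add_left_mono])
    qed
    then have "(cmod (ac g E))\<^sup>2 \<le> (cmod (rem g E) + (\<Sum>\<kappa>\<in>SE E. \<bar>m \<kappa>\<bar> * cmod (z E \<kappa>)))\<^sup>2"
      by (rule power_mono) simp
    also have "\<dots> \<le> 2 * (cmod (rem g E))\<^sup>2 + 2 * (\<Sum>\<kappa>\<in>SE E. \<bar>m \<kappa>\<bar> * cmod (z E \<kappa>))\<^sup>2"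
      using sum_squares_bound[of "cmod (rem g E)" "\<Sum>\<kappa>\<in>SE E. \<bar>m \<kappa>\<bar> * cmod (z E \<kappa>)"]
      by (simp add: power2_sum)
    also have "(\<Sum>\<kappa>\<in>SE E. \<bar>m \<kappa>\<bar> * cmod (z E \<kappa>))\<^sup>2 \<le> 4 * (\<Sum>\<kappa>\<in>SA. W \<kappa> * (cmod (z E \<kappa>))\<^sup>2)"
    proof -
      have "(\<Sum>\<kappa>\<in>SE E. \<bar>m \<kappa>\<bar> * cmod (z E \<kappa>)) = (\<Sum>\<kappa>\<in>SE E. (1 / h \<kappa>) * (h \<kappa> * (\<bar>m \<kappa>\<bar> * cmod (z E \<kappa>))))"
        by (rule sum.cong[OF refl]) (simp add: hne)
      then have "(\<Sum>\<kappa>\<in>SE E. \<bar>m \<kappa>\<bar> * cmod (z E \<kappa>))\<^sup>2 \<le> (\<Sum>\<kappa>\<in>SE E. (1 / h \<kappa>)\<^sup>2) * (\<Sum>\<kappa>\<in>SE E. (h \<kappa> * (\<bar>m \<kappa>\<bar> * cmod (z E \<kappa>)))\<^sup>2)"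
        by (simp only:) (rule Cauchy_Schwarz_ineq_sum)
      also have "\<dots> \<le> 4 * (\<Sum>\<kappa>\<in>SA. W \<kappa> * (cmod (z E \<kappa>))\<^sup>2)"
      proof (rule mult_mono)
        let ?Z = "?q ^ (2 * r + 2)"
        have Z: "2 * ?q ^ (2 * r) \<le> ?Z"
        proof -
          have "2 * 1 \<le> ?q * ?q" by (rule mult_mono[OF q2 q1]) (use q2 in linarith)+
          then have "2 \<le> ?q\<^sup>2" by (simp only: power2_eq_square mult_1_right)
          then have "2 * ?q ^ (2 * r) \<le> ?q\<^sup>2 * ?q ^ (2 * r)"
            by (rule mult_right_mono) simp
          then show ?thesis unfolding power_add by (simp only: mult.commute)
        qed
        have h2: "(1 / h (K, N))\<^sup>2 = (1 / ?Z ^ vec.dim K) * (1 / ?Z ^ vec.dim N)" for K N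
        proof -
          have "(r + 1) * (vec.dim K + vec.dim N) * 2 = (2 * r + 2) * vec.dim K + (2 * r + 2) * vec.dim N" by (simp add: algebra_simps)
          then have "(h (K, N))\<^sup>2 = ?Z ^ vec.dim K * ?Z ^ vec.dim N"
            unfolding h_def fst_conv snd_conv power_mult[symmetric] power_add[symmetric] by (rule arg_cong)
          then show ?thesis by (simp add: power_divide)
        qed
        have "(\<Sum>\<kappa>\<in>SE E. (1 / h \<kappa>)\<^sup>2) \<le> (\<Sum>\<kappa>\<in>subs (ran E) \<times> subs (ran (transpose E)). (1 / h \<kappa>)\<^sup>2)"
          unfolding SE_def by (rule sum_mono2) auto
        also have "\<dots> = (\<Sum>K\<in>subs (ran E). 1 / ?Z ^ vec.dim K) * (\<Sum>N\<in>subs (ran (transpose E)). 1 / ?Z ^ vec.dim N)"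
          unfolding sum_product sum.cartesian_product by (rule sum.cong[OF refl]) (auto simp only: h2 split: prod.split)
        also have "\<dots> \<le> 2 * 2"
          using True rk_transpose[of E]
          by (intro mult_mono sum_subs_inverse[OF subspace_ran _ Z] sum_nonneg) (simp_all add: rk_def)
        finally show "(\<Sum>\<kappa>\<in>SE E. (1 / h \<kappa>)\<^sup>2) \<le> 4" by simp
        have "(\<Sum>\<kappa>\<in>SE E. (h \<kappa> * (\<bar>m \<kappa>\<bar> * cmod (z E \<kappa>)))\<^sup>2) \<le> (\<Sum>\<kappa>\<in>SE E. W \<kappa> * (cmod (z E \<kappa>))\<^sup>2)"
        proof (rule sum_mono)
          fix \<kappa> assume "\<kappa> \<in> SE E"
          then obtain K N where KN: "\<kappa> = (K, N)" "vec.subspace K" "vec.subspace N" by (auto simp: SE_def subs_def)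
          have e1: "(r + 1) * (vec.dim K + vec.dim N) * 2 = (2 * r + 2) * vec.dim K + (2 * r + 2) * vec.dim N" by (simp add: algebra_simps)
          have "(h \<kappa>)\<^sup>2 * (m \<kappa>)\<^sup>2 = (?q ^ ((2 * r + 2) * vec.dim K) * (\<mu> K)\<^sup>2) * (?q ^ ((2 * r + 2) * vec.dim N) * (\<mu> N)\<^sup>2)"
            unfolding h_def m_def KN(1) fst_conv snd_conv power_mult[symmetric] e1 power_add power_mult_distrib by (simp only: mult_ac)
          also have "\<dots> \<le> ?q ^ ((6 * r + 2) * vec.dim K) * ?q ^ ((6 * r + 2) * vec.dim N)"
            by (intro mult_mono v KN) (use q1 in auto)
          also have "\<dots> = W \<kappa>" unfolding W_def KN(1) by (simp only: fst_conv snd_conv distrib_left power_add)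
          finally have "(h \<kappa>)\<^sup>2 * (m \<kappa>)\<^sup>2 * (cmod (z E \<kappa>))\<^sup>2 \<le> W \<kappa> * (cmod (z E \<kappa>))\<^sup>2"
            by (rule mult_right_mono) simp
          then show "(h \<kappa> * (\<bar>m \<kappa>\<bar> * cmod (z E \<kappa>)))\<^sup>2 \<le> W \<kappa> * (cmod (z E \<kappa>))\<^sup>2"
            by (simp add: power_mult_distrib mult.assoc)
        qed
        also have "\<dots> \<le> (\<Sum>\<kappa>\<in>SA. W \<kappa> * (cmod (z E \<kappa>))\<^sup>2)"
          by (rule sum_mono2) (auto simp: SA_def SE_def subs_def W_def)
        finally show "(\<Sum>\<kappa>\<in>SE E. (h \<kappa> * (\<bar>m \<kappa>\<bar> * cmod (z E \<kappa>)))\<^sup>2) \<le> (\<Sum>\<kappa>\<in>SA. W \<kappa> * (cmod (z E \<kappa>))\<^sup>2)" .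
      qed (auto intro!: sum_nonneg)
      finally show ?thesis .
    qed
    finally show ?thesis by simp
  qed
  have "q4 g \<le> (\<Sum>E\<in>UNIV. 2 * (cmod (rem g E))\<^sup>2 + 8 * (\<Sum>\<kappa>\<in>SA. W \<kappa> * (cmod (z E \<kappa>))\<^sup>2))"
    unfolding q4_ac by (rule sum_mono) (rule pt)
  also have "\<dots> = 2 * (\<Sum>E\<in>UNIV. (cmod (rem g E))\<^sup>2) + 8 * (\<Sum>E\<in>UNIV. \<Sum>\<kappa>\<in>SA. W \<kappa> * (cmod (z E \<kappa>))\<^sup>2)"
    by (simp only: sum.distrib sum_distrib_left)
  also have "(\<Sum>E\<in>UNIV. \<Sum>\<kappa>\<in>SA. W \<kappa> * (cmod (z E \<kappa>))\<^sup>2) = (\<Sum>\<kappa>\<in>SA. W \<kappa> * q4 (LKN (fst \<kappa>) (snd \<kappa>) g))"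
    unfolding q4_ac z_def sum_distrib_left by (rule sum.swap)
  also have "\<dots> = (\<Sum>(K, N)\<in>SA. ?q ^ ((6 * r + 2) * (vec.dim K + vec.dim N)) * q4 (LKN K N g))"
    unfolding W_def by (simp only: case_prod_unfold)
  finally show ?thesis using rem_bound[OF g] unfolding SA_def by linarith
qed

section \<open>Hypercontractivity\<close>

lemma card_ran_mult:
  fixes P B :: "'a::{field,finite}^'n^'n"
  shows "card (ran B) = card (ran (P ** B)) * card (kern P \<inter> ran B)"
proof -
  have fib: "card {x\<in>ran B. P *v x = P *v x0} = card (kern P \<inter> ran B)" if x0: "x0 \<in> ran B" for x0
  proof -
    have "bij_betw (\<lambda>x. x + x0) (kern P \<inter> ran B) {x\<in>ran B. P *v x = P *v x0}"
      by (rule bij_betw_byWitness[where f' = "\<lambda>x. x - x0"])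
         (auto simp: kern_def matrix_vector_right_distrib matrix_vector_mult_diff_distrib
            intro!: vec.subspace_add[OF subspace_ran] vec.subspace_diff[OF subspace_ran] x0)
    then show ?thesis by (simp add: bij_betw_same_card)
  qed
  have "card (ran B) = card (\<Union>y\<in>ran (P ** B). {x\<in>ran B. P *v x = y})"
    by (rule arg_cong[of _ _ card]) (auto simp: ran_def simp flip: matrix_vector_mul_assoc)
  also have "\<dots> = (\<Sum>y\<in>ran (P ** B). card {x\<in>ran B. P *v x = y})"
    by (rule card_UN_disjoint) auto
  also have "\<dots> = (\<Sum>y\<in>ran (P ** B). card (kern P \<inter> ran B))"
  proof (rule sum.cong[OF refl])
    fix y assume "y \<in> ran (P ** B)"
    then obtain w where "y = P *v (B *v w)" by (auto simp: ran_def simp flip: matrix_vector_mul_assoc)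
    then show "card {x\<in>ran B. P *v x = y} = card (kern P \<inter> ran B)" using fib[OF mem_ran] by simp
  qed
  finally show ?thesis by simp
qed

lemma rk_mult_kern_subset:
  fixes P B :: "'a::{field,finite}^'n^'n"
  assumes "kern P \<subseteq> ran B"
  shows "rk B = rk (P ** B) + corank P"
proof -
  have "kern P \<inter> ran B = kern P" using assms by blast
  then have "CARD('a) ^ rk B = CARD('a) ^ (rk (P ** B) + corank P)"
    using card_ran_mult[of B P] unfolding card_ran by (simp only: card_kern power_add)
  then show ?thesis by (rule power_inject_exp[THEN iffD1, rotated]) (rule card_field_gt_1)
qed

lemma q4_transpose: "q4 (\<lambda>A. g (transpose A)) = q4 (g :: 'a::{field,finite}^'n^'n \<Rightarrow> complex)"
  unfolding q4_def by (rule mean_bij[OF bij_transpose])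

lemma mean_q4_rst: "EE (\<lambda>T. q4 (rst S P T g)) = q4 g"
  unfolding q4_def rst_def by (rule mean_rst)

lemma mean_sq_rst: "EE (\<lambda>T. sq (rst S P T g)) = sq g"
  unfolding sq_def rst_def by (rule mean_rst)

lemma LKN_transpose: "LKN K N (\<lambda>A. g (transpose A)) = (\<lambda>A. LKN N K g (transpose A))"
  unfolding LKN_def fproj_transpose
  by (rule ext, rule arg_cong[of _ _ "\<lambda>X. fproj X g _"]) auto

lemma glob_LKN:
  fixes g :: "'a::{field,finite}^'n^'n \<Rightarrow> complex"
  assumes "pure r g" "vec.subspace K" "vec.subspace N" "glob k c g"
  shows "glob k ((1 + real CARD('a) ^ r) ^ (vec.dim K + vec.dim N) * c) (LKN K N g)"
proof -
  have "LKN K N g = fproj {B. K \<subseteq> ran B} (fproj {B. N \<subseteq> ran (transpose B)} g)"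
    unfolding LKN_def fproj_fproj by (rule arg_cong[of _ _ "\<lambda>X. fproj X g"]) auto
  then show ?thesis
    using glob_fproj_subspace[OF pure_fproj[OF assms(1)] assms(2) glob_fproj_subspace_row[OF assms(1,3,4)]]
    by (simp only: power_add mult.assoc)
qed

text \<open>Each column space contains all of \<open>kern P\<close>, so every frequency loses the
  same amount of rank and purity survives. This drop drives the induction in
  \<open>pure_hyper\<close>.\<close>

lemma pure_rst_kern:
  assumes "pure r g" "\<And>B. fc g B \<noteq> 0 \<Longrightarrow> kern P \<subseteq> ran B"
  shows "pure (r - corank P) (rst (mat 1) P T g)"
  unfolding pure_def
proof (intro allI impI)
  fix B assume "fc (rst (mat 1) P T g) B \<noteq> 0"
  then have "\<exists>B'\<in>{B'. P ** B' ** mat 1 = B}. fc g B' * ch B' T \<noteq> 0"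
    unfolding fc_rst using sum.not_neutral_contains_not_neutral by blast
  then obtain B' where B': "P ** B' = B" "fc g B' \<noteq> 0" by auto
  then have "rk B' = r" using assms(1) by (simp add: pure_def)
  then show "rk B = r - corank P" using rk_mult_kern_subset[OF assms(2)[OF B'(2)]] B'(1) by simp
qed

lemma fc_zero: "fc (\<lambda>_. 0) B = 0"
  by (simp add: fc_def mean_def)

text \<open>Every term of \<open>four_norm\<close> with (K, N) nontrivial is restricted by a
  projection whose kernel is the larger of K and N. The rank drops by its dimension x, the induction
  hypothesis applies to each restriction, and averaging over T returns to the term itself. The gain
  from 40 r^2 to 40 (r - x)^2 has to pay for all losses.\<close>

lemma pure_hyper:
  fixes g :: "'a::{field,finite}^'n^'n \<Rightarrow> complex"
  assumes "pure r g" "glob r c g"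
  shows "q4 g \<le> real CARD('a) ^ (40 * r\<^sup>2) * c\<^sup>2 * sq g"
  using assms
proof (induction r arbitrary: g c rule: less_induct)
  case (less r)
  let ?q = "real CARD('a)"
  have q2: "2 \<le> ?q" using card_field_ge_2[where 'a='a] by linarith
  then have q1: "1 \<le> ?q" and q0: "0 < ?q" by linarith+
  note pure = less.prems(1) and glob = less.prems(2)
  have c0: "0 \<le> c" by (rule glob_nonneg[OF glob])
  have sqc: "sq g \<le> c\<^sup>2"
    unfolding n2_squared[symmetric] by (rule power_mono[OF glob_n2[OF glob]]) simp
  show ?case
  proof (cases "r = 0")
    case True
    have f0: "fc g B = 0" if "B \<noteq> 0" for B
      using pure that True by (auto simp: pure_def rk_eq_0)
    have gA: "g A = fc g 0" for A
    proof -
      have "g A = (\<Sum>B\<in>(UNIV :: ('a^'n^'n) set). if B = 0 then fc g 0 else 0)"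
        unfolding fourier_inversion[of g A] by (rule sum.cong) (auto simp: f0)
      then show ?thesis by simp
    qed
    have "q4 g = (cmod (fc g 0)) ^ 4" "sq g = (cmod (fc g 0))\<^sup>2"
      unfolding q4_def sq_def by (subst gA, simp)+
    then have "q4 g = sq g * sq g" by (simp add: power2_eq_square power4_eq_xxxx)
    also have "\<dots> \<le> c\<^sup>2 * sq g" by (rule mult_right_mono[OF sqc]) simp
    finally show ?thesis using True by simp
  next
    case False
    then have r1: "1 \<le> r" by simp
    have one: "q4 (LKN K N h) \<le> ?q ^ (40 * (r - vec.dim K)\<^sup>2) * ((1 + ?q ^ r) ^ (vec.dim K + vec.dim N) * c)\<^sup>2 * sq (LKN K N h)"
      if h: "pure r h" "glob r c h" and KN: "vec.subspace K" "vec.subspace N" "1 \<le> vec.dim K" "vec.dim K \<le> r" for h and K N :: "('a^'n) set"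
    proof -
      obtain P where P: "kern P = K" "P ** P = P" "corank P = vec.dim K" by (rule exists_projection[OF KN(1)])
      let ?c = "(1 + ?q ^ r) ^ (vec.dim K + vec.dim N) * c"
      let ?D = "\<lambda>T. rst (mat 1) P T (LKN K N h)"
      have pD: "pure (r - vec.dim K) (?D T)" for T
        unfolding P(3)[symmetric]
        by (rule pure_rst_kern) (auto simp: LKN_def intro!: pure_fproj h(1), auto simp: fc_fproj P(1) split: if_splits)
      have gD: "glob (r - vec.dim K) ?c (?D T)" for T
        by (rule glob_rst) (use glob_LKN[OF h(1) KN(1,2) h(2)] KN(4) in \<open>simp add: P(3)\<close>)
      have "q4 (?D T) \<le> ?q ^ (40 * (r - vec.dim K)\<^sup>2) * ?c\<^sup>2 * sq (?D T)" for T
        by (rule less.IH[OF _ pD gD]) (use KN r1 in linarith)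
      then have "EE (\<lambda>T. q4 (?D T)) \<le> EE (\<lambda>T. ?q ^ (40 * (r - vec.dim K)\<^sup>2) * ?c\<^sup>2 * sq (?D T))"
        by (intro mean_mono) simp
      then show ?thesis unfolding mean_cmult mean_q4_rst mean_sq_rst .
    qed
    have two: "?q ^ ((6 * r + 2) * (vec.dim K + vec.dim N)) * q4 (LKN K N g)
        \<le> ?q ^ (40 * r\<^sup>2) * c\<^sup>2 * (1 / ?q ^ (8 * r * (vec.dim K + vec.dim N)) * sq (LKN K N g))"
      if KN: "vec.subspace K" "vec.subspace N" "(K, N) \<noteq> ({0}, {0})" for K N :: "('a^'n) set"
    proof -
      define x where "x = max (vec.dim K) (vec.dim N)"
      define s where "s = vec.dim K + vec.dim N"
      have "x \<noteq> 0"
      proof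
        assume "x = 0"
        then have "vec.dim K = 0" "vec.dim N = 0" unfolding x_def by linarith+
        then have "K = {0}" "N = {0}" using subspace_dim_0[OF KN(1)] subspace_dim_0[OF KN(2)] by blast+
        then show False using KN(3) by blast
      qed
      then have x1: "1 \<le> x" by simp
      have s2: "s \<le> 2 * x" by (simp add: s_def x_def)
      show ?thesis
      proof (cases "x \<le> r")
        case False
        \<comment> \<open>No frequency of rank r can contain a subspace of dimension above r in its
          column or row space, so the term is zero.\<close>
        have "fc (LKN K N g) B = 0" for B
        proof (rule ccontr)
          assume "fc (LKN K N g) B \<noteq> 0"
          then have "K \<subseteq> ran B" "N \<subseteq> ran (transpose B)" "fc g B \<noteq> 0" by (auto simp: fc_LKN split: if_splits)
          then have "vec.dim K \<le> rk B" "vec.dim N \<le> rk (transpose B)" "rk B = r"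
            using pure by (auto simp: rk_def pure_def intro: vec.dim_subset)
          then show False using False by (simp add: rk_transpose x_def)
        qed
        then have "LKN K N g = (\<lambda>_. 0)" by (intro fc_inject[OF ext]) (simp only: fc_zero)
        then show ?thesis by (simp add: q4_def sq_def)
      next
        case True
        have main: "q4 (LKN K N g) \<le> ?q ^ (40 * (r - x)\<^sup>2) * ((1 + ?q ^ r) ^ s * c)\<^sup>2 * sq (LKN K N g)"
        proof (cases "vec.dim N \<le> vec.dim K")
          case True
          then have "x = vec.dim K" by (simp add: x_def)
          then show ?thesis using one[OF pure glob KN(1,2)] x1 \<open>x \<le> r\<close> unfolding s_def by simp
        next
          case F: False
          then have xN: "x = vec.dim N" by (simp add: x_def)
          have "q4 (LKN N K (\<lambda>A. g (transpose A))) \<le> ?q ^ (40 * (r - vec.dim N)\<^sup>2) * ((1 + ?q ^ r) ^ (vec.dim N + vec.dim K) * c)\<^sup>2 * sq (LKN N K (\<lambda>A. g (transpose A)))"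
            by (rule one[OF pure_transpose[OF pure] glob_transpose[OF glob] KN(2,1)]) (use xN x1 \<open>x \<le> r\<close> in linarith)+
          then show ?thesis unfolding LKN_transpose q4_transpose sq_transpose s_def xN by (simp only: add.commute)
        qed
        have "(1 + ?q ^ r) ^ s \<le> (?q ^ (r + 1)) ^ s"
        proof (rule power_mono)
          have "1 + ?q ^ r \<le> 2 * ?q ^ r" using one_le_power[OF q1, of r] by linarith
          also have "\<dots> \<le> ?q * ?q ^ r" by (rule mult_right_mono[OF q2]) simp
          finally show "1 + ?q ^ r \<le> ?q ^ (r + 1)" by simp
        qed simp
        then have "((1 + ?q ^ r) ^ s * c)\<^sup>2 \<le> ((?q ^ (r + 1)) ^ s * c)\<^sup>2"
          using power_mono[OF mult_right_mono[OF _ c0], of "(1 + ?q ^ r) ^ s" "(?q ^ (r + 1)) ^ s" 2] c0 by simp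
        also have "\<dots> = ?q ^ (2 * (r + 1) * s) * c\<^sup>2"
        proof -
          have "(r + 1) * s * 2 = 2 * (r + 1) * s" by simp
          then show ?thesis by (simp only: power_mult_distrib power_mult[symmetric])
        qed
        finally have b: "((1 + ?q ^ r) ^ s * c)\<^sup>2 \<le> ?q ^ (2 * (r + 1) * s) * c\<^sup>2" .
        \<comment> \<open>The summands are the weight in \<open>four_norm\<close>, the induction
          hypothesis, the loss of globalness in \<open>glob_LKN\<close>, and a reserve 8 r s for the
          later sum over (K, N). Since s <= 2 x, all but the second add up to at most 40 r x, and (r
          - x)^2 + r x <= r^2.\<close>
        have ex: "(6 * r + 2) * s + 40 * (r - x)\<^sup>2 + 2 * (r + 1) * s + 8 * r * s \<le> 40 * r\<^sup>2"
        proof -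
          obtain y where y: "r = x + y" using le_Suc_ex[OF \<open>x \<le> r\<close>] by blast
          have "(6 * r + 2) * s + 2 * (r + 1) * s + 8 * r * s = (16 * r + 4) * s" by (simp add: algebra_simps)
          also have "\<dots> \<le> (16 * r + 4) * (2 * x)" by (rule mult_le_mono2[OF s2])
          also have "\<dots> \<le> 40 * r * x" using r1 by (simp add: algebra_simps)
          finally have "(6 * r + 2) * s + 2 * (r + 1) * s + 8 * r * s \<le> 40 * r * x" .
          moreover have "40 * (r - x)\<^sup>2 + 40 * r * x \<le> 40 * r\<^sup>2"
            unfolding y by (simp add: power2_eq_square algebra_simps)
          ultimately show ?thesis by linarith
        qed
        have "?q ^ ((6 * r + 2) * s) * q4 (LKN K N g) \<le> ?q ^ ((6 * r + 2) * s) * (?q ^ (40 * (r - x)\<^sup>2) * (?q ^ (2 * (r + 1) * s) * c\<^sup>2) * sq (LKN K N g))"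
          by (intro mult_left_mono order_trans[OF main] mult_right_mono b) simp_all
        also have "\<dots> = ?q ^ ((6 * r + 2) * s + 40 * (r - x)\<^sup>2 + 2 * (r + 1) * s) * (c\<^sup>2 * sq (LKN K N g))"
          by (simp only: power_add mult_ac)
        also have "\<dots> \<le> (?q ^ (40 * r\<^sup>2) / ?q ^ (8 * r * s)) * (c\<^sup>2 * sq (LKN K N g))"
        proof (rule mult_right_mono)
          have "?q ^ ((6 * r + 2) * s + 40 * (r - x)\<^sup>2 + 2 * (r + 1) * s) * ?q ^ (8 * r * s) \<le> ?q ^ (40 * r\<^sup>2)"
            unfolding power_add[symmetric] by (rule power_increasing[OF ex q1])
          then show "?q ^ ((6 * r + 2) * s + 40 * (r - x)\<^sup>2 + 2 * (r + 1) * s) \<le> ?q ^ (40 * r\<^sup>2) / ?q ^ (8 * r * s)"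
            by (rule pos_le_divide_eq[THEN iffD2, OF zero_less_power[OF q0]])
        qed (rule mult_nonneg_nonneg, simp_all)
        finally show ?thesis unfolding s_def by (simp only: times_divide_eq_left times_divide_eq_right mult_1_left mult.assoc)
      qed
    qed
    define SA where "SA = subs (UNIV :: ('a^'n) set) \<times> subs (UNIV :: ('a^'n) set) - {({0}, {0})}"
    \<comment> \<open>The reserve is split: q^(-6 r s) is at most 1/64 as s >= 1, and q^(-2 r s)
      makes the sums over K and over N geometric, each at most 2.\<close>
    have three: "(\<Sum>(K, N)\<in>SA. 1 / ?q ^ (8 * r * (vec.dim K + vec.dim N)) * sq (LKN K N g)) \<le> 1 / 16 * sq g"
    proof -
      define W where "W \<kappa> = 1 / ?q ^ (8 * r * (vec.dim (fst \<kappa>) + vec.dim (snd \<kappa>)))" for \<kappa> :: "('a^'n) set \<times> ('a^'n) set"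
      define I where "I \<kappa> B \<longleftrightarrow> fst \<kappa> \<subseteq> ran B \<and> snd \<kappa> \<subseteq> ran (transpose B)" for \<kappa> and B :: "'a^'n^'n"
      have W0: "0 \<le> W \<kappa>" for \<kappa> by (simp add: W_def)
      have "(\<Sum>(K, N)\<in>SA. 1 / ?q ^ (8 * r * (vec.dim K + vec.dim N)) * sq (LKN K N g)) = (\<Sum>\<kappa>\<in>SA. \<Sum>B\<in>UNIV. (if I \<kappa> B then W \<kappa> else 0) * (cmod (fc g B))\<^sup>2)"
        unfolding case_prod_unfold W_def[symmetric] parseval[symmetric] fc_LKN sum_distrib_left I_def[symmetric]
        by (intro sum.cong refl) simp
      also have "\<dots> = (\<Sum>B\<in>UNIV. (\<Sum>\<kappa>\<in>SA. if I \<kappa> B then W \<kappa> else 0) * (cmod (fc g B))\<^sup>2)"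
        unfolding sum_distrib_right by (rule sum.swap)
      also have "\<dots> \<le> (\<Sum>B\<in>UNIV. 1 / 16 * (cmod (fc g B))\<^sup>2)"
      proof (rule sum_mono)
        fix B :: "'a^'n^'n"
        show "(\<Sum>\<kappa>\<in>SA. if I \<kappa> B then W \<kappa> else 0) * (cmod (fc g B))\<^sup>2 \<le> 1 / 16 * (cmod (fc g B))\<^sup>2"
        proof (cases "fc g B = 0")
          case True
          then show ?thesis by simp
        next
          case False
          then have rB: "rk B = r" "rk (transpose B) = r" using pure by (simp_all add: pure_def rk_transpose)
          let ?Z = "?q ^ (2 * r)"
          have Z: "2 * ?q ^ r \<le> ?Z"
          proof -
            have "?q ^ 1 \<le> ?q ^ r" by (rule power_increasing[OF r1 q1])
            then have "2 \<le> ?q ^ r" using q2 unfolding power_one_right by (rule order_trans[rotated])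
            then have "2 * ?q ^ r \<le> ?q ^ r * ?q ^ r" by (rule mult_right_mono) simp
            then show ?thesis by (simp only: mult_2 power_add)
          qed
          have "(\<Sum>\<kappa>\<in>SA. if I \<kappa> B then W \<kappa> else 0) = (\<Sum>\<kappa>\<in>{\<kappa>\<in>SA. I \<kappa> B}. W \<kappa>)"
            by (rule sum.inter_filter[symmetric]) (simp add: SA_def)
          also have "\<dots> \<le> (\<Sum>\<kappa>\<in>{\<kappa>\<in>SA. I \<kappa> B}. 1 / 64 * (1 / ?Z ^ vec.dim (fst \<kappa>) * (1 / ?Z ^ vec.dim (snd \<kappa>))))"
          proof (rule sum_mono)
            fix \<kappa> assume "\<kappa> \<in> {\<kappa>\<in>SA. I \<kappa> B}"
            then obtain K N where \<kappa>: "\<kappa> = (K, N)" "vec.subspace K" "vec.subspace N" "(K, N) \<noteq> ({0}, {0})"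
              by (auto simp: SA_def subs_def)
            define s where "s = vec.dim K + vec.dim N"
            have "s \<noteq> 0" using \<kappa> subspace_dim_0[of K] subspace_dim_0[of N] by (auto simp: s_def)
            then have s1: "1 \<le> s" by simp
            have e: "8 * r * s = 6 * r * s + (2 * r * vec.dim K + 2 * r * vec.dim N)" by (simp add: s_def algebra_simps)
            have "64 \<le> ?q ^ 6" using power_mono[OF q2, of 6] by simp
            also have "\<dots> \<le> ?q ^ (6 * r * s)" by (rule power_increasing[OF _ q1]) (use r1 s1 in simp)
            finally have 64: "64 \<le> ?q ^ (6 * r * s)" .
            have "W \<kappa> = 1 / ?q ^ (6 * r * s) * (1 / ?Z ^ vec.dim K * (1 / ?Z ^ vec.dim N))"
              unfolding W_def \<kappa>(1) fst_conv snd_conv s_def[symmetric] e power_add power_mult[symmetric] by simp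
            also have "\<dots> \<le> 1 / 64 * (1 / ?Z ^ vec.dim K * (1 / ?Z ^ vec.dim N))"
              by (intro mult_right_mono divide_left_mono 64) (use q1 in simp_all)
            finally show "W \<kappa> \<le> 1 / 64 * (1 / ?Z ^ vec.dim (fst \<kappa>) * (1 / ?Z ^ vec.dim (snd \<kappa>)))"
              by (simp add: \<kappa>(1))
          qed
          also have "\<dots> \<le> (\<Sum>\<kappa>\<in>subs (ran B) \<times> subs (ran (transpose B)). 1 / 64 * (1 / ?Z ^ vec.dim (fst \<kappa>) * (1 / ?Z ^ vec.dim (snd \<kappa>))))"
            by (rule sum_mono2) (auto simp: SA_def I_def subs_def)
          also have "\<dots> = 1 / 64 * ((\<Sum>K\<in>subs (ran B). 1 / ?Z ^ vec.dim K) * (\<Sum>N\<in>subs (ran (transpose B)). 1 / ?Z ^ vec.dim N))"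
            unfolding sum_distrib_left[symmetric] by (simp only: sum_product sum.cartesian_product case_prod_unfold)
          also have "\<dots> \<le> 1 / 64 * (2 * 2)"
            by (intro mult_left_mono mult_mono sum_subs_inverse[OF subspace_ran _ Z] sum_nonneg) (use rB in \<open>simp_all add: rk_def\<close>)
          finally have "(\<Sum>\<kappa>\<in>SA. if I \<kappa> B then W \<kappa> else 0) \<le> 1 / 16" by simp
          then show ?thesis by (rule mult_right_mono) simp
        qed
      qed
      also have "\<dots> = 1 / 16 * sq g" unfolding parseval[symmetric] by (simp only: sum_distrib_left)
      finally show ?thesis .
    qed
    have dg: "deg_le r g" using pure by (auto simp: pure_def deg_le_def)
    define U where "U = (\<Sum>(K, N)\<in>SA. ?q ^ ((6 * r + 2) * (vec.dim K + vec.dim N)) * q4 (LKN K N g))"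
    have A: "q4 g \<le> 2 * (?q ^ (6 * r\<^sup>2) * (sq g)\<^sup>2) + 8 * U"
      unfolding SA_def U_def by (rule four_norm[OF dg])
    have "U \<le> (\<Sum>(K, N)\<in>SA. ?q ^ (40 * r\<^sup>2) * c\<^sup>2 * (1 / ?q ^ (8 * r * (vec.dim K + vec.dim N)) * sq (LKN K N g)))"
      unfolding U_def
    proof (rule sum_mono)
      fix \<kappa> assume "\<kappa> \<in> SA"
      then obtain K N where \<kappa>: "\<kappa> = (K, N)" "vec.subspace K" "vec.subspace N" "(K, N) \<noteq> ({0}, {0})"
        by (auto simp: SA_def subs_def)
      show "(case \<kappa> of (K, N) \<Rightarrow> ?q ^ ((6 * r + 2) * (vec.dim K + vec.dim N)) * q4 (LKN K N g))
          \<le> (case \<kappa> of (K, N) \<Rightarrow> ?q ^ (40 * r\<^sup>2) * c\<^sup>2 * (1 / ?q ^ (8 * r * (vec.dim K + vec.dim N)) * sq (LKN K N g)))"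
        unfolding \<kappa>(1) prod.case by (rule two[OF \<kappa>(2,3,4)])
    qed
    also have "\<dots> = ?q ^ (40 * r\<^sup>2) * c\<^sup>2 * (\<Sum>(K, N)\<in>SA. 1 / ?q ^ (8 * r * (vec.dim K + vec.dim N)) * sq (LKN K N g))"
      by (simp only: case_prod_unfold sum_distrib_left)
    also have "\<dots> \<le> ?q ^ (40 * r\<^sup>2) * c\<^sup>2 * (1 / 16 * sq g)"
      by (rule mult_left_mono[OF three]) simp
    finally have U: "U \<le> ?q ^ (40 * r\<^sup>2) * c\<^sup>2 * (1 / 16 * sq g)" .
    have r2: "1 \<le> r\<^sup>2" by (rule one_le_power[OF r1])
    \<comment> \<open>Each of the two terms of \<open>four_norm\<close> may use half of the bound:
      8/16 for the sum over (K, N), and the good part because of this inequality.\<close>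
    have "4 * ?q ^ (6 * r\<^sup>2) \<le> ?q\<^sup>2 * ?q ^ (6 * r\<^sup>2)"
      by (rule mult_right_mono) (use power_mono[OF q2, of 2] in simp_all)
    also have "\<dots> = ?q ^ (2 + 6 * r\<^sup>2)" by (simp only: power_add)
    also have "\<dots> \<le> ?q ^ (40 * r\<^sup>2)" by (rule power_increasing[OF _ q1]) (use r2 in linarith)
    finally have e4: "4 * ?q ^ (6 * r\<^sup>2) \<le> ?q ^ (40 * r\<^sup>2)" .
    have "sq g * sq g \<le> c\<^sup>2 * sq g" by (rule mult_right_mono[OF sqc]) simp
    then have "4 * ?q ^ (6 * r\<^sup>2) * (sq g * sq g) \<le> ?q ^ (40 * r\<^sup>2) * (c\<^sup>2 * sq g)"
      by (rule mult_mono[OF e4]) simp_all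
    then have V: "4 * (?q ^ (6 * r\<^sup>2) * (sq g)\<^sup>2) \<le> ?q ^ (40 * r\<^sup>2) * c\<^sup>2 * sq g"
      by (simp only: power2_eq_square mult.assoc)
    show ?thesis using A U V by linarith
  qed
qed

section \<open>Rank parts and functions of bounded degree\<close>

lemma two_div_le:
  assumes "2 * X \<le> Y" "0 < X"
  shows "2 / Y \<le> 1 / (X::real)"
  using assms by (simp add: field_simps)

text \<open>Lagrange interpolation in \<open>psi\<close>, which acts on rank \<open>b\<close> by \<open>1 / q\<^sup>b\<close>.\<close>

lemma exists_level_filter:
  fixes g :: "'a::{field,finite}^'n^'n \<Rightarrow> complex"
  assumes g: "glob k c g" and r: "r \<le> d" and F: "finite F" "F \<subseteq> {..d} - {r}"
  shows "\<exists>h. (\<forall>B. fc h B = fc g B * (\<Prod>b\<in>F. (1 / of_nat CARD('a) ^ rk B - 1 / of_nat CARD('a) ^ b) / (1 / of_nat CARD('a) ^ r - 1 / of_nat CARD('a) ^ b)))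
           \<and> glob k ((2 * real CARD('a) ^ d) ^ card F * c) h"
  using F
proof (induction F rule: finite_induct)
  case empty
  then show ?case using g by auto
next
  case (insert b F)
  let ?q = "real CARD('a)"
  have q2: "2 \<le> ?q" using card_field_ge_2[where 'a='a] by linarith
  obtain h where h: "\<And>B. fc h B = fc g B * (\<Prod>b\<in>F. (1 / of_nat CARD('a) ^ rk B - 1 / of_nat CARD('a) ^ b) / (1 / of_nat CARD('a) ^ r - 1 / of_nat CARD('a) ^ b))"
    "glob k ((2 * ?q ^ d) ^ card F * c) h" using insert by auto
  define D where "D = (1 / of_nat CARD('a) ^ r - 1 / of_nat CARD('a) ^ b :: complex)"
  have br: "b \<noteq> r" "b \<le> d" using insert.prems by auto
  \<comment> \<open>Distinct nodes q^(-b) with b <= d are at least q^(-d) apart, so one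
    interpolation factor costs at most 2 q^d.\<close>
  have gap: "1 / ?q ^ d \<le> 1 / ?q ^ m - 1 / ?q ^ m'" if "m < m'" "m' \<le> d" for m m'
  proof -
    have "2 * ?q ^ m \<le> ?q * ?q ^ m" by (rule mult_right_mono[OF q2]) simp
    also have "?q * ?q ^ m = ?q ^ Suc m" by simp
    also have "\<dots> \<le> ?q ^ m'" by (rule power_increasing) (use that q2 in auto)
    finally have mm: "2 * ?q ^ m \<le> ?q ^ m'" .
    have "0 < ?q ^ m" "0 < ?q ^ m'" using q2 by (auto intro!: zero_less_power)
    with mm have "2 / ?q ^ m' \<le> 1 / ?q ^ m" by (intro two_div_le)
    moreover have "1 / ?q ^ d \<le> 1 / ?q ^ m'"
      by (rule divide_left_mono[OF power_increasing]) (use that q2 in auto)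
    ultimately show ?thesis by linarith
  qed
  have "cmod D = \<bar>1 / ?q ^ r - 1 / ?q ^ b\<bar>"
  proof -
    have "D = of_real (1 / ?q ^ r - 1 / ?q ^ b)" by (simp add: D_def)
    then show ?thesis by (simp only: norm_of_real)
  qed
  then have Dge: "1 / ?q ^ d \<le> cmod D"
    using gap[of r b] gap[of b r] br r by (cases "r < b") auto
  have "0 < 1 / ?q ^ d" by (rule divide_pos_pos) (use q2 in simp_all)
  then have "0 < cmod D" using Dge by (rule order_less_le_trans)
  then have D0: "D \<noteq> 0" by simp
  define h' where "h' = (\<lambda>A. (1 / D) * (psi h A - (1 / of_nat CARD('a) ^ b) * h A))"
  have "fc h' B = fc g B * (\<Prod>b\<in>insert b F. (1 / of_nat CARD('a) ^ rk B - 1 / of_nat CARD('a) ^ b) / (1 / of_nat CARD('a) ^ r - 1 / of_nat CARD('a) ^ b))" for B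
  proof -
    have "fc h' B = (1 / D) * (fc h B / of_nat CARD('a) ^ rk B - (1 / of_nat CARD('a) ^ b) * fc h B)"
      unfolding h'_def fc_cmult fc_diff fc_psi ..
    also have "\<dots> = fc h B * ((1 / of_nat CARD('a) ^ rk B - 1 / of_nat CARD('a) ^ b) / D)"
      by (simp add: algebra_simps diff_divide_distrib)
    finally show ?thesis using insert.hyps by (simp add: h(1) D_def)
  qed
  moreover have "glob k ((2 * ?q ^ d) ^ card (insert b F) * c) h'"
  proof -
    define C where "C = (2 * ?q ^ d) ^ card F * c"
    have hC: "glob k C h" unfolding C_def by (rule h(2))
    have C0: "0 \<le> C" by (rule glob_nonneg[OF hC])
    have 1: "glob k (cmod (1 / D) * (C + cmod (1 / of_nat CARD('a) ^ b) * C)) h'"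
      unfolding h'_def by (intro glob_cmult glob_diff glob_psi hC)
    have b1: "cmod (1 / of_nat CARD('a) ^ b) \<le> 1"
      using one_le_power[of ?q b] q2 by (simp add: norm_divide norm_power)
    have D1: "cmod (1 / D) \<le> ?q ^ d"
    proof -
      have "1 / cmod D \<le> 1 / (1 / ?q ^ d)" by (rule divide_left_mono[OF Dge]) (use D0 q2 in auto)
      then show "cmod (1 / D) \<le> ?q ^ d" by (simp add: norm_divide)
    qed
    have b2: "C + cmod (1 / of_nat CARD('a) ^ b) * C \<le> C + 1 * C"
      by (rule add_left_mono[OF mult_right_mono[OF b1 C0]])
    have 2: "cmod (1 / D) * (C + cmod (1 / of_nat CARD('a) ^ b) * C) \<le> ?q ^ d * (C + 1 * C)"
      by (rule mult_mono[OF D1 b2]) (use C0 in simp_all)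
    have 3: "?q ^ d * (C + 1 * C) = (2 * ?q ^ d) ^ card (insert b F) * c"
      using insert.hyps by (simp add: C_def)
    show ?thesis by (rule glob_mono[OF 1 order_refl 2[unfolded 3]])
  qed
  ultimately show ?case by blast
qed

text \<open>The filter takes all ranks up to d other than r as its zeros. It has d factors, each
  costing 2 q^d.\<close>

lemma glob_level_part:
  fixes g :: "'a::{field,finite}^'n^'n \<Rightarrow> complex"
  assumes g: "glob k c g" and d: "deg_le d g" and r: "r \<le> d"
  shows "glob k ((2 * real CARD('a) ^ d) ^ d * c) (fproj {B. rk B = r} g)"
proof -
  let ?F = "{..d} - {r}"
  obtain h where h: "\<And>B. fc h B = fc g B * (\<Prod>b\<in>?F. (1 / of_nat CARD('a) ^ rk B - 1 / of_nat CARD('a) ^ b) / (1 / of_nat CARD('a) ^ r - 1 / of_nat CARD('a) ^ b))"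
    "glob k ((2 * real CARD('a) ^ d) ^ card ?F * c) h"
    using exists_level_filter[OF g r finite_Diff[OF finite_atMost] order_refl] by blast
  have inj: "(1 / of_nat CARD('a) ^ a = (1 / of_nat CARD('a) ^ b :: complex)) \<longleftrightarrow> a = b" for a b
  proof -
    have "(1 / of_nat CARD('a) ^ a = (1 / of_nat CARD('a) ^ b :: complex)) \<longleftrightarrow> (of_nat (CARD('a) ^ a) = (of_nat (CARD('a) ^ b) :: complex))"
      by simp
    also have "\<dots> \<longleftrightarrow> a = b" unfolding of_nat_eq_iff by (rule power_inject_exp) simp
    finally show ?thesis .
  qed
  have "h = fproj {B. rk B = r} g"
  proof (rule fc_inject, rule ext)
    fix B
    show "fc h B = fc (fproj {B. rk B = r} g) B"
    proof (cases "fc g B = 0")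
      case True
      then show ?thesis by (simp add: h(1) fc_fproj)
    next
      case False
      then have rkd: "rk B \<le> d" using d by (simp add: deg_le_def)
      show ?thesis
      proof (cases "rk B = r")
        case True
        have "(\<Prod>b\<in>?F. (1 / of_nat CARD('a) ^ rk B - 1 / of_nat CARD('a) ^ b) / (1 / of_nat CARD('a) ^ r - 1 / of_nat CARD('a) ^ b)) = (1::complex)"
          by (rule prod.neutral) (use inj True in auto)
        then show ?thesis unfolding h(1) using True by (simp add: fc_fproj)
      next
        case False
        have "(\<Prod>b\<in>?F. (1 / of_nat CARD('a) ^ rk B - 1 / of_nat CARD('a) ^ b) / (1 / of_nat CARD('a) ^ r - 1 / of_nat CARD('a) ^ b)) = (0::complex)"
          by (rule prod_zero) (use False rkd in \<open>auto intro!: bexI[of _ "rk B"]\<close>)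
        then show ?thesis unfolding h(1) using False by (simp add: fc_fproj)
      qed
    qed
  qed
  moreover have "card ?F = d" using r by simp
  ultimately show ?thesis using h(2) by simp
qed

lemma fproj_levels:
  assumes "deg_le d g"
  shows "g A = (\<Sum>r\<le>d. fproj {B. rk B = r} g A)"
proof -
  have "fc (\<lambda>A. \<Sum>r\<le>d. fproj {B. rk B = r} g A) B = fc g B" for B
  proof -
    have "(\<Sum>r\<le>d. fc (fproj {B. rk B = r} g) B) = (\<Sum>r\<le>d. if r = rk B then fc g B else 0)"
      by (rule sum.cong) (auto simp: fc_fproj)
    also have "\<dots> = fc g B" using assms by (auto simp: deg_le_def)
    finally show ?thesis by (simp only: fc_sum)
  qed
  then have "(\<lambda>A. \<Sum>r\<le>d. fproj {B. rk B = r} g A) = g" by (intro fc_inject[OF ext])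
  from fun_cong[OF this, of A] show ?thesis by (rule sym)
qed

lemma sq_levels:
  assumes "deg_le d g"
  shows "sq g = (\<Sum>r\<le>d. sq (fproj {B. rk B = r} g))"
proof -
  have "(\<Sum>r\<le>d. sq (fproj {B. rk B = r} g)) = (\<Sum>r\<le>d. \<Sum>B\<in>UNIV. if rk B = r then (cmod (fc g B))\<^sup>2 else 0)"
    unfolding sq_fproj by (rule sum.cong[OF refl], rule sum.mono_neutral_cong_left) auto
  also have "\<dots> = (\<Sum>B\<in>UNIV. \<Sum>r\<le>d. if rk B = r then (cmod (fc g B))\<^sup>2 else 0)" by (rule sum.swap)
  also have "\<dots> = (\<Sum>B\<in>UNIV. (cmod (fc g B))\<^sup>2)"
    by (rule sum.cong) (use assms in \<open>auto simp: deg_le_def\<close>)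
  finally show ?thesis by (simp add: parseval)
qed

lemma power4_sum_le:
  fixes y :: "'i \<Rightarrow> real"
  shows "(\<Sum>i\<in>I. y i) ^ 4 \<le> real (card I) ^ 3 * (\<Sum>i\<in>I. (y i) ^ 4)"
proof -
  have "((\<Sum>i\<in>I. y i)\<^sup>2)\<^sup>2 \<le> (real (card I) * (\<Sum>i\<in>I. (y i)\<^sup>2))\<^sup>2"
    by (rule power_mono[OF cauchy_schwarz_card]) simp
  also have "\<dots> = real (card I) ^ 2 * (\<Sum>i\<in>I. (y i)\<^sup>2)\<^sup>2" by (rule power_mult_distrib)
  also have "\<dots> \<le> real (card I) ^ 2 * (real (card I) * (\<Sum>i\<in>I. ((y i)\<^sup>2)\<^sup>2))"
    by (rule mult_left_mono[OF cauchy_schwarz_card]) simp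
  finally show ?thesis unfolding power2_eq_square power3_eq_cube power4_eq_xxxx by (simp only: mult_ac)
qed

text \<open>\<open>pure_hyper\<close> is applied to the d + 1 rank parts. Hoelder contributes (d +
  1)^3 <= q^(3 d^2), passing to a part loses (2 q^d)^d <= q^(2 d^2) in globalness, which enters
  squared, and 3 + 40 + 4 <= 48.\<close>

lemma deg_hyper:
  fixes g :: "'a::{field,finite}^'n^'n \<Rightarrow> complex"
  assumes d: "deg_le d g" and g: "glob d c g"
  shows "q4 g \<le> real CARD('a) ^ (48 * d\<^sup>2) * c\<^sup>2 * sq g"
proof (cases "d = 0")
  case True
  then have "pure 0 g" using d by (auto simp: pure_def deg_le_def)
  then show ?thesis using pure_hyper[of 0 g c] g True by simp
next
  case False
  let ?q = "real CARD('a)"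
  have q2: "2 \<le> ?q" using card_field_ge_2[where 'a='a] by linarith
  then have q1: "1 \<le> ?q" by linarith
  have d1: "1 \<le> d" using False by simp
  have dd: "d \<le> d\<^sup>2" using d1 by (simp add: power2_eq_square)
  define p where "p r = fproj {B. rk B = r} g" for r
  have "q4 g \<le> EE (\<lambda>A. real (card {..d}) ^ 3 * (\<Sum>r\<le>d. (cmod (p r A)) ^ 4))"
    unfolding q4_def
  proof (rule mean_mono)
    fix A
    have "cmod (g A) \<le> (\<Sum>r\<le>d. cmod (p r A))"
      unfolding p_def by (subst fproj_levels[OF d]) (rule norm_sum)
    then have "(cmod (g A)) ^ 4 \<le> (\<Sum>r\<le>d. cmod (p r A)) ^ 4" by (rule power_mono) simp
    then show "(cmod (g A)) ^ 4 \<le> real (card {..d}) ^ 3 * (\<Sum>r\<le>d. (cmod (p r A)) ^ 4)"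
      using power4_sum_le by (rule order_trans)
  qed
  also have "\<dots> = real (d + 1) ^ 3 * (\<Sum>r\<le>d. q4 (p r))"
    by (simp add: mean_cmult mean_sum q4_def)
  also have "\<dots> \<le> ?q ^ (3 * d\<^sup>2) * (\<Sum>r\<le>d. ?q ^ (40 * d\<^sup>2) * (?q ^ (4 * d\<^sup>2) * c\<^sup>2) * sq (p r))"
  proof (rule mult_mono)
    have "d + 1 \<le> 2 ^ d" by (induction d) auto
    then have "real (d + 1) \<le> real (2 ^ d)" by (rule of_nat_mono)
    also have "real (2 ^ d) = 2 ^ d" by simp
    also have "\<dots> \<le> ?q ^ d" by (rule power_mono[OF q2]) simp
    finally have "real (d + 1) ^ 3 \<le> (?q ^ d) ^ 3" by (rule power_mono) simp
    also have "\<dots> = ?q ^ (3 * d)" by (simp add: power_mult[symmetric] mult.commute)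
    also have "\<dots> \<le> ?q ^ (3 * d\<^sup>2)" by (rule power_increasing[OF _ q1]) (use dd in simp)
    finally show "real (d + 1) ^ 3 \<le> ?q ^ (3 * d\<^sup>2)" .
    show "(\<Sum>r\<le>d. q4 (p r)) \<le> (\<Sum>r\<le>d. ?q ^ (40 * d\<^sup>2) * (?q ^ (4 * d\<^sup>2) * c\<^sup>2) * sq (p r))"
    proof (rule sum_mono)
      fix r assume "r \<in> {..d}"
      then have rd: "r \<le> d" by simp
      let ?c = "(2 * ?q ^ d) ^ d * c"
      have "pure r (p r)" by (auto simp: pure_def p_def fc_fproj)
      moreover have "glob r ?c (p r)"
        unfolding p_def by (rule glob_mono[OF glob_level_part[OF g d rd] rd order_refl])
      ultimately have 1: "q4 (p r) \<le> ?q ^ (40 * r\<^sup>2) * ?c\<^sup>2 * sq (p r)" by (rule pure_hyper)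
      have "r\<^sup>2 \<le> d\<^sup>2" by (rule power_mono[OF rd]) simp
      then have 2: "?q ^ (40 * r\<^sup>2) \<le> ?q ^ (40 * d\<^sup>2)" by (rule power_increasing[OF mult_le_mono2 q1])
      have "(2 * ?q ^ d) ^ d \<le> (?q * ?q ^ d) ^ d" by (rule power_mono[OF mult_right_mono[OF q2]]) simp_all
      also have "\<dots> = ?q ^ ((1 + d) * d)" by (simp only: power_add power_one_right power_mult)
      also have "\<dots> \<le> ?q ^ (2 * d\<^sup>2)" by (rule power_increasing[OF _ q1]) (use dd in \<open>simp add: power2_eq_square algebra_simps\<close>)
      finally have "((2 * ?q ^ d) ^ d)\<^sup>2 \<le> (?q ^ (2 * d\<^sup>2))\<^sup>2" by (rule power_mono) simp
      also have "\<dots> = ?q ^ (4 * d\<^sup>2)" by (simp add: power_mult[symmetric])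
      finally have "((2 * ?q ^ d) ^ d)\<^sup>2 * c\<^sup>2 \<le> ?q ^ (4 * d\<^sup>2) * c\<^sup>2" by (rule mult_right_mono) simp
      then have 3: "?c\<^sup>2 \<le> ?q ^ (4 * d\<^sup>2) * c\<^sup>2" unfolding power_mult_distrib .
      have "?q ^ (40 * r\<^sup>2) * ?c\<^sup>2 * sq (p r) \<le> ?q ^ (40 * d\<^sup>2) * (?q ^ (4 * d\<^sup>2) * c\<^sup>2) * sq (p r)"
        by (rule mult_right_mono[OF mult_mono[OF 2 3]]) simp_all
      with 1 show "q4 (p r) \<le> ?q ^ (40 * d\<^sup>2) * (?q ^ (4 * d\<^sup>2) * c\<^sup>2) * sq (p r)" by (rule order_trans)
    qed
  qed (auto intro!: sum_nonneg)
  also have "\<dots> = ?q ^ (3 * d\<^sup>2 + 40 * d\<^sup>2 + 4 * d\<^sup>2) * c\<^sup>2 * sq g"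
    unfolding sum_distrib_left[symmetric] p_def sq_levels[OF d, symmetric] by (simp only: power_add mult.assoc)
  also have "\<dots> \<le> ?q ^ (48 * d\<^sup>2) * c\<^sup>2 * sq g"
    by (rule mult_right_mono[OF mult_right_mono[OF power_increasing[OF _ q1]]]) simp_all
  finally show ?thesis .
qed

section \<open>Products, powers and higher moments\<close>

lemma fc_cnj: "fc (\<lambda>A. cnj (g A)) B = cnj (fc g (- B))"
  by (simp add: fc_def mean_cnj ch_minus_left)

text \<open>Multiplication convolves Fourier coefficients, and rank is subadditive.\<close>

lemma deg_le_mult:
  fixes g h :: "'a::{field,finite}^'n^'n \<Rightarrow> complex"
  assumes "deg_le d g" "deg_le e h"
  shows "deg_le (d + e) (\<lambda>A. g A * h A)"
  unfolding deg_le_def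
proof (intro allI impI)
  fix E assume nz: "fc (\<lambda>A. g A * h A) E \<noteq> 0"
  have "fc (\<lambda>A. g A * h A) E = (\<Sum>B\<in>UNIV. fc g B * fc h (E - B))"
    using fc_mult_cnj[of g "\<lambda>A. cnj (h A)" E] by (simp add: fc_cnj)
  then have "(\<Sum>B\<in>UNIV. fc g B * fc h (E - B)) \<noteq> 0" using nz by simp
  then obtain B where "fc g B * fc h (E - B) \<noteq> 0" by (rule sum.not_neutral_contains_not_neutral)
  then have "rk B \<le> d" "rk (E - B) \<le> e" using assms by (auto simp: deg_le_def)
  then show "rk E \<le> d + e" using rk_add[of B "E - B"] by simp
qed

lemma deg_le_power:
  fixes g :: "'a::{field,finite}^'n^'n \<Rightarrow> complex"
  assumes "deg_le d g"
  shows "deg_le (m * d) (\<lambda>A. g A ^ m)"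
  using assms
proof (induction m)
  case 0
  have "fc (\<lambda>A. 1) = (\<lambda>B :: 'a^'n^'n. if B = 0 then 1 else 0)"
  proof -
    have "synth (\<lambda>B :: 'a^'n^'n. if B = 0 then 1 else 0) = (\<lambda>A. 1)"
    proof
      fix A
      have "synth (\<lambda>B :: 'a^'n^'n. if B = 0 then 1 else 0) A = (\<Sum>B\<in>UNIV. if B = 0 then ch B A else 0)"
        unfolding synth_def by (rule sum.cong) auto
      then show "synth (\<lambda>B :: 'a^'n^'n. if B = 0 then 1 else 0) A = 1" by simp
    qed
    then show ?thesis using fc_synth[of "\<lambda>B :: 'a^'n^'n. if B = 0 then 1 else 0"] by simp
  qed
  then show ?case by (auto simp: deg_le_def fun_eq_iff split: if_splits)
next
  case (Suc m)
  then show ?case using deg_le_mult[of d g "m * d" "\<lambda>A. g A ^ m"] by simp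
qed

lemma deg_le_rst: "deg_le d g \<Longrightarrow> deg_le d (rst S P T g)"
  unfolding deg_le_def
proof (intro allI impI)
  fix B assume d: "\<forall>B. fc g B \<noteq> 0 \<longrightarrow> rk B \<le> d" and "fc (rst S P T g) B \<noteq> 0"
  then have "\<exists>B'\<in>{B'. P ** B' ** S = B}. fc g B' * ch B' T \<noteq> 0"
    unfolding fc_rst using sum.not_neutral_contains_not_neutral by blast
  then obtain B' where B': "P ** B' ** S = B" "fc g B' \<noteq> 0" by auto
  have "rk B \<le> rk B'" unfolding B'(1)[symmetric] using rk_mult_left[of "P ** B'" S] rk_mult_right[of P B'] by linarith
  then show "rk B \<le> d" using d B'(2) by force
qed

text \<open>\<open>deg_hyper\<close> is applied to u = g^(2^j), which has degree 2^j d. Globalness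
  of u is the induction hypothesis for the restrictions of g, so restrictions of g up to order (2^j
  - 1) d + 2^j d = (2^(j+1) - 1) d must be under control. The exponents obey e' = 48 * 4^j d^2 + 2
  e, which 24 * 4^j d^2 solves.\<close>

lemma moment_bound:
  fixes g :: "'a::{field,finite}^'n^'n \<Rightarrow> complex"
  assumes "deg_le d g" "glob ((2 ^ j - 1) * d) c g"
  shows "EE (\<lambda>A. cmod (g A) ^ (2 ^ (j + 1))) \<le> real CARD('a) ^ (24 * 4 ^ j * d\<^sup>2) * c ^ (2 ^ (j + 1) - 2) * sq g"
  using assms
proof (induction j arbitrary: g)
  case 0
  have "sq g \<le> real CARD('a) ^ (24 * 4 ^ 0 * d\<^sup>2) * sq g"
    using mult_right_mono[OF one_le_power[of "real CARD('a)" "24 * 4 ^ 0 * d\<^sup>2"], of "sq g"] card_field_ge_2[where 'a='a] by simp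
  then show ?case by (simp add: sq_def)
next
  case (Suc j)
  let ?q = "real CARD('a)" and ?e = "24 * 4 ^ j * d\<^sup>2"
  define u where "u A = g A ^ (2 ^ j)" for A
  have c0: "0 \<le> c" by (rule glob_nonneg[OF Suc.prems(2)])
  have pw: "2 \<le> (2::nat) ^ (j + 1)" by simp
  have usq: "sq (rst S P T u) = EE (\<lambda>A. cmod (rst S P T g A) ^ (2 ^ (j + 1)))" for S P T
    by (simp add: sq_def u_def rst_def norm_power power_mult[symmetric] mult.commute)
  have du: "deg_le (2 ^ j * d) u" unfolding u_def by (rule deg_le_power[OF Suc.prems(1)])
  have n1: "(2 ^ j - 1) * d + 2 ^ j * d = (2 ^ Suc j - 1) * (d::nat)"
    by (simp add: algebra_simps)
  have gu: "glob (2 ^ j * d) (sqrt (?q ^ ?e * c ^ (2 ^ (j + 1)))) u"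
    unfolding glob_def
  proof (intro allI impI)
    fix S P T :: "'a^'n^'n" assume SP: "corank S + corank P \<le> 2 ^ j * d"
    have "glob ((2 ^ j - 1) * d) c (rst S P T g)"
      by (rule glob_rst, rule glob_mono[OF Suc.prems(2) _ order_refl]) (use SP n1 in linarith)
    from Suc.IH[OF deg_le_rst[OF Suc.prems(1)] this]
    have "sq (rst S P T u) \<le> ?q ^ ?e * c ^ (2 ^ (j + 1) - 2) * sq (rst S P T g)" unfolding usq .
    also have "\<dots> \<le> ?q ^ ?e * c ^ (2 ^ (j + 1) - 2) * c\<^sup>2"
    proof (intro mult_left_mono)
      have "corank S + corank P \<le> (2 ^ Suc j - 1) * d" using SP n1 by linarith
      then show "sq (rst S P T g) \<le> c\<^sup>2"
        unfolding n2_squared[symmetric] by (intro power_mono globD[OF Suc.prems(2)]) simp_all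
    qed (use c0 in simp)
    also have "\<dots> = ?q ^ ?e * c ^ (2 ^ (j + 1))"
    proof -
      have "2 ^ (j + 1) - 2 + 2 = (2::nat) ^ (j + 1)" using pw by linarith
      then show ?thesis unfolding mult.assoc power_add[symmetric] by (simp only:)
    qed
    finally show "n2 (rst S P T u) \<le> sqrt (?q ^ ?e * c ^ (2 ^ (j + 1)))" unfolding n2_def by (rule real_sqrt_le_mono)
  qed
  have L: "EE (\<lambda>A. cmod (g A) ^ (2 ^ (Suc j + 1))) = q4 u"
  proof -
    have "(2::nat) ^ (Suc j + 1) = 2 ^ j * 4" by simp
    then show ?thesis unfolding q4_def u_def norm_power by (simp only: power_mult)
  qed
  define X where "X = ?q ^ (48 * (2 ^ j * d)\<^sup>2) * (?q ^ ?e * c ^ (2 ^ (j + 1)))"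
  have Y0: "0 \<le> ?q ^ ?e * c ^ (2 ^ (j + 1))" by (intro mult_nonneg_nonneg zero_le_power c0) simp
  have X0: "0 \<le> X" unfolding X_def by (rule mult_nonneg_nonneg[OF _ Y0]) simp
  have "q4 u \<le> X * sq u"
    using deg_hyper[OF du gu] unfolding X_def real_sqrt_pow2[OF Y0] .
  also have "\<dots> \<le> X * (?q ^ ?e * c ^ (2 ^ (j + 1) - 2) * sq g)"
  proof (rule mult_left_mono[OF _ X0])
    have "glob ((2 ^ j - 1) * d) c g"
      by (rule glob_mono[OF Suc.prems(2) _ order_refl]) (use n1 in linarith)
    from Suc.IH[OF Suc.prems(1) this] show "sq u \<le> ?q ^ ?e * c ^ (2 ^ (j + 1) - 2) * sq g"
      using usq[of "mat 1" "mat 1" 0] by (simp only: rst_id)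
  qed
  also have "\<dots> = ?q ^ (48 * (2 ^ j * d)\<^sup>2 + ?e + ?e) * c ^ (2 ^ (j + 1) + (2 ^ (j + 1) - 2)) * sq g"
    unfolding X_def by (simp only: power_add mult_ac)
  also have "48 * (2 ^ j * d)\<^sup>2 + ?e + ?e = 24 * 4 ^ Suc j * d\<^sup>2"
  proof -
    have "((2::nat) ^ j)\<^sup>2 = 4 ^ j"
      unfolding power2_eq_square power_mult_distrib[symmetric] by simp
    then show ?thesis by (simp add: power_mult_distrib)
  qed
  also have "(2::nat) ^ (j + 1) + (2 ^ (j + 1) - 2) = 2 ^ (Suc j + 1) - 2" using pw by simp
  finally show ?case unfolding L .
qed

section \<open>Restrictions of averages and of rank parts\<close>

lemma outer_shift_identity:
  fixes P A :: "'a::{field,finite}^'n^'n"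
  assumes "\<And>v. dot m (P *v v) = 0" "dot m z = 1"
  shows "(A + outer w m) ** (P + outer z l) = A ** P + outer (w + A *v z) l"
  unfolding matrix_eq
proof
  fix v
  have "dot m (P *v v + dot l v *s z) = dot l v"
    by (simp add: assms dot_commute[of m] dot_add_left dot_scale_left, simp add: assms dot_commute[of _ m])
  then show "((A + outer w m) ** (P + outer z l)) *v v = (A ** P + outer (w + A *v z) l) *v v"
    by (simp add: matrix_vector_mul_assoc[symmetric] matrix_vector_add_left outer_mult_vec matrix_vector_right_distrib mat_vec_scale vector_add_ldistrib assms)
qed

text \<open>Let m vanish on \<open>ran P\<close> with value 1 at z. Replacing A by A + w m^T in A (P
  + z l^T) gives A P + (w + A z) l^T, and averaging over w absorbs A z. A random rank-one summand
  thus turns a restriction along P into one along a matrix of larger rank.\<close>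

lemma mean_rank_one_update:
  fixes P S T :: "'a::{field,finite}^'n^'n" and F :: "'a^'n^'n \<Rightarrow> real"
  assumes z: "z \<notin> ran P"
  shows "EE (\<lambda>w. EE (\<lambda>A. F (T + S ** A ** P + outer (S *v w) l))) = EE (\<lambda>A. F (T + S ** A ** (P + outer z l)))"
proof -
  obtain m where m: "\<forall>s\<in>ran P. dot m s = 0" "dot m z = 1"
    by (rule separate_subspace[OF subspace_ran z])
  have id: "S ** (A + outer w m) ** (P + outer z l) = S ** A ** P + outer (S *v (w + A *v z)) l" for A w
  proof -
    have "(A + outer w m) ** (P + outer z l) = A ** P + outer (w + A *v z) l"
      by (rule outer_shift_identity) (use m in auto)
    then show ?thesis unfolding matrix_mul_assoc[symmetric] by (simp only: matrix_add_ldistrib mult_outer)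
  qed
  have "EE (\<lambda>A. F (T + S ** A ** (P + outer z l))) = EE (\<lambda>w. EE (\<lambda>A. F (T + S ** (A + outer w m) ** (P + outer z l))))"
  proof -
    have "EE (\<lambda>A. F (T + S ** (A + outer w m) ** (P + outer z l))) = EE (\<lambda>A. F (T + S ** A ** (P + outer z l)))" for w
      by (rule mean_translate)
    then show ?thesis by (simp only: mean_const)
  qed
  also have "\<dots> = EE (\<lambda>A. EE (\<lambda>w. F (T + (S ** A ** P + outer (S *v (w + A *v z)) l))))"
    unfolding id by (rule mean_swap)
  also have "\<dots> = EE (\<lambda>A. EE (\<lambda>w. F (T + (S ** A ** P + outer (S *v w) l))))"
  proof -
    have "EE (\<lambda>w. F (T + (S ** A ** P + outer (S *v (w + A *v z)) l))) = EE (\<lambda>w. F (T + (S ** A ** P + outer (S *v w) l)))" for A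
      by (rule mean_translate)
    then show ?thesis by (simp only:)
  qed
  also have "\<dots> = EE (\<lambda>w. EE (\<lambda>A. F (T + (S ** A ** P + outer (S *v w) l))))"
    by (rule mean_swap)
  finally show ?thesis by (simp only: add.assoc)
qed

text \<open>The shifts inside \<open>theta\<close> may be followed by a further random shift
  \<open>outer (S *v w) l\<close> without changing the average. By
  \<open>mean_rank_one_update\<close> the result is an average of restrictions along P + z l^T, so
  the averaging in \<open>theta\<close> pays back part of the restriction.\<close>

lemma n2_rst_theta:
  fixes h :: "'a::{field,finite}^'n^'n \<Rightarrow> complex"
  assumes x: "x \<noteq> 0" and z: "z \<notin> ran P"
    and b: "\<And>l u. dot l x = 1 \<Longrightarrow> n2 (rst S (P + outer z l) (T + outer u l) h) \<le> c"
  shows "n2 (rst S P T (theta x h)) \<le> c"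
proof -
  obtain l1 where l1: "dot l1 x = 1" by (rule exists_functional[OF x])
  have c0: "0 \<le> c" using order_trans[OF n2_nonneg b[OF l1]] .
  have eq: "rst S P T (theta x h) = (\<lambda>A. mean {l. dot l x = 1} (\<lambda>l. EE (\<lambda>u. EE (\<lambda>w. h (T + outer u l + S ** A ** P + outer (S *v w) l)))))"
  proof
    fix A
    have "EE (\<lambda>u. h (T + S ** A ** P + outer u l)) = EE (\<lambda>u. EE (\<lambda>w. h (T + outer u l + S ** A ** P + outer (S *v w) l)))" for l
    proof -
      have "EE (\<lambda>u. EE (\<lambda>w. h (T + outer u l + S ** A ** P + outer (S *v w) l))) = EE (\<lambda>u. EE (\<lambda>w. h (T + S ** A ** P + outer (u + S *v w) l)))"
        by (simp only: outer_add_left add_ac)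
      also have "\<dots> = EE (\<lambda>w. EE (\<lambda>u. h (T + S ** A ** P + outer (u + S *v w) l)))" by (rule mean_swap)
      also have "\<dots> = EE (\<lambda>w :: 'a^'n. EE (\<lambda>u. h (T + S ** A ** P + outer u l)))"
      proof -
        have "EE (\<lambda>u. h (T + S ** A ** P + outer (u + S *v w) l)) = EE (\<lambda>u. h (T + S ** A ** P + outer u l))" for w
          by (rule mean_translate)
        then show ?thesis by (simp only:)
      qed
      finally show ?thesis by (simp only: mean_const)
    qed
    then show "rst S P T (theta x h) A = mean {l. dot l x = 1} (\<lambda>l. EE (\<lambda>u. EE (\<lambda>w. h (T + outer u l + S ** A ** P + outer (S *v w) l))))"
      unfolding rst_def theta_def by (simp only:)
  qed
  show ?thesis unfolding eq
  proof (rule n2_mean_le)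
    show "{l. dot l x = 1} \<noteq> {}" using l1 by blast
    fix l assume "l \<in> {l. dot l x = 1}"
    then have l: "dot l x = 1" by simp
    show "n2 (\<lambda>A. EE (\<lambda>u. EE (\<lambda>w. h (T + outer u l + S ** A ** P + outer (S *v w) l)))) \<le> c"
    proof (rule n2_mean_le)
      fix u
      let ?T = "T + outer u l"
      have "sq (\<lambda>A. EE (\<lambda>w. h (?T + S ** A ** P + outer (S *v w) l))) \<le> EE (\<lambda>w. sq (\<lambda>A. h (?T + S ** A ** P + outer (S *v w) l)))"
        by (rule sq_mean_le) simp_all
      also have "\<dots> = sq (rst S (P + outer z l) ?T h)"
        unfolding sq_def rst_def by (rule mean_rank_one_update[OF z])
      also have "\<dots> \<le> c\<^sup>2" unfolding n2_squared[symmetric] by (rule power_mono[OF b[OF l]]) simp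
      finally show "n2 (\<lambda>A. EE (\<lambda>w. h (?T + S ** A ** P + outer (S *v w) l))) \<le> c"
        unfolding n2_def using c0 by (simp add: real_le_lsqrt)
    qed simp_all
  qed simp
qed

text \<open>As z is outside \<open>ran P\<close>, the new summand cannot cancel against P v, so no
  kernel vector is gained; x is lost.\<close>

lemma corank_rank_one_update:
  fixes P :: "'a::{field,finite}^'n^'n"
  assumes z: "z \<notin> ran P" and x: "P *v x = 0" "dot l x = 1"
  shows "corank (P + outer z l) < corank P"
proof -
  have "kern (P + outer z l) \<subset> kern P"
  proof
    show "kern (P + outer z l) \<subseteq> kern P"
    proof
      fix v assume "v \<in> kern (P + outer z l)"
      then have e: "P *v v + dot l v *s z = 0" by (simp add: kern_def matrix_vector_add_left outer_mult_vec)
      have "dot l v = 0"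
      proof (rule ccontr)
        assume nz: "dot l v \<noteq> 0"
        have "dot l v *s z = P *v (0 - v)"
          unfolding matrix_vector_mult_diff_distrib using e by (simp add: eq_neg_iff_add_eq_0 add.commute)
        then have "dot l v *s z \<in> ran P" by (simp only: mem_ran)
        then have "(1 / dot l v) *s (dot l v *s z) \<in> ran P" by (rule vec.subspace_scale[OF subspace_ran])
        then show False using z nz by (simp add: vector_smult_assoc)
      qed
      then show "v \<in> kern P" using e by (simp add: kern_def)
    qed
    have "x \<in> kern P" "x \<notin> kern (P + outer z l)"
      using x z vec.subspace_0[OF subspace_ran[of P]] by (auto simp: kern_def matrix_vector_add_left outer_mult_vec)
    then show "kern (P + outer z l) \<noteq> kern P" by blast
  qed
  then have "card (kern (P + outer z l)) < card (kern P)" by (rule psubset_card_mono[rotated]) simp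
  then show ?thesis unfolding card_kern by (rule power_less_imp_less_exp[rotated]) simp
qed

abbreviation pr :: "nat \<Rightarrow> ('a::{field,finite}^'n^'n \<Rightarrow> complex) \<Rightarrow> 'a^'n^'n \<Rightarrow> complex" where
  "pr r g \<equiv> fproj {B. rk B = r} g"

lemma pure_pr: "pure r (pr r g)"
  by (auto simp: pure_def fc_fproj)

lemma rk_mult_line_kern:
  fixes B p :: "'a::{field,finite}^'n^'n"
  assumes K: "kern p = {c *s x | c. True}" and x: "x \<noteq> 0"
  shows "rk B = rk (p ** B) + (if x \<in> ran B then 1 else 0)"
proof (cases "x \<in> ran B")
  case True
  have K': "kern p = vec.span {x}" unfolding K vec.span_singleton by auto
  have "vec.dim (kern p) = 1" unfolding K' using x by (simp add: vec.dim_eq_card_independent)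
  moreover have "kern p \<subseteq> ran B" unfolding K' by (rule vec.span_minimal) (use True subspace_ran in auto)
  then have "card (kern p) * card (ran (p ** B)) = card (ran B)"
    using card_ran_mult[of B p] by (simp add: Int_absorb1 Int_absorb2)
  ultimately have "CARD('a) ^ (1 + rk (p ** B)) = CARD('a) ^ rk B"
    unfolding card_ran card_subspace[OF subspace_kern] power_add by simp
  then have "1 + rk (p ** B) = rk B" by (rule power_inject_exp[THEN iffD1, rotated]) simp
  then show ?thesis using True by simp
next
  case False
  have "kern p \<inter> ran B = {0}"
  proof -
    have "c = 0" if "c *s x \<in> ran B" for c
    proof (rule ccontr)
      assume "c \<noteq> 0"
      then show False using vec.subspace_scale[OF subspace_ran that, of "1 / c"] False by (simp add: vector_smult_assoc)
    qed
    then show ?thesis unfolding K using vec.subspace_0[OF subspace_ran[of B]] by fastforce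
  qed
  then have "card (ran (p ** B)) = card (ran B)"
    using card_ran_mult[of B p] by (simp add: Int_commute)
  then show ?thesis using False unfolding card_ran by simp
qed

text \<open>The budget r is shared between the corank of the restriction and the rank of the part.
  This is what an induction on the rank can supply, and \<open>n2_rst_pr\<close> upgrades it to
  globalness of the rank-r part.\<close>

definition level_bound :: "nat \<Rightarrow> real \<Rightarrow> ('a::{field,finite}^'n^'n \<Rightarrow> complex) \<Rightarrow> bool" where
  "level_bound r c f \<longleftrightarrow> (\<forall>S P T k. corank S + corank P + k \<le> r \<longrightarrow> n2 (pr k (rst S P T f)) \<le> c)"

lemma level_bound_mono: "level_bound r c f \<Longrightarrow> r' \<le> r \<Longrightarrow> level_bound r' c f"
  unfolding level_bound_def by (meson order_trans)

lemma level_bound_rst: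
  assumes "level_bound (r + corank S + corank P) c f"
  shows "level_bound r c (rst S P T f)"
  unfolding level_bound_def rst_rst
proof (intro allI impI)
  fix S' P' T' :: "'a^'b^'b" and k
  assume "corank S' + corank P' + k \<le> r"
  then have "corank (S ** S') + corank (P' ** P) + k \<le> r + corank S + corank P"
    using corank_mult[of S S'] corank_mult[of P' P] by linarith
  then show "n2 (pr k (rst (S ** S') (P' ** P) (T + S ** T' ** P) f)) \<le> c"
    using assms unfolding level_bound_def by blast
qed

lemma pr_transpose: "pr r (\<lambda>A. f (transpose A)) = (\<lambda>A. pr r f (transpose A))"
  by (simp add: fproj_transpose rk_transpose)

lemma level_bound_transpose:
  assumes "level_bound r c f"
  shows "level_bound r c (\<lambda>A. f (transpose A))"
  unfolding level_bound_def rst_transpose pr_transpose n2_transpose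
  using assms unfolding level_bound_def by (simp add: corank_transpose add.commute)

lemma level_bound_n2: "level_bound r c f \<Longrightarrow> n2 (pr r f) \<le> c"
  unfolding level_bound_def
  by (drule spec[of _ "mat 1"], drule spec[of _ "mat 1"], drule spec[of _ 0], drule spec[of _ r]) simp

lemma fproj_not_contains:
  fixes x :: "'a::{field,finite}^'n"
  assumes "x \<noteq> 0"
  shows "fproj {B. rk B = r \<and> x \<notin> ran B} f = (\<lambda>A. of_nat CARD('a) ^ r * theta x (pr r f) A)"
  by (rule fc_inject, rule ext) (auto simp: fc_fproj fc_cmult fc_theta[OF assms])

text \<open>Multiplication by p lowers the rank by one exactly when x is in the column space.
  Frequencies of rank r after the restriction therefore come from rank r + 1 with x or from rank r
  without x, and the latter are q^r times a \<open>theta\<close> average. The restricted part with x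
  is thus expressed by a rank part of a restriction, which \<open>level_bound\<close>
  controls.\<close>

lemma rst_pr_contains:
  fixes f :: "'a::{field,finite}^'n^'n \<Rightarrow> complex"
  assumes K: "kern p = {c *s x | c. True}" and x: "x \<noteq> 0"
  shows "rst (mat 1) p T (fproj {B. rk B = Suc r \<and> x \<in> ran B} f)
       = (\<lambda>A. pr r (rst (mat 1) p T f) A
            - of_nat CARD('a) ^ r * rst (mat 1) p T (theta x (pr r f)) A)"
proof
  fix A
  have "pr r (rst (mat 1) p T f) = rst (mat 1) p T (fproj {B. rk (p ** B) = r} f)"
    by (simp add: fproj_rst)
  also have "fproj {B. rk (p ** B) = r} f = (\<lambda>A. fproj {B. rk B = Suc r \<and> x \<in> ran B} f A + fproj {B. rk B = r \<and> x \<notin> ran B} f A)"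
  proof (rule fc_inject, rule ext)
    fix B
    show "fc (fproj {B. rk (p ** B) = r} f) B = fc (\<lambda>A. fproj {B. rk B = Suc r \<and> x \<in> ran B} f A + fproj {B. rk B = r \<and> x \<notin> ran B} f A) B"
      using rk_mult_line_kern[OF K x, of B] by (auto simp: fc_fproj fc_add)
  qed
  finally show "rst (mat 1) p T (fproj {B. rk B = Suc r \<and> x \<in> ran B} f) A
       = pr r (rst (mat 1) p T f) A
            - of_nat CARD('a) ^ r * rst (mat 1) p T (theta x (pr r f)) A"
    unfolding fproj_not_contains[OF x] by (simp add: rst_def)
qed

text \<open>The factorization of P lets a restriction along P proceed in two stages: first along p,
  which collapses one line, then along P + z l^T, which has smaller corank.\<close>

lemma line_projection:
  fixes x :: "'a::{field,finite}^'n" and P :: "'a^'n^'n"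
  assumes "dot l x = 1"
  defines "p \<equiv> mat 1 - outer x l"
  shows "kern p = {c *s x | c. True}" "P *v x = 0 \<Longrightarrow> (P + outer z l) ** p = P"
proof -
  have pv: "p *v v = v - dot l v *s x" for v
    by (simp add: p_def matrix_vector_diff_left outer_mult_vec)
  show "kern p = {c *s x | c. True}"
  proof
    show "kern p \<subseteq> {c *s x | c. True}" by (auto simp: kern_def pv)
    show "{c *s x | c. True} \<subseteq> kern p"
      using assms(1) by (auto simp: kern_def pv dot_commute[of l] dot_scale_left)
  qed
  assume P: "P *v x = 0"
  show "(P + outer z l) ** p = P"
    unfolding matrix_eq
  proof
    fix v
    have "dot l (v - dot l v *s x) = 0"
      using assms(1) by (simp add: dot_commute[of l] dot_diff_left dot_scale_left)
    then show "((P + outer z l) ** p) *v v = P *v v"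
      by (simp add: matrix_vector_mul_assoc[symmetric] pv matrix_vector_add_left outer_mult_vec matrix_vector_mult_diff_distrib mat_vec_scale P assms(1))
  qed
qed

text \<open>Taking rank parts does not commute with restriction. With x in \<open>kern P\<close>,
  the rank-r part is split according to whether x lies in the column space. The part without x is
  q^r times a \<open>theta\<close> average; the part with x is treated by
  \<open>rst_pr_contains\<close>. Both then only involve corank at most k, and the factors satisfy
  q^r + (1 + q^(r-1)) <= 3 q^r. Restrictions on the left side follow by transposition.\<close>

lemma n2_rst_pr:
  fixes f :: "'a::{field,finite}^'n^'n \<Rightarrow> complex"
  assumes "corank S + corank P \<le> k" "level_bound r c f"
  shows "n2 (rst S P T (pr r f)) \<le> (3 * real CARD('a) ^ r) ^ k * c"
  using assms
proof (induction k arbitrary: r f S P T)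
  case 0
  then have z: "corank S = 0" "corank P = 0" by linarith+
  have "rk (P ** B ** S) = rk B" for B
  proof -
    obtain S' where S': "S ** S' = mat 1"
      using z(1) unfolding corank_eq_0_invertible invertible_def by blast
    obtain P' where P': "P' ** P = mat 1"
      using z(2) unfolding corank_eq_0_invertible invertible_def by blast
    have "P' ** (P ** B ** S) ** S' = (P' ** P) ** B ** (S ** S')" by (simp add: matrix_mul_assoc)
    then have "P' ** (P ** B ** S) ** S' = B" by (simp add: S' P')
    then have "rk B \<le> rk (P ** B ** S)"
      using rk_mult_left[of "P' ** (P ** B ** S)" S'] rk_mult_right[of P' "P ** B ** S"] by simp
    moreover have "rk (P ** B ** S) \<le> rk B" using rk_mult_left[of "P ** B" S] rk_mult_right[of P B] by linarith
    ultimately show ?thesis by linarith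
  qed
  then have "rst S P T (pr r f) = pr r (rst S P T f)" by (simp add: fproj_rst)
  then show ?case using 0 by (simp add: level_bound_def)
next
  case (Suc k)
  let ?q = "real CARD('a)"
  have q2: "2 \<le> ?q" using card_field_ge_2[where 'a='a] by linarith
  then have q1: "1 \<le> ?q" by linarith
  have c0: "0 \<le> c" using order_trans[OF n2_nonneg level_bound_n2[OF Suc.prems(2)]] .
  have qr: "1 \<le> ?q ^ m" for m by (rule one_le_power[OF q1])
  have main: "n2 (rst S P T (pr r f)) \<le> (3 * ?q ^ r) ^ Suc k * c"
    if S: "corank S + corank P \<le> Suc k" "corank P \<noteq> 0" and f: "level_bound r c f" for S P T :: "'a^'n^'n" and f
  proof -
    obtain x where x: "P *v x = 0" "x \<noteq> 0"
      using S(2) unfolding corank_eq_0 kern_def by auto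
    have "ran P \<noteq> UNIV" using S(2) rk_full_ran[of P] by simp
    then obtain z where z: "z \<notin> ran P" by blast
    have upd: "corank S + corank (P + outer z l) \<le> k" if "dot l x = 1" for l
      using corank_rank_one_update[OF z x(1) that] S(1) by linarith
    obtain l0 where l0: "dot l0 x = 1" by (rule exists_functional[OF x(2)])
    have th: "n2 (rst S P T (theta x (pr m f))) \<le> (3 * ?q ^ m) ^ k * c" if "m \<le> r" for m
      by (rule n2_rst_theta[OF x(2) z]) (intro Suc.IH upd level_bound_mono[OF f that])
    have ct: "n2 (rst S P T (fproj {B. rk B = r \<and> x \<in> ran B} f)) \<le> (3 * ?q ^ r) ^ k * c * (2 * ?q ^ r - 1)"
    proof (cases r)
      case 0
      have "fproj {B. rk B = r \<and> x \<in> ran B} f = (\<lambda>A. 0)"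
      proof (rule fc_inject[OF ext])
        fix B :: "'a^'n^'n"
        have "\<not> (rk B = r \<and> x \<in> ran B)" using 0 x(2) by (auto simp: rk_eq_0 ran_def)
        then show "fc (fproj {B. rk B = r \<and> x \<in> ran B} f) B = fc (\<lambda>A. 0) B"
          by (simp only: fc_fproj fc_zero mem_Collect_eq if_False)
      qed
      then show ?thesis using 0 c0 by (simp add: rst_def n2_def sq_def)
    next
      case (Suc r')
      define p :: "'a^'n^'n" where "p = mat 1 - outer x l0"
      note pp = line_projection[OF l0, folded p_def]
      let ?P = "P + outer z l0"
      have red: "rst S P T g = rst S ?P 0 (rst (mat 1) p T g)" for g :: "'a^'n^'n \<Rightarrow> complex"
        unfolding rst_rst by (simp add: pp(2)[OF x(1)])
      let ?f1 = "rst (mat 1) p T f"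
      have "vec.dim (kern p) = 1"
      proof -
        have K': "kern p = vec.span {x}" unfolding pp(1) vec.span_singleton by auto
        show ?thesis unfolding K' using x(2) by (simp add: vec.dim_eq_card_independent)
      qed
      then have "CARD('a) ^ corank p = CARD('a) ^ 1"
        using card_kern[of p] card_subspace[OF subspace_kern, of p] by simp
      then have cp: "corank p = 1" by (rule power_inject_exp[THEN iffD1, rotated]) simp
      \<comment> \<open>One unit of the budget r pays for the corank of p.\<close>
      have f1: "level_bound r' c ?f1"
        by (rule level_bound_rst) (use f in \<open>simp add: Suc cp\<close>)
      have 1: "n2 (rst S ?P 0 (pr r' ?f1)) \<le> (3 * ?q ^ r') ^ k * c"
        by (rule Suc.IH[OF upd[OF l0] f1])
      have 2: "n2 (rst S P T (theta x (pr r' f))) \<le> (3 * ?q ^ r') ^ k * c"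
        by (rule th) (simp add: Suc)
      have "rst S P T (fproj {B. rk B = r \<and> x \<in> ran B} f) = rst S ?P 0 (rst (mat 1) p T (fproj {B. rk B = r \<and> x \<in> ran B} f))"
        by (rule red)
      also have "rst (mat 1) p T (fproj {B. rk B = r \<and> x \<in> ran B} f) = (\<lambda>A. pr r' ?f1 A - of_nat CARD('a) ^ r' * rst (mat 1) p T (theta x (pr r' f)) A)"
        unfolding Suc by (rule rst_pr_contains[OF pp(1) x(2)])
      also have "rst S ?P 0 (\<lambda>A. pr r' ?f1 A - of_nat CARD('a) ^ r' * rst (mat 1) p T (theta x (pr r' f)) A)
          = (\<lambda>A. rst S ?P 0 (pr r' ?f1) A - of_nat CARD('a) ^ r' * rst S ?P 0 (rst (mat 1) p T (theta x (pr r' f))) A)"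
        by (simp only: rst_def[of S ?P])
      finally have "rst S P T (fproj {B. rk B = r \<and> x \<in> ran B} f) = (\<lambda>A. rst S ?P 0 (pr r' ?f1) A - of_nat CARD('a) ^ r' * rst S P T (theta x (pr r' f)) A)"
        unfolding red[of "theta x (pr r' f)", symmetric] .
      then have "n2 (rst S P T (fproj {B. rk B = r \<and> x \<in> ran B} f)) \<le> n2 (rst S ?P 0 (pr r' ?f1)) + cmod (of_nat CARD('a) ^ r') * n2 (rst S P T (theta x (pr r' f)))"
        using n2_diff[of "rst S ?P 0 (pr r' ?f1)" "\<lambda>A. of_nat CARD('a) ^ r' * rst S P T (theta x (pr r' f)) A"] by (simp only: n2_cmult)
      also have "cmod (of_nat CARD('a) ^ r') = ?q ^ r'" by (simp add: norm_power)
      also have "n2 (rst S ?P 0 (pr r' ?f1)) + ?q ^ r' * n2 (rst S P T (theta x (pr r' f))) \<le> (3 * ?q ^ r') ^ k * c + ?q ^ r' * ((3 * ?q ^ r') ^ k * c)"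
        by (intro add_mono 1 mult_left_mono 2) simp
      also have "\<dots> = (3 * ?q ^ r') ^ k * (c * (1 + ?q ^ r'))" by (simp add: algebra_simps)
      also have "\<dots> \<le> (3 * ?q ^ r) ^ k * (c * (2 * ?q ^ r - 1))"
      proof (rule mult_mono)
        have le: "?q ^ r' \<le> ?q ^ r" by (rule power_increasing[OF _ q1]) (simp add: Suc)
        then show "(3 * ?q ^ r') ^ k \<le> (3 * ?q ^ r) ^ k" by (intro power_mono) simp_all
        have "2 * ?q ^ r' \<le> ?q * ?q ^ r'" by (rule mult_right_mono[OF q2]) simp
        then have "2 * ?q ^ r' \<le> ?q ^ r" by (simp add: Suc)
        then have "1 + ?q ^ r' \<le> 2 * ?q ^ r - 1" using qr[of r'] by linarith
        then show "c * (1 + ?q ^ r') \<le> c * (2 * ?q ^ r - 1)" by (rule mult_left_mono[OF _ c0])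
        show "0 \<le> c * (1 + ?q ^ r')" by (rule mult_nonneg_nonneg[OF c0]) simp
      qed simp
      finally show ?thesis by (simp only: mult.assoc)
    qed
    have "fproj {B. x \<in> ran B} (pr r f) = fproj {B. rk B = r \<and> x \<in> ran B} f"
      unfolding fproj_fproj by (rule arg_cong[of _ _ "\<lambda>X. fproj X f"]) auto
    from this[symmetric] have "pr r f = (\<lambda>A. fproj {B. rk B = r \<and> x \<in> ran B} f A + of_nat CARD('a) ^ r * theta x (pr r f) A)"
      unfolding fproj_contains[OF pure_pr x(2)] by (simp add: fun_eq_iff)
    then have "rst S P T (pr r f) = (\<lambda>A. rst S P T (fproj {B. rk B = r \<and> x \<in> ran B} f) A + of_nat CARD('a) ^ r * rst S P T (theta x (pr r f)) A)"
      unfolding rst_def by (simp only: fun_eq_iff) blast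
    then have "n2 (rst S P T (pr r f)) \<le> n2 (rst S P T (fproj {B. rk B = r \<and> x \<in> ran B} f)) + cmod (of_nat CARD('a) ^ r) * n2 (rst S P T (theta x (pr r f)))"
      using n2_triangle[of "rst S P T (fproj {B. rk B = r \<and> x \<in> ran B} f)" "\<lambda>A. of_nat CARD('a) ^ r * rst S P T (theta x (pr r f)) A"] by (simp only: n2_cmult)
    also have "cmod (of_nat CARD('a) ^ r) = ?q ^ r" by (simp add: norm_power)
    also have "n2 (rst S P T (fproj {B. rk B = r \<and> x \<in> ran B} f)) + ?q ^ r * n2 (rst S P T (theta x (pr r f)))
        \<le> (3 * ?q ^ r) ^ k * c * (2 * ?q ^ r - 1) + ?q ^ r * ((3 * ?q ^ r) ^ k * c)"
      by (intro add_mono ct mult_left_mono th) simp_all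
    also have "\<dots> = (3 * ?q ^ r) ^ k * c * (3 * ?q ^ r - 1)" by (simp add: algebra_simps)
    also have "\<dots> \<le> (3 * ?q ^ r) ^ k * c * (3 * ?q ^ r)"
      by (rule mult_left_mono) (use c0 in simp_all)
    finally show ?thesis by (simp add: mult_ac)
  qed
  show ?case
  proof (cases "corank P = 0")
    case False
    then show ?thesis by (rule main[OF Suc.prems(1) _ Suc.prems(2)])
  next
    case True
    show ?thesis
    proof (cases "corank S = 0")
      case S: True
      have "n2 (rst S P T (pr r f)) \<le> (3 * ?q ^ r) ^ k * c"
        by (rule Suc.IH[OF _ Suc.prems(2)]) (simp add: True S)
      also have "\<dots> \<le> (3 * ?q ^ r) ^ Suc k * c"
        by (rule mult_right_mono[OF power_increasing c0]) (use qr[of r] in linarith)+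
      finally show ?thesis .
    next
      case False
      have "n2 (rst (transpose P) (transpose S) (transpose T) (pr r (\<lambda>A. f (transpose A)))) \<le> (3 * ?q ^ r) ^ Suc k * c"
        by (rule main[OF _ _ level_bound_transpose[OF Suc.prems(2)]]) (use False Suc.prems(1) in \<open>simp_all add: corank_transpose add.commute\<close>)
      then show ?thesis unfolding pr_transpose rst_transpose n2_transpose by simp
    qed
  qed
qed

lemma glob_pr:
  fixes f :: "'a::{field,finite}^'n^'n \<Rightarrow> complex"
  assumes "level_bound r c f"
  shows "glob k ((3 * real CARD('a) ^ r) ^ k * c) (pr r f)"
  unfolding glob_def using n2_rst_pr[OF _ assms] by blast

section \<open>The level inequality on the space of all matrices\<close>

lemma power_sum_le_card:
  fixes y :: "'i \<Rightarrow> real"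
  assumes "\<And>i. i \<in> I \<Longrightarrow> 0 \<le> y i"
  shows "(\<Sum>i\<in>I. y i) ^ (2 ^ m) \<le> real (card I) ^ (2 ^ m - 1) * (\<Sum>i\<in>I. y i ^ (2 ^ m))"
proof (induction m)
  case 0
  show ?case by simp
next
  case (Suc m)
  let ?N = "real (card I)"
  have e: "(2::nat) ^ Suc m = 2 ^ m * 2" by simp
  have e2: "(2 ^ m - 1) * 2 + 1 = (2::nat) ^ Suc m - 1"
  proof -
    have "1 \<le> (2::nat) ^ m" by simp
    then show ?thesis unfolding e by linarith
  qed
  have "(\<Sum>i\<in>I. y i) ^ (2 ^ Suc m) = ((\<Sum>i\<in>I. y i) ^ (2 ^ m))\<^sup>2"
    unfolding e by (rule power_mult)
  also have "\<dots> \<le> (?N ^ (2 ^ m - 1) * (\<Sum>i\<in>I. y i ^ (2 ^ m)))\<^sup>2"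
    by (rule power_mono[OF Suc.IH]) (intro zero_le_power sum_nonneg assms)
  also have "\<dots> = ?N ^ ((2 ^ m - 1) * 2) * (\<Sum>i\<in>I. y i ^ (2 ^ m))\<^sup>2"
    by (simp only: power_mult_distrib power_mult)
  also have "\<dots> \<le> ?N ^ ((2 ^ m - 1) * 2) * (?N * (\<Sum>i\<in>I. (y i ^ (2 ^ m))\<^sup>2))"
    by (rule mult_left_mono[OF cauchy_schwarz_card]) simp
  also have "\<dots> = ?N ^ ((2 ^ m - 1) * 2 + 1) * (\<Sum>i\<in>I. (y i ^ (2 ^ m))\<^sup>2)"
    by (simp only: power_add power_one_right mult.assoc)
  finally show ?case unfolding e2 unfolding e power_mult .
qed

text \<open>Hoelder's inequality on the support of f. The exponents are dyadic, so it follows by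
  iterating Cauchy-Schwarz.\<close>

lemma mean_indicator_power_le:
  fixes f :: "'x::finite \<Rightarrow> complex"
  assumes f: "\<And>A. f A \<in> {0, 1}"
  shows "EE (\<lambda>A. cmod (f A) * cmod (h A)) ^ (2 ^ m) \<le> EE (\<lambda>A. cmod (f A)) ^ (2 ^ m - 1) * EE (\<lambda>A. cmod (h A) ^ (2 ^ m))"
proof -
  define I where "I = {A. f A = 1}"
  let ?N = "real CARD('x)" and ?p = "(2::nat) ^ m"
  have N: "0 < ?N" by simp
  have p: "?p = (?p - 1) + 1" by simp
  have f0: "f A = 0" if "A \<notin> I" for A using f[of A] that by (auto simp: I_def)
  have f1: "f A = 1" if "A \<in> I" for A using that by (simp add: I_def)
  have s1: "(\<Sum>A\<in>UNIV. cmod (f A) * cmod (h A)) = (\<Sum>A\<in>I. cmod (h A))"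
    by (rule sum.mono_neutral_cong_right) (auto simp: f0 f1)
  have "(\<Sum>A\<in>UNIV. cmod (f A)) = (\<Sum>A\<in>I. 1)"
    by (rule sum.mono_neutral_cong_right) (auto simp: f0 f1)
  then have s2: "EE (\<lambda>A. cmod (f A)) = real (card I) / ?N" by (simp add: mean_def)
  have "EE (\<lambda>A. cmod (f A) * cmod (h A)) ^ ?p = (\<Sum>A\<in>I. cmod (h A)) ^ ?p / ?N ^ ?p"
    unfolding mean_def s1 by (rule power_divide)
  also have "\<dots> \<le> (real (card I) ^ (?p - 1) * (\<Sum>A\<in>I. cmod (h A) ^ ?p)) / ?N ^ ?p"
    by (rule divide_right_mono[OF power_sum_le_card]) simp_all
  also have "\<dots> \<le> (real (card I) ^ (?p - 1) * (\<Sum>A\<in>UNIV. cmod (h A) ^ ?p)) / ?N ^ ?p"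
    by (intro divide_right_mono mult_left_mono sum_mono2) simp_all
  also have "\<dots> = (real (card I) / ?N) ^ (?p - 1) * ((\<Sum>A\<in>UNIV. cmod (h A) ^ ?p) / ?N)"
  proof -
    have "?N ^ ?p = ?N ^ (?p - 1) * ?N" by (subst p) (simp only: power_add power_one_right)
    then show ?thesis by (simp only: power_divide times_divide_times_eq)
  qed
  finally show ?thesis unfolding s2 by (simp only: mean_def)
qed

text \<open>By orthogonality one of the two factors in the squared norm of the projection may be
  replaced by f.\<close>

lemma sq_fproj_le_mean:
  "sq (fproj X f) \<le> EE (\<lambda>A. cmod (f A) * cmod (fproj X f A))"
proof -
  have "complex_of_real (sq (fproj X f)) = (\<Sum>B\<in>UNIV. fc (fproj X f) B * cnj (fc (fproj X f) B))"
    unfolding sq_complex parseval_inner ..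
  also have "\<dots> = (\<Sum>B\<in>UNIV. fc f B * cnj (fc (fproj X f) B))"
    by (rule sum.cong) (auto simp: fc_fproj)
  also have "\<dots> = EE (\<lambda>A. f A * cnj (fproj X f A))" by (rule parseval_inner)
  finally have eq: "complex_of_real (sq (fproj X f)) = EE (\<lambda>A. f A * cnj (fproj X f A))" .
  have "sq (fproj X f) = cmod (complex_of_real (sq (fproj X f)))" by simp
  also have "\<dots> = cmod (\<Sum>A\<in>UNIV. f A * cnj (fproj X f A)) / real (card (UNIV :: ('a^'b^'b) set))"
    unfolding eq by (simp only: mean_def norm_divide norm_of_nat)
  also have "\<dots> \<le> (\<Sum>A\<in>UNIV. cmod (f A) * cmod (fproj X f A)) / real (card (UNIV :: ('a^'b^'b) set))"
  proof (rule divide_right_mono)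
    have "cmod (\<Sum>A\<in>UNIV. f A * cnj (fproj X f A)) \<le> (\<Sum>A\<in>UNIV. cmod (f A * cnj (fproj X f A)))" by (rule norm_sum)
    then show "cmod (\<Sum>A\<in>UNIV. f A * cnj (fproj X f A)) \<le> (\<Sum>A\<in>UNIV. cmod (f A) * cmod (fproj X f A))"
      by (simp only: norm_mult complex_mod_cnj)
  qed simp
  finally show ?thesis by (simp only: mean_def)
qed

text \<open>
  Here \<open>n\<close> is the norm of a level part, \<open>m\<close> the mean of \<open>f\<close>, and \<open>c\<close> the globalness bound supplied by
  the induction on the rank.
\<close>

lemma pow_bound_arith:
  fixes n m \<epsilon> R W :: real
  assumes p: "2 \<le> p" and n: "0 < n" and m: "0 \<le> m" "m \<le> \<epsilon>" and e: "0 < \<epsilon>" and R: "0 < R" and W: "0 \<le> W" "W \<le> R ^ p * \<epsilon>"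
    and c: "c \<le> n \<or> c \<le> R * \<epsilon>" "0 \<le> c"
    and b: "(n\<^sup>2) ^ p \<le> m ^ (p - 1) * (W * c ^ (p - 2) * n\<^sup>2)"
  shows "n\<^sup>2 \<le> R\<^sup>2 * m * \<epsilon>"
proof -
  obtain k where k: "p = k + 2" using p le_Suc_ex[of 2 p] by (metis add.commute)
  have p1: "p - 1 = Suc k" and p2: "p - 2 = k" by (simp_all add: k)
  have mW: "0 \<le> m ^ Suc k * W" using m(1) W(1) by simp
  have "(n\<^sup>2) ^ p = (n\<^sup>2) ^ Suc k * n\<^sup>2" by (simp add: k)
  with b have "(n\<^sup>2) ^ Suc k * n\<^sup>2 \<le> (m ^ Suc k * (W * c ^ k)) * n\<^sup>2" unfolding p1 p2 by (simp only: mult.assoc)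
  then have b1: "(n\<^sup>2) ^ Suc k \<le> m ^ Suc k * (W * c ^ k)"
    by (rule mult_right_le_imp_le) (use n in simp)
  from c(1) show ?thesis
  proof
    assume "c \<le> n"
    then have "c ^ k \<le> n ^ k" by (rule power_mono[OF _ c(2)])
    then have "m ^ Suc k * (W * c ^ k) \<le> m ^ Suc k * (W * n ^ k)"
      by (intro mult_left_mono) (use m W in simp_all)
    with b1 have "(n\<^sup>2) ^ Suc k \<le> (m ^ Suc k * W) * n ^ k" by (simp only: mult.assoc)
    moreover have "(n\<^sup>2) ^ Suc k = n ^ p * n ^ k"
    proof -
      have "2 * Suc k = p + k" by (simp add: k)
      then show ?thesis by (simp only: power_mult[symmetric] power_add[symmetric])
    qed
    ultimately have "n ^ p * n ^ k \<le> (m ^ Suc k * W) * n ^ k" by (simp only:)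
    then have "n ^ p \<le> m ^ Suc k * W" by (rule mult_right_le_imp_le) (use n in simp)
    then have "(n ^ p)\<^sup>2 \<le> (m ^ Suc k * (R ^ p * \<epsilon>))\<^sup>2"
      by (intro power_mono order_trans[OF _ mult_left_mono[OF W(2)]]) (use m n in simp_all)
    also have "\<dots> = (R\<^sup>2) ^ p * (m ^ Suc k)\<^sup>2 * \<epsilon>\<^sup>2"
      by (simp add: power_mult_distrib power_mult[symmetric] mult.commute mult.left_commute)
    also have "(m ^ Suc k)\<^sup>2 = m ^ p * m ^ k"
    proof -
      have "Suc k * 2 = p + k" by (simp add: k)
      then show ?thesis by (simp only: power_mult[symmetric] power_add[symmetric])
    qed
    also have "(R\<^sup>2) ^ p * (m ^ p * m ^ k) * \<epsilon>\<^sup>2 \<le> (R\<^sup>2) ^ p * (m ^ p * \<epsilon> ^ k) * \<epsilon>\<^sup>2"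
      by (intro mult_right_mono mult_left_mono power_mono m) (use m in simp_all)
    also have "\<dots> = (R\<^sup>2 * m * \<epsilon>) ^ p" by (simp add: k power_mult_distrib power_add power2_eq_square mult_ac)
    finally have "(n ^ p)\<^sup>2 \<le> (R\<^sup>2 * m * \<epsilon>) ^ p" .
    then have "(n\<^sup>2) ^ p \<le> (R\<^sup>2 * m * \<epsilon>) ^ p" by (simp only: power_mult[symmetric] mult.commute)
    then show ?thesis by (rule power_mono_iff[THEN iffD1, rotated 3]) (use m e p in simp_all)
  next
    assume "c \<le> R * \<epsilon>"
    then have "c ^ k \<le> (R * \<epsilon>) ^ k" by (rule power_mono[OF _ c(2)])
    then have "W * c ^ k \<le> (R ^ p * \<epsilon>) * (R * \<epsilon>) ^ k"
      by (rule mult_mono[OF W(2)]) (use R e c in simp_all)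
    then have "m ^ Suc k * (W * c ^ k) \<le> m ^ Suc k * ((R ^ p * \<epsilon>) * (R * \<epsilon>) ^ k)"
      by (rule mult_left_mono) (use m in simp)
    with b1 have "(n\<^sup>2) ^ Suc k \<le> m ^ Suc k * ((R ^ p * \<epsilon>) * (R * \<epsilon>) ^ k)" by (rule order_trans)
    also have "\<dots> = (R\<^sup>2 * m * \<epsilon>) ^ Suc k" by (simp add: k power_mult_distrib power_add power2_eq_square mult_ac)
    finally show ?thesis by (rule power_mono_iff[THEN iffD1, rotated 3]) (use m e in simp_all)
  qed
qed

text \<open>Multiplication by invertible S and P preserves ranks, so here taking the rank part
  commutes with restriction, which only permutes the matrices.\<close>

lemma pr_rst_invertible:
  fixes f :: "'a::{field,finite}^'n^'n \<Rightarrow> complex"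
  assumes z: "corank S = 0" "corank P = 0"
  shows "n2 (pr r (rst S P T f)) \<le> n2 (pr r f)"
proof -
  have rk: "rk (P ** B ** S) = rk B" for B
  proof -
    obtain S' where S': "S ** S' = mat 1"
      using z(1) unfolding corank_eq_0_invertible invertible_def by blast
    obtain P' where P': "P' ** P = mat 1"
      using z(2) unfolding corank_eq_0_invertible invertible_def by blast
    have "P' ** (P ** B ** S) ** S' = (P' ** P) ** B ** (S ** S')" by (simp add: matrix_mul_assoc)
    then have "P' ** (P ** B ** S) ** S' = B" by (simp add: S' P')
    then have "rk B \<le> rk (P ** B ** S)"
      using rk_mult_left[of "P' ** (P ** B ** S)" S'] rk_mult_right[of P' "P ** B ** S"] by simp
    moreover have "rk (P ** B ** S) \<le> rk B" using rk_mult_left[of "P ** B" S] rk_mult_right[of P B] by linarith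
    ultimately show ?thesis by linarith
  qed
  obtain S' where S': "S ** S' = mat 1" "S' ** S = mat 1"
    using z(1) unfolding corank_eq_0_invertible invertible_def by blast
  obtain P' where P': "P ** P' = mat 1" "P' ** P = mat 1"
    using z(2) unfolding corank_eq_0_invertible invertible_def by blast
  have c1: "S ** (S' ** X ** P') ** P = X" for X
  proof -
    have "S ** (S' ** X ** P') ** P = (S ** S') ** X ** (P' ** P)" by (simp add: matrix_mul_assoc)
    then show ?thesis by (simp add: S' P')
  qed
  have c2: "S' ** (S ** X ** P) ** P' = X" for X
  proof -
    have "S' ** (S ** X ** P) ** P' = (S' ** S) ** X ** (P ** P')" by (simp add: matrix_mul_assoc)
    then show ?thesis by (simp add: S' P')
  qed
  have bij: "bij (\<lambda>A. T + S ** A ** P)"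
    by (rule bij_betw_byWitness[where f' = "\<lambda>A. S' ** (A - T) ** P'"]) (auto simp: c1 c2)
  have "pr r (rst S P T f) = rst S P T (pr r f)" by (simp add: fproj_rst rk)
  then have "sq (pr r (rst S P T f)) = sq (pr r f)"
    unfolding sq_def rst_def using mean_bij[OF bij, of "\<lambda>A. (cmod (pr r f A))\<^sup>2"] by simp
  then show ?thesis by (simp add: n2_def)
qed

text \<open>Let n be the unknown norm of the rank-r part. For a restriction and a rank k within the
  budget, either k < r and the induction hypothesis, with e lowered by the corank, gives R
  \<epsilon>, or the restriction is invertible and the norm is at most n. So
  \<open>level_bound\<close> holds with c = max n (R \<epsilon>). Inserting the resulting moment
  bound into Hoelder's inequality gives an estimate of n in terms of c, which
  \<open>pow_bound_arith\<close> resolves in both cases.\<close>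

lemma level_inequality:
  fixes f :: "'a::{field,finite}^'n^'n \<Rightarrow> complex"
  assumes f: "\<And>A. f A \<in> {0, 1}"
    and g: "\<And>S P T. corank S + corank P \<le> e \<Longrightarrow> EE (\<lambda>A. cmod (rst S P T f A)) \<le> \<epsilon>"
    and r: "r \<le> e" "e \<le> d" and e: "0 < \<epsilon>" and R: "0 < R"
    and RW: "real CARD('a) ^ (9 * (2 ^ (j + 1))\<^sup>2 * d\<^sup>2) \<le> R ^ (2 ^ (j + 1)) * \<epsilon>" and d: "1 \<le> d"
  shows "sq (pr r f) \<le> R\<^sup>2 * EE (\<lambda>A. cmod (f A)) * \<epsilon>"
  using f g r
proof (induction r arbitrary: f e rule: less_induct)
  case (less r)
  let ?q = "real CARD('a)" and ?p = "(2::nat) ^ (j + 1)"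
  have q2: "2 \<le> ?q" using card_field_ge_2[where 'a='a] by linarith
  then have q1: "1 \<le> ?q" by linarith
  define n where "n = n2 (pr r f)"
  define m where "m = EE (\<lambda>A. cmod (f A))"
  have nsq: "n\<^sup>2 = sq (pr r f)" unfolding n_def by (rule n2_squared)
  have m0: "0 \<le> m" unfolding m_def by (rule mean_nonneg) simp
  have mean_le: "EE (\<lambda>A. cmod (f A)) \<le> \<epsilon>"
    using less.prems(2)[of "mat 1" "mat 1" 0] by simp
  show ?case
  proof (cases "n = 0")
    case True
    then show ?thesis using nsq m0 e R by (simp add: m_def[symmetric])
  next
    case False
    then have n0: "0 < n" using n2_nonneg[of "pr r f"] unfolding n_def by linarith
    define c where "c = max n (R * \<epsilon>)"
    have lb: "level_bound r c f"
      unfolding level_bound_def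
    proof (intro allI impI)
      fix S P T :: "'a^'n^'n" and k assume sk: "corank S + corank P + k \<le> r"
      show "n2 (pr k (rst S P T f)) \<le> c"
      proof (cases "k < r")
        case True
        have "sq (pr k (rst S P T f)) \<le> R\<^sup>2 * EE (\<lambda>A. cmod (rst S P T f A)) * \<epsilon>"
        proof (rule less.IH[OF True])
          show "rst S P T f A \<in> {0, 1}" for A unfolding rst_def by (rule less.prems(1))
          show "k \<le> e - (corank S + corank P)" using sk less.prems(3) by linarith
          show "e - (corank S + corank P) \<le> d" using less.prems(4) by linarith
          fix S' P' T' :: "'a^'n^'n" assume "corank S' + corank P' \<le> e - (corank S + corank P)"
          then have "corank (S ** S') + corank (P' ** P) \<le> e"
            using corank_mult[of S S'] corank_mult[of P' P] sk less.prems(3) by linarith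
          then show "EE (\<lambda>A. cmod (rst S' P' T' (rst S P T f) A)) \<le> \<epsilon>"
            unfolding rst_rst by (rule less.prems(2))
        qed
        also have "\<dots> \<le> R\<^sup>2 * \<epsilon> * \<epsilon>"
          by (intro mult_right_mono mult_left_mono less.prems(2)) (use sk less.prems(3) e in simp_all)
        also have "\<dots> = (R * \<epsilon>)\<^sup>2" by (simp add: power2_eq_square)
        finally have "n2 (pr k (rst S P T f)) \<le> R * \<epsilon>"
          unfolding n2_def using R e by (simp add: real_le_lsqrt)
        then show ?thesis unfolding c_def by linarith
      next
        case False
        then have "corank S = 0" "corank P = 0" "k = r" using sk by linarith+
        then have "n2 (pr k (rst S P T f)) \<le> n" unfolding n_def using pr_rst_invertible by simp
        then show ?thesis unfolding c_def by linarith
      qed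
    qed
    have c0: "0 \<le> c" unfolding c_def using n0 by linarith
    \<comment> \<open>The order of globalness that \<open>moment_bound\<close> demands;
      \<open>glob_pr\<close> supplies it at the price (3 q^r)^K.\<close>
    define K where "K = (2 ^ j - 1) * r"
    define C where "C = (3 * ?q ^ r) ^ K * c"
    have rd: "r \<le> d" using less.prems(3,4) by linarith
    have "glob K C (pr r f)" unfolding C_def by (rule glob_pr[OF lb])
    moreover have "deg_le r (pr r f)" by (auto simp: deg_le_def fc_fproj)
    ultimately have mb: "EE (\<lambda>A. cmod (pr r f A) ^ ?p) \<le> ?q ^ (24 * 4 ^ j * r\<^sup>2) * C ^ (?p - 2) * sq (pr r f)"
      unfolding K_def by (intro moment_bound)
    \<comment> \<open>With p = 2^(j+1) the moment bound contributes 24 * 4^j r^2 = 6 p^2 r^2. As 3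
      q^r <= q^(3 d) and K <= p d, the loss of globalness contributes at most 3 p^2 d^2.\<close>
    have W: "?q ^ (24 * 4 ^ j * r\<^sup>2) * C ^ (?p - 2) \<le> ?q ^ (9 * ?p\<^sup>2 * d\<^sup>2) * c ^ (?p - 2)"
    proof -
      have "3 * ?q ^ r \<le> ?q ^ (3 * d)"
      proof -
        have "(3::real) \<le> 2 ^ 2" by simp
        also have "\<dots> \<le> ?q ^ 2" by (rule power_mono[OF q2]) simp
        finally have "3 * ?q ^ r \<le> ?q ^ 2 * ?q ^ r" by (rule mult_right_mono) simp
        also have "\<dots> = ?q ^ (2 + r)" by (simp only: power_add)
        also have "\<dots> \<le> ?q ^ (3 * d)" by (rule power_increasing[OF _ q1]) (use rd d in linarith)
        finally show ?thesis .
      qed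
      then have "((3 * ?q ^ r) ^ K) ^ (?p - 2) \<le> ((?q ^ (3 * d)) ^ K) ^ (?p - 2)" by (intro power_mono) simp_all
      also have "\<dots> = ?q ^ (3 * d * K * (?p - 2))" by (simp only: power_mult)
      finally have a: "((3 * ?q ^ r) ^ K) ^ (?p - 2) \<le> ?q ^ (3 * d * K * (?p - 2))" .
      have p4: "?p\<^sup>2 = 4 * 4 ^ j"
      proof -
        have "?p\<^sup>2 = 4 * (2 ^ j * 2 ^ j)" by (simp add: power2_eq_square)
        also have "(2::nat) ^ j * 2 ^ j = 4 ^ j" unfolding power_mult_distrib[symmetric] by simp
        finally show ?thesis .
      qed
      have Kd: "K \<le> ?p * d"
        unfolding K_def by (rule mult_le_mono[OF _ rd]) simp
      have "3 * d * K * (?p - 2) \<le> 3 * d * (?p * d) * ?p"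
        by (intro mult_le_mono Kd order_refl diff_le_self)
      also have "\<dots> = 3 * ?p\<^sup>2 * d\<^sup>2" by (simp only: power2_eq_square mult_ac)
      finally have e1: "3 * d * K * (?p - 2) \<le> 3 * ?p\<^sup>2 * d\<^sup>2" .
      have "24 * 4 ^ j * r\<^sup>2 = 6 * ?p\<^sup>2 * r\<^sup>2" unfolding p4 by simp
      also have "\<dots> \<le> 6 * ?p\<^sup>2 * d\<^sup>2" by (intro mult_le_mono order_refl power_mono rd) simp
      finally have e2: "24 * 4 ^ j * r\<^sup>2 \<le> 6 * ?p\<^sup>2 * d\<^sup>2" .
      have e3: "6 * ?p\<^sup>2 * d\<^sup>2 + 3 * ?p\<^sup>2 * d\<^sup>2 = 9 * ?p\<^sup>2 * d\<^sup>2" by (simp only: distrib_right[symmetric]) simp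
      have "?q ^ (24 * 4 ^ j * r\<^sup>2) * ((3 * ?q ^ r) ^ K) ^ (?p - 2) \<le> ?q ^ (24 * 4 ^ j * r\<^sup>2) * ?q ^ (3 * d * K * (?p - 2))"
        by (rule mult_left_mono[OF a]) simp
      also have "\<dots> = ?q ^ (24 * 4 ^ j * r\<^sup>2 + 3 * d * K * (?p - 2))" by (simp only: power_add)
      also have "\<dots> \<le> ?q ^ (9 * ?p\<^sup>2 * d\<^sup>2)"
        by (rule power_increasing[OF _ q1]) (use e1 e2 e3 in linarith)
      finally have "?q ^ (24 * 4 ^ j * r\<^sup>2) * ((3 * ?q ^ r) ^ K) ^ (?p - 2) * c ^ (?p - 2) \<le> ?q ^ (9 * ?p\<^sup>2 * d\<^sup>2) * c ^ (?p - 2)"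
        by (rule mult_right_mono) (use c0 in simp)
      then show ?thesis unfolding C_def power_mult_distrib[of _ c] by (simp only: mult.assoc)
    qed
    have p2: "2 \<le> ?p" by simp
    have "(n\<^sup>2) ^ ?p \<le> EE (\<lambda>A. cmod (f A) * cmod (pr r f A)) ^ ?p"
      unfolding nsq by (rule power_mono[OF sq_fproj_le_mean]) simp
    also have "\<dots> \<le> m ^ (?p - 1) * EE (\<lambda>A. cmod (pr r f A) ^ ?p)"
      unfolding m_def by (rule mean_indicator_power_le[OF less.prems(1)])
    also have "\<dots> \<le> m ^ (?p - 1) * (?q ^ (9 * ?p\<^sup>2 * d\<^sup>2) * c ^ (?p - 2) * n\<^sup>2)"
      unfolding nsq by (rule mult_left_mono[OF order_trans[OF mb mult_right_mono[OF W]]]) (use m0 in simp_all)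
    finally have b: "(n\<^sup>2) ^ ?p \<le> m ^ (?p - 1) * (?q ^ (9 * ?p\<^sup>2 * d\<^sup>2) * c ^ (?p - 2) * n\<^sup>2)" .
    have "n\<^sup>2 \<le> R\<^sup>2 * m * \<epsilon>"
      by (rule pow_bound_arith[OF p2 n0 m0 mean_le[folded m_def] e R _ RW _ c0 b]) (auto simp: c_def)
    then show ?thesis unfolding nsq m_def .
  qed
qed

section \<open>Orthogonal projections\<close>

definition ip :: "'x set \<Rightarrow> ('x \<Rightarrow> complex) \<Rightarrow> ('x \<Rightarrow> complex) \<Rightarrow> complex" where
  "ip X f h = (\<Sum>x\<in>X. f x * cnj (h x))"

lemma ip_add_left: "ip X (f + g) h = ip X f h + ip X g h"
  by (simp add: ip_def distrib_right sum.distrib)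

lemma ip_add_right: "ip X f (g + h) = ip X f g + ip X f h"
  by (simp add: ip_def distrib_left sum.distrib)

lemma ip_diff_left: "ip X (f - g) h = ip X f h - ip X g h"
  by (simp add: ip_def left_diff_distrib sum_subtractf)

lemma ip_scale_left: "ip X (fscale c f) h = c * ip X f h"
  by (simp add: ip_def fscale_def sum_distrib_left mult.assoc)

lemma ip_scale_right: "ip X f (fscale c h) = cnj c * ip X f h"
  by (simp add: ip_def fscale_def sum_distrib_left mult_ac)

lemma ip_zero_right [simp]: "ip X f 0 = 0"
  by (simp add: ip_def)

lemma ip_commute: "ip X f h = cnj (ip X h f)"
  by (simp add: ip_def mult.commute)

lemma ip_self: "ip X f f = of_real (\<Sum>x\<in>X. (cmod (f x))\<^sup>2)"
  by (simp add: ip_def complex_norm_square flip: of_real_power)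

lemma ip_self_eq_0:
  assumes "finite X"
  shows "ip X f f = 0 \<longleftrightarrow> (\<forall>x\<in>X. f x = 0)"
proof -
  have "ip X f f = 0 \<longleftrightarrow> (\<Sum>x\<in>X. (cmod (f x))\<^sup>2) = 0" unfolding ip_self by (simp only: of_real_eq_0_iff)
  also have "\<dots> \<longleftrightarrow> (\<forall>x\<in>X. f x = 0)" using assms by (subst sum_nonneg_eq_0_iff) auto
  finally show ?thesis .
qed

lemma ip_span_zero:
  assumes "\<And>b. b \<in> B \<Longrightarrow> ip X v b = 0" and "u \<in> fun_space.span B"
  shows "ip X v u = 0"
proof -
  have "fun_space.subspace {u. ip X v u = 0}"
    by (rule fun_space.subspaceI) (simp_all add: ip_add_right ip_scale_right)
  then have "fun_space.span B \<subseteq> {u. ip X v u = 0}"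
    by (rule fun_space.span_minimal[rotated]) (use assms(1) in blast)
  then show ?thesis using assms(2) by blast
qed

text \<open>Gram-Schmidt. Functions may differ outside X, so the form is only semidefinite; a new
  direction c with zero norm vanishes on X, and then every inner product with it is zero
  anyway.\<close>

lemma exists_projection_span:
  assumes X: "finite X" and B: "finite B"
  shows "\<exists>w\<in>fun_space.span B. \<forall>b\<in>B. ip X (v - w) b = 0"
  using B
proof (induction B arbitrary: v rule: finite_induct)
  case empty
  show ?case by (simp add: fun_space.span_empty)
next
  case (insert b B)
  obtain p where p: "p \<in> fun_space.span B" "\<forall>b'\<in>B. ip X (b - p) b' = 0" using insert.IH by blast
  obtain w where w: "w \<in> fun_space.span B" "\<forall>b'\<in>B. ip X (v - w) b' = 0" using insert.IH by blast
  define c where "c = b - p"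
  define \<alpha> where "\<alpha> = ip X (v - w) c / ip X c c"
  define w' where "w' = w + fscale \<alpha> c"
  have sub: "fun_space.span B \<subseteq> fun_space.span (insert b B)" by (rule fun_space.span_mono) blast
  have c: "c \<in> fun_space.span (insert b B)"
    unfolding c_def by (rule fun_space.span_diff[OF fun_space.span_base subsetD[OF sub p(1)]]) simp
  have w': "w' \<in> fun_space.span (insert b B)"
    unfolding w'_def by (rule fun_space.span_add[OF subsetD[OF sub w(1)] fun_space.span_scale[OF c]])
  have e: "ip X (v - w') h = ip X (v - w) h - \<alpha> * ip X c h" for h
    unfolding w'_def by (simp only: ip_diff_left ip_add_left ip_scale_left) simp
  have B0: "ip X (v - w') b' = 0" if "b' \<in> B" for b'
    unfolding e using that w(2) p(2) by (simp add: c_def)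
  have c0: "ip X (v - w') c = 0"
  proof (cases "ip X c c = 0")
    case True
    then have "\<forall>x\<in>X. c x = 0" using ip_self_eq_0[OF X] by blast
    then show ?thesis by (simp add: ip_def)
  next
    case False
    then show ?thesis unfolding e \<alpha>_def by simp
  qed
  have "b = c + p" by (simp add: c_def)
  then have "ip X (v - w') b = ip X (v - w') c + ip X (v - w') p" by (simp only: ip_add_right)
  also have "\<dots> = 0" unfolding c0 using ip_span_zero[OF B0 p(1)] by simp
  finally show ?case using w' B0 by blast
qed

lemma exists_projection_finite_dim:
  assumes X: "finite X" and L: "fun_space.subspace L" and D: "finite D" "L \<subseteq> fun_space.span D"
  shows "\<exists>w\<in>L. \<forall>u\<in>L. ip X (v - w) u = 0"
proof -
  obtain B where B: "B \<subseteq> L" "fun_space.independent B" "L \<subseteq> fun_space.span B" "card B = fun_space.dim L"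
    by (rule fun_space.basis_exists[of L])
  have "finite B" using fun_space.independent_span_bound[OF D(1) B(2)] B(1) D(2) by blast
  from exists_projection_span[OF X this, of v] obtain w where w: "w \<in> fun_space.span B" "\<forall>b\<in>B. ip X (v - w) b = 0"
    by auto
  have "w \<in> L" using fun_space.span_minimal[OF B(1) L] w(1) by blast
  moreover have "ip X (v - w) u = 0" if "u \<in> L" for u
    by (rule ip_span_zero[of B]) (use w(2) B(3) that in auto)
  ultimately show ?thesis by blast
qed

lemma exists_projection_subspace:
  fixes v :: "'x::finite \<Rightarrow> complex"
  assumes L: "fun_space.subspace L"
  shows "\<exists>w\<in>L. \<forall>u\<in>L. ip X (v - w) u = 0"
proof (rule exists_projection_finite_dim[OF _ L])
  let ?D = "range (\<lambda>y :: 'x. indicator {y} :: 'x \<Rightarrow> complex)"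
  show "L \<subseteq> fun_space.span ?D"
  proof
    fix u :: "'x \<Rightarrow> complex"
    show "u \<in> fun_space.span ?D"
      by (subst fun_space_point_masses) (intro fun_space.span_sum fun_space.span_scale fun_space.span_base rangeI)
  qed
qed simp_all

text \<open>X may be a finite part of an infinite type, such as the tuples among the lists, so the
  spanning point masses are those at elements of X.\<close>

lemma exists_projection_L2:
  assumes X: "finite X" and L: "fun_space.subspace L" "L \<subseteq> L2 X"
  shows "\<exists>w\<in>L. \<forall>u\<in>L. ip X (v - w) u = 0"
proof (rule exists_projection_finite_dim[OF X L(1)])
  let ?D = "(\<lambda>y. indicator {y}) ` X"
  show "finite ?D" using X by simp
  show "L \<subseteq> fun_space.span ?D"
  proof
    fix u assume "u \<in> L"
    then have u: "u x = 0" if "x \<notin> X" for x using L(2) that by (auto simp: L2_def)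
    have "u = (\<Sum>y\<in>X. fscale (u y) (indicator {y}))"
    proof
      fix x
      have "(\<Sum>y\<in>X. fscale (u y) (indicator {y})) x = (\<Sum>y\<in>X. if y = x then u x else 0)"
        unfolding sum_fun_apply fscale_def by (rule sum.cong) (auto simp: indicator_def)
      then show "u x = (\<Sum>y\<in>X. fscale (u y) (indicator {y})) x" using u[of x] X by simp
    qed
    moreover have "(\<Sum>y\<in>X. fscale (u y) (indicator {y})) \<in> fun_space.span ?D"
      by (intro fun_space.span_sum fun_space.span_scale fun_space.span_base imageI)
    ultimately show "u \<in> fun_space.span ?D" by simp
  qed
qed

lemma L2_inner_ip: "L2_inner X f h = ip X f h / of_nat (card X)"
  by (simp add: L2_inner_def mean_def ip_def)

text \<open>The description in \<open>orth_proj\<close> is unique: two candidates differ by an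
  element of L that is orthogonal to itself, hence zero on X, and elements of L vanish outside
  X.\<close>

lemma orth_proj_props:
  fixes f :: "'x::finite \<Rightarrow> complex"
  assumes X: "X \<noteq> {}" and L: "fun_space.subspace L" "L \<subseteq> L2 X"
  shows "orth_proj X L f \<in> L" "u \<in> L \<Longrightarrow> ip X (f - orth_proj X L f) u = 0"
proof -
  have cX: "(of_nat (card X) :: complex) \<noteq> 0" using X by simp
  have inner: "L2_inner X h u = 0 \<longleftrightarrow> ip X h u = 0" for h u
    unfolding L2_inner_ip using cX by simp
  obtain w where w: "w \<in> L" "\<forall>u\<in>L. ip X (f - w) u = 0"
    using exists_projection_subspace[OF L(1)] by blast
  have uniq: "h = w" if h: "h \<in> L" "\<forall>u\<in>L. ip X (f - h) u = 0" for h
  proof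
    fix x
    have hw: "h - w \<in> L" by (rule fun_space.subspace_diff[OF L(1) h(1) w(1)])
    have "h - w = (f - w) - (f - h)" by simp
    then have "ip X (h - w) (h - w) = ip X (f - w) (h - w) - ip X (f - h) (h - w)" by (simp only: ip_diff_left)
    then have "ip X (h - w) (h - w) = 0" using h(2) w(2) hw by simp
    then have "\<forall>x\<in>X. (h - w) x = 0" using ip_self_eq_0[of X] by simp
    moreover have "h \<in> L2 X" "w \<in> L2 X" using h(1) w(1) L(2) by blast+
    ultimately show "h x = w x" by (cases "x \<in> X") (simp_all add: L2_def)
  qed
  have eq: "orth_proj X L f = w"
    unfolding orth_proj_def inner
  proof (rule the_equality)
    show "w \<in> L \<and> (\<forall>u\<in>L. ip X (f - w) u = 0)" using w by (rule conjI)
    show "h = w" if "h \<in> L \<and> (\<forall>u\<in>L. ip X (f - h) u = 0)" for h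
      by (rule uniq[OF conjunct1[OF that] conjunct2[OF that]])
  qed
  show "orth_proj X L f \<in> L" "u \<in> L \<Longrightarrow> ip X (f - orth_proj X L f) u = 0"
    unfolding eq using w by auto
qed

section \<open>Matrix groups acting on matrices\<close>

definition matrix_group :: "('a::{field,finite}^'n^'n) set \<Rightarrow> bool" where
  "matrix_group X \<longleftrightarrow> mat 1 \<in> X \<and> (\<forall>A\<in>X. \<forall>B\<in>X. A ** B \<in> X) \<and>
     (\<forall>A\<in>X. \<exists>B\<in>X. A ** B = mat 1 \<and> B ** A = mat 1)"

lemma matrix_group_bij_left:
  assumes X: "matrix_group X" and h: "h \<in> X" and Y: "\<And>g y. g \<in> X \<Longrightarrow> y \<in> Y \<Longrightarrow> g ** y \<in> Y"
  shows "bij_betw (\<lambda>y. h ** y) Y Y"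
proof -
  obtain h' where h': "h' \<in> X" "h ** h' = mat 1" "h' ** h = mat 1"
    using X h unfolding matrix_group_def by blast
  show ?thesis
    by (rule bij_betw_byWitness[where f' = "\<lambda>y. h' ** y"]) (use Y h h' in \<open>auto simp: matrix_mul_assoc\<close>)
qed

lemma matrix_group_bij_right:
  assumes X: "matrix_group X" and h: "h \<in> X"
  shows "bij_betw (\<lambda>y. y ** h) X X"
proof -
  obtain h' where h': "h' \<in> X" "h ** h' = mat 1" "h' ** h = mat 1"
    using X h unfolding matrix_group_def by blast
  have m: "A ** B \<in> X" if "A \<in> X" "B \<in> X" for A B using X that unfolding matrix_group_def by blast
  show ?thesis
    by (rule bij_betw_byWitness[where f' = "\<lambda>y. y ** h'"]) (use m h h' in \<open>auto simp: matrix_mul_assoc[symmetric]\<close>)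
qed

lemma matrix_group_sum_left:
  assumes X: "matrix_group X" and h: "h \<in> X"
  shows "(\<Sum>g\<in>X. F (h ** g)) = (\<Sum>g\<in>X. F g)"
  by (rule sum.reindex_bij_betw[OF matrix_group_bij_left[OF X h]]) (use X in \<open>auto simp: matrix_group_def\<close>)

lemma matrix_group_sum_right:
  assumes X: "matrix_group X" and h: "h \<in> X"
  shows "(\<Sum>g\<in>X. F (g ** h)) = (\<Sum>g\<in>X. F g)"
  by (rule sum.reindex_bij_betw[OF matrix_group_bij_right[OF X h]])

definition stab :: "('a::{field,finite}^'n^'n) set \<Rightarrow> 'a^'n^'n \<Rightarrow> ('a^'n^'n) set" where
  "stab X x = {k\<in>X. k ** x = x}"

lemma matrix_group_stab:
  assumes X: "matrix_group X"
  shows "matrix_group (stab X x)"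
proof -
  have m: "A ** B \<in> X" if "A \<in> X" "B \<in> X" for A B using X that unfolding matrix_group_def by blast
  have "\<exists>B\<in>stab X x. A ** B = mat 1 \<and> B ** A = mat 1" if A: "A \<in> stab X x" for A
  proof -
    obtain B where B: "B \<in> X" "A ** B = mat 1" "B ** A = mat 1"
      using X A unfolding matrix_group_def stab_def by blast
    have "B ** x = B ** (A ** x)" using A by (simp add: stab_def)
    also have "\<dots> = x" by (simp add: matrix_mul_assoc B(3))
    finally show ?thesis using B by (auto simp: stab_def)
  qed
  moreover have "A ** B \<in> stab X x" if "A \<in> stab X x" "B \<in> stab X x" for A B
    using that m by (simp add: stab_def matrix_mul_assoc[symmetric])
  ultimately show ?thesis using X by (auto simp: matrix_group_def stab_def)
qed

lemma coset_sum:
  assumes X: "matrix_group X" and g: "g \<in> X"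
  shows "(\<Sum>g'\<in>{g'\<in>X. g' ** x = g ** x}. F g') = (\<Sum>k\<in>stab X x. F (g ** k))"
proof -
  obtain h where h: "h \<in> X" "g ** h = mat 1" "h ** g = mat 1"
    using X g unfolding matrix_group_def by blast
  have m: "A ** B \<in> X" if "A \<in> X" "B \<in> X" for A B using X that unfolding matrix_group_def by blast
  have "bij_betw (\<lambda>k. g ** k) (stab X x) {g'\<in>X. g' ** x = g ** x}"
  proof (rule bij_betw_byWitness[where f' = "\<lambda>k. h ** k"])
    show "(\<lambda>k. h ** k) ` {g'\<in>X. g' ** x = g ** x} \<subseteq> stab X x"
    proof
      fix k assume "k \<in> (\<lambda>k. h ** k) ` {g'\<in>X. g' ** x = g ** x}"
      then obtain g' where g': "g' \<in> X" "g' ** x = g ** x" "k = h ** g'" by blast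
      have "h ** g' ** x = h ** (g ** x)" by (simp add: matrix_mul_assoc[symmetric] g'(2))
      also have "\<dots> = x" by (simp add: matrix_mul_assoc h(3))
      finally show "k \<in> stab X x" using g' h m by (simp add: stab_def)
    qed
  qed (use h g m in \<open>auto simp: stab_def matrix_mul_assoc, auto simp: matrix_mul_assoc[symmetric]\<close>)
  then show ?thesis by (rule sum.reindex_bij_betw[symmetric])
qed

lemma card_le_orbit_stab:
  fixes X \<Omega> :: "('a::{field,finite}^'n^'n) set"
  assumes X: "matrix_group X" and \<Omega>: "\<And>g x. g \<in> X \<Longrightarrow> x \<in> \<Omega> \<Longrightarrow> g ** x \<in> \<Omega>" and w: "w \<in> \<Omega>"
  shows "card X \<le> card \<Omega> * card (stab X w)"
proof -
  have "X = (\<Union>y\<in>\<Omega>. {g\<in>X. g ** w = y})" using \<Omega> w by auto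
  then have "card X = card (\<Union>y\<in>\<Omega>. {g\<in>X. g ** w = y})" by simp
  also have "\<dots> \<le> (\<Sum>y\<in>\<Omega>. card {g\<in>X. g ** w = y})" by (rule card_UN_le) simp
  also have "\<dots> \<le> (\<Sum>y\<in>\<Omega>. card (stab X w))"
  proof (rule sum_mono)
    fix y assume "y \<in> \<Omega>"
    show "card {g\<in>X. g ** w = y} \<le> card (stab X w)"
    proof (cases "\<exists>g\<in>X. g ** w = y")
      case True
      then obtain g where g: "g \<in> X" "g ** w = y" by blast
      from coset_sum[OF X g(1), where x = w and F = "\<lambda>_. 1 :: nat"] show ?thesis by (simp add: g(2))
    next
      case False
      then have "{g\<in>X. g ** w = y} = {}" by blast
      then show ?thesis by (simp only: card.empty)
    qed
  qed
  finally show ?thesis by simp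
qed

text \<open>By invariance under H the double sum is 1/|H| times the sum over x of the squared
  modulus of the sum of psi (k x) over k. All terms are nonnegative, and since H fixes w the term at
  w is |H|^2 times the squared modulus of psi w.\<close>

lemma averaging_lower_bound:
  fixes H \<Omega> :: "('a::{field,finite}^'n^'n) set" and \<psi> :: "'a^'n^'n \<Rightarrow> complex"
  assumes H: "matrix_group H" and \<Omega>: "\<And>g x. g \<in> H \<Longrightarrow> x \<in> \<Omega> \<Longrightarrow> g ** x \<in> \<Omega>"
    and w: "w \<in> \<Omega>" "\<And>k. k \<in> H \<Longrightarrow> k ** w = w"
  shows "real (card H) * (cmod (\<psi> w))\<^sup>2 \<le> Re (\<Sum>k\<in>H. \<Sum>x\<in>\<Omega>. \<psi> (k ** x) * cnj (\<psi> x))"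
proof -
  define T where "T = (\<Sum>k\<in>H. \<Sum>x\<in>\<Omega>. \<psi> (k ** x) * cnj (\<psi> x))"
  have H1: "mat 1 \<in> H" using H unfolding matrix_group_def by blast
  then have cH: "0 < real (card H)" by (auto simp: card_gt_0_iff)
  have l: "(\<Sum>k\<in>H. \<Sum>x\<in>\<Omega>. \<psi> (k ** x) * cnj (\<psi> (l ** x))) = T" if l: "l \<in> H" for l
  proof -
    have "(\<Sum>k\<in>H. \<Sum>x\<in>\<Omega>. \<psi> (k ** x) * cnj (\<psi> (l ** x))) = (\<Sum>k\<in>H. \<Sum>x\<in>\<Omega>. \<psi> (k ** l ** x) * cnj (\<psi> (l ** x)))"
      by (rule matrix_group_sum_right[OF H l, symmetric, of "\<lambda>k. \<Sum>x\<in>\<Omega>. \<psi> (k ** x) * cnj (\<psi> (l ** x))"])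
    also have "\<dots> = T"
      unfolding T_def
    proof (rule sum.cong[OF refl])
      fix k
      show "(\<Sum>x\<in>\<Omega>. \<psi> (k ** l ** x) * cnj (\<psi> (l ** x))) = (\<Sum>x\<in>\<Omega>. \<psi> (k ** x) * cnj (\<psi> x))"
        unfolding matrix_mul_assoc[symmetric]
        by (rule sum.reindex_bij_betw[OF matrix_group_bij_left[OF H l \<Omega>], of "\<lambda>x. \<psi> (k ** x) * cnj (\<psi> x)"]) simp_all
    qed
    finally show ?thesis .
  qed
  have "complex_of_real (\<Sum>x\<in>\<Omega>. (cmod (\<Sum>k\<in>H. \<psi> (k ** x)))\<^sup>2) = (\<Sum>x\<in>\<Omega>. (\<Sum>k\<in>H. \<psi> (k ** x)) * cnj (\<Sum>k\<in>H. \<psi> (k ** x)))"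
    by (simp only: of_real_sum complex_norm_square)
  also have "\<dots> = (\<Sum>x\<in>\<Omega>. \<Sum>l\<in>H. \<Sum>k\<in>H. \<psi> (k ** x) * cnj (\<psi> (l ** x)))"
    by (simp only: cnj_sum sum_distrib_left sum_distrib_right)
  also have "\<dots> = (\<Sum>l\<in>H. \<Sum>x\<in>\<Omega>. \<Sum>k\<in>H. \<psi> (k ** x) * cnj (\<psi> (l ** x)))" by (rule sum.swap)
  also have "\<dots> = (\<Sum>l\<in>H. T)"
  proof (rule sum.cong[OF refl])
    fix l' assume "l' \<in> H"
    then show "(\<Sum>x\<in>\<Omega>. \<Sum>k\<in>H. \<psi> (k ** x) * cnj (\<psi> (l' ** x))) = T" by (subst sum.swap) (rule l)
  qed
  also have "\<dots> = of_real (real (card H)) * T" by simp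
  finally have "(\<Sum>x\<in>\<Omega>. (cmod (\<Sum>k\<in>H. \<psi> (k ** x)))\<^sup>2) = Re (of_real (real (card H)) * T)"
    by (metis Re_complex_of_real)
  then have e: "(\<Sum>x\<in>\<Omega>. (cmod (\<Sum>k\<in>H. \<psi> (k ** x)))\<^sup>2) = real (card H) * Re T" by simp
  have "(\<Sum>k\<in>H. \<psi> (k ** w)) = of_nat (card H) * \<psi> w" using w(2) by simp
  then have "(real (card H))\<^sup>2 * (cmod (\<psi> w))\<^sup>2 = (cmod (\<Sum>k\<in>H. \<psi> (k ** w)))\<^sup>2"
    by (simp add: norm_mult power_mult_distrib)
  also have "\<dots> \<le> (\<Sum>x\<in>\<Omega>. (cmod (\<Sum>k\<in>H. \<psi> (k ** x)))\<^sup>2)"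
    by (rule member_le_sum[OF w(1), of "\<lambda>x. (cmod (\<Sum>k\<in>H. \<psi> (k ** x)))\<^sup>2"]) simp_all
  finally have "real (card H) * (real (card H) * (cmod (\<psi> w))\<^sup>2) \<le> real (card H) * Re T"
    unfolding e by (simp add: power2_eq_square mult.assoc)
  then show ?thesis unfolding T_def[symmetric] by (rule mult_left_le_imp_le[OF _ cH])
qed

text \<open>Expanding u g over w and collecting the pairs g, h with h w = g w into cosets of
  \<open>stab X w\<close> writes the energy of u as a sum of autocorrelations of B over the
  stabilizers. \<open>averaging_lower_bound\<close> bounds each of them from below, and |X| is at
  most |\<Omega>| times the size of the stabilizer.\<close>

lemma orbit_coeff_bound:
  fixes X \<Omega> :: "('a::{field,finite}^'n^'n) set" and B :: "'a^'n^'n \<Rightarrow> 'a^'n^'n \<Rightarrow> complex"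
  assumes X: "matrix_group X" and \<Omega>: "\<And>g x. g \<in> X \<Longrightarrow> x \<in> \<Omega> \<Longrightarrow> g ** x \<in> \<Omega>"
    and B: "\<And>x y. B x y = (\<Sum>h\<in>X. b h * (if h ** x = y then 1 else 0))"
    and u: "\<And>g. g \<in> X \<Longrightarrow> u g = (\<Sum>x\<in>\<Omega>. B x (g ** x))"
  shows "real (card X) * (\<Sum>x\<in>\<Omega>. \<Sum>y\<in>\<Omega>. (cmod (B x y))\<^sup>2) \<le> real (card \<Omega>) * (\<Sum>g\<in>X. (cmod (u g))\<^sup>2)"
proof -
  have ev: "(\<Sum>h\<in>X. b h * F (h ** x)) = (\<Sum>y\<in>\<Omega>. B x y * F y)" if "x \<in> \<Omega>" for x and F :: "'a^'n^'n \<Rightarrow> complex"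
  proof -
    have "(\<Sum>y\<in>\<Omega>. B x y * F y) = (\<Sum>y\<in>\<Omega>. \<Sum>h\<in>X. (if h ** x = y then b h * F (h ** x) else 0))"
      unfolding B sum_distrib_right by (intro sum.cong refl) auto
    also have "\<dots> = (\<Sum>h\<in>X. \<Sum>y\<in>\<Omega>. (if h ** x = y then b h * F (h ** x) else 0))" by (rule sum.swap)
    also have "\<dots> = (\<Sum>h\<in>X. b h * F (h ** x))"
      by (rule sum.cong) (use \<Omega> that in auto)
    finally show ?thesis ..
  qed
  have "complex_of_real (\<Sum>g\<in>X. (cmod (u g))\<^sup>2) = (\<Sum>g\<in>X. u g * cnj (u g))"
    by (simp only: of_real_sum complex_norm_square)
  also have "\<dots> = (\<Sum>g\<in>X. \<Sum>w\<in>\<Omega>. \<Sum>h\<in>X. b h * (if h ** w = g ** w then cnj (u g) else 0))"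
    by (rule sum.cong[OF refl], subst u, assumption, unfold B sum_distrib_right, intro sum.cong refl) auto
  also have "\<dots> = (\<Sum>w\<in>\<Omega>. \<Sum>g\<in>X. \<Sum>h\<in>X. b h * (if h ** w = g ** w then cnj (u g) else 0))" by (rule sum.swap)
  also have "\<dots> = (\<Sum>w\<in>\<Omega>. \<Sum>k\<in>stab X w. \<Sum>y\<in>\<Omega>. \<Sum>x\<in>\<Omega>. B (k ** x) y * cnj (B x y))"
  proof (rule sum.cong[OF refl])
    fix w assume w: "w \<in> \<Omega>"
    have "(\<Sum>g\<in>X. \<Sum>h\<in>X. b h * (if h ** w = g ** w then cnj (u g) else 0)) = (\<Sum>h\<in>X. \<Sum>g\<in>X. b h * (if h ** w = g ** w then cnj (u g) else 0))"
      by (rule sum.swap)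
    also have "\<dots> = (\<Sum>h\<in>X. \<Sum>k\<in>stab X w. b h * cnj (u (h ** k)))"
    proof (rule sum.cong[OF refl])
      fix h assume h: "h \<in> X"
      have "(\<Sum>g\<in>X. b h * (if h ** w = g ** w then cnj (u g) else 0)) = (\<Sum>g\<in>{g\<in>X. g ** w = h ** w}. b h * cnj (u g))"
        by (rule sum.mono_neutral_cong_right) auto
      also have "\<dots> = (\<Sum>k\<in>stab X w. b h * cnj (u (h ** k)))" by (rule coset_sum[OF X h])
      finally show "(\<Sum>g\<in>X. b h * (if h ** w = g ** w then cnj (u g) else 0)) = (\<Sum>k\<in>stab X w. b h * cnj (u (h ** k)))" .
    qed
    also have "\<dots> = (\<Sum>k\<in>stab X w. \<Sum>h\<in>X. b h * cnj (u (h ** k)))" by (rule sum.swap)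
    also have "\<dots> = (\<Sum>k\<in>stab X w. \<Sum>y\<in>\<Omega>. \<Sum>x\<in>\<Omega>. B (k ** x) y * cnj (B x y))"
    proof (rule sum.cong[OF refl])
      fix k assume "k \<in> stab X w"
      then have k: "k \<in> X" by (simp add: stab_def)
      have "(\<Sum>h\<in>X. b h * cnj (u (h ** k))) = (\<Sum>h\<in>X. \<Sum>x\<in>\<Omega>. b h * cnj (B x (h ** (k ** x))))"
      proof (rule sum.cong[OF refl])
        fix h assume "h \<in> X"
        then have "h ** k \<in> X" using k X unfolding matrix_group_def by blast
        then show "b h * cnj (u (h ** k)) = (\<Sum>x\<in>\<Omega>. b h * cnj (B x (h ** (k ** x))))"
          by (simp only: u cnj_sum sum_distrib_left matrix_mul_assoc)
      qed
      also have "\<dots> = (\<Sum>x\<in>\<Omega>. \<Sum>h\<in>X. b h * cnj (B x (h ** (k ** x))))" by (rule sum.swap)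
      also have "\<dots> = (\<Sum>x\<in>\<Omega>. \<Sum>y\<in>\<Omega>. B (k ** x) y * cnj (B x y))"
        by (rule sum.cong[OF refl]) (rule ev[OF \<Omega>[OF k]])
      also have "\<dots> = (\<Sum>y\<in>\<Omega>. \<Sum>x\<in>\<Omega>. B (k ** x) y * cnj (B x y))" by (rule sum.swap)
      finally show "(\<Sum>h\<in>X. b h * cnj (u (h ** k))) = (\<Sum>y\<in>\<Omega>. \<Sum>x\<in>\<Omega>. B (k ** x) y * cnj (B x y))" .
    qed
    finally show "(\<Sum>g\<in>X. \<Sum>h\<in>X. b h * (if h ** w = g ** w then cnj (u g) else 0)) = (\<Sum>k\<in>stab X w. \<Sum>y\<in>\<Omega>. \<Sum>x\<in>\<Omega>. B (k ** x) y * cnj (B x y))" .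
  qed
  also have "\<dots> = (\<Sum>w\<in>\<Omega>. \<Sum>y\<in>\<Omega>. \<Sum>k\<in>stab X w. \<Sum>x\<in>\<Omega>. B (k ** x) y * cnj (B x y))"
    by (rule sum.cong[OF refl]) (rule sum.swap)
  finally have "(\<Sum>g\<in>X. (cmod (u g))\<^sup>2) = Re (\<Sum>w\<in>\<Omega>. \<Sum>y\<in>\<Omega>. \<Sum>k\<in>stab X w. \<Sum>x\<in>\<Omega>. B (k ** x) y * cnj (B x y))"
    by (metis Re_complex_of_real)
  then have U: "(\<Sum>g\<in>X. (cmod (u g))\<^sup>2) = (\<Sum>w\<in>\<Omega>. \<Sum>y\<in>\<Omega>. Re (\<Sum>k\<in>stab X w. \<Sum>x\<in>\<Omega>. B (k ** x) y * cnj (B x y)))"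
    by (simp only: Re_sum)
  have "real (card X) * (\<Sum>x\<in>\<Omega>. \<Sum>y\<in>\<Omega>. (cmod (B x y))\<^sup>2) = (\<Sum>w\<in>\<Omega>. \<Sum>y\<in>\<Omega>. real (card X) * (cmod (B w y))\<^sup>2)"
    by (simp only: sum_distrib_left)
  also have "\<dots> \<le> (\<Sum>w\<in>\<Omega>. \<Sum>y\<in>\<Omega>. real (card \<Omega>) * Re (\<Sum>k\<in>stab X w. \<Sum>x\<in>\<Omega>. B (k ** x) y * cnj (B x y)))"
  proof (intro sum_mono)
    fix w y assume w: "w \<in> \<Omega>"
    have "real (card X) \<le> real (card \<Omega> * card (stab X w))"
      by (rule of_nat_mono[OF card_le_orbit_stab[OF X \<Omega> w]])
    then have "real (card X) * (cmod (B w y))\<^sup>2 \<le> real (card \<Omega> * card (stab X w)) * (cmod (B w y))\<^sup>2"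
      by (rule mult_right_mono) simp
    also have "\<dots> = real (card \<Omega>) * (real (card (stab X w)) * (cmod (B w y))\<^sup>2)" by simp
    also have "\<dots> \<le> real (card \<Omega>) * Re (\<Sum>k\<in>stab X w. \<Sum>x\<in>\<Omega>. B (k ** x) y * cnj (B x y))"
      by (rule mult_left_mono[OF averaging_lower_bound[OF matrix_group_stab[OF X], where \<psi> = "\<lambda>x. B x y"]]) (use \<Omega> w in \<open>auto simp: stab_def\<close>)
    finally show "real (card X) * (cmod (B w y))\<^sup>2 \<le> real (card \<Omega>) * Re (\<Sum>k\<in>stab X w. \<Sum>x\<in>\<Omega>. B (k ** x) y * cnj (B x y))" .
  qed
  also have "\<dots> = real (card \<Omega>) * (\<Sum>g\<in>X. (cmod (u g))\<^sup>2)"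
    unfolding U by (simp only: sum_distrib_left)
  finally show ?thesis .
qed

text \<open>
  Every irreducible constituent of the span of the functions \<open>g \<mapsto> [g x = y]\<close> has dimension at most
  \<open>|\<Omega>|\<close>, which bounds the frame constant; averaging over stabilizers replaces this argument.
\<close>

lemma orbit_frame_bound:
  fixes X \<Omega> :: "('a::{field,finite}^'n^'n) set" and B0 :: "'a^'n^'n \<Rightarrow> 'a^'n^'n \<Rightarrow> complex"
  assumes X: "matrix_group X" and \<Omega>: "\<And>g x. g \<in> X \<Longrightarrow> x \<in> \<Omega> \<Longrightarrow> g ** x \<in> \<Omega>"
    and u: "\<And>g. g \<in> X \<Longrightarrow> u g = (\<Sum>x\<in>\<Omega>. B0 x (g ** x))"
  shows "real (card X) * (\<Sum>g\<in>X. (cmod (u g))\<^sup>2) \<le> real (card \<Omega>) * (\<Sum>x\<in>\<Omega>. \<Sum>y\<in>\<Omega>. (cmod (\<Sum>g\<in>{g\<in>X. g ** x = y}. u g))\<^sup>2)"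
proof -
  define ind where "ind h = (\<lambda>p :: ('a^'n^'n) \<times> ('a^'n^'n). if h ** fst p = snd p then 1 else 0 :: complex)" for h
  \<comment> \<open>Evaluating B0 along g is the inner product with \<open>ind g\<close>. Replacing
    B0 by its projection onto the span of these functions leaves u unchanged and brings the
    coefficients into the form required by \<open>orbit_coeff_bound\<close>.\<close>
  obtain w where w: "w \<in> fun_space.span (ind ` X)" "\<forall>b\<in>ind ` X. ip (\<Omega> \<times> \<Omega>) (case_prod B0 - w) b = 0"
    using exists_projection_span[of "\<Omega> \<times> \<Omega>" "ind ` X" "case_prod B0"] by auto
  have "fun_space.subspace (range (\<lambda>b p. \<Sum>h\<in>X. b h * ind h p))"
  proof (rule fun_space.subspaceI)
    show "0 \<in> range (\<lambda>b p. \<Sum>h\<in>X. b h * ind h p)" by (rule range_eqI[of _ _ "\<lambda>_. 0"]) (simp add: fun_eq_iff)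
    fix s t assume "s \<in> range (\<lambda>b p. \<Sum>h\<in>X. b h * ind h p)" "t \<in> range (\<lambda>b p. \<Sum>h\<in>X. b h * ind h p)"
    then obtain b b' where "s = (\<lambda>p. \<Sum>h\<in>X. b h * ind h p)" "t = (\<lambda>p. \<Sum>h\<in>X. b' h * ind h p)" by blast
    then show "s + t \<in> range (\<lambda>b p. \<Sum>h\<in>X. b h * ind h p)"
      by (intro range_eqI[of _ _ "\<lambda>h. b h + b' h"]) (simp add: fun_eq_iff distrib_right sum.distrib)
  next
    fix c s assume "s \<in> range (\<lambda>b p. \<Sum>h\<in>X. b h * ind h p)"
    then obtain b where "s = (\<lambda>p. \<Sum>h\<in>X. b h * ind h p)" by blast
    then show "fscale c s \<in> range (\<lambda>b p. \<Sum>h\<in>X. b h * ind h p)"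
      by (intro range_eqI[of _ _ "\<lambda>h. c * b h"]) (simp add: fun_eq_iff fscale_def sum_distrib_left mult.assoc)
  qed
  moreover have "ind ` X \<subseteq> range (\<lambda>b p. \<Sum>h\<in>X. b h * ind h p)"
  proof
    fix t assume "t \<in> ind ` X"
    then obtain g where g: "g \<in> X" "t = ind g" by blast
    have "(\<Sum>h\<in>X. (if h = g then 1 else 0) * ind h p) = ind g p" for p
    proof -
      have "(\<Sum>h\<in>X. (if h = g then 1 else 0) * ind h p) = (\<Sum>h\<in>X. if h = g then ind g p else 0)"
        by (rule sum.cong) auto
      then show ?thesis using g(1) by simp
    qed
    then show "t \<in> range (\<lambda>b p. \<Sum>h\<in>X. b h * ind h p)"
      by (intro range_eqI[of _ _ "\<lambda>h. if h = g then 1 else 0"]) (simp add: fun_eq_iff g(2))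
  qed
  ultimately have "fun_space.span (ind ` X) \<subseteq> range (\<lambda>b p. \<Sum>h\<in>X. b h * ind h p)"
    by (rule fun_space.span_minimal[rotated])
  then obtain b where b: "w = (\<lambda>p. \<Sum>h\<in>X. b h * ind h p)" using w(1) by blast
  define B where "B x y = w (x, y)" for x y
  have B: "B x y = (\<Sum>h\<in>X. b h * (if h ** x = y then 1 else 0))" for x y
    by (simp add: B_def b ind_def)
  have uB: "u g = (\<Sum>x\<in>\<Omega>. B x (g ** x))" if g: "g \<in> X" for g
  proof -
    have "0 = ip (\<Omega> \<times> \<Omega>) (case_prod B0 - w) (ind g)" using w(2) g by simp
    also have "\<dots> = (\<Sum>x\<in>\<Omega>. \<Sum>y\<in>\<Omega>. (B0 x y - B x y) * (if g ** x = y then 1 else 0))"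
      unfolding ip_def sum.cartesian_product by (rule sum.cong) (auto simp: ind_def B_def)
    also have "\<dots> = (\<Sum>x\<in>\<Omega>. \<Sum>y\<in>\<Omega>. if g ** x = y then B0 x (g ** x) - B x (g ** x) else 0)"
      by (intro sum.cong refl) auto
    also have "\<dots> = (\<Sum>x\<in>\<Omega>. B0 x (g ** x) - B x (g ** x))"
      by (rule sum.cong) (use \<Omega> g in auto)
    finally show ?thesis using u[OF g] by (simp add: sum_subtractf)
  qed
  \<comment> \<open>Duality: U is the inner product of the correlations \<open>a\<close> with B.
    Cauchy-Schwarz and the bound of the energy of B by that of u leave an inequality quadratic in
    U.\<close>
  define U where "U = (\<Sum>g\<in>X. (cmod (u g))\<^sup>2)"
  define a where "a x y = (\<Sum>g\<in>{g\<in>X. g ** x = y}. u g)" for x y :: "'a^'n^'n"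
  have U0: "0 \<le> U" unfolding U_def by (rule sum_nonneg) simp
  have "complex_of_real U = (\<Sum>g\<in>X. u g * cnj (u g))"
    unfolding U_def by (simp only: of_real_sum complex_norm_square)
  also have "\<dots> = (\<Sum>g\<in>X. \<Sum>x\<in>\<Omega>. u g * cnj (B x (g ** x)))"
  proof (rule sum.cong[OF refl])
    fix g assume g: "g \<in> X"
    have "u g * cnj (u g) = u g * cnj (\<Sum>x\<in>\<Omega>. B x (g ** x))" by (simp only: uB[OF g, symmetric])
    then show "u g * cnj (u g) = (\<Sum>x\<in>\<Omega>. u g * cnj (B x (g ** x)))" by (simp only: cnj_sum sum_distrib_left)
  qed
  also have "\<dots> = (\<Sum>x\<in>\<Omega>. \<Sum>g\<in>X. u g * cnj (B x (g ** x)))" by (rule sum.swap)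
  also have "\<dots> = (\<Sum>x\<in>\<Omega>. \<Sum>y\<in>\<Omega>. a x y * cnj (B x y))"
  proof (rule sum.cong[OF refl])
    fix x assume x: "x \<in> \<Omega>"
    have "(\<Sum>g\<in>X. u g * cnj (B x (g ** x))) = (\<Sum>y\<in>\<Omega>. \<Sum>g\<in>{g\<in>X. g ** x = y}. u g * cnj (B x (g ** x)))"
      by (rule sum.group[symmetric]) (use \<Omega> x in auto)
    also have "\<dots> = (\<Sum>y\<in>\<Omega>. a x y * cnj (B x y))"
      unfolding a_def sum_distrib_right by (intro sum.cong refl) auto
    finally show "(\<Sum>g\<in>X. u g * cnj (B x (g ** x))) = (\<Sum>y\<in>\<Omega>. a x y * cnj (B x y))" .
  qed
  also have "\<dots> = (\<Sum>p\<in>\<Omega> \<times> \<Omega>. a (fst p) (snd p) * cnj (B (fst p) (snd p)))"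
    by (simp only: sum.cartesian_product case_prod_unfold)
  finally have "cmod (complex_of_real U) = cmod (\<Sum>p\<in>\<Omega> \<times> \<Omega>. a (fst p) (snd p) * cnj (B (fst p) (snd p)))" by (simp only:)
  then have "U = cmod (\<Sum>p\<in>\<Omega> \<times> \<Omega>. a (fst p) (snd p) * cnj (B (fst p) (snd p)))" using U0 by simp
  also have "\<dots> \<le> (\<Sum>p\<in>\<Omega> \<times> \<Omega>. cmod (a (fst p) (snd p)) * cmod (B (fst p) (snd p)))"
    by (rule order_trans[OF norm_sum]) (simp add: norm_mult)
  finally have "U\<^sup>2 \<le> (\<Sum>p\<in>\<Omega> \<times> \<Omega>. cmod (a (fst p) (snd p)) * cmod (B (fst p) (snd p)))\<^sup>2"
    by (rule power_mono[OF _ U0])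
  also have "\<dots> \<le> (\<Sum>p\<in>\<Omega> \<times> \<Omega>. (cmod (a (fst p) (snd p)))\<^sup>2) * (\<Sum>p\<in>\<Omega> \<times> \<Omega>. (cmod (B (fst p) (snd p)))\<^sup>2)"
    by (rule Cauchy_Schwarz_ineq_sum)
  finally have cs: "U\<^sup>2 \<le> (\<Sum>x\<in>\<Omega>. \<Sum>y\<in>\<Omega>. (cmod (a x y))\<^sup>2) * (\<Sum>x\<in>\<Omega>. \<Sum>y\<in>\<Omega>. (cmod (B x y))\<^sup>2)"
    by (simp only: sum.cartesian_product case_prod_unfold)
  define a2 where "a2 = (\<Sum>x\<in>\<Omega>. \<Sum>y\<in>\<Omega>. (cmod (a x y))\<^sup>2)"
  have a20: "0 \<le> a2" unfolding a2_def by (intro sum_nonneg) simp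
  have "real (card X) * U\<^sup>2 \<le> a2 * (real (card X) * (\<Sum>x\<in>\<Omega>. \<Sum>y\<in>\<Omega>. (cmod (B x y))\<^sup>2))"
    using mult_left_mono[OF cs, of "real (card X)"] by (simp add: a2_def mult_ac)
  also have "\<dots> \<le> a2 * (real (card \<Omega>) * U)"
    unfolding U_def by (rule mult_left_mono[OF orbit_coeff_bound[OF X \<Omega> B uB] a20])
  finally have "(real (card X) * U) * U \<le> (real (card \<Omega>) * a2) * U" by (simp add: power2_eq_square mult_ac)
  moreover have "0 \<le> real (card \<Omega>) * a2" using a20 by simp
  ultimately have "real (card X) * U \<le> real (card \<Omega>) * a2"
    using U0 by (cases "U = 0") (auto dest: mult_right_le_imp_le)
  then show ?thesis unfolding U_def a2_def a_def .
qed

section \<open>From matrix groups to all matrices\<close>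

lemma exists_generalized_inverse:
  fixes P :: "'a::{field,finite}^'n^'n"
  shows "\<exists>Q. P ** Q ** P = P"
proof -
  obtain g where g: "Vector_Spaces.linear (*s) (*s) g" "\<forall>v\<in>range ((*v) P). P *v (g v) = v"
    using vec.linear_exists_right_inverse_on[OF matrix_vector_mul_linear_gen[of P] vec.subspace_UNIV] by blast
  have "P ** matrix g ** P = P"
    unfolding matrix_eq
  proof
    fix v
    have "(P ** matrix g ** P) *v v = P *v (g (P *v v))"
      by (simp add: matrix_vector_mul_assoc[symmetric] matrix_works[OF g(1)])
    also have "\<dots> = P *v v" using g(2) by blast
    finally show "(P ** matrix g ** P) *v v = P *v v" .
  qed
  then show ?thesis by blast
qed

lemma ran_subset_factor:
  fixes B x :: "'a::{field,finite}^'n^'n"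
  assumes "ran B \<subseteq> ran x"
  shows "\<exists>z. B = x ** z"
proof -
  obtain y where y: "x ** y ** x = x" using exists_generalized_inverse[of x] by blast
  have "B = x ** (y ** B)"
    unfolding matrix_eq
  proof
    fix v
    have "B *v v \<in> ran x" using assms mem_ran by blast
    then obtain w where w: "B *v v = x *v w" by (auto simp: ran_def)
    have "(x ** (y ** B)) *v v = x *v (y *v (x *v w))" by (simp add: matrix_vector_mul_assoc[symmetric] w)
    also have "\<dots> = (x ** y ** x) *v w" by (simp only: matrix_vector_mul_assoc matrix_mul_assoc)
    finally show "B *v v = (x ** (y ** B)) *v v" by (simp only: y w)
  qed
  then show ?thesis by blast
qed

lemma kern_subset_factor:
  fixes x y :: "'a::{field,finite}^'n^'n"
  assumes "kern x \<subseteq> kern y"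
  shows "\<exists>z. y = z ** x"
proof -
  obtain w where w: "x ** w ** x = x" using exists_generalized_inverse[of x] by blast
  have "y = (y ** w) ** x"
    unfolding matrix_eq
  proof
    fix v
    have "x *v (w *v (x *v v) - v) = (x ** w ** x) *v v - x *v v"
      by (simp add: matrix_vector_mul_assoc[symmetric] matrix_vector_mult_diff_distrib)
    then have "x *v (w *v (x *v v) - v) = 0" by (simp add: w)
    then have "w *v (x *v v) - v \<in> kern y" using assms by (auto simp: kern_def)
    then have "y *v (w *v (x *v v)) = y *v v" by (simp add: kern_def matrix_vector_mult_diff_distrib)
    then show "y *v v = ((y ** w) ** x) *v v" by (simp add: matrix_vector_mul_assoc[symmetric])
  qed
  then show ?thesis by blast
qed

text \<open>If \<open>ran B\<close> is not inside \<open>ran x\<close>, some l vanishes on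
  \<open>ran x\<close> but not on \<open>ran B\<close>. Translations by u l^T leave A x unchanged,
  whereas the character of B averages to 0 over u.\<close>

lemma fc_comp_right:
  fixes x :: "'a::{field,finite}^'n^'n"
  assumes "fc (\<lambda>A. F (A ** x)) B \<noteq> 0"
  shows "ran B \<subseteq> ran x"
proof (rule ccontr)
  assume "\<not> ran B \<subseteq> ran x"
  then obtain v where v: "B *v v \<notin> ran x" by (auto simp: ran_def)
  obtain l where l: "\<forall>s\<in>ran x. dot l s = 0" "dot l (B *v v) = 1"
    by (rule separate_subspace[OF subspace_ran v])
  have "dot (transpose x *v l) u = 0" for u
    using l(1) by (simp flip: dot_transpose)
  then have xl: "transpose x *v l = 0" using dot_all_zero[of "transpose x *v l"] by (simp add: dot_commute)
  have Bl: "transpose B *v l \<noteq> 0"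
  proof
    assume h: "transpose B *v l = 0"
    have "dot 0 v = (1::'a)" using l(2) unfolding dot_transpose h .
    then show False by (simp add: dot_def)
  qed
  have "(A + outer u l) ** x = A ** x" for A and u :: "'a^'n"
    by (simp add: matrix_add_rdistrib_gen outer_mult xl) (simp add: outer_def vec_eq_iff)
  then have e: "fc (\<lambda>A. F (A ** x)) B = fc (\<lambda>A. F (A ** x)) B * ch B (outer u l)" for u
    using fc_shift[of "\<lambda>A. F (A ** x)" "outer u l" B] by simp
  have "EE (\<lambda>u :: 'a^'n. fc (\<lambda>A. F (A ** x)) B) = EE (\<lambda>u. fc (\<lambda>A. F (A ** x)) B * ch B (outer u l))"
    by (rule arg_cong[of _ _ EE], rule ext, rule e)
  also have "\<dots> = fc (\<lambda>A. F (A ** x)) B * EE (\<lambda>u. chi (dot u (transpose B *v l)))"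
    by (simp only: mean_cmult ch_outer dot_transpose[of _ B] dot_commute[of "transpose B *v _"])
  also have "\<dots> = 0" unfolding mean_chi_dot using Bl by simp
  finally show False using assms by simp
qed

lemma rk_mono: "ran B \<subseteq> ran x \<Longrightarrow> rk B \<le> rk x"
  for B x :: "'a::{field,finite}^'n^'n"
  unfolding rk_def by (rule vec.dim_subset)

lemma deg_le_comp_right: "deg_le (rk x) (\<lambda>A. F (A ** x))"
  for x :: "'a::{field,finite}^'n^'n"
  unfolding deg_le_def using fc_comp_right rk_mono by blast

section \<open>Functions of low degree as functions of A x\<close>

lemma matrix_sub_rdistrib_gen: "(B - C) ** A = B ** A - C ** (A::'a::comm_ring_1^'n^'m)"
  by (simp add: matrix_matrix_mult_def vec_eq_iff left_diff_distrib sum_subtractf)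

lemma matrix_vector_axis: "(x *v axis j 1) $ i = x $ i $ j"
  for x :: "'a::comm_ring_1^'n^'m"
proof -
  have "(x *v axis j 1) $ i = (\<Sum>k\<in>UNIV. if k = j then x $ i $ j else 0)"
    unfolding matrix_vector_mult_def axis_def vec_lambda_beta by (rule sum.cong) auto
  then show ?thesis by simp
qed

lemma sum_comp_right:
  fixes x :: "'a::{field,finite}^'n^'n" and F :: "'a^'n^'n \<Rightarrow> 'c::comm_semiring_1"
  shows "(\<Sum>A\<in>UNIV. F (A ** x)) = of_nat (card {A :: 'a^'n^'n. A ** x = 0}) * (\<Sum>y\<in>range (\<lambda>A :: 'a^'n^'n. A ** x). F y)"
proof -
  have "(\<Sum>A\<in>UNIV. F (A ** x)) = (\<Sum>y\<in>range (\<lambda>A :: 'a^'n^'n. A ** x). \<Sum>A\<in>{A :: 'a^'n^'n. A \<in> UNIV \<and> A ** x = y}. F (A ** x))"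
    by (rule sum.group[symmetric]) auto
  also have "\<dots> = (\<Sum>y\<in>range (\<lambda>A :: 'a^'n^'n. A ** x). of_nat (card {A :: 'a^'n^'n. A ** x = 0}) * F y)"
  proof (rule sum.cong[OF refl])
    fix y assume "y \<in> range (\<lambda>A :: 'a^'n^'n. A ** x)"
    then obtain A0 where A0: "y = A0 ** x" by blast
    have "bij_betw (\<lambda>A. A + A0) {A :: 'a^'n^'n. A ** x = 0} {A :: 'a^'n^'n. A \<in> UNIV \<and> A ** x = y}"
      by (rule bij_betw_byWitness[where f' = "\<lambda>A. A - A0"]) (auto simp: A0 matrix_add_rdistrib_gen matrix_sub_rdistrib_gen)
    then have "card {A :: 'a^'n^'n. A \<in> UNIV \<and> A ** x = y} = card {A :: 'a^'n^'n. A ** x = 0}" by (simp add: bij_betw_same_card)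
    moreover have "(\<Sum>A\<in>{A :: 'a^'n^'n. A \<in> UNIV \<and> A ** x = y}. F (A ** x)) = (\<Sum>A\<in>{A :: 'a^'n^'n. A \<in> UNIV \<and> A ** x = y}. F y)" by (rule sum.cong) auto
    ultimately show "(\<Sum>A\<in>{A :: 'a^'n^'n. A \<in> UNIV \<and> A ** x = y}. F (A ** x)) = of_nat (card {A :: 'a^'n^'n. A ** x = 0}) * F y"
      by simp
  qed
  finally show ?thesis by (simp only: sum_distrib_left)
qed

lemma card_kernel_range_right:
  "card {A :: 'a^'n^'n. A ** x = 0} * card (range (\<lambda>A :: 'a^'n^'n. A ** x)) = CARD('a^'n^'n)"
  for x :: "'a::{field,finite}^'n^'n"
  using sum_comp_right[of "\<lambda>_. 1 :: nat" x] by simp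

text \<open>These stand for the n by |S| matrices, padded with zero columns so that every product
  stays within one type of square matrices.\<close>

definition cols :: "'n set \<Rightarrow> ('a::{field,finite}^'n^'n) set" where
  "cols S = {x. \<forall>i. \<forall>j. j \<notin> S \<longrightarrow> x $ i $ j = 0}"

lemma cols_mult_vec_eq:
  assumes "x \<in> cols S" "\<And>j. j \<in> S \<Longrightarrow> v $ j = w $ j"
  shows "x *v v = x *v (w :: 'a::{field,finite}^'n)"
proof -
  have e: "x $ i $ j * v $ j = x $ i $ j * w $ j" for i j
    using assms by (cases "j \<in> S") (simp_all add: cols_def)
  then show ?thesis by (simp only: matrix_vector_mult_def e)
qed

lemma cols_mult_left: "x \<in> cols S \<Longrightarrow> A ** x \<in> cols S"
  by (simp add: cols_def matrix_matrix_mult_def)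

lemma dim_supported_le: "vec.dim {v :: 'a::{field,finite}^'n. \<forall>j. j \<notin> S \<longrightarrow> v $ j = 0} \<le> card S"
proof -
  have "{v :: 'a^'n. \<forall>j. j \<notin> S \<longrightarrow> v $ j = 0} \<subseteq> vec.span ((\<lambda>j. axis j 1) ` S)"
  proof
    fix v :: "'a^'n" assume v: "v \<in> {v. \<forall>j. j \<notin> S \<longrightarrow> v $ j = 0}"
    have "v = (\<Sum>j\<in>S. v $ j *s axis j 1)"
    proof -
      have "v $ i = (\<Sum>j\<in>S. v $ j * (if i = j then 1 else 0))" for i
      proof -
        have "(\<Sum>j\<in>S. v $ j * (if i = j then 1 else 0)) = (\<Sum>j\<in>S. if i = j then v $ i else 0)" by (rule sum.cong) auto
        then show ?thesis using v by simp
      qed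
      then show ?thesis unfolding vec_eq_iff sum_component vector_smult_component axis_def vec_lambda_beta by blast
    qed
    moreover have "(\<Sum>j\<in>S. v $ j *s axis j 1) \<in> vec.span ((\<lambda>j. axis j 1) ` S)"
      by (intro vec.span_sum vec.span_scale vec.span_base imageI)
    ultimately show "v \<in> vec.span ((\<lambda>j. axis j 1) ` S)" by simp
  qed
  then have "vec.dim {v :: 'a^'n. \<forall>j. j \<notin> S \<longrightarrow> v $ j = 0} \<le> card ((\<lambda>j. axis j 1 :: 'a^'n) ` S)"
    by (rule vec.dim_le_card) simp
  also have "\<dots> \<le> card S" by (rule card_image_le) simp
  finally show ?thesis .
qed

text \<open>An x of full rank |S| kills exactly the vectors vanishing on S, and each y in
  \<open>cols S\<close> kills these too.\<close>

lemma cols_factor: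
  fixes x y :: "'a::{field,finite}^'n^'n"
  assumes x: "x \<in> cols S" "rk x = card S" and y: "y \<in> cols S"
  shows "y \<in> range (\<lambda>A. A ** x)"
proof -
  define p :: "'a^'n^'n" where "p = (\<chi> i j. if i = j \<and> i \<in> S then 1 else 0)"
  have pv: "(p *v v) $ i = (if i \<in> S then v $ i else 0)" for v i
  proof -
    have "(p *v v) $ i = (\<Sum>j\<in>UNIV. if i = j then (if i \<in> S then v $ i else 0) else 0)"
      unfolding p_def matrix_vector_mult_def vec_lambda_beta by (rule sum.cong) auto
    then show ?thesis by simp
  qed
  have ker: "kern p \<subseteq> kern z" if "z \<in> cols S" for z
  proof
    fix v assume "v \<in> kern p"
    then have "\<And>i. (p *v v) $ i = 0" by (simp add: kern_def)
    then have "v $ j = 0" if "j \<in> S" for j using that unfolding pv by (metis (full_types))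
    then have "z *v v = z *v 0" using \<open>z \<in> cols S\<close> by (intro cols_mult_vec_eq) auto
    then show "v \<in> kern z" by (simp add: kern_def)
  qed
  have "rk p \<le> card S"
  proof -
    have "ran p \<subseteq> {v. \<forall>j. j \<notin> S \<longrightarrow> v $ j = 0}" by (auto simp: ran_def pv)
    then show ?thesis unfolding rk_def by (rule order_trans[OF vec.dim_subset dim_supported_le])
  qed
  then have "corank x \<le> corank p" unfolding corank_def x(2) by linarith
  then have "card (kern x) \<le> card (kern p)" unfolding card_kern by (intro power_increasing) simp_all
  then have "kern p = kern x" by (intro card_seteq ker x(1)) simp_all
  then have "kern x \<subseteq> kern y" using ker[OF y] by simp
  then show ?thesis using kern_subset_factor by blast
qed

lemma cols_cover:
  fixes B :: "'a::{field,finite}^'n^'n"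
  assumes "rk B \<le> card S"
  shows "\<exists>x\<in>cols S. ran B \<subseteq> ran x"
proof -
  obtain C where C: "C \<subseteq> ran B" "vec.independent C" "ran B \<subseteq> vec.span C" "card C = vec.dim (ran B)"
    by (rule vec.basis_exists[of "ran B"])
  have "card C \<le> card S" using assms by (simp add: C(4) rk_def)
  then obtain f where f: "f ` C \<subseteq> S" "inj_on f C" using card_le_inj[of C S] by auto
  define x :: "'a^'n^'n" where "x = (\<chi> i j. if j \<in> f ` C then inv_into C f j $ i else 0)"
  have "x \<in> cols S" using f(1) by (auto simp: cols_def x_def)
  moreover have "C \<subseteq> ran x"
  proof
    fix c assume c: "c \<in> C"
    have "x *v axis (f c) 1 = c"
    proof -
      have "(x *v axis (f c) 1) $ i = c $ i" for i
        unfolding matrix_vector_axis using c f(2) by (simp add: x_def)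
      then show ?thesis by (simp add: vec_eq_iff)
    qed
    then show "c \<in> ran x" using mem_ran by metis
  qed
  then have "vec.span C \<subseteq> ran x" by (rule vec.span_minimal[OF _ subspace_ran])
  ultimately show ?thesis using C(3) by blast
qed

text \<open>Equal dimensions force ran x = ran B, so each of the |S| relevant columns is one of
  q^|S| vectors.\<close>

lemma card_cols_ran:
  fixes B :: "'a::{field,finite}^'n^'n"
  assumes "rk B = card S"
  shows "card {x\<in>cols S. rk x = card S \<and> ran B \<subseteq> ran x} \<le> CARD('a) ^ (card S)\<^sup>2"
proof -
  let ?Y = "{x\<in>cols S. rk x = card S \<and> ran B \<subseteq> ran x}"
  have ran: "ran x = ran B" if "x \<in> ?Y" for x
    using vec.subspace_dim_equal[OF subspace_ran subspace_ran, of B x] that assms by (simp add: rk_def)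
  define \<phi> where "\<phi> x = restrict (\<lambda>j. x *v axis j 1) S" for x :: "'a^'n^'n"
  have ent: "(x *v axis j 1) $ i = x $ i $ j" for x :: "'a^'n^'n" and i j
    by (rule matrix_vector_axis)
  have "inj_on \<phi> ?Y"
  proof (rule inj_onI)
    fix x y assume xy: "x \<in> ?Y" "y \<in> ?Y" "\<phi> x = \<phi> y"
    have "x $ i $ j = y $ i $ j" for i j
    proof (cases "j \<in> S")
      case True
      then have "x *v axis j 1 = y *v axis j 1" using fun_cong[OF xy(3), of j] by (simp add: \<phi>_def)
      then show ?thesis using ent by metis
    next
      case False
      then show ?thesis using xy(1,2) by (simp add: cols_def)
    qed
    then show "x = y" by (simp add: vec_eq_iff)
  qed
  moreover have "\<phi> ` ?Y \<subseteq> (\<Pi>\<^sub>E j\<in>S. ran B)"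
  proof
    fix t assume "t \<in> \<phi> ` ?Y"
    then obtain x where x: "x \<in> ?Y" "t = \<phi> x" by blast
    show "t \<in> (\<Pi>\<^sub>E j\<in>S. ran B)" unfolding x(2) \<phi>_def ran[OF x(1), symmetric] by auto
  qed
  ultimately have "card ?Y \<le> card (\<Pi>\<^sub>E j\<in>S. ran B)" by (rule card_inj_on_le) (simp add: finite_PiE)
  also have "\<dots> = CARD('a) ^ (card S)\<^sup>2"
    by (simp add: card_PiE card_ran assms power_mult[symmetric] power2_eq_square)
  finally show ?thesis .
qed

lemma ch_factor: "ch (x ** z) A = chi (trace (z ** (A ** x)))"
  for x z A :: "'a::{field,finite}^'n^'n"
  unfolding ch_def using trace_mul_sym[of x "z ** A"] by (simp only: matrix_mul_assoc)

text \<open>A frequency of rank at most |S| factors as x z with x in \<open>cols S\<close>, and its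
  character depends on A only through A x.\<close>

lemma deg_le_orbit_expansion:
  fixes u :: "'a::{field,finite}^'n^'n \<Rightarrow> complex"
  assumes u: "deg_le (card S) u"
  shows "\<exists>B0. \<forall>A. u A = (\<Sum>x\<in>cols S. B0 x (A ** x))"
proof -
  have "\<exists>x z. x \<in> cols S \<and> B = x ** z" if "fc u B \<noteq> 0" for B
    using cols_cover[of B S] ran_subset_factor[of B] u that unfolding deg_le_def by blast
  then obtain x z where xz: "\<And>B. fc u B \<noteq> 0 \<Longrightarrow> x B \<in> cols S \<and> B = x B ** z B" by metis
  define B0 where "B0 y w = (\<Sum>B\<in>{B. fc u B \<noteq> 0 \<and> x B = y}. fc u B * chi (trace (z B ** w)))" for y w
  have "u A = (\<Sum>y\<in>cols S. B0 y (A ** y))" for A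
  proof -
    have "u A = (\<Sum>B\<in>UNIV. fc u B * ch B A)" by (rule fourier_inversion)
    also have "\<dots> = (\<Sum>B\<in>{B. fc u B \<noteq> 0}. fc u B * chi (trace (z B ** (A ** x B))))"
    proof (rule sum.mono_neutral_cong_right)
      fix B assume "B \<in> {B. fc u B \<noteq> 0}"
      then have "ch B A = chi (trace (z B ** (A ** x B)))" using ch_factor[of "x B" "z B" A] xz[of B] by simp
      then show "fc u B * ch B A = fc u B * chi (trace (z B ** (A ** x B)))" by simp
    qed auto
    also have "\<dots> = (\<Sum>y\<in>cols S. \<Sum>B\<in>{B. B \<in> {B. fc u B \<noteq> 0} \<and> x B = y}. fc u B * chi (trace (z B ** (A ** x B))))"
      by (rule sum.group[symmetric]) (use xz in auto)
    also have "\<dots> = (\<Sum>y\<in>cols S. B0 y (A ** y))"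
      unfolding B0_def by (intro sum.cong refl) auto
    finally show ?thesis .
  qed
  then show ?thesis by blast
qed

lemma ip_comp_right_support:
  fixes x :: "'a::{field,finite}^'n^'n"
  shows "(\<Sum>g\<in>{g\<in>X. g ** x = y}. v g) = ip X v (\<lambda>A. if A ** x = y then 1 else 0)"
  unfolding ip_def by (rule sum.mono_neutral_cong_left) auto

lemma rk_cols_le:
  fixes x :: "'a::{field,finite}^'n^'n"
  assumes "x \<in> cols S"
  shows "rk x \<le> card S"
proof -
  have "(transpose x *v v) $ j = 0" if "j \<notin> S" for v j
    using assms that by (simp add: cols_def transpose_def matrix_vector_mult_def)
  then have "ran (transpose x) \<subseteq> {v. \<forall>j. j \<notin> S \<longrightarrow> v $ j = 0}" by (auto simp: ran_def)
  then have "rk (transpose x) \<le> card S" unfolding rk_def by (rule order_trans[OF vec.dim_subset dim_supported_le])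
  then show ?thesis by (simp only: rk_transpose)
qed

section \<open>Transfer from a matrix group to all matrices through correlations\<close>

context
  fixes X :: "('a::{field,finite}^'n^'n) set" and v :: "'a^'n^'n \<Rightarrow> complex" and r :: nat
  assumes X: "matrix_group X"
    and orth: "\<And>w k. k < r \<Longrightarrow> deg_le k w \<Longrightarrow> ip X v w = 0"
begin

text \<open>The correlation of v with the event g x = y. Composed with A |-> A x it extends to all
  matrices, although v is only summed over X.\<close>

definition orbsum :: "'a^'n^'n \<Rightarrow> 'a^'n^'n \<Rightarrow> complex" where
  "orbsum x y = (\<Sum>g\<in>{g\<in>X. g ** x = y}. v g)"

text \<open>The event g x = y depends on g only through g x, so its degree is at most rk x and v is
  orthogonal to it.\<close>

lemma orbsum_zero: "rk x < r \<Longrightarrow> orbsum x y = 0"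
  unfolding orbsum_def ip_comp_right_support
  by (rule orth[OF _ deg_le_comp_right[of x "\<lambda>z. if z = y then 1 else 0"]])

lemma sum_orbsum: "(\<Sum>y\<in>UNIV. orbsum x y * F y) = (\<Sum>g\<in>X. v g * F (g ** x))"
proof -
  have "(\<Sum>g\<in>X. v g * F (g ** x)) = (\<Sum>y\<in>UNIV. \<Sum>g\<in>{g\<in>X. g ** x = y}. v g * F (g ** x))"
    by (rule sum.group[symmetric]) auto
  also have "\<dots> = (\<Sum>y\<in>UNIV. orbsum x y * F y)"
    unfolding orbsum_def sum_distrib_right by (intro sum.cong refl) auto
  finally show ?thesis ..
qed

lemma orbsum_outside: "y \<notin> range (\<lambda>A :: 'a^'n^'n. A ** x) \<Longrightarrow> orbsum x y = 0"
  unfolding orbsum_def by (rule sum.neutral) auto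

lemma sum_UNIV_orbsum:
  assumes "\<And>y. orbsum x y = 0 \<Longrightarrow> F y = (0 :: 'c::comm_semiring_1)"
  shows "(\<Sum>A\<in>UNIV. F (A ** x)) = of_nat (card {A :: 'a^'n^'n. A ** x = 0}) * (\<Sum>y\<in>UNIV. F y)"
proof -
  have "(\<Sum>y\<in>range (\<lambda>A :: 'a^'n^'n. A ** x). F y) = (\<Sum>y\<in>UNIV. F y)"
    by (rule sum.mono_neutral_left) (auto intro!: assms orbsum_outside)
  then show ?thesis unfolding sum_comp_right by simp
qed

text \<open>On X the function is a sum of right translates of v over the stabilizer of x, and right
  translation does not raise degrees.\<close>

lemma orbsum_orth:
  assumes k: "k < r" "deg_le k w"
  shows "ip X (\<lambda>A. orbsum x (A ** x)) w = 0"
proof -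
  have "ip X (\<lambda>A. orbsum x (A ** x)) w = (\<Sum>g\<in>X. \<Sum>h\<in>stab X x. v (g ** h) * cnj (w g))"
    unfolding ip_def
  proof (rule sum.cong[OF refl])
    fix g assume g: "g \<in> X"
    show "orbsum x (g ** x) * cnj (w g) = (\<Sum>h\<in>stab X x. v (g ** h) * cnj (w g))"
      unfolding orbsum_def coset_sum[OF X g] by (rule sum_distrib_right)
  qed
  also have "\<dots> = (\<Sum>h\<in>stab X x. \<Sum>g\<in>X. v (g ** h) * cnj (w g))" by (rule sum.swap)
  also have "\<dots> = (\<Sum>h\<in>stab X x. 0)"
  proof (rule sum.cong[OF refl])
    fix h assume "h \<in> stab X x"
    then have h: "h \<in> X" by (simp add: stab_def)
    obtain h' where h': "h ** h' = mat 1"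
      using X h unfolding matrix_group_def by blast
    have "(\<Sum>g\<in>X. v (g ** h) * cnj (w g)) = (\<Sum>g\<in>X. v (g ** h) * cnj (w (g ** h ** h')))"
      by (simp add: matrix_mul_assoc[symmetric] h')
    also have "\<dots> = (\<Sum>g\<in>X. v g * cnj (w (g ** h')))"
      by (rule matrix_group_sum_right[OF X h, of "\<lambda>g. v g * cnj (w (g ** h'))"])
    also have "\<dots> = ip X v (rst (mat 1) h' 0 w)"
      by (simp add: ip_def rst_def)
    also have "\<dots> = 0" by (rule orth[OF k(1) deg_le_rst[OF k(2)]])
    finally show "(\<Sum>g\<in>X. v (g ** h) * cnj (w g)) = 0" .
  qed
  finally show ?thesis by simp
qed

text \<open>At a frequency B = x z the coefficient is a multiple of the inner product over X of v
  with the character of B. Orthogonality on the group thus becomes vanishing of low-rank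
  coefficients on all matrices.\<close>

lemma fc_orbsum_zero:
  assumes "rk B < r"
  shows "fc (\<lambda>A. orbsum x (A ** x)) B = 0"
proof (cases "ran B \<subseteq> ran x")
  case False
  then show ?thesis using fc_comp_right by blast
next
  case True
  then obtain z where z: "B = x ** z" using ran_subset_factor by blast
  let ?F = "\<lambda>y. orbsum x y * cnj (chi (trace (z ** y)))"
  have "(\<Sum>A\<in>UNIV. orbsum x (A ** x) * cnj (ch B A)) = (\<Sum>A\<in>UNIV. ?F (A ** x))"
    unfolding z ch_factor ..
  also have "\<dots> = of_nat (card {A :: 'a^'n^'n. A ** x = 0}) * (\<Sum>y\<in>UNIV. ?F y)"
    by (rule sum_UNIV_orbsum) simp
  also have "(\<Sum>y\<in>UNIV. ?F y) = (\<Sum>g\<in>X. v g * cnj (chi (trace (z ** (g ** x)))))"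
    by (rule sum_orbsum)
  also have "\<dots> = ip X v (ch B)" unfolding ip_def z ch_factor ..
  also have "\<dots> = 0"
  proof (rule orth[OF assms])
    have "ch B = (\<lambda>A. synth (\<lambda>B'. if B' = B then 1 else 0) A)"
    proof
      fix A
      have "synth (\<lambda>B'. if B' = B then 1 else 0) A = (\<Sum>B'\<in>UNIV. if B' = B then ch B A else 0)"
        unfolding synth_def by (rule sum.cong) auto
      then show "ch B A = synth (\<lambda>B'. if B' = B then 1 else 0) A" by simp
    qed
    then have "fc (ch B) = (\<lambda>B'. if B' = B then 1 else 0)" by (simp only: fc_synth)
    then show "deg_le (rk B) (ch B)" by (simp add: deg_le_def)
  qed
  finally show ?thesis by (simp add: fc_def mean_def)
qed

text \<open>The left side W is the inner product over X of v with its extension V. By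
  \<open>match\<close> it equals that of \<phi> with V, that is, of J with V over all matrices,
  where V only has frequencies of rank exactly r inside \<open>ran x\<close>. Cauchy-Schwarz leaves
  \<open>sq V\<close>, which is again proportional to W, so one factor W cancels.\<close>

lemma orbsum_bound:
  fixes \<phi> :: "'a^'n^'n \<Rightarrow> complex"
  assumes match: "\<And>w. deg_le r w \<Longrightarrow> (\<And>v k. k < r \<Longrightarrow> deg_le k v \<Longrightarrow> ip X w v = 0) \<Longrightarrow> ip X \<phi> w = ip X v w"
    and J: "\<And>A. J A = (if A \<in> X then \<phi> A else 0)" and x: "rk x = r"
  shows "(\<Sum>y\<in>UNIV. (cmod (orbsum x y))\<^sup>2) \<le>
    real CARD('a^'n^'n) * real (card {A :: 'a^'n^'n. A ** x = 0}) * (\<Sum>B\<in>{B. rk B = r \<and> ran B \<subseteq> ran x}. (cmod (fc J B))\<^sup>2)"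
proof -
  define V where "V = (\<lambda>A. orbsum x (A ** x))"
  define W where "W = (\<Sum>y\<in>UNIV. (cmod (orbsum x y))\<^sup>2)"
  let ?N = "CARD('a^'n^'n)" and ?\<kappa> = "card {A :: 'a^'n^'n. A ** x = 0}" and ?BB = "{B :: 'a^'n^'n. rk B = r \<and> ran B \<subseteq> ran x}"
  have N0: "0 < real ?N" by simp
  have dV: "deg_le r V" unfolding V_def using deg_le_comp_right[of x "orbsum x"] x by simp
  have oV: "ip X V w = 0" if "k < r" "deg_le k w" for k w unfolding V_def by (rule orbsum_orth[OF that])
  have "ip X v V = (\<Sum>y\<in>UNIV. orbsum x y * cnj (orbsum x y))"
    unfolding ip_def V_def by (rule sum_orbsum[symmetric])
  also have "\<dots> = complex_of_real W"
    unfolding W_def by (simp only: of_real_sum complex_norm_square)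
  finally have "complex_of_real W = ip X \<phi> V" using match[OF dV oV] by simp
  also have "\<dots> = (\<Sum>A\<in>UNIV. J A * cnj (V A))"
    unfolding ip_def by (rule sum.mono_neutral_cong_left) (auto simp: J)
  also have "\<dots> = of_nat ?N * EE (\<lambda>A. J A * cnj (V A))" by (simp add: mean_def)
  also have "\<dots> = of_nat ?N * (\<Sum>B\<in>UNIV. fc J B * cnj (fc V B))" unfolding parseval_inner ..
  also have "(\<Sum>B\<in>UNIV. fc J B * cnj (fc V B)) = (\<Sum>B\<in>?BB. fc J B * cnj (fc V B))"
  proof (rule sum.mono_neutral_right)
    show "\<forall>B\<in>UNIV - ?BB. fc J B * cnj (fc V B) = 0"
    proof
      fix B :: "'a^'n^'n" assume B: "B \<in> UNIV - ?BB"
      have "fc V B = 0"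
      proof (rule ccontr)
        assume nz: "fc V B \<noteq> 0"
        then have 1: "ran B \<subseteq> ran x" unfolding V_def by (rule fc_comp_right)
        have "\<not> rk B < r" using nz fc_orbsum_zero unfolding V_def by blast
        moreover have "rk B \<le> r" using rk_mono[OF 1] x by simp
        ultimately show False using B 1 by simp
      qed
      then show "fc J B * cnj (fc V B) = 0" by simp
    qed
  qed simp_all
  finally have eq: "complex_of_real W = of_nat ?N * (\<Sum>B\<in>?BB. fc J B * cnj (fc V B))" .
  have W0: "0 \<le> W" unfolding W_def by (rule sum_nonneg) simp
  define S where "S = (\<Sum>B\<in>?BB. (cmod (fc J B))\<^sup>2)"
  have S0: "0 \<le> S" unfolding S_def by (rule sum_nonneg) simp
  have "W = cmod (complex_of_real W)" using W0 by simp
  also have "\<dots> = real ?N * cmod (\<Sum>B\<in>?BB. fc J B * cnj (fc V B))" unfolding eq norm_mult norm_of_nat ..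
  also have "\<dots> \<le> real ?N * (\<Sum>B\<in>?BB. cmod (fc J B) * cmod (fc V B))"
  proof (rule mult_left_mono)
    have "cmod (\<Sum>B\<in>?BB. fc J B * cnj (fc V B)) \<le> (\<Sum>B\<in>?BB. cmod (fc J B * cnj (fc V B)))" by (rule norm_sum)
    then show "cmod (\<Sum>B\<in>?BB. fc J B * cnj (fc V B)) \<le> (\<Sum>B\<in>?BB. cmod (fc J B) * cmod (fc V B))"
      by (simp only: norm_mult complex_mod_cnj)
  qed simp
  finally have "W\<^sup>2 \<le> (real ?N * (\<Sum>B\<in>?BB. cmod (fc J B) * cmod (fc V B)))\<^sup>2" by (rule power_mono[OF _ W0])
  also have "\<dots> = (real ?N)\<^sup>2 * (\<Sum>B\<in>?BB. cmod (fc J B) * cmod (fc V B))\<^sup>2" by (rule power_mult_distrib)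
  also have "\<dots> \<le> (real ?N)\<^sup>2 * (S * (\<Sum>B\<in>?BB. (cmod (fc V B))\<^sup>2))"
    unfolding S_def by (rule mult_left_mono[OF Cauchy_Schwarz_ineq_sum]) simp
  also have "\<dots> \<le> (real ?N)\<^sup>2 * (S * sq V)"
  proof (rule mult_left_mono[OF mult_left_mono[OF _ S0]])
    show "(\<Sum>B\<in>?BB. (cmod (fc V B))\<^sup>2) \<le> sq V" unfolding parseval[symmetric] by (rule sum_mono2) simp_all
  qed simp
  also have "sq V = real ?\<kappa> * W / real ?N"
  proof -
    have "(\<Sum>A\<in>UNIV. (cmod (V A))\<^sup>2) = of_nat ?\<kappa> * W"
      unfolding V_def W_def by (rule sum_UNIV_orbsum) simp
    then show ?thesis unfolding sq_def mean_def by simp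
  qed
  also have "(real ?N)\<^sup>2 * (S * (real ?\<kappa> * W / real ?N)) = (real ?N * real ?\<kappa> * S) * W"
    using N0 by (simp only: power2_eq_square times_divide_eq_right) (simp only: field_simps)
  finally have "W * W \<le> (real ?N * real ?\<kappa> * S) * W" by (simp only: power2_eq_square)
  moreover have "0 \<le> real ?N * real ?\<kappa> * S" using S0 by simp
  ultimately have "W \<le> real ?N * real ?\<kappa> * S"
    using W0 by (cases "W = 0") (auto dest: mult_right_le_imp_le)
  then show ?thesis unfolding W_def S_def .
qed

text \<open>In the application v is the increment from degree below r to degree r of the projection
  of \<phi>, and \<open>match\<close> records this. \<open>orbit_frame_bound\<close> recovers v from
  its correlations and \<open>orbsum_bound\<close> bounds those with rk x = r; smaller x contribute
  nothing. A frequency of rank r is met by at most q^(r^2) matrices x. All of \<Omega> lies in the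
  range of A |-> A x, so |\<Omega>| times the size of its kernel is at most the number of
  matrices.\<close>

lemma transfer_level:
  fixes \<phi> :: "'a^'n^'n \<Rightarrow> complex"
  assumes r: "r \<le> CARD('n)" and d: "deg_le r v"
    and match: "\<And>w. deg_le r w \<Longrightarrow> (\<And>v k. k < r \<Longrightarrow> deg_le k v \<Longrightarrow> ip X w v = 0) \<Longrightarrow> ip X \<phi> w = ip X v w"
    and J: "\<And>A. J A = (if A \<in> X then \<phi> A else 0)"
  shows "real (card X) * (\<Sum>g\<in>X. (cmod (v g))\<^sup>2) \<le> (real CARD('a^'n^'n))\<^sup>2 * (real CARD('a) ^ r\<^sup>2 * sq (pr r J))"
proof -
  obtain S :: "'n set" where S: "card S = r" using obtain_subset_with_card_n[OF r] by metis
  let ?N = "real CARD('a^'n^'n)"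
  define \<Omega> where "\<Omega> = (cols S :: ('a^'n^'n) set)"
  define T where "T x = (\<Sum>B\<in>{B. rk B = r \<and> ran B \<subseteq> ran x}. (cmod (fc J B))\<^sup>2)" for x :: "'a^'n^'n"
  have T0: "0 \<le> T x" for x unfolding T_def by (rule sum_nonneg) simp
  have dS: "deg_le (card S) v" using d S by simp
  obtain B0 where B0: "\<forall>A. v A = (\<Sum>x\<in>\<Omega>. B0 x (A ** x))"
    using deg_le_orbit_expansion[OF dS] unfolding \<Omega>_def by blast
  have "real (card X) * (\<Sum>g\<in>X. (cmod (v g))\<^sup>2) \<le> real (card \<Omega>) * (\<Sum>x\<in>\<Omega>. \<Sum>y\<in>\<Omega>. (cmod (\<Sum>g\<in>{g\<in>X. g ** x = y}. v g))\<^sup>2)"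
    by (rule orbit_frame_bound[OF X, of \<Omega> v B0]) (use B0 in \<open>auto simp: \<Omega>_def cols_mult_left\<close>)
  also have "\<dots> = (\<Sum>x\<in>\<Omega>. real (card \<Omega>) * (\<Sum>y\<in>\<Omega>. (cmod (orbsum x y))\<^sup>2))"
    unfolding orbsum_def by (rule sum_distrib_left)
  also have "\<dots> \<le> (\<Sum>x\<in>\<Omega>. ?N\<^sup>2 * (if rk x = r then T x else 0))"
  proof (rule sum_mono)
    fix x assume x: "x \<in> \<Omega>"
    show "real (card \<Omega>) * (\<Sum>y\<in>\<Omega>. (cmod (orbsum x y))\<^sup>2) \<le> ?N\<^sup>2 * (if rk x = r then T x else 0)"
    proof (cases "rk x = r")
      case False
      then have "rk x < r" using rk_cols_le[of x S] x S by (simp add: \<Omega>_def)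
      then show ?thesis using False by (simp add: orbsum_zero)
    next
      case True
      let ?\<kappa> = "card {A :: 'a^'n^'n. A ** x = 0}"
      have "\<Omega> \<subseteq> range (\<lambda>A :: 'a^'n^'n. A ** x)"
        by (rule subsetI, rule cols_factor) (use x True S in \<open>simp_all add: \<Omega>_def\<close>)
      then have "card \<Omega> \<le> card (range (\<lambda>A :: 'a^'n^'n. A ** x))" by (rule card_mono[rotated]) simp
      then have "?\<kappa> * card \<Omega> \<le> CARD('a^'n^'n)"
        unfolding card_kernel_range_right[of x, symmetric] by (rule mult_le_mono2)
      then have "real (?\<kappa> * card \<Omega>) \<le> real CARD('a^'n^'n)" by (rule of_nat_mono)
      then have c: "real ?\<kappa> * real (card \<Omega>) \<le> ?N" by (simp only: of_nat_mult)
      have "(\<Sum>y\<in>\<Omega>. (cmod (orbsum x y))\<^sup>2) \<le> (\<Sum>y\<in>UNIV. (cmod (orbsum x y))\<^sup>2)" by (rule sum_mono2) simp_all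
      also have "\<dots> \<le> ?N * real ?\<kappa> * T x"
        unfolding T_def
      proof (rule orbsum_bound[OF _ J True])
        fix w assume w: "deg_le r w" "\<And>v k. k < r \<Longrightarrow> deg_le k v \<Longrightarrow> ip X w v = 0"
        show "ip X \<phi> w = ip X v w" by (rule match[OF w(1)]) (rule w(2))
      qed
      finally have "real (card \<Omega>) * (\<Sum>y\<in>\<Omega>. (cmod (orbsum x y))\<^sup>2) \<le> real (card \<Omega>) * (?N * real ?\<kappa> * T x)"
        by (rule mult_left_mono) simp
      also have "\<dots> = ?N * (real ?\<kappa> * real (card \<Omega>)) * T x" by (simp only: mult_ac)
      also have "\<dots> \<le> ?N * ?N * T x"
        by (rule mult_right_mono[OF mult_left_mono[OF c]]) (use T0 in simp_all)
      finally show ?thesis unfolding if_P[OF True] power2_eq_square[of ?N] .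
    qed
  qed
  also have "\<dots> = ?N\<^sup>2 * (\<Sum>x\<in>\<Omega>. if rk x = r then T x else 0)" by (rule sum_distrib_left[symmetric])
  also have "\<dots> \<le> ?N\<^sup>2 * (real CARD('a) ^ r\<^sup>2 * sq (pr r J))"
  proof (rule mult_left_mono)
    have "(\<Sum>x\<in>\<Omega>. if rk x = r then T x else 0) = (\<Sum>x\<in>{x\<in>\<Omega>. rk x = r}. T x)"
      by (rule sum.inter_filter[symmetric]) simp
    also have "\<dots> = (\<Sum>x\<in>{x\<in>\<Omega>. rk x = r}. \<Sum>B\<in>{B. B \<in> {B. rk B = r} \<and> ran B \<subseteq> ran x}. (cmod (fc J B))\<^sup>2)"
      by (simp add: T_def)
    also have "\<dots> = (\<Sum>B\<in>{B. rk B = r}. \<Sum>x\<in>{x. x \<in> {x\<in>\<Omega>. rk x = r} \<and> ran B \<subseteq> ran x}. (cmod (fc J B))\<^sup>2)"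
      by (rule sum.swap_restrict) simp_all
    also have "\<dots> \<le> (\<Sum>B\<in>{B. rk B = r}. real CARD('a) ^ r\<^sup>2 * (cmod (fc J B))\<^sup>2)"
    proof (rule sum_mono)
      fix B :: "'a^'n^'n" assume "B \<in> {B. rk B = r}"
      then have B: "rk B = card S" by (simp add: S)
      have "{x. x \<in> {x\<in>\<Omega>. rk x = r} \<and> ran B \<subseteq> ran x} = {x\<in>cols S. rk x = card S \<and> ran B \<subseteq> ran x}"
        by (auto simp: \<Omega>_def S)
      then have "card {x. x \<in> {x\<in>\<Omega>. rk x = r} \<and> ran B \<subseteq> ran x} \<le> CARD('a) ^ r\<^sup>2"
        using card_cols_ran[OF B] by (simp only: S)
      then have "real (card {x. x \<in> {x\<in>\<Omega>. rk x = r} \<and> ran B \<subseteq> ran x}) \<le> real (CARD('a) ^ r\<^sup>2)" by (rule of_nat_mono)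
      then have "real (card {x. x \<in> {x\<in>\<Omega>. rk x = r} \<and> ran B \<subseteq> ran x}) * (cmod (fc J B))\<^sup>2 \<le> real CARD('a) ^ r\<^sup>2 * (cmod (fc J B))\<^sup>2"
        unfolding of_nat_power by (rule mult_right_mono) simp
      then show "(\<Sum>x\<in>{x. x \<in> {x\<in>\<Omega>. rk x = r} \<and> ran B \<subseteq> ran x}. (cmod (fc J B))\<^sup>2) \<le> real CARD('a) ^ r\<^sup>2 * (cmod (fc J B))\<^sup>2"
        by (simp only: sum_constant)
    qed
    also have "\<dots> = real CARD('a) ^ r\<^sup>2 * sq (pr r J)" unfolding sq_fproj by (rule sum_distrib_left[symmetric])
    finally show "(\<Sum>x\<in>\<Omega>. if rk x = r then T x else 0) \<le> real CARD('a) ^ r\<^sup>2 * sq (pr r J)" .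
  qed simp
  finally show ?thesis .
qed

end

section \<open>Projection onto functions of bounded degree on a group\<close>

lemma deg_le_mono: "deg_le d g \<Longrightarrow> d \<le> e \<Longrightarrow> deg_le e g"
  unfolding deg_le_def by (meson order_trans)

lemma subspace_deg_le: "fun_space.subspace {g. deg_le d (g :: 'a::{field,finite}^'n^'n \<Rightarrow> complex)}"
proof (rule fun_space.subspaceI)
  show "0 \<in> {g. deg_le d (g :: 'a^'n^'n \<Rightarrow> complex)}"
    by (simp add: deg_le_def zero_fun_def fc_zero)
  fix g h :: "'a^'n^'n \<Rightarrow> complex"
  assume "g \<in> {g. deg_le d g}" "h \<in> {g. deg_le d g}"
  then show "g + h \<in> {g. deg_le d g}"
    unfolding deg_le_def mem_Collect_eq plus_fun_def fc_add by (metis add.right_neutral)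
next
  fix c and g :: "'a^'n^'n \<Rightarrow> complex"
  assume "g \<in> {g. deg_le d g}"
  then show "fscale c g \<in> {g. deg_le d g}"
    unfolding deg_le_def mem_Collect_eq fscale_def fc_cmult by simp
qed

text \<open>Passing from degree r to r + 1 adds an increment that is orthogonal on X to everything
  of degree at most r. Energies therefore add up, and \<open>transfer_level\<close> bounds each
  increment by the corresponding rank part of J.\<close>

lemma degree_projection_bound:
  fixes X :: "('a::{field,finite}^'n^'n) set" and \<phi> :: "'a^'n^'n \<Rightarrow> complex"
  assumes X: "matrix_group X" and J: "\<And>A. J A = (if A \<in> X then \<phi> A else 0)"
    and d: "d \<le> CARD('n)"
  shows "\<exists>u. deg_le d u \<and> (\<forall>w. deg_le d w \<longrightarrow> ip X (\<phi> - u) w = 0) \<and>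
    real (card X) * (\<Sum>g\<in>X. (cmod (u g))\<^sup>2) \<le> (real CARD('a^'n^'n))\<^sup>2 * (\<Sum>r\<le>d. real CARD('a) ^ r\<^sup>2 * sq (pr r J))"
  using d
proof (induction d)
  case 0
  obtain u where u: "deg_le 0 u" "\<And>w. deg_le 0 w \<Longrightarrow> ip X (\<phi> - u) w = 0"
    using exists_projection_subspace[OF subspace_deg_le[of 0], where X = X and v = \<phi>] by auto
  have "real (card X) * (\<Sum>g\<in>X. (cmod (u g))\<^sup>2) \<le> (real CARD('a^'n^'n))\<^sup>2 * (real CARD('a) ^ 0\<^sup>2 * sq (pr 0 J))"
  proof (rule transfer_level[OF X _ _ u(1) _ J])
    fix w :: "'a^'n^'n \<Rightarrow> complex" assume "deg_le 0 w"
    from u(2)[OF this] show "ip X \<phi> w = ip X u w" by (simp add: ip_diff_left)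
  qed simp_all
  moreover have "(\<Sum>r\<le>(0::nat). F r) = F 0" for F :: "nat \<Rightarrow> real" by simp
  ultimately show ?case using u by (intro exI[of _ u] conjI allI impI) (simp_all only:)
next
  case (Suc r)
  let ?N = "real CARD('a^'n^'n)"
  have "r \<le> CARD('n)" using Suc.prems by simp
  from Suc.IH[OF this] obtain u where u: "deg_le r u" "\<forall>w. deg_le r w \<longrightarrow> ip X (\<phi> - u) w = 0"
    "real (card X) * (\<Sum>g\<in>X. (cmod (u g))\<^sup>2) \<le> ?N\<^sup>2 * (\<Sum>r\<le>r. real CARD('a) ^ r\<^sup>2 * sq (pr r J))" by blast
  obtain u' where u': "deg_le (Suc r) u'" "\<And>w. deg_le (Suc r) w \<Longrightarrow> ip X (\<phi> - u') w = 0"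
    using exists_projection_subspace[OF subspace_deg_le[of "Suc r"], where X = X and v = \<phi>] by auto
  define v where "v = u' - u"
  have dv: "deg_le (Suc r) v"
    using fun_space.subspace_diff[OF subspace_deg_le, of u' "Suc r" u] u'(1) deg_le_mono[OF u(1), of "Suc r"]
    by (simp add: v_def)
  have orth: "ip X v w = 0" if "k < Suc r" "deg_le k w" for w k
  proof -
    have "deg_le r w" "deg_le (Suc r) w" using that by (simp_all add: deg_le_mono[OF that(2)])
    moreover have "v = (\<phi> - u) - (\<phi> - u')" by (simp add: v_def)
    ultimately show ?thesis using u(2) u'(2) by (simp only: ip_diff_left[of X "\<phi> - u"]) simp
  qed
  have b: "real (card X) * (\<Sum>g\<in>X. (cmod (v g))\<^sup>2) \<le> ?N\<^sup>2 * (real CARD('a) ^ (Suc r)\<^sup>2 * sq (pr (Suc r) J))"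
  proof (rule transfer_level[OF X orth Suc.prems dv _ J])
    fix w :: "'a^'n^'n \<Rightarrow> complex" assume w: "deg_le (Suc r) w" "\<And>v k. k < Suc r \<Longrightarrow> deg_le k v \<Longrightarrow> ip X w v = 0"
    have "ip X w u = 0" by (rule w(2)[OF _ u(1)]) simp
    then have "ip X u w = 0" by (subst ip_commute) simp
    moreover have "v = \<phi> - (\<phi> - u') - u" by (simp add: v_def)
    then have "ip X v w = ip X \<phi> w - ip X (\<phi> - u') w - ip X u w" by (simp only: ip_diff_left)
    ultimately show "ip X \<phi> w = ip X v w" using u'(2)[OF w(1)] by simp
  qed simp_all
  have "u' = u + v" by (simp add: v_def)
  then have "ip X u' u' = ip X u u + ip X u v + (ip X v u + ip X v v)" by (simp only: ip_add_left ip_add_right add_ac)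
  moreover have "ip X v u = 0" by (rule orth[OF _ u(1)]) simp
  moreover from this have "ip X u v = 0" by (subst ip_commute) simp
  ultimately have "ip X u' u' = ip X u u + ip X v v" by simp
  then have "(\<Sum>g\<in>X. (cmod (u' g))\<^sup>2) = (\<Sum>g\<in>X. (cmod (u g))\<^sup>2) + (\<Sum>g\<in>X. (cmod (v g))\<^sup>2)"
    unfolding ip_self of_real_add[symmetric] by (simp only: of_real_eq_iff)
  then have "real (card X) * (\<Sum>g\<in>X. (cmod (u' g))\<^sup>2) = real (card X) * (\<Sum>g\<in>X. (cmod (u g))\<^sup>2) + real (card X) * (\<Sum>g\<in>X. (cmod (v g))\<^sup>2)"
    by (simp only: distrib_left)
  also have "\<dots> \<le> ?N\<^sup>2 * (\<Sum>r\<le>r. real CARD('a) ^ r\<^sup>2 * sq (pr r J)) + ?N\<^sup>2 * (real CARD('a) ^ (Suc r)\<^sup>2 * sq (pr (Suc r) J))"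
    by (rule add_mono[OF u(3) b])
  also have "\<dots> = ?N\<^sup>2 * (\<Sum>r\<le>Suc r. real CARD('a) ^ r\<^sup>2 * sq (pr r J))"
    by (simp only: sum.atMost_Suc distrib_left)
  finally show ?case using u' by blast
qed

section \<open>The special linear group\<close>

lemma additive_fiber_card:
  fixes \<phi> :: "'x::{finite,ab_group_add} \<Rightarrow> 'y::{finite,ab_group_add}"
  assumes add: "\<And>x y. \<phi> (x + y) = \<phi> x + \<phi> y" and surj: "surj \<phi>"
  shows "card {x. \<phi> x = y} * CARD('y) = CARD('x)"
proof -
  have diff: "\<phi> (x - z) = \<phi> x - \<phi> z" for x z
    using add[of "x - z" z] by (simp add: eq_diff_eq)
  have eq: "card {x. \<phi> x = z} = card {x. \<phi> x = y}" for z
  proof -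
    obtain c where c: "\<phi> c = z - y" using surj by (metis surj_def)
    have "bij_betw (\<lambda>x. x + c) {x. \<phi> x = y} {x. \<phi> x = z}"
      by (rule bij_betw_byWitness[where f' = "\<lambda>x. x - c"]) (auto simp: add diff c)
    then show ?thesis by (simp add: bij_betw_same_card)
  qed
  have "CARD('x) = card (\<Union>z\<in>UNIV. {x. \<phi> x = z})" by (rule arg_cong[of _ _ card]) auto
  also have "\<dots> = (\<Sum>z\<in>UNIV. card {x. \<phi> x = z})" by (rule card_UN_disjoint) auto
  also have "\<dots> = (\<Sum>z\<in>(UNIV :: 'y set). card {x. \<phi> x = y})" by (rule sum.cong[OF refl eq])
  finally show ?thesis by simp
qed

lemma vec_nth_axis: "axis k c $ i = (if i = k then c else 0)"
  by (simp add: axis_def)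

lemma card_transpose_kernel:
  fixes w :: "'a::{field,finite}^'n"
  assumes "w \<noteq> 0"
  shows "card {A :: 'a^'n^'n. transpose A *v w = 0} * CARD('a^'n) = CARD('a^'n^'n)"
proof (rule additive_fiber_card)
  show "transpose (A + B) *v w = transpose A *v w + transpose B *v w" for A B :: "'a^'n^'n"
    by (simp add: transpose_add matrix_vector_add_left)
  obtain l where l: "dot l w = 1" by (rule exists_functional[OF assms])
  have "transpose (outer l v) *v w = v" for v :: "'a^'n"
  proof -
    have "transpose (outer l v) = outer v l" by (simp add: transpose_def outer_def vec_eq_iff mult.commute)
    then show ?thesis by (simp add: outer_mult_vec l)
  qed
  then show "surj (\<lambda>A :: 'a^'n^'n. transpose A *v w)" by (rule surjI)
qed

lemma card_coordinate_zero:
  "card {w :: 'a::{field,finite}^'n. w $ k = 0} * CARD('a) = CARD('a^'n)"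
proof (rule additive_fiber_card)
  show "surj (\<lambda>w :: 'a^'n. w $ k)" by (rule surjI[of _ "axis k"]) (simp add: vec_nth_axis)
qed simp

definition replace_row :: "'n \<Rightarrow> 'a^'n^'n \<Rightarrow> 'a::comm_ring_1^'n \<Rightarrow> 'a^'n^'n" where
  "replace_row k A w = (\<chi> i. if i = k then w else A $ i)"

lemma det_replace_row_add: "det (replace_row k A (v + w)) = det (replace_row k A v) + det (replace_row k A w)"
  unfolding replace_row_def by (rule det_row_add)

lemma det_replace_row_scale: "det (replace_row k A (c *s w)) = c * det (replace_row k A w)"
  unfolding replace_row_def by (rule det_row_mul)

lemma add_outer_axis: "A + outer (axis k 1) w = replace_row k A (A $ k + w)"
  by (simp add: replace_row_def vec_eq_iff outer_def vec_nth_axis)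

lemma card_det_replace_row:
  fixes A :: "'a::{field,finite}^'n^'n"
  assumes "det (replace_row k A w0) \<noteq> 0"
  shows "card {w. det (A + outer (axis k 1) w) = 1} * CARD('a) = CARD('a^'n)"
proof -
  have "bij_betw (\<lambda>w. A $ k + w) {w. det (A + outer (axis k 1) w) = 1} {w. det (replace_row k A w) = 1}"
    by (rule bij_betw_byWitness[where f' = "\<lambda>w. w - A $ k"]) (auto simp: add_outer_axis)
  then have "card {w. det (A + outer (axis k 1) w) = 1} = card {w. det (replace_row k A w) = 1}"
    by (rule bij_betw_same_card)
  moreover have "card {w. det (replace_row k A w) = 1} * CARD('a) = CARD('a^'n)"
  proof (rule additive_fiber_card)
    show "surj (\<lambda>w. det (replace_row k A w))"
    proof (rule surjI)
      fix c
      show "det (replace_row k A ((c / det (replace_row k A w0)) *s w0)) = c"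
        unfolding det_replace_row_scale using assms by simp
    qed
  qed (rule det_replace_row_add)
  ultimately show ?thesis by simp
qed

text \<open>With row k cleared, the transposed matrix P kills the k-th unit vector, so its range
  misses some z, which becomes the new row. A vector killed by the new transpose has k-th entry 0,
  as z is outside the range, and the hypothesis then makes it zero.\<close>

lemma exists_completing_row:
  fixes A :: "'a::{field,finite}^'n^'n"
  assumes A: "\<And>w. w $ k = 0 \<Longrightarrow> transpose A *v w = 0 \<Longrightarrow> w = 0"
  shows "\<exists>w. det (replace_row k A w) \<noteq> 0"
proof -
  define P where "P = transpose (replace_row k A 0)"
  have Pv: "P *v v = transpose A *v v - (v $ k) *s (A $ k)" for v
  proof -
    have "replace_row k A 0 = A + outer (axis k 1) (- (A $ k))" unfolding add_outer_axis by simp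
    moreover have "transpose (outer (axis k 1) (- (A $ k))) *v v = - ((v $ k) *s (A $ k))"
    proof -
      have "transpose (outer (axis k 1) (- (A $ k))) = outer (- (A $ k)) (axis k 1)"
        by (simp add: transpose_def outer_def vec_eq_iff mult.commute)
      then show ?thesis by (simp add: outer_mult_vec)
    qed
    ultimately show ?thesis by (simp add: P_def transpose_add matrix_vector_add_left)
  qed
  have "P *v axis k 1 = 0"
    unfolding Pv by (simp add: vec_eq_iff matrix_vector_axis vec_nth_axis transpose_def)
  then have "axis k 1 \<in> kern P" by (simp add: kern_def)
  moreover have "axis k 1 \<noteq> (0 :: 'a^'n)" by (simp add: vec_eq_iff vec_nth_axis)
  ultimately have "corank P \<noteq> 0" unfolding corank_eq_0 by blast
  then have "ran P \<noteq> UNIV" using rk_full_ran[of P] by simp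
  then obtain z where z: "z \<notin> ran P" by blast
  have tr: "transpose (replace_row k A z) *v v = P *v v + (v $ k) *s z" for v
  proof -
    have "replace_row k A z = replace_row k A 0 + outer (axis k 1) z" by (simp add: replace_row_def vec_eq_iff outer_def vec_nth_axis)
    moreover have "transpose (outer (axis k 1) z) = outer z (axis k 1)"
      by (simp add: transpose_def outer_def vec_eq_iff mult.commute)
    ultimately show ?thesis by (simp add: P_def transpose_add matrix_vector_add_left outer_mult_vec)
  qed
  have "v = 0" if "transpose (replace_row k A z) *v v = 0" for v
  proof -
    have e: "P *v v + (v $ k) *s z = 0" using that by (simp add: tr)
    have vk: "v $ k = 0"
    proof (rule ccontr)
      assume nz: "v $ k \<noteq> 0"
      have "(v $ k) *s z = P *v (0 - v)"
        unfolding matrix_vector_mult_diff_distrib using e by (simp add: eq_neg_iff_add_eq_0 add.commute)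
      then have "(v $ k) *s z \<in> ran P" by (simp only: mem_ran)
      then have "(1 / v $ k) *s ((v $ k) *s z) \<in> ran P" by (rule vec.subspace_scale[OF subspace_ran])
      then show False using z nz by (simp add: vector_smult_assoc)
    qed
    then have "transpose A *v v = 0" using e Pv[of v] by simp
    then show ?thesis using A vk by blast
  qed
  then have "kern (transpose (replace_row k A z)) = {0}" by (auto simp: kern_def)
  then have "invertible (transpose (replace_row k A z))"
    by (simp only: corank_eq_0[symmetric] corank_eq_0_invertible)
  then have "det (replace_row k A z) \<noteq> 0" by (simp add: invertible_det_nz)
  then show ?thesis by blast
qed

text \<open>
  If no nonzero row vector \<open>w\<close> with \<open>w\<^sub>k = 0\<close> annihilates \<open>A\<close>, then the determinant is a nonzero linear
  function of row \<open>k\<close>. By the union bound this holds for at least half of all matrices.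
\<close>

lemma card_special_linear_ge:
  "CARD('a^'n^'n) \<le> 2 * CARD('a) * card {A :: 'a::{field,finite}^'n^'n. det A = 1}"
proof -
  obtain k :: 'n where True by blast
  let ?q = "CARD('a)" and ?V = "CARD('a^'n)" and ?N = "CARD('a^'n^'n)"
  define SL where "SL = {A :: 'a^'n^'n. det A = 1}"
  define \<A> where "\<A> = {A :: 'a^'n^'n. \<forall>w. w $ k = 0 \<longrightarrow> transpose A *v w = 0 \<longrightarrow> w = 0}"
  define W where "W = {w :: 'a^'n. w $ k = 0} - {0}"
  have V0: "0 < ?V" by simp
  have q2: "2 \<le> ?q" by (rule card_field_ge_2)
  \<comment> \<open>Union bound: fewer than q^(n-1) vectors w compete, each annihilating a fraction
    q^(-n) of all matrices, so at most a fraction 1/q <= 1/2 is lost.\<close>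
  have "UNIV - \<A> \<subseteq> (\<Union>w\<in>W. {A :: 'a^'n^'n. transpose A *v w = 0})"
    by (auto simp: \<A>_def W_def)
  then have "card (UNIV - \<A>) \<le> card (\<Union>w\<in>W. {A :: 'a^'n^'n. transpose A *v w = 0})" by (rule card_mono[rotated]) simp
  also have "\<dots> \<le> (\<Sum>w\<in>W. card {A :: 'a^'n^'n. transpose A *v w = 0})" by (rule card_UN_le) simp
  finally have "card (UNIV - \<A>) * ?V \<le> (\<Sum>w\<in>W. card {A :: 'a^'n^'n. transpose A *v w = 0}) * ?V" by simp
  also have "\<dots> = (\<Sum>w\<in>W. card {A :: 'a^'n^'n. transpose A *v w = 0} * ?V)" by (rule sum_distrib_right)
  also have "\<dots> = (\<Sum>w\<in>W. ?N)"
    by (rule sum.cong[OF refl]) (rule card_transpose_kernel, simp add: W_def)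
  also have "\<dots> = card W * ?N" by (simp only: sum_constant of_nat_id)
  also have "\<dots> \<le> card {w :: 'a^'n. w $ k = 0} * ?N"
    by (rule mult_le_mono1[OF card_mono]) (auto simp: W_def)
  finally have "card (UNIV - \<A>) * ?V * ?q \<le> card {w :: 'a^'n. w $ k = 0} * ?N * ?q" by (rule mult_le_mono1)
  also have "\<dots> = (card {w :: 'a^'n. w $ k = 0} * ?q) * ?N" by (simp only: mult_ac)
  also have "\<dots> = ?N * ?V" unfolding card_coordinate_zero by (rule mult.commute)
  finally have "(card (UNIV - \<A>) * ?q) * ?V \<le> ?N * ?V" by (simp only: mult_ac)
  then have "card (UNIV - \<A>) * ?q \<le> ?N" using V0 by (simp only: mult_le_cancel2)
  then have "card (UNIV - \<A>) * 2 \<le> ?N" using mult_le_mono2[OF q2, of "card (UNIV - \<A>)"] by linarith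
  moreover have "card (UNIV - \<A>) = ?N - card \<A>" by (rule card_Diff_subset) simp_all
  moreover have "card \<A> \<le> ?N" by (rule card_mono) simp_all
  ultimately have half: "?N \<le> 2 * card \<A>" by linarith
  \<comment> \<open>The pairs (A, w) for which adding w to row k of A gives determinant 1 are
    counted twice: a good A has q^(n-1) partners w, and each w has exactly \<open>card SL\<close>
    partners A.\<close>
  have tr: "card {A :: 'a^'n^'n. det (A + outer (axis k 1) w) = 1} = card SL" for w
  proof -
    have "bij_betw (\<lambda>A. A + outer (axis k 1) w) {A. det (A + outer (axis k 1) w) = 1} SL"
      by (rule bij_betw_byWitness[where f' = "\<lambda>A. A - outer (axis k 1) w"]) (auto simp: SL_def)
    then show ?thesis by (rule bij_betw_same_card)
  qed
  define g where "g A = card {w. det (A + outer (axis k 1) w) = 1}" for A :: "'a^'n^'n"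
  have "(\<Sum>A\<in>\<A>. g A * ?q) = (\<Sum>A\<in>\<A>. ?V)"
  proof (rule sum.cong[OF refl])
    fix A assume A: "A \<in> \<A>"
    have "\<exists>w. det (replace_row k A w) \<noteq> 0"
      by (rule exists_completing_row) (use A in \<open>simp add: \<A>_def\<close>)
    then obtain w0 where "det (replace_row k A w0) \<noteq> 0" by blast
    then show "g A * ?q = ?V" unfolding g_def by (rule card_det_replace_row)
  qed
  then have h1: "card \<A> * ?V = (\<Sum>A\<in>\<A>. g A) * ?q"
    unfolding sum_distrib_right by (simp only: sum_constant of_nat_id)
  have h2: "(\<Sum>A\<in>\<A>. g A) \<le> (\<Sum>A\<in>UNIV. g A)" by (rule sum_mono2) simp_all
  have "(\<Sum>A\<in>UNIV. g A) = (\<Sum>A\<in>(UNIV :: ('a^'n^'n) set). \<Sum>w\<in>{w. w \<in> UNIV \<and> det (A + outer (axis k 1) w) = 1}. 1)"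
    unfolding g_def by simp
  also have "\<dots> = (\<Sum>w\<in>(UNIV :: ('a^'n) set). \<Sum>A\<in>{A :: 'a^'n^'n. A \<in> UNIV \<and> det (A + outer (axis k 1) w) = 1}. (1::nat))"
    by (rule sum.swap_restrict) simp_all
  also have "\<dots> = (\<Sum>w\<in>(UNIV :: ('a^'n) set). card SL)" using tr by simp
  also have "\<dots> = ?V * card SL" by (simp only: sum_constant of_nat_id)
  finally have h3: "(\<Sum>A\<in>UNIV. g A) = ?V * card SL" .
  have "card \<A> * ?V \<le> (?V * card SL) * ?q" unfolding h1 h3[symmetric] by (rule mult_le_mono1[OF h2])
  then have "card \<A> * ?V \<le> (card SL * ?q) * ?V" by (simp only: mult_ac)
  then have "card \<A> \<le> card SL * ?q" using V0 by (simp only: mult_le_cancel2)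
  with half have "?N \<le> 2 * (card SL * ?q)" by linarith
  then show ?thesis unfolding SL_def by (simp only: mult_ac)
qed

section \<open>Transvections and characters of the special linear group\<close>

abbreviation (input) tv :: "'a::comm_ring_1^'n \<Rightarrow> 'a^'n \<Rightarrow> 'a^'n^'n" where
  "tv u v \<equiv> mat 1 + outer u v"

lemma tv_vec: "tv u v *v x = x + dot v x *s u"
  by (simp add: matrix_vector_add_left outer_mult_vec)

lemma dot_minus_right: "dot x (- y) = - dot x y"
  using dot_scale_right[of x "- 1" y] by (simp add: vector_sneg_minus1[symmetric])

lemma tv_inverse:
  assumes "dot v u = 0"
  shows "tv u v ** tv (- u) v = mat 1"
  unfolding matrix_eq
proof
  fix x
  have 1: "tv (- u) v *v x = x - dot v x *s u" by (simp add: tv_vec)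
  have 2: "dot v (x - dot v x *s u) = dot v x" by (simp add: dot_diff_right dot_scale_right assms)
  show "tv u v ** tv (- u) v *v x = mat 1 *v x"
    unfolding matrix_vector_mul_assoc[symmetric] 1 unfolding tv_vec 2 by simp
qed

text \<open>A coordinate-free form of the relation [e_ik, e_kj] = e_ij between elementary matrices,
  with w and z in the role of the intermediate index k.\<close>

lemma tv_commutator:
  fixes u v :: "'a::{field,finite}^'n"
  assumes "dot v u = 0" "dot w u = 0" "dot v z = 0" "dot w z = 1"
  shows "tv u w ** tv z v ** tv (- u) w ** tv (- z) v = tv u v"
  unfolding matrix_eq
proof
  fix x
  define \<alpha> \<beta> where "\<alpha> = dot v x" and "\<beta> = dot w x"
  have 1: "tv (- z) v *v x = x - \<alpha> *s z" by (simp add: tv_vec \<alpha>_def)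
  have "dot w (x - \<alpha> *s z) = \<beta> - \<alpha>" by (simp add: dot_diff_right dot_scale_right assms \<beta>_def)
  then have 2: "tv (- u) w *v (x - \<alpha> *s z) = x - \<alpha> *s z - (\<beta> - \<alpha>) *s u" by (simp add: tv_vec)
  have "dot v (x - \<alpha> *s z - (\<beta> - \<alpha>) *s u) = \<alpha>" by (simp add: dot_diff_right dot_scale_right assms \<alpha>_def)
  then have 3: "tv z v *v (x - \<alpha> *s z - (\<beta> - \<alpha>) *s u) = x - (\<beta> - \<alpha>) *s u" by (simp add: tv_vec)
  have "dot w (x - (\<beta> - \<alpha>) *s u) = \<beta>" by (simp add: dot_diff_right dot_scale_right assms \<beta>_def)
  then have "tv u w *v (x - (\<beta> - \<alpha>) *s u) = x - (\<beta> - \<alpha>) *s u + \<beta> *s u" by (simp only: tv_vec)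
  also have "\<dots> = x + \<alpha> *s u" by (simp add: vec_eq_iff algebra_simps)
  finally have 4: "tv u w *v (x - (\<beta> - \<alpha>) *s u) = x + \<alpha> *s u" .
  show "tv u w ** tv z v ** tv (- u) w ** tv (- z) v *v x = tv u v *v x"
    unfolding matrix_vector_mul_assoc[symmetric] 1 2 3 4 by (simp add: tv_vec \<alpha>_def)
qed

text \<open>For n >= 3 the hyperplane annihilated by v is larger than a line, so it contains some z
  outside the span of u, and w separates z from u.\<close>

lemma exists_commutator_vectors:
  fixes u v :: "'a::{field,finite}^'n"
  assumes n: "3 \<le> CARD('n)" and v: "v \<noteq> 0"
  shows "\<exists>w z. dot w u = 0 \<and> dot v z = 0 \<and> dot w z = 1"
proof -
  have "\<not> {z. dot v z = 0} \<subseteq> vec.span {u}"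
  proof
    assume sub: "{z. dot v z = 0} \<subseteq> vec.span {u}"
    have "card {z. dot v z = 0} \<le> card (vec.span {u})" by (rule card_mono[OF _ sub]) simp
    also have "\<dots> \<le> CARD('a)"
      unfolding vec.span_singleton by (rule card_image_le) simp
    finally have 1: "card {z. dot v z = 0} \<le> CARD('a)" .
    have "card {z. dot v z = 0} * CARD('a) = CARD('a^'n)"
    proof (rule additive_fiber_card)
      obtain l where l: "dot l v = 1" by (rule exists_functional[OF v])
      show "surj (dot v)"
        by (rule surjI[of _ "\<lambda>c. c *s l"]) (simp add: dot_scale_right dot_commute[of v] l)
    qed (rule dot_add_right)
    then have "CARD('a) ^ CARD('n) \<le> CARD('a) * CARD('a)" using mult_le_mono1[OF 1, of "CARD('a)"] by simp
    also have "\<dots> = CARD('a) ^ 2" by (simp add: power2_eq_square)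
    finally have "CARD('n) \<le> 2" by (rule power_le_imp_le_exp[rotated]) simp
    then show False using n by simp
  qed
  then obtain z where z: "dot v z = 0" "z \<notin> vec.span {u}" by blast
  obtain w where w: "\<forall>s\<in>vec.span {u}. dot w s = 0" "dot w z = 1"
    by (rule separate_subspace[OF vec.subspace_span z(2)])
  have "dot w u = 0" using w(1) vec.span_base[of u "{u}"] by simp
  then show ?thesis using z w by blast
qed

text \<open>As a commutator, a transvection is a product in which the determinants of mutually
  inverse factors cancel.\<close>

lemma det_tv:
  fixes u v :: "'a::{field,finite}^'n"
  assumes n: "3 \<le> CARD('n)" and vu: "dot v u = 0"
  shows "det (tv u v) = 1"
proof (cases "v = 0")
  case True
  then have "tv u v = mat 1" by (simp add: outer_def vec_eq_iff)
  then show ?thesis by (simp only: det_I)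
next
  case False
  obtain w z where wz: "dot w u = 0" "dot v z = 0" "dot w z = 1"
    using exists_commutator_vectors[OF n False, of u] by blast
  have i: "det (tv x y) * det (tv (- x) y) = 1" if "dot y x = 0" for x y :: "'a^'n"
    using arg_cong[OF tv_inverse[OF that], of det] by (simp add: det_mul)
  have "det (tv u v) = det (tv u w) * det (tv z v) * det (tv (- u) w) * det (tv (- z) v)"
    unfolding tv_commutator[OF vu wz, symmetric] by (simp only: det_mul)
  also have "\<dots> = (det (tv u w) * det (tv (- u) w)) * (det (tv z v) * det (tv (- z) v))"
    by (simp only: mult_ac)
  finally show ?thesis unfolding i[OF wz(1)] i[OF wz(2)] by simp
qed

text \<open>The direction must be w - y, so the functional has to be 1 at y and vanish on F and on y
  - w. The hypothesis is the condition for separating y from these.\<close>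

lemma exists_tv_moving:
  fixes y w :: "'a::{field,finite}^'n"
  assumes F: "vec.subspace F" and y: "y \<notin> vec.span (insert (y - w) F)"
  shows "\<exists>u v. dot v u = 0 \<and> tv u v *v y = w \<and> (\<forall>f\<in>F. tv u v *v f = f)"
proof -
  obtain v where v: "\<forall>s\<in>vec.span (insert (y - w) F). dot v s = 0" "dot v y = 1"
    by (rule separate_subspace[OF vec.subspace_span y])
  have "dot v (y - w) = 0" using v(1) vec.span_base[of "y - w" "insert (y - w) F"] by simp
  then have "dot v (w - y) = 0" by (simp add: dot_diff_right)
  moreover have "dot v f = 0" if "f \<in> F" for f using v(1) vec.span_base[of f "insert (y - w) F"] that by simp
  ultimately show ?thesis
    by (intro exI[of _ "w - y"] exI[of _ v]) (simp add: tv_vec v(2))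
qed

lemma span_insert_subspace:
  assumes "vec.subspace F" "x \<in> vec.span (insert a F)"
  shows "\<exists>b. x - b *s a \<in> F"
  using assms by (simp add: vec.span_breakdown_eq) (metis vec.span_eq_iff)

text \<open>Induction on a set K of coordinates such that A fixes every vector vanishing on K. To
  remove k, the vector y = A e_k is moved back to e_k by transvections fixing F. One is enough if y
  is outside the span of e_k and F; otherwise two are used when another coordinate is left in K. If
  none is left, one transvection makes the matrix diagonal with a single entry c possibly different
  from 1, and the determinant gives c = 1.\<close>

lemma transvections_generate:
  fixes A :: "'a::{field,finite}^'n^'n"
  assumes n: "3 \<le> CARD('n)"
    and tvP: "\<And>u v B. dot v u = 0 \<Longrightarrow> P (tv u v ** B) \<Longrightarrow> P B"
    and oneP: "P (mat 1)"
    and A: "det A = 1"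
  shows "P A"
proof -
  have "P A" if "det A = 1" "\<And>v. (\<forall>j\<in>K. v $ j = 0) \<Longrightarrow> A *v v = v" for K :: "'n set" and A :: "'a^'n^'n"
    using finite[of K] that
  proof (induction K arbitrary: A rule: finite_induct)
    case empty
    then have "A = mat 1" by (simp add: matrix_eq)
    then show ?case using oneP by simp
  next
    case (insert k K)
    define F where "F = {v :: 'a^'n. \<forall>j\<in>insert k K. v $ j = 0}"
    have F: "vec.subspace F" by (rule vec.subspaceI) (auto simp: F_def)
    have AF: "A *v f = f" if "f \<in> F" for f using insert.prems(2)[of f] that by (simp add: F_def)
    let ?e = "axis k 1 :: 'a^'n"
    have eF: "?e \<notin> F" by (simp add: F_def vec_nth_axis)
    define y where "y = A *v ?e"
    have "invertible A" using insert.prems(1) by (simp add: invertible_det_nz)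
    then have inj: "x = 0" if "A *v x = 0" for x
      using that corank_eq_0_invertible[of A] corank_eq_0[of A] by (auto simp: kern_def)
    have yF: "y \<notin> F"
    proof
      assume yF: "y \<in> F"
      have "A *v (?e - y) = 0" using AF[OF yF] by (simp add: matrix_vector_mult_diff_distrib y_def)
      then have "?e = y" using inj[of "?e - y"] by simp
      then show False using eF yF by simp
    qed
    have split: "v = v $ k *s ?e + (v - v $ k *s ?e)" for v :: "'a^'n" by simp
    have reduce: "P A" if uv: "dot v u = 0" "P (tv u v ** A)" for u v by (rule tvP[OF uv])
    have IHtv: "P B" if B: "det B = 1" "B *v ?e = ?e" "\<And>f. f \<in> F \<Longrightarrow> B *v f = f" for B
    proof (rule insert.IH[OF B(1)])
      fix v :: "'a^'n" assume v: "\<forall>j\<in>K. v $ j = 0"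
      have "v - v $ k *s ?e \<in> F" using v insert.hyps by (auto simp: F_def vec_nth_axis)
      then have "B *v (v - v $ k *s ?e) = v - v $ k *s ?e" by (rule B(3))
      then have "B *v v - v $ k *s ?e = v - v $ k *s ?e" by (simp only: matrix_vector_mult_diff_distrib mat_vec_scale B(2))
      then show "B *v v = v" by simp
    qed
    have one_step: "P A" if y: "y \<notin> vec.span (insert (y - ?e) F)"
    proof -
      obtain u v where uv: "dot v u = 0" "tv u v *v y = ?e" "\<forall>f\<in>F. tv u v *v f = f"
        using exists_tv_moving[OF F y] by blast
      show ?thesis
      proof (rule reduce[OF uv(1)], rule IHtv)
        show "det (tv u v ** A) = 1" by (simp add: det_mul det_tv[OF n uv(1)] insert.prems(1))
        show "tv u v ** A *v ?e = ?e" using uv(2) by (simp only: matrix_vector_mul_assoc[symmetric] y_def)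
        show "tv u v ** A *v f = f" if "f \<in> F" for f
          using uv(3) that by (simp only: matrix_vector_mul_assoc[symmetric] AF[OF that])
      qed
    qed
    show ?case
    proof (cases "y \<in> vec.span (insert ?e F)")
      case False
      show ?thesis
      proof (rule one_step, rule notI)
        assume "y \<in> vec.span (insert (y - ?e) F)"
        then obtain b where b: "y - b *s (y - ?e) \<in> F" using span_insert_subspace[OF F] by blast
        show False
        proof (cases "b = 1")
          case True
          then show False using b eF by simp
        next
          case nb: False
          \<comment> \<open>As b is not 1, the relation can be solved for y, placing it in the span
            excluded by the present case.\<close>
          have "(1 / (1 - b)) *s (y - b *s (y - ?e)) \<in> F" by (rule vec.subspace_scale[OF F b])
          then have "(1 / (1 - b)) *s (y - b *s (y - ?e)) \<in> vec.span (insert ?e F)" by (intro vec.span_base) simp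
          moreover have "(b / (1 - b)) *s ?e \<in> vec.span (insert ?e F)" by (intro vec.span_scale vec.span_base) simp
          ultimately have "(1 / (1 - b)) *s (y - b *s (y - ?e)) - (b / (1 - b)) *s ?e \<in> vec.span (insert ?e F)"
            by (rule vec.span_diff)
          moreover have "(1 / (1 - b)) *s (y - b *s (y - ?e)) - (b / (1 - b)) *s ?e = y"
            unfolding vec_eq_iff
          proof
            fix i
            have "1 / (1 - b) * (y $ i - b * (y $ i - ?e $ i)) - b / (1 - b) * ?e $ i = ((y $ i - b * (y $ i - ?e $ i)) - b * ?e $ i) / (1 - b)"
              by (simp add: diff_divide_distrib)
            also have "(y $ i - b * (y $ i - ?e $ i)) - b * ?e $ i = (1 - b) * y $ i" by (simp add: algebra_simps)
            also have "(1 - b) * y $ i / (1 - b) = y $ i" using nb by simp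
            finally show "((1 / (1 - b)) *s (y - b *s (y - ?e)) - (b / (1 - b)) *s ?e) $ i = y $ i"
              by (simp only: vector_minus_component vector_smult_component)
          qed
          ultimately show False using False by simp
        qed
      qed
    next
      case True
      then obtain c where c: "y - c *s ?e \<in> F" using span_insert_subspace[OF F] by blast
      have yk: "y $ k = c" using c by (simp add: F_def vec_nth_axis)
      have c0: "c \<noteq> 0" using c yF by auto
      show ?thesis
      proof (cases "K = {}")
        case False
        then obtain k' where k': "k' \<in> K" "k' \<noteq> k" using insert.hyps by blast
        let ?e' = "axis k' 1 :: 'a^'n"
        \<comment> \<open>A detour: adding e_k' keeps the nonzero k-th entry, which allows the move
          from y to w, and makes the entry at k' equal to 1, which allows the move from w to
          e_k.\<close>
        define w where "w = y + ?e'"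
        have "y \<notin> vec.span (insert (y - w) F)"
        proof
          assume "y \<in> vec.span (insert (y - w) F)"
          then obtain b where "y - b *s (y - w) \<in> F" using span_insert_subspace[OF F] by blast
          then have "(y - b *s (y - w)) $ k = 0" by (simp add: F_def)
          then show False using yk c0 k'(2) by (simp add: w_def vec_nth_axis)
        qed
        from exists_tv_moving[OF F this] obtain u v where uv: "dot v u = 0" "tv u v *v y = w" "\<forall>f\<in>F. tv u v *v f = f" by blast
        have "w \<notin> vec.span (insert (w - ?e) F)"
        proof
          assume "w \<in> vec.span (insert (w - ?e) F)"
          then obtain b where b: "w - b *s (w - ?e) \<in> F" using span_insert_subspace[OF F] by blast
          have "y $ k' = 0" using c k' by (simp add: F_def vec_nth_axis)
          then have "w $ k' = 1" by (simp add: w_def vec_nth_axis)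
          moreover have "(w - b *s (w - ?e)) $ k' = 0" using b k'(1) by (simp add: F_def)
          ultimately have "b = 1" using k'(2) by (simp add: vec_nth_axis)
          then show False using b eF by simp
        qed
        from exists_tv_moving[OF F this] obtain u' v' where uv': "dot v' u' = 0" "tv u' v' *v w = ?e" "\<forall>f\<in>F. tv u' v' *v f = f" by blast
        show ?thesis
        proof (rule reduce[OF uv(1)], rule tvP[OF uv'(1)], rule IHtv)
          show "det (tv u' v' ** (tv u v ** A)) = 1"
            by (simp add: det_mul det_tv[OF n uv(1)] det_tv[OF n uv'(1)] insert.prems(1))
          show "tv u' v' ** (tv u v ** A) *v ?e = ?e"
            using uv(2) uv'(2) by (simp only: matrix_vector_mul_assoc[symmetric] y_def)
          show "tv u' v' ** (tv u v ** A) *v f = f" if "f \<in> F" for f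
            using uv(3) uv'(3) that by (simp only: matrix_vector_mul_assoc[symmetric] AF[OF that])
        qed
      next
        case K: True
        define u' where "u' = y - c *s ?e"
        \<comment> \<open>Chosen so that the transvection with functional e_k subtracts u' from y,
          whose k-th entry is c.\<close>
        define u where "u = (- (1 / c)) *s u'"
        have eu: "dot ?e u = 0" using yk by (simp add: u_def u'_def dot_scale_right vec_nth_axis)
        define B where "B = tv u ?e ** A"
        have detB: "det B = 1" unfolding B_def by (simp add: det_mul det_tv[OF n eu] insert.prems(1))
        have Be: "B *v ?e = c *s ?e"
        proof -
          have "B *v ?e = y + c *s u" unfolding B_def matrix_vector_mul_assoc[symmetric] y_def[symmetric] by (simp add: tv_vec yk)
          also have "c *s u = - u'" using c0 by (simp add: u_def vector_smult_assoc)
          finally show ?thesis by (simp add: u'_def)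
        qed
        have Bf: "B *v f = f" if "f \<in> F" for f
          using that unfolding B_def matrix_vector_mul_assoc[symmetric] AF[OF that] by (simp add: tv_vec F_def)
        have Be': "B *v axis j 1 = axis j 1" if "j \<noteq> k" for j
          by (rule Bf) (use that in \<open>simp add: F_def K vec_nth_axis\<close>)
        have ent: "B $ i $ j = (if i = j then (if j = k then c else 1) else 0)" for i j
        proof (cases "j = k")
          case True
          have "B $ i $ j = (c *s ?e) $ i" using matrix_vector_axis[of B k i] unfolding Be True by (rule sym)
          then show ?thesis using True by (simp add: vec_nth_axis)
        next
          case False
          have "B $ i $ j = axis j 1 $ i" using matrix_vector_axis[of B j i] unfolding Be'[OF False] by (rule sym)
          then show ?thesis using False by (simp add: vec_nth_axis)
        qed
        have "det B = (\<Prod>i\<in>UNIV. B $ i $ i)" by (rule det_diagonal) (simp add: ent)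
        also have "\<dots> = c" by (simp add: ent)
        finally have "c = 1" using detB by simp
        then show ?thesis
          using Be Bf IHtv[OF detB] reduce[OF eu] unfolding B_def by simp
      qed
    qed
  qed
  from this[OF A, of UNIV] have gen: "(\<And>v. v = 0 \<Longrightarrow> A *v v = v) \<Longrightarrow> P A" by (simp add: vec_eq_iff)
  show ?thesis by (rule gen) simp
qed

text \<open>A multiplicative function into the complex numbers is 1 on commutators, hence on
  transvections, and these generate.\<close>

lemma special_linear_character_trivial:
  fixes \<psi> :: "'a::{field,finite}^'n^'n \<Rightarrow> complex"
  assumes n: "3 \<le> CARD('n)"
    and mult: "\<And>A B. det A = 1 \<Longrightarrow> det B = 1 \<Longrightarrow> \<psi> (A ** B) = \<psi> A * \<psi> B"
    and nz: "\<And>A. det A = 1 \<Longrightarrow> \<psi> A \<noteq> 0"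
    and A: "det A = 1"
  shows "\<psi> A = 1"
proof -
  have one: "\<psi> (mat 1) = 1"
    using mult[of "mat 1" "mat 1"] nz[of "mat 1"] by simp
  have tv: "\<psi> (tv u v) = 1" if vu: "dot v u = 0" for u v :: "'a^'n"
  proof (cases "v = 0")
    case True
    then have "tv u v = mat 1" by (simp add: outer_def vec_eq_iff)
    then show ?thesis using one by (simp only:)
  next
    case False
    obtain w z where wz: "dot w u = 0" "dot v z = 0" "dot w z = 1"
      using exists_commutator_vectors[OF n False, of u] by blast
    have d: "det (tv u w) = 1" "det (tv z v) = 1" "det (tv (- u) w) = 1" "det (tv (- z) v) = 1"
      by (rule det_tv[OF n], simp add: wz dot_minus_right)+
    have i: "\<psi> (tv x y) * \<psi> (tv (- x) y) = 1" if "dot y x = 0" for x y :: "'a^'n"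
    proof -
      have "det (tv x y) = 1" "det (tv (- x) y) = 1"
        by (rule det_tv[OF n], simp add: that dot_minus_right)+
      from mult[OF this] show ?thesis unfolding tv_inverse[OF that] one by simp
    qed
    have "\<psi> (tv u v) = \<psi> (tv u w) * \<psi> (tv z v) * \<psi> (tv (- u) w) * \<psi> (tv (- z) v)"
      using mult[of "tv u w ** tv z v ** tv (- u) w" "tv (- z) v"] mult[of "tv u w ** tv z v" "tv (- u) w"] mult[of "tv u w" "tv z v"]
      unfolding tv_commutator[OF vu wz] by (simp only: det_mul d mult_1 simp_thms)
    also have "\<dots> = (\<psi> (tv u w) * \<psi> (tv (- u) w)) * (\<psi> (tv z v) * \<psi> (tv (- z) v))"
      by (simp only: mult_ac)
    finally show ?thesis unfolding i[OF wz(1)] i[OF wz(2)] by simp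
  qed
  have "det A = 1 \<longrightarrow> \<psi> A = 1"
  proof (rule transvections_generate[OF n _ _ A, where P = "\<lambda>A. det A = 1 \<longrightarrow> \<psi> A = 1"])
    fix u v :: "'a^'n" and B assume vu: "dot v u = 0" and IH: "det (tv u v ** B) = 1 \<longrightarrow> \<psi> (tv u v ** B) = 1"
    show "det B = 1 \<longrightarrow> \<psi> B = 1"
    proof
      assume B: "det B = 1"
      have "\<psi> (tv u v ** B) = 1" using IH by (simp add: det_mul det_tv[OF n vu] B)
      then show "\<psi> B = 1" unfolding mult[OF det_tv[OF n vu] B] tv[OF vu] by simp
    qed
  qed (simp add: one)
  then show ?thesis using A by blast
qed

section \<open>Globalness\<close>

lemma matrix_sub_ldistrib_gen: "A ** (B - C) = A ** B - A ** (C::'a::comm_ring_1^'n^'m)"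
  by (simp add: matrix_matrix_mult_def vec_eq_iff right_diff_distrib sum_subtractf)

lemma maps_quotient_range:
  fixes P S :: "'a::{field,finite}^'n^'n"
  shows "maps_quotient_into (kern P) (ran S) = range (\<lambda>A :: 'a^'n^'n. S ** A ** P)"
proof
  show "range (\<lambda>A :: 'a^'n^'n. S ** A ** P) \<subseteq> maps_quotient_into (kern P) (ran S)"
    by (auto simp: maps_quotient_into_def kern_def matrix_vector_mul_assoc[symmetric] simp del: matrix_vector_mul_assoc)
  show "maps_quotient_into (kern P) (ran S) \<subseteq> range (\<lambda>A :: 'a^'n^'n. S ** A ** P)"
  proof
    fix Z assume Z: "Z \<in> maps_quotient_into (kern P) (ran S)"
    then have "kern P \<subseteq> kern Z" "ran Z \<subseteq> ran S"
      by (auto simp: maps_quotient_into_def kern_def ran_def)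
    then obtain W Y where WY: "Z = W ** P" "Z = S ** Y" using kern_subset_factor ran_subset_factor by metis
    obtain Q where Q: "S ** Q ** S = S" using exists_generalized_inverse[of S] by blast
    have "S ** (Q ** W) ** P = S ** Q ** Z" unfolding WY(1) by (simp only: matrix_mul_assoc)
    also have "\<dots> = S ** Q ** S ** Y" unfolding WY(2) by (simp only: matrix_mul_assoc)
    also have "\<dots> = Z" unfolding Q WY(2) ..
    finally show "Z \<in> range (\<lambda>A :: 'a^'n^'n. S ** A ** P)" by (metis rangeI)
  qed
qed

text \<open>The map A |-> S A P is additive, so all its fibres have the same size. This links the
  averages in \<open>is_global\<close> with the restrictions \<open>rst\<close>.\<close>

lemma mean_maps_quotient:
  fixes P S :: "'a::{field,finite}^'n^'n" and F :: "'a^'n^'n \<Rightarrow> real"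
  shows "mean (maps_quotient_into (kern P) (ran S)) F = EE (\<lambda>A :: 'a^'n^'n. F (S ** A ** P))"
proof -
  let ?\<phi> = "\<lambda>A :: 'a^'n^'n. S ** A ** P"
  let ?c = "card {A :: 'a^'n^'n. ?\<phi> A = 0}"
  have s: "(\<Sum>A\<in>UNIV. G (?\<phi> A)) = real ?c * (\<Sum>y\<in>range ?\<phi>. G y)" for G :: "'a^'n^'n \<Rightarrow> real"
  proof -
    have "(\<Sum>A\<in>UNIV. G (?\<phi> A)) = (\<Sum>y\<in>range ?\<phi>. \<Sum>A\<in>{A. A \<in> UNIV \<and> ?\<phi> A = y}. G (?\<phi> A))"
      by (rule sum.group[symmetric]) auto
    also have "\<dots> = (\<Sum>y\<in>range ?\<phi>. real ?c * G y)"
    proof (rule sum.cong[OF refl])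
      fix y assume "y \<in> range ?\<phi>"
      then obtain A0 where A0: "y = ?\<phi> A0" by blast
      have "bij_betw (\<lambda>A. A + A0) {A. ?\<phi> A = 0} {A. A \<in> UNIV \<and> ?\<phi> A = y}"
        by (rule bij_betw_byWitness[where f' = "\<lambda>A. A - A0"])
           (auto simp: A0 matrix_add_rdistrib_gen matrix_sub_rdistrib_gen matrix_add_ldistrib matrix_sub_ldistrib_gen)
      then have "card {A. A \<in> UNIV \<and> ?\<phi> A = y} = ?c" by (simp add: bij_betw_same_card)
      moreover have "(\<Sum>A\<in>{A. A \<in> UNIV \<and> ?\<phi> A = y}. G (?\<phi> A)) = (\<Sum>A\<in>{A. A \<in> UNIV \<and> ?\<phi> A = y}. G y)" by (rule sum.cong) auto
      ultimately show "(\<Sum>A\<in>{A. A \<in> UNIV \<and> ?\<phi> A = y}. G (?\<phi> A)) = real ?c * G y" by simp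
    qed
    finally show ?thesis by (simp only: sum_distrib_left)
  qed
  have "(0 :: 'a^'n^'n) \<in> {A. ?\<phi> A = 0}" by simp
  then have c0: "0 < real ?c" by (metis card_gt_0_iff empty_iff finite of_nat_0_less_iff)
  have "real CARD('a^'n^'n) = real ?c * real (card (range ?\<phi>))" using s[of "\<lambda>_. 1"] by (simp only: sum_constant mult_1_right)
  moreover have "sum F (range ?\<phi>) / real (card (range ?\<phi>)) = (real ?c * sum F (range ?\<phi>)) / (real ?c * real (card (range ?\<phi>)))"
    by (rule mult_divide_mult_cancel_left[symmetric]) (rule less_imp_neq[OF c0, THEN not_sym])
  ultimately show ?thesis unfolding maps_quotient_range mean_def s by (simp only:)
qed

lemma dim_kern: "vec.dim (kern P) = corank P" for P :: "'a::{field,finite}^'n^'n"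
proof -
  have "CARD('a) ^ vec.dim (kern P) = CARD('a) ^ corank P"
    using card_kern[of P] card_subspace[OF subspace_kern, of P] by simp
  then show ?thesis by (rule power_inject_exp[THEN iffD1, rotated]) simp
qed

text \<open>\<open>is_global\<close> speaks of total corank exactly d. Smaller coranks follow by
  averaging: composing P with a projection Q that kills a line of \<open>ran P\<close> raises the
  corank by one, and the mean over B of the restrictions based at T + S B P is the mean in question.
  Since d <= n, P is nonzero as long as the total is below d.\<close>

lemma global_rst:
  fixes P S T :: "'a::{field,finite}^'n^'n"
  assumes g: "is_global G d \<epsilon> f" and d: "d \<le> CARD('n)" and SP: "corank S + corank P \<le> d"
  shows "EE (\<lambda>A. (cmod (zero_extension G f (T + S ** A ** P)))\<^sup>2) \<le> \<epsilon>"
  using SP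
proof (induction "d - (corank S + corank P)" arbitrary: P T)
  case 0
  then have tot: "corank S + corank P = d" by simp
  have "vec.dim (kern P) + (CARD('n) - vec.dim (ran S)) = d"
    using tot unfolding dim_kern corank_def rk_def[symmetric] by linarith
  then have "vec.subspace (kern P) \<and> vec.subspace (ran S) \<and> vec.dim (kern P) + (CARD('n) - vec.dim (ran S)) = d"
    by (intro conjI subspace_kern subspace_ran)
  then have "mean (maps_quotient_into (kern P) (ran S)) (\<lambda>Z. (cmod (zero_extension G f (Z + T)))\<^sup>2) \<le> \<epsilon>"
    using g unfolding is_global_def by blast
  then show ?case unfolding mean_maps_quotient by (simp only: add.commute)
next
  case (Suc m)
  have "corank P < CARD('n)" using Suc.hyps(2) d by linarith
  then have "P \<noteq> 0" by (auto simp: corank_def)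
  then obtain x where x: "P *v x \<noteq> 0" by (metis matrix_eq matrix_vector_mult_0)
  obtain l where l: "dot l (P *v x) = 1" by (rule exists_functional[OF x])
  define Q where "Q = mat 1 - outer (P *v x) l"
  have kQ: "kern Q = {c *s (P *v x) | c. True}" unfolding Q_def by (rule line_projection(1)[OF l])
  have "kern Q = vec.span {P *v x}" unfolding kQ vec.span_singleton by auto
  then have cQ: "corank Q = 1" using x by (simp add: dim_kern[symmetric] vec.dim_eq_card_independent)
  have "kern P \<subset> kern (Q ** P)"
  proof
    show "kern P \<subseteq> kern (Q ** P)" by (auto simp: kern_def matrix_vector_mul_assoc[symmetric] simp del: matrix_vector_mul_assoc)
    have "P *v x \<in> kern Q" unfolding kQ by (metis (mono_tags, lifting) mem_Collect_eq vector_smult_lid)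
    then have "x \<in> kern (Q ** P)" by (simp add: kern_def matrix_vector_mul_assoc)
    then show "kern P \<noteq> kern (Q ** P)" using x by (auto simp: kern_def)
  qed
  then have "card (kern P) < card (kern (Q ** P))" by (rule psubset_card_mono[rotated]) simp
  then have "corank P < corank (Q ** P)" unfolding card_kern by (rule power_less_imp_less_exp[rotated]) simp
  moreover have "corank (Q ** P) \<le> corank P + 1" using corank_mult[of Q P] cQ by simp
  ultimately have c: "corank (Q ** P) = corank P + 1" by linarith
  let ?F = "\<lambda>A. (cmod (zero_extension G f A))\<^sup>2"
  have le: "EE (\<lambda>A. ?F ((T + S ** B ** P) + S ** A ** (Q ** P))) \<le> \<epsilon>" for B
    by (rule Suc.hyps(1)) (use Suc.hyps(2) c in linarith)+
  have "EE (\<lambda>A. ?F (T + S ** A ** P)) = EE (\<lambda>C :: 'a^'n^'n. EE (\<lambda>B. ?F (T + S ** (B + C ** Q) ** P)))"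
  proof -
    have "EE (\<lambda>B. ?F (T + S ** (B + C ** Q) ** P)) = EE (\<lambda>B. ?F (T + S ** B ** P))" for C :: "'a^'n^'n"
      by (rule mean_translate)
    then show ?thesis by (simp only: mean_const)
  qed
  also have "\<dots> = EE (\<lambda>B. EE (\<lambda>C :: 'a^'n^'n. ?F (T + S ** (B + C ** Q) ** P)))" by (rule mean_swap)
  also have "\<dots> = EE (\<lambda>B. EE (\<lambda>C. ?F ((T + S ** B ** P) + S ** C ** (Q ** P))))"
    by (simp only: matrix_add_ldistrib matrix_add_rdistrib_gen matrix_mul_assoc add.assoc)
  also have "\<dots> \<le> \<epsilon>" by (rule mean_le_const) (simp_all add: le)
  finally show ?case .
qed

section \<open>Matrix coefficients\<close>

lemma deg_le_sum: "(\<And>i. i \<in> I \<Longrightarrow> deg_le d (F i)) \<Longrightarrow> deg_le d (\<lambda>A. \<Sum>i\<in>I. F i A)"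
  for F :: "'i \<Rightarrow> 'a::{field,finite}^'n^'n \<Rightarrow> complex"
  using fun_space.subspace_sum[OF subspace_deg_le, of I F d] by (simp add: sum_fun_apply[abs_def] fun_eq_iff)

lemma deg_le_cmult: "deg_le d F \<Longrightarrow> deg_le d (\<lambda>A. c * F A)"
  unfolding deg_le_def by (simp add: fc_cmult)

lemma deg_le_const: "deg_le d (\<lambda>A. c :: complex)"
  using deg_le_cmult[OF deg_le_mono[OF deg_le_comp_right[of 0 "\<lambda>_. 1"]], of d c] by simp

text \<open>The event A y = z depends on A only through its product with the rank-one matrix y
  e_k^T.\<close>

lemma deg_le_indicator:
  fixes y z :: "'a::{field,finite}^'n"
  shows "deg_le 1 (\<lambda>A. if A *v y = z then 1 else 0)"
proof -
  obtain k :: 'n where True by blast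
  have out: "outer u (axis k 1) = outer v (axis k 1) \<longleftrightarrow> u = v" for u v :: "'a^'n"
  proof
    assume "outer u (axis k 1) = outer v (axis k 1)"
    then have "outer u (axis k 1) *v axis k 1 = outer v (axis k 1) *v axis k 1" by simp
    then show "u = v" by (simp add: outer_mult_vec)
  qed simp
  have eq: "(\<lambda>A. if A *v y = z then 1 else 0) = (\<lambda>A. (\<lambda>w. if w = outer z (axis k 1) then 1 else 0) (A ** outer y (axis k 1)) :: complex)"
    unfolding mult_outer out ..
  show ?thesis unfolding eq by (rule deg_le_mono[OF deg_le_comp_right rk_outer])
qed

lemma deg_le_indicator_list:
  "deg_le (length ys) (\<lambda>A :: 'a::{field,finite}^'n^'n. if map ((*v) A) ys = xs then 1 else 0)"
proof (induction ys arbitrary: xs)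
  case Nil
  show ?case using deg_le_const[of 0 "if [] = xs then 1 else 0"] by simp
next
  case (Cons y ys)
  show ?case
  proof (cases xs)
    case Nil
    then show ?thesis using deg_le_const[of "length (y # ys)" 0] by simp
  next
    case C: (Cons x xs')
    have "(\<lambda>A :: 'a^'n^'n. if map ((*v) A) (y # ys) = xs then 1 else 0) = (\<lambda>A. (if A *v y = x then 1 else 0) * (if map ((*v) A) ys = xs' then 1 else 0) :: complex)"
      by (auto simp: C)
    then show ?thesis using deg_le_mult[OF deg_le_indicator Cons.IH, of y x xs'] by simp
  qed
qed

text \<open>
  The functional is evaluation against the component of \<open>T e\<close> orthogonal to \<open>T (ker L)\<close>, where \<open>L e = 1\<close>.
\<close>

lemma functional_representation:
  fixes T :: "complex Matrix.vec \<Rightarrow> 'x \<Rightarrow> complex" and L :: "complex Matrix.vec \<Rightarrow> complex"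
  assumes X: "finite X" and T: "T \<in> carrier_vec N \<rightarrow> L2 X"
    and Tadd: "\<And>v w. v \<in> carrier_vec N \<Longrightarrow> w \<in> carrier_vec N \<Longrightarrow> T (v + w) = T v + T w"
    and Tscale: "\<And>c v. v \<in> carrier_vec N \<Longrightarrow> T (c \<cdot>\<^sub>v v) = fscale c (T v)"
    and inj: "inj_on T (carrier_vec N)"
    and Ladd: "\<And>v w. v \<in> carrier_vec N \<Longrightarrow> w \<in> carrier_vec N \<Longrightarrow> L (v + w) = L v + L w"
    and Lscale: "\<And>c v. v \<in> carrier_vec N \<Longrightarrow> L (c \<cdot>\<^sub>v v) = c * L v"
  shows "\<exists>lam. \<forall>w\<in>carrier_vec N. L w = (\<Sum>x\<in>X. lam x * T w x)"
proof (cases "\<forall>w\<in>carrier_vec N. L w = 0")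
  case True
  then show ?thesis by (intro exI[of _ "\<lambda>_. 0"]) simp
next
  case False
  then obtain e0 where e0: "e0 \<in> carrier_vec N" "L e0 \<noteq> 0" by blast
  define e where "e = (1 / L e0) \<cdot>\<^sub>v e0"
  have e: "e \<in> carrier_vec N" "L e = 1" using e0 by (simp_all add: e_def Lscale)
  define K where "K = {c\<in>carrier_vec N. L c = 0}"
  have z0: "0 \<cdot>\<^sub>v 0\<^sub>v N = (0\<^sub>v N :: complex Matrix.vec)" by (rule eq_vecI) simp_all
  have L0: "L (0\<^sub>v N) = 0"
    using Lscale[of "0\<^sub>v N" 0] by (simp add: z0)
  have T0: "T (0\<^sub>v N) = 0"
  proof -
    have "T (0 \<cdot>\<^sub>v 0\<^sub>v N) = fscale 0 (T (0\<^sub>v N))" by (rule Tscale) simp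
    then show ?thesis by (simp add: fscale_def zero_fun_def z0)
  qed
  have sub: "fun_space.subspace (T ` K)"
  proof (rule fun_space.subspaceI)
    show "0 \<in> T ` K" using T0 L0 by (intro image_eqI[of _ _ "0\<^sub>v N"]) (simp_all add: K_def)
    fix s t assume "s \<in> T ` K" "t \<in> T ` K"
    then obtain v w where "v \<in> K" "w \<in> K" "s = T v" "t = T w" by blast
    then show "s + t \<in> T ` K" by (intro image_eqI[of _ _ "v + w"]) (simp_all add: K_def Tadd Ladd)
  next
    fix c s assume "s \<in> T ` K"
    then obtain v where "v \<in> K" "s = T v" by blast
    then show "fscale c s \<in> T ` K" by (intro image_eqI[of _ _ "c \<cdot>\<^sub>v v"]) (simp_all add: K_def Tscale Lscale)
  qed
  have "T ` K \<subseteq> L2 X" using T by (auto simp: K_def)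
  from exists_projection_L2[OF X sub this, of "T e"] obtain c0 where c0: "c0 \<in> K" "\<And>c. c \<in> K \<Longrightarrow> ip X (T e - T c0) (T c) = 0"
    by blast
  define r where "r = T e - T c0"
  have ortho: "ip X (T c) r = 0" if "c \<in> K" for c
    using c0(2)[OF that] by (subst ip_commute) (simp add: r_def)
  have "ip X r r \<noteq> 0"
  proof
    assume "ip X r r = 0"
    then have z: "\<forall>x\<in>X. r x = 0" using ip_self_eq_0[OF X] by blast
    have "T e x = T c0 x" for x
    proof (cases "x \<in> X")
      case True
      then show ?thesis using z by (simp add: r_def)
    next
      case False
      have "T e \<in> L2 X" "T c0 \<in> L2 X" using T e(1) c0(1) by (auto simp: K_def)
      then show ?thesis using False by (simp add: L2_def)
    qed
    then have "T e = T c0" by (rule ext)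
    then have "e = c0" using inj e(1) c0(1) by (auto simp: K_def inj_on_def)
    then show False using e(2) c0(1) by (simp add: K_def)
  qed
  moreover have "ip X (T e) r = ip X r r"
  proof -
    have "T e = r + T c0" by (simp add: r_def)
    then have "ip X (T e) r = ip X r r + ip X (T c0) r" by (simp only: ip_add_left)
    then show ?thesis using ortho[OF c0(1)] by simp
  qed
  ultimately have rr: "ip X (T e) r \<noteq> 0" by simp
  have "L w = ip X (T w) r / ip X (T e) r" if w: "w \<in> carrier_vec N" for w
  proof -
    define k where "k = w + (- L w) \<cdot>\<^sub>v e"
    have k: "k \<in> K" using w e by (simp add: k_def K_def Ladd Lscale)
    have "T k = T w + fscale (- L w) (T e)" using w e by (simp add: k_def Tadd Tscale)
    then have "ip X (T k) r = ip X (T w) r + (- L w) * ip X (T e) r" by (simp only: ip_add_left ip_scale_left)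
    then have "ip X (T w) r = L w * ip X (T e) r" using ortho[OF k] by simp
    then show ?thesis using rr by simp
  qed
  then show ?thesis
    by (intro exI[of _ "\<lambda>x. cnj (r x) / ip X (T e) r"]) (simp add: ip_def[of X "T _" r] sum_divide_distrib mult.commute)
qed

lemma smult_mat_mult_vec:
  fixes A :: "complex Matrix.mat"
  assumes "A \<in> carrier_mat N N" "v \<in> carrier_vec N"
  shows "(c \<cdot>\<^sub>m A) *\<^sub>v v = c \<cdot>\<^sub>v (A *\<^sub>v v)"
  using assms by (intro eq_vecI) (auto simp: scalar_prod_def sum_distrib_left mult.assoc)

lemma representation_carrier:
  assumes "representation G N \<rho>" "g \<in> carrier G"
  shows "\<rho> g \<in> carrier_mat N N"
proof -
  have "\<rho> g \<in> carrier (units_of (ring_mat TYPE(complex) N ()))"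
    using assms unfolding representation_def hom_def by blast
  then show ?thesis by (simp add: units_of_def Units_def ring_mat_def)
qed

text \<open>The embedding into functions on k-tuples, with the functional given by u expressed on
  its image, writes the coefficient as a combination of the events g ys = xs. Each is a product of k
  conditions of degree 1.\<close>

lemma coeff_deg_le:
  fixes G :: "('a::{field,finite}^'n^'n) monoid"
  assumes G: "\<And>g. g \<in> carrier G \<Longrightarrow> invertible g" and rep: "representation G N \<rho>"
    and T: "in_perm_tensor_power G k N \<rho>" and vu: "v \<in> carrier_vec N" "u \<in> carrier_vec N"
  shows "\<exists>F. deg_le k F \<and> (\<forall>g\<in>carrier G. (\<rho> g *\<^sub>v v) \<bullet>c u = F g)"
proof -
  obtain T where T: "T \<in> carrier_vec N \<rightarrow> L2 (tuples k)"
    "\<forall>v\<in>carrier_vec N. \<forall>w\<in>carrier_vec N. T (v + w) = T v + T w"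
    "\<forall>c. \<forall>v\<in>carrier_vec N. T (c \<cdot>\<^sub>v v) = fscale c (T v)"
    "inj_on T (carrier_vec N)"
    "\<forall>g\<in>carrier G. \<forall>v\<in>carrier_vec N. T (\<rho> g *\<^sub>v v) = tensor_power k (perm_rep g) (T v)"
    using T unfolding in_perm_tensor_power_def subrepresentation_def by blast
  let ?L = "\<lambda>w. w \<bullet>c u"
  have cu: "conjugate u \<in> carrier_vec N" using vu(2) by simp
  have "\<exists>lam. \<forall>w\<in>carrier_vec N. ?L w = (\<Sum>x\<in>tuples k. lam x * T w x)"
  proof (rule functional_representation[OF finite_tuples T(1)])
    show "?L (v + w) = ?L v + ?L w" if "v \<in> carrier_vec N" "w \<in> carrier_vec N" for v w
      by (rule add_scalar_prod_distrib[OF that cu])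
    show "?L (c \<cdot>\<^sub>v v) = c * ?L v" if "v \<in> carrier_vec N" for c v
      by (rule smult_scalar_prod_distrib[OF that cu])
  qed (use T in auto)
  then obtain lam where lam: "\<And>w. w \<in> carrier_vec N \<Longrightarrow> ?L w = (\<Sum>x\<in>tuples k. lam x * T w x)" by blast
  define F where "F A = (\<Sum>xs\<in>tuples k. \<Sum>ys\<in>tuples k. (lam xs * T v ys) * (if map ((*v) A) ys = xs then 1 else 0))" for A :: "'a^'n^'n"
  have "deg_le k F"
    unfolding F_def
  proof (intro deg_le_sum deg_le_cmult)
    fix xs ys :: "('a^'n) list" assume "ys \<in> tuples k"
    then have "length ys = k" by (simp add: tuples_def)
    then show "deg_le k (\<lambda>A. if map ((*v) A) ys = xs then 1 else 0)" using deg_le_indicator_list[of ys xs] by simp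
  qed
  moreover have "(\<rho> g *\<^sub>v v) \<bullet>c u = F g" if g: "g \<in> carrier G" for g
  proof -
    obtain h where h: "g ** h = mat 1" "h ** g = mat 1"
      using G[OF g] unfolding invertible_def by blast
    have inv: "g ** matrix_inv g = mat 1" "matrix_inv g ** g = mat 1"
    proof -
      have "g ** matrix_inv g = mat 1 \<and> matrix_inv g ** g = mat 1"
        unfolding matrix_inv_def by (rule someI_ex) (use h in blast)
      then show "g ** matrix_inv g = mat 1" "matrix_inv g ** g = mat 1" by blast+
    qed
    have "\<rho> g *\<^sub>v v \<in> carrier_vec N" by (rule mult_mat_vec_carrier[OF representation_carrier[OF rep g] vu(1)])
    then have "(\<rho> g *\<^sub>v v) \<bullet>c u = (\<Sum>xs\<in>tuples k. lam xs * T (\<rho> g *\<^sub>v v) xs)" by (rule lam)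
    also have "\<dots> = (\<Sum>xs\<in>tuples k. lam xs * T v (map ((*v) (matrix_inv g)) xs))"
      using T(5) g vu(1) by (intro sum.cong refl) (simp add: tensor_power_perm_rep)
    also have "\<dots> = F g"
      unfolding F_def
    proof (rule sum.cong[OF refl])
      fix xs :: "('a^'n) list" assume xs: "xs \<in> tuples k"
      let ?zs = "map ((*v) (matrix_inv g)) xs"
      have zs: "?zs \<in> tuples k" using xs by (simp add: tuples_def)
      have iff: "map ((*v) g) ys = xs \<longleftrightarrow> ys = ?zs" for ys
      proof
        assume "map ((*v) g) ys = xs"
        then have "?zs = map ((*v) (matrix_inv g)) (map ((*v) g) ys)" by simp
        also have "\<dots> = ys" by (simp add: comp_def matrix_vector_mul_assoc inv)
        finally show "ys = ?zs" ..
      next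
        assume "ys = ?zs"
        then show "map ((*v) g) ys = xs" by (simp add: comp_def matrix_vector_mul_assoc inv)
      qed
      have "(\<Sum>ys\<in>tuples k. (lam xs * T v ys) * (if map ((*v) g) ys = xs then 1 else 0)) = (\<Sum>ys\<in>tuples k. if ys = ?zs then lam xs * T v ?zs else 0)"
        unfolding iff by (rule sum.cong) auto
      also have "\<dots> = lam xs * T v ?zs" using zs by (simp add: finite_tuples)
      finally show "lam xs * T v ?zs = (\<Sum>ys\<in>tuples k. (lam xs * T v ys) * (if map ((*v) g) ys = xs then 1 else 0))" ..
    qed
    finally show ?thesis .
  qed
  ultimately show ?thesis by blast
qed

lemma linear_character_mult:
  assumes "linear_character G \<psi>" "g \<in> carrier G" "h \<in> carrier G"
  shows "\<psi> (g \<otimes>\<^bsub>G\<^esub> h) = \<psi> g * \<psi> h" "\<psi> g \<noteq> 0"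
proof -
  have h: "\<psi> \<in> hom G (units_of (class_ring :: complex ring))" using assms(1) unfolding linear_character_def .
  show "\<psi> (g \<otimes>\<^bsub>G\<^esub> h) = \<psi> g * \<psi> h" using h assms(2,3) unfolding hom_def by (simp add: units_of_def class_ring_simps)
  have "\<psi> g \<in> Units (class_ring :: complex ring)" using h assms(2) unfolding hom_def by (auto simp: units_of_def)
  then show "\<psi> g \<noteq> 0" by (auto simp: Units_def class_ring_simps)
qed

text \<open>The twisting character is trivial on determinant-one matrices, so on the coset of h it
  is the constant given by its value at h. What remains is a function of degree at most d composed
  with right multiplication by h.\<close>

lemma L2_le_coset:
  fixes G :: "('a::{field,finite}^'n^'n) monoid"
  assumes n: "3 \<le> CARD('n)" and G: "G = special_linear \<or> G = general_linear"
    and h: "h \<in> carrier G" and F: "F \<in> L2_le G d"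
  shows "\<exists>u. deg_le d u \<and> (\<forall>A. det A = 1 \<longrightarrow> F (A ** h) = u A)"
proof -
  have mult: "g \<otimes>\<^bsub>G\<^esub> g' = g ** g'" for g g' using G by (auto simp: special_linear_def general_linear_def)
  have inv: "invertible g" if "g \<in> carrier G" for g
    using that G by (auto simp: special_linear_def general_linear_def invertible_det_nz)
  have SL: "A \<in> carrier G" if "det A = 1" for A
    using that G by (auto simp: special_linear_def general_linear_def invertible_det_nz)
  have Ah: "A ** h \<in> carrier G" if "det A = 1" for A
    using that G h by (auto simp: special_linear_def general_linear_def invertible_det_nz det_mul)
  let ?Y = "{F. \<exists>u. deg_le d u \<and> (\<forall>A. det A = 1 \<longrightarrow> F (A ** h) = u A)}"
  have "fun_space.subspace ?Y"
  proof (rule fun_space.subspaceI)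
    show "0 \<in> ?Y" using deg_le_const[of d 0] by (auto intro!: exI[of _ "\<lambda>_. 0"])
    fix s t assume "s \<in> ?Y" "t \<in> ?Y"
    then obtain u u' where "deg_le d u" "\<forall>A. det A = 1 \<longrightarrow> s (A ** h) = u A"
      "deg_le d u'" "\<forall>A. det A = 1 \<longrightarrow> t (A ** h) = u' A" by blast
    then show "s + t \<in> ?Y"
      using fun_space.subspace_add[OF subspace_deg_le, of u d u'] by (auto intro!: exI[of _ "u + u'"])
  next
    fix c s assume "s \<in> ?Y"
    then obtain u where "deg_le d u" "\<forall>A. det A = 1 \<longrightarrow> s (A ** h) = u A" by blast
    then show "fscale c s \<in> ?Y"
      using fun_space.subspace_scale[OF subspace_deg_le, of u d c] by (auto intro!: exI[of _ "fscale c u"] simp: fscale_def)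
  qed
  moreover have "{matrix_coeff G \<rho> v u | N \<rho> v u. (\<exists>k\<le>d. tensor_rank G N \<rho> k) \<and> v \<in> carrier_vec N \<and> u \<in> carrier_vec N} \<subseteq> ?Y"
  proof
    fix s assume "s \<in> {matrix_coeff G \<rho> v u | N \<rho> v u. (\<exists>k\<le>d. tensor_rank G N \<rho> k) \<and> v \<in> carrier_vec N \<and> u \<in> carrier_vec N}"
    then obtain N \<rho> v u k where s: "s = matrix_coeff G \<rho> v u" "k \<le> d" "tensor_rank G N \<rho> k" "v \<in> carrier_vec N" "u \<in> carrier_vec N"
      by blast
    then obtain \<rho>' \<psi> where \<rho>: "strict_tensor_rank G N \<rho>' k" "linear_character G \<psi>" "\<forall>g\<in>carrier G. \<rho> g = \<psi> g \<cdot>\<^sub>m \<rho>' g"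
      unfolding tensor_rank_def twist_of_strict_tensor_rank_def by blast
    have rep: "representation G N \<rho>'" "in_perm_tensor_power G k N \<rho>'"
      using \<rho>(1) unfolding strict_tensor_rank_def irreducible_rep_def by blast+
    obtain F where F: "deg_le k F" "\<And>g. g \<in> carrier G \<Longrightarrow> (\<rho>' g *\<^sub>v v) \<bullet>c u = F g"
      using coeff_deg_le[OF inv rep s(4,5)] by blast
    have cu: "conjugate u \<in> carrier_vec N" using s(5) by simp
    have "s (A ** h) = \<psi> h * rst (mat 1) h 0 F A" if A: "det A = 1" for A
    proof -
      note gA = Ah[OF A]
      have "\<psi> A = 1"
      proof (rule special_linear_character_trivial[OF n _ _ A])
        show "\<psi> (B ** C) = \<psi> B * \<psi> C" if "det B = 1" "det C = 1" for B C
          using linear_character_mult(1)[OF \<rho>(2) SL[OF that(1)] SL[OF that(2)]] by (simp only: mult)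
        show "\<psi> B \<noteq> 0" if "det B = 1" for B
          by (rule linear_character_mult(2)[OF \<rho>(2) SL[OF that] SL[OF that]])
      qed
      then have \<psi>: "\<psi> (A ** h) = \<psi> h" using linear_character_mult(1)[OF \<rho>(2) SL[OF A] h] by (simp add: mult)
      have \<rho>c: "\<rho>' (A ** h) \<in> carrier_mat N N" by (rule representation_carrier[OF rep(1) gA])
      have "s (A ** h) = ((\<psi> h \<cdot>\<^sub>m \<rho>' (A ** h)) *\<^sub>v v) \<bullet>c u"
        using gA \<rho>(3) by (simp add: s(1) matrix_coeff_def \<psi>)
      also have "\<dots> = \<psi> h * ((\<rho>' (A ** h) *\<^sub>v v) \<bullet>c u)"
        unfolding smult_mat_mult_vec[OF \<rho>c s(4)]
        by (rule smult_scalar_prod_distrib[OF mult_mat_vec_carrier[OF \<rho>c s(4)] cu])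
      finally show ?thesis using F(2)[OF gA] by (simp add: rst_def)
    qed
    moreover have "deg_le d (\<lambda>A. \<psi> h * rst (mat 1) h 0 F A)"
      by (rule deg_le_cmult[OF deg_le_rst[OF deg_le_mono[OF F(1) s(2)]]])
    ultimately show "s \<in> ?Y" by blast
  qed
  ultimately have "L2_le G d \<subseteq> ?Y" unfolding L2_le_def by (rule fun_space.span_minimal[rotated])
  then show ?thesis using F by blast
qed

lemma L2_le_subset: "L2_le G d \<subseteq> L2 (carrier G)"
  unfolding L2_le_def
proof (rule fun_space.span_minimal)
  show "fun_space.subspace (L2 (carrier G))"
    by (rule fun_space.subspaceI) (simp_all add: L2_def fscale_def)
qed (auto simp: L2_def matrix_coeff_def)

section \<open>The level inequality on the groups\<close>

lemma projection_contraction: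
  assumes X: "finite X" and h: "ip X (\<phi> - h) h = 0"
  shows "(\<Sum>x\<in>X. (cmod (h x))\<^sup>2) \<le> (\<Sum>x\<in>X. (cmod (\<phi> x))\<^sup>2)"
proof -
  define v where "v = \<phi> - h"
  have \<phi>: "\<phi> = v + h" by (simp add: v_def)
  have "ip X h v = 0" using h by (subst ip_commute) (simp add: v_def)
  then have "ip X \<phi> \<phi> = ip X v v + ip X h h"
    using h unfolding \<phi> ip_add_left ip_add_right by (simp add: v_def)
  then have "(\<Sum>x\<in>X. (cmod (\<phi> x))\<^sup>2) = (\<Sum>x\<in>X. (cmod (v x))\<^sup>2) + (\<Sum>x\<in>X. (cmod (h x))\<^sup>2)"
    unfolding ip_self of_real_add[symmetric] by (simp only: of_real_eq_iff)
  moreover have "0 \<le> (\<Sum>x\<in>X. (cmod (v x))\<^sup>2)" by (rule sum_nonneg) simp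
  ultimately show ?thesis by linarith
qed

lemma Re_ip_le: "2 * Re (ip X u w) \<le> (\<Sum>x\<in>X. (cmod (u x))\<^sup>2) + (\<Sum>x\<in>X. (cmod (w x))\<^sup>2)"
proof -
  have "2 * Re (u x * cnj (w x)) \<le> (cmod (u x))\<^sup>2 + (cmod (w x))\<^sup>2" for x
  proof -
    have "Re (u x * cnj (w x)) \<le> cmod (u x) * cmod (w x)"
      using complex_Re_le_cmod[of "u x * cnj (w x)"] by (simp add: norm_mult)
    moreover have "0 \<le> (cmod (u x) - cmod (w x))\<^sup>2" by simp
    ultimately show ?thesis by (simp add: power2_diff)
  qed
  then have "(\<Sum>x\<in>X. 2 * Re (u x * cnj (w x))) \<le> (\<Sum>x\<in>X. (cmod (u x))\<^sup>2 + (cmod (w x))\<^sup>2)" by (rule sum_mono)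
  then show ?thesis by (simp add: ip_def Re_sum sum_distrib_left sum.distrib)
qed

lemma exists_dyadic_scale:
  assumes "2 \<le> (x::real)"
  shows "\<exists>j. 2 ^ (j + 1) \<le> x \<and> x < 2 * 2 ^ (j + 1)"
proof -
  obtain m where m: "x < 2 ^ m" using real_arch_pow[of 2 x] by auto
  define k where "k = (LEAST m. x < 2 ^ m)"
  have k: "x < 2 ^ k" unfolding k_def by (rule LeastI[of "\<lambda>m. x < 2 ^ m", OF m])
  have "1 < k"
  proof (rule ccontr)
    assume "\<not> 1 < k"
    then have "(2::real) ^ k \<le> 2 ^ 1" by (intro power_increasing) simp_all
    then show False using k assms by simp
  qed
  then obtain j where j: "k = j + 2" using le_Suc_ex[of 2 k] by (metis One_nat_def Suc_leI add.commute numeral_2_eq_2)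
  have "\<not> x < 2 ^ (j + 1)"
    using not_less_Least[of "j + 1" "\<lambda>m. x < 2 ^ m"] unfolding k_def[symmetric] j by simp
  then show ?thesis using k unfolding j by (intro exI[of _ j]) simp
qed

lemma matrix_group_SL: "matrix_group {A :: 'a::{field,finite}^'n^'n. det A = 1}"
proof -
  have "\<exists>B. det B = 1 \<and> A ** B = mat 1 \<and> B ** A = mat 1"
    if A: "det A = 1" for A :: "'a^'n^'n"
  proof -
    obtain B where B: "A ** B = mat 1" "B ** A = mat 1"
      using A invertible_det_nz[of A] unfolding invertible_def by auto
    have "det B = 1" using arg_cong[OF B(1), of det] A by (simp add: det_mul)
    then show ?thesis using B by blast
  qed
  then show ?thesis by (simp add: matrix_group_def det_mul)
qed

lemma matrix_group_invertible: "matrix_group {A :: 'a::{field,finite}^'n^'n. invertible A}"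
proof -
  have "\<exists>B. invertible B \<and> A ** B = mat 1 \<and> B ** A = mat 1"
    if A: "invertible A" for A :: "'a^'n^'n"
    using A unfolding invertible_def by blast
  then show ?thesis by (simp add: matrix_group_def invertible_det_nz det_mul)
qed

lemma density_cancel: "N \<noteq> 0 \<Longrightarrow> N\<^sup>2 * (D * (Q * (R * (s / N) * e))) = N * (D * Q * R * (e * s))"
  for N :: real
  by (simp add: field_simps power2_eq_square)

text \<open>Let p be dyadic with p d <= t <= 2 p d. Then 9 p^2 d^2 <= 9 p d t and t^2 <= 2 p d t, so
  R = q^(11 d t) meets the requirement of \<open>level_inequality\<close>. In the result R^2 gives
  22 d t, and the remaining 4 d t covers the density loss 2 q, the number d + 1 of ranks and the
  factor q^(d^2) from \<open>transfer_level\<close>.\<close>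

lemma coset_level_bound:
  fixes X :: "('a::{field,finite}^'n^'n) set" and \<phi> :: "'a^'n^'n \<Rightarrow> real"
  defines "q \<equiv> real CARD('a)"
  assumes X: "matrix_group X" and d: "1 \<le> d" "d \<le> CARD('n)"
    and \<phi>: "\<And>A. A \<in> X \<Longrightarrow> \<phi> A \<in> {0, 1}" and J: "\<And>A. J A = (if A \<in> X then complex_of_real (\<phi> A) else 0)"
    and g: "\<And>S P T. corank S + corank P \<le> d \<Longrightarrow> EE (\<lambda>A. cmod (rst S P T J A)) \<le> \<epsilon>"
    and e: "q powr (- (t\<^sup>2)) \<le> \<epsilon>" and t: "2 * real d \<le> t"
    and dens: "real CARD('a^'n^'n) \<le> 2 * q * real (card X)"
  shows "\<exists>u. deg_le d u \<and> (\<forall>w. deg_le d w \<longrightarrow> ip X ((\<lambda>A. complex_of_real (\<phi> A)) - u) w = 0) \<and>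
    (\<Sum>A\<in>X. (cmod (u A))\<^sup>2) \<le> q powr (26 * real d * t) * \<epsilon> * (\<Sum>A\<in>X. \<phi> A)"
proof -
  let ?N = "real CARD('a^'n^'n)"
  have q2: "2 \<le> q" unfolding q_def using card_field_ge_2[where 'a='a] by linarith
  then have q1: "1 \<le> q" "1 < q" "0 < q" by linarith+
  have d1: "1 \<le> real d" using d(1) by simp
  have t0: "0 < t" using t d1 by linarith
  have e0: "0 < \<epsilon>" using e q1 powr_gt_zero[of q "- (t\<^sup>2)"] by linarith
  have "2 \<le> t / real d" using t d1 by (simp add: pos_le_divide_eq)
  from exists_dyadic_scale[OF this] obtain j where j: "2 ^ (j + 1) \<le> t / real d" "t / real d < 2 * 2 ^ (j + 1)" by blast
  define p where "p = (2::nat) ^ (j + 1)"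
  have p: "real p * real d \<le> t" "t \<le> 2 * real p * real d"
    using j d1 unfolding p_def by (simp_all add: pos_le_divide_eq pos_divide_less_eq)
  define R where "R = q powr (11 * real d * t)"
  have R0: "0 < R" unfolding R_def using q1 by simp
  have RW: "real CARD('a) ^ (9 * (2 ^ (j + 1))\<^sup>2 * d\<^sup>2) \<le> R ^ (2 ^ (j + 1)) * \<epsilon>"
  proof -
    have "real (9 * p\<^sup>2 * d\<^sup>2) = 9 * (real p * real d) * (real p * real d)" by (simp add: power2_eq_square)
    also have "\<dots> \<le> 9 * (real p * real d) * t" by (rule mult_left_mono[OF p(1)]) simp
    finally have a: "real (9 * p\<^sup>2 * d\<^sup>2) \<le> 9 * (real p * real d) * t" .
    have "t\<^sup>2 \<le> (2 * real p * real d) * t" unfolding power2_eq_square by (rule mult_right_mono[OF p(2)]) (use t0 in simp)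
    with a have "real (9 * p\<^sup>2 * d\<^sup>2) \<le> real p * (11 * real d * t) + - (t\<^sup>2)" by (simp add: algebra_simps)
    then have "q powr real (9 * p\<^sup>2 * d\<^sup>2) \<le> q powr (real p * (11 * real d * t) + - (t\<^sup>2))"
      by (rule powr_mono) (rule q1(1))
    also have "\<dots> = R ^ p * q powr (- (t\<^sup>2))"
      unfolding powr_add R_def using q1 by (simp add: powr_power mult.commute)
    also have "\<dots> \<le> R ^ p * \<epsilon>" by (rule mult_left_mono[OF e]) (use R0 in simp)
    finally show ?thesis unfolding p_def[symmetric] q_def[symmetric] using q1 by (simp only: powr_realpow)
  qed
  obtain u where u: "deg_le d u" "\<forall>w. deg_le d w \<longrightarrow> ip X ((\<lambda>A. complex_of_real (\<phi> A)) - u) w = 0"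
    "real (card X) * (\<Sum>g\<in>X. (cmod (u g))\<^sup>2) \<le> ?N\<^sup>2 * (\<Sum>r\<le>d. real CARD('a) ^ r\<^sup>2 * sq (pr r J))"
    using degree_projection_bound[OF X J d(2)] by blast
  have Jv: "J A \<in> {0, 1}" for A using \<phi>[of A] by (auto simp: J)
  define s where "s = (\<Sum>A\<in>X. \<phi> A)"
  have s0: "0 \<le> s" unfolding s_def by (rule sum_nonneg) (use \<phi> in force)
  have "(\<Sum>A\<in>UNIV. cmod (J A)) = (\<Sum>A\<in>X. \<phi> A)"
    by (rule sum.mono_neutral_cong_right) (use \<phi> in \<open>force simp: J\<close>)+
  then have mJ: "EE (\<lambda>A. cmod (J A)) = s / ?N" by (simp only: mean_def s_def)
  have N0: "0 < ?N" by simp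
  define K where "K = q powr (26 * real d * t)"
  have lev: "real CARD('a) ^ r\<^sup>2 * sq (pr r J) \<le> q ^ d\<^sup>2 * (R\<^sup>2 * (s / ?N) * \<epsilon>)" if r: "r \<le> d" for r
  proof (rule mult_mono)
    have "r\<^sup>2 \<le> d\<^sup>2" by (rule power_mono[OF r]) simp
    then show "real CARD('a) ^ r\<^sup>2 \<le> q ^ d\<^sup>2" unfolding q_def[symmetric] by (rule power_increasing[OF _ q1(1)])
    show "sq (pr r J) \<le> R\<^sup>2 * (s / ?N) * \<epsilon>"
      unfolding mJ[symmetric] by (rule level_inequality[OF Jv g r order_refl e0 R0 RW d(1)])
  qed (use q1 in simp_all)
  have cX: "0 < real (card X)" using X unfolding matrix_group_def by (auto simp: card_gt_0_iff)
  have "(\<Sum>r\<le>d. real CARD('a) ^ r\<^sup>2 * sq (pr r J)) \<le> (\<Sum>r\<le>d. q ^ d\<^sup>2 * (R\<^sup>2 * (s / ?N) * \<epsilon>))"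
    by (rule sum_mono) (rule lev, simp)
  also have "\<dots> = real (d + 1) * (q ^ d\<^sup>2 * (R\<^sup>2 * (s / ?N) * \<epsilon>))" by simp
  finally have "?N\<^sup>2 * (\<Sum>r\<le>d. real CARD('a) ^ r\<^sup>2 * sq (pr r J)) \<le> ?N\<^sup>2 * (real (d + 1) * (q ^ d\<^sup>2 * (R\<^sup>2 * (s / ?N) * \<epsilon>)))"
    by (rule mult_left_mono) simp
  also have "\<dots> = ?N * (real (d + 1) * q ^ d\<^sup>2 * R\<^sup>2 * (\<epsilon> * s))"
    by (rule density_cancel) (rule less_imp_neq[OF N0, THEN not_sym])
  finally have "real (card X) * (\<Sum>g\<in>X. (cmod (u g))\<^sup>2) \<le> ?N * (real (d + 1) * q ^ d\<^sup>2 * R\<^sup>2 * (\<epsilon> * s))"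
    using u(3) by linarith
  also have "\<dots> \<le> (2 * q * real (card X)) * (real (d + 1) * q ^ d\<^sup>2 * R\<^sup>2 * (\<epsilon> * s))"
    by (rule mult_right_mono[OF dens]) (use q1 e0 s0 in simp)
  also have "\<dots> = real (card X) * ((2 * q * real (d + 1) * q ^ d\<^sup>2 * R\<^sup>2) * (\<epsilon> * s))" by (simp only: mult_ac)
  finally have "(\<Sum>g\<in>X. (cmod (u g))\<^sup>2) \<le> (2 * q * real (d + 1) * q ^ d\<^sup>2 * R\<^sup>2) * (\<epsilon> * s)"
    by (rule mult_left_le_imp_le[OF _ cX])
  also have "\<dots> \<le> K * (\<epsilon> * s)"
  proof (rule mult_right_mono)
    have "d + 1 \<le> 2 ^ d" by (induction d) auto
    then have "real (d + 1) \<le> real (2 ^ d)" by (rule of_nat_mono)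
    also have "real (2 ^ d) = 2 ^ d" by simp
    also have "\<dots> \<le> q ^ d" by (rule power_mono[OF q2]) simp
    finally have dq: "real (d + 1) \<le> q ^ d" .
    have "2 * q * real (d + 1) * q ^ d\<^sup>2 \<le> q * q * q ^ d * q ^ d\<^sup>2"
      by (intro mult_right_mono mult_mono dq q2) (use q1 in simp_all)
    also have "\<dots> = q ^ (1 + 1 + d + d\<^sup>2)" by (simp only: power_add power_one_right)
    also have "\<dots> \<le> q ^ (4 * d\<^sup>2)"
    proof (rule power_increasing[OF _ q1(1)])
      have "d \<le> d\<^sup>2" "1 \<le> d\<^sup>2" using d(1) by (simp_all add: power2_eq_square)
      then show "1 + 1 + d + d\<^sup>2 \<le> 4 * d\<^sup>2" by linarith
    qed
    also have "\<dots> = q powr real (4 * d\<^sup>2)" using q1 by (simp only: powr_realpow)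
    also have "\<dots> \<le> q powr (4 * real d * t)"
    proof (rule powr_mono[OF _ q1(1)])
      have "real d * real d \<le> real d * t" by (rule mult_left_mono) (use t d1 in linarith)+
      then show "real (4 * d\<^sup>2) \<le> 4 * real d * t" by (simp add: power2_eq_square)
    qed
    finally have a: "2 * q * real (d + 1) * q ^ d\<^sup>2 \<le> q powr (4 * real d * t)" .
    have "R\<^sup>2 = q powr (22 * real d * t)"
      unfolding R_def using q1 by (simp add: powr_power mult_ac)
    then have "2 * q * real (d + 1) * q ^ d\<^sup>2 * R\<^sup>2 \<le> q powr (4 * real d * t) * q powr (22 * real d * t)"
      using mult_right_mono[OF a, of "R\<^sup>2"] by simp
    also have "\<dots> = K" unfolding K_def powr_add[symmetric] by (simp add: algebra_simps)
    finally show "2 * q * real (d + 1) * q ^ d\<^sup>2 * R\<^sup>2 \<le> K" .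
  qed (use e0 s0 in simp)
  finally show ?thesis using u(1,2) unfolding K_def s_def mult.assoc[symmetric] by blast
qed

theorem theorem6p12:
  fixes G :: "('a::{field,finite}^'n^'n) monoid"
    and f :: "'a^'n^'n \<Rightarrow> real"
    and d :: nat and t \<epsilon> :: real
  assumes "G = special_linear \<or> G = general_linear"
    and "1 \<le> d" and "d \<le> CARD('n)"
    and "t > 0"
    and "\<forall>A\<in>carrier G. f A \<in> {0, 1}"
    and "is_global G d \<epsilon> (\<lambda>A. complex_of_real (f A))"
    and "\<epsilon> \<ge> real CARD('a) powr (- (t\<^sup>2))"
  shows "(L2_norm (carrier G) (level_proj G d (\<lambda>A. complex_of_real (f A))))\<^sup>2
         \<le> real CARD('a) powr (926 * real d * t) * mean (carrier G) f * \<epsilon>"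
proof -
  let ?q = "real CARD('a)" and ?C = "carrier G" and ?f = "\<lambda>A. complex_of_real (f A)"
  let ?N = "real CARD('a^'n^'n)"
  define X where "X = {A :: 'a^'n^'n. det A = 1}"
  define h where "h = level_proj G d ?f"
  have q2: "2 \<le> ?q" using card_field_ge_2[where 'a='a] by linarith
  then have q1: "1 \<le> ?q" "1 < ?q" "0 < ?q" by linarith+
  have d1: "1 \<le> real d" using assms(2) by simp
  have C: "matrix_group ?C"
    using assms(1) matrix_group_SL matrix_group_invertible by (auto simp: special_linear_def general_linear_def)
  have X: "matrix_group X" unfolding X_def by (rule matrix_group_SL)
  have XC: "A ** g \<in> ?C" if "A \<in> X" "g \<in> ?C" for A g
    using that assms(1) by (auto simp: X_def special_linear_def general_linear_def invertible_det_nz det_mul)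
  have XC': "A \<in> ?C" if "A \<in> X" for A
    using that assms(1) by (auto simp: X_def special_linear_def general_linear_def invertible_det_nz)
  have inv: "invertible g" if "g \<in> ?C" for g
    using that assms(1) by (auto simp: special_linear_def general_linear_def invertible_det_nz)
  have Cne: "?C \<noteq> {}" using C unfolding matrix_group_def by blast
  have cC: "0 < real (card ?C)" using Cne by (simp add: card_gt_0_iff)
  have cX: "0 < real (card X)" using X unfolding matrix_group_def by (auto simp: card_gt_0_iff)
  have L: "fun_space.subspace (L2_le G d)" unfolding L2_le_def by (rule fun_space.subspace_span)
  have h: "h \<in> L2_le G d" "ip ?C (?f - h) h = 0"
    unfolding h_def level_proj_def
    by (rule orth_proj_props(1)[OF Cne L L2_le_subset],
        rule orth_proj_props(2)[OF Cne L L2_le_subset orth_proj_props(1)[OF Cne L L2_le_subset]])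
  define H where "H = (\<Sum>A\<in>?C. (cmod (h A))\<^sup>2)"
  define F where "F = (\<Sum>A\<in>?C. f A)"
  have f01: "f A \<in> {0, 1}" if "A \<in> ?C" for A using assms(5) that by blast
  have F0: "0 \<le> F" unfolding F_def by (rule sum_nonneg) (use f01 in force)
  have "(\<Sum>A\<in>?C. (cmod (?f A))\<^sup>2) = F" unfolding F_def by (rule sum.cong) (use f01 in force)+
  then have HF: "H \<le> F" using projection_contraction[OF _ h(2)] unfolding H_def by simp
  have H0: "0 \<le> H" unfolding H_def by (rule sum_nonneg) simp
  have norm: "(L2_norm ?C h)\<^sup>2 = H / real (card ?C)"
    using H0 by (simp add: L2_norm_def mean_def H_def)
  have e0: "0 < \<epsilon>" using assms(7) powr_gt_zero[of ?q "- (t\<^sup>2)"] q1 by linarith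
  let ?K = "?q powr (926 * real d * t)"
  have "H \<le> ?K * \<epsilon> * F"
  proof (cases "1 \<le> ?K * \<epsilon> \<or> F = 0")
    case True
    then show ?thesis using HF F0 mult_right_mono[of 1 "?K * \<epsilon>" F] by auto
  next
    case False
    then have K1: "?K * \<epsilon> < 1" and Fn: "F \<noteq> 0" by auto
    let ?j = "zero_extension G ?f"
    \<comment> \<open>A single point of the support already forces \<epsilon> >= 1/N = q^(-(n^2)),
      which bounds d t in terms of n in the remaining case.\<close>
    obtain A0 where A0: "A0 \<in> ?C" "f A0 = 1"
      using Fn f01 unfolding F_def by (metis insertE singletonD sum.neutral)
    have glob: "EE (\<lambda>A. (cmod (?j (T + S ** A ** P)))\<^sup>2) \<le> \<epsilon>" if "corank S + corank P \<le> d" for S P T :: "'a^'n^'n"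
      by (rule global_rst[OF assms(6,3) that])
    have "1 / ?N \<le> EE (\<lambda>A. (cmod (?j A))\<^sup>2)"
      unfolding mean_def
    proof (rule divide_right_mono)
      have "1 = (cmod (?j A0))\<^sup>2" using A0 by (simp add: zero_extension_def)
      also have "\<dots> \<le> (\<Sum>A\<in>UNIV. (cmod (?j A))\<^sup>2)" by (rule member_le_sum) simp_all
      finally show "1 \<le> (\<Sum>A\<in>UNIV. (cmod (?j A))\<^sup>2)" .
    qed simp
    also have "\<dots> \<le> \<epsilon>" using glob[of "mat 1" "mat 1" 0] by simp
    finally have eN: "1 / ?N \<le> \<epsilon>" .
    have N: "?N = ?q powr ((real CARD('n))\<^sup>2)"
    proof -
      have "?N = ?q ^ (CARD('n) * CARD('n))" by (simp add: card_vec_space power_mult[symmetric])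
      also have "\<dots> = ?q powr real (CARD('n) * CARD('n))" using q1 by (simp only: powr_realpow)
      finally show ?thesis by (simp only: of_nat_mult power2_eq_square)
    qed
    have "?q powr (- ((real CARD('n))\<^sup>2)) \<le> \<epsilon>" using eN unfolding N by (simp only: powr_minus_divide)
    then have "?K * ?q powr (- ((real CARD('n))\<^sup>2)) \<le> ?K * \<epsilon>" by (rule mult_left_mono) simp
    then have "?K * ?q powr (- ((real CARD('n))\<^sup>2)) < 1" using K1 by (rule order_le_less_trans)
    then have "?q powr (926 * real d * t + - ((real CARD('n))\<^sup>2)) < ?q powr 0" using q1 by (simp only: powr_add powr_zero_eq_one) simp
    then have nt: "926 * real d * t < (real CARD('n))\<^sup>2" using q1 by (simp only: powr_less_cancel_iff)
    have "?K * ?q powr (- (t\<^sup>2)) \<le> ?K * \<epsilon>" by (rule mult_left_mono[OF assms(7)]) simp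
    then have "?K * ?q powr (- (t\<^sup>2)) < 1" using K1 by (rule order_le_less_trans)
    then have "?q powr (926 * real d * t + - (t\<^sup>2)) < ?q powr 0" using q1 by (simp only: powr_add powr_zero_eq_one) simp
    then have "926 * real d * t < t * t" using q1 by (simp only: powr_less_cancel_iff power2_eq_square)
    then have td: "926 * real d < t" using assms(4) by (simp only: mult_less_cancel_right_pos)
    \<comment> \<open>From 926 d < t and 926 d t < n^2 it follows that n is large, in particular in
      the range where linear characters are trivial on SL.\<close>
    have n3: "3 \<le> CARD('n)"
    proof (rule ccontr)
      assume "\<not> 3 \<le> CARD('n)"
      then have "real CARD('n) \<le> 2" by linarith
      then have "(real CARD('n))\<^sup>2 \<le> 2\<^sup>2" by (rule power_mono) simp
      moreover have "926 * 1 * 926 \<le> 926 * real d * t" by (intro mult_mono) (use d1 td in linarith)+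
      ultimately show False using nt by simp
    qed
    have "CARD('a^'n^'n) \<le> 2 * CARD('a) * card X" unfolding X_def by (rule card_special_linear_ge)
    then have "?N \<le> real (2 * CARD('a) * card X)" by (rule of_nat_mono)
    then have dens: "?N \<le> 2 * ?q * real (card X)" by (simp only: of_nat_mult of_nat_numeral)
    let ?B = "?q powr (26 * real d * t)"
    \<comment> \<open>On the coset h is a function w of degree at most d, so f can be exchanged for
      its degree projection u in the inner product with h. The arithmetic-geometric mean inequality
      leaves the energy of h on the right; after summation over g it is absorbed by the 2 H on the
      left.\<close>
    have coset: "2 * Re (ip X (\<lambda>A. ?f (A ** g)) (\<lambda>A. h (A ** g))) \<le> ?B * \<epsilon> * (\<Sum>A\<in>X. f (A ** g)) + (\<Sum>A\<in>X. (cmod (h (A ** g)))\<^sup>2)"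
      if g: "g \<in> ?C" for g
    proof -
      define J where "J A = (if A \<in> X then complex_of_real (f (A ** g)) else 0)" for A
      have cg: "corank g = 0" using inv[OF g] by (simp only: corank_eq_0_invertible)
      have Jg: "EE (\<lambda>A. cmod (rst S P T J A)) \<le> \<epsilon>" if "corank S + corank P \<le> d" for S P T :: "'a^'n^'n"
      proof -
        have "cmod (rst S P T J A) \<le> (cmod (?j (T ** g + S ** A ** (P ** g))))\<^sup>2" for A
        proof -
          have eq: "T ** g + S ** A ** (P ** g) = (T + S ** A ** P) ** g"
            by (simp only: matrix_add_rdistrib_gen matrix_mul_assoc)
          have "cmod (J B) \<le> (cmod (?j (B ** g)))\<^sup>2" for B
            using XC[OF _ g, of B] f01[of "B ** g"] by (auto simp: J_def zero_extension_def)
          then show ?thesis unfolding eq rst_def .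
        qed
        then have "EE (\<lambda>A. cmod (rst S P T J A)) \<le> EE (\<lambda>A. (cmod (?j (T ** g + S ** A ** (P ** g))))\<^sup>2)" by (intro mean_mono)
        also have "\<dots> \<le> \<epsilon>" by (rule glob) (use that corank_mult[of P g] cg in linarith)
        finally show ?thesis .
      qed
      have "2 * real d \<le> t" using td d1 by linarith
      from coset_level_bound[OF X assms(2,3), of "\<lambda>A. f (A ** g)" J \<epsilon> t, OF _ J_def Jg assms(7) this dens]
      obtain u where u: "deg_le d u" "\<forall>w. deg_le d w \<longrightarrow> ip X ((\<lambda>A. ?f (A ** g)) - u) w = 0"
        "(\<Sum>A\<in>X. (cmod (u A))\<^sup>2) \<le> ?B * \<epsilon> * (\<Sum>A\<in>X. f (A ** g))"
        using f01 XC[OF _ g] by blast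
      obtain w where w: "deg_le d w" "\<forall>A. det A = 1 \<longrightarrow> h (A ** g) = w A"
        using L2_le_coset[OF n3 assms(1) g h(1)] by blast
      have wX: "h (A ** g) = w A" if "A \<in> X" for A using w(2) that unfolding X_def by blast
      have "ip X (\<lambda>A. ?f (A ** g)) w = ip X u w" using u(2) w(1) ip_diff_left[of X "\<lambda>A. ?f (A ** g)" u w] by simp
      moreover have "ip X (\<lambda>A. ?f (A ** g)) (\<lambda>A. h (A ** g)) = ip X (\<lambda>A. ?f (A ** g)) w"
        unfolding ip_def by (rule sum.cong) (simp_all add: wX)
      moreover have "(\<Sum>A\<in>X. (cmod (h (A ** g)))\<^sup>2) = (\<Sum>A\<in>X. (cmod (w A))\<^sup>2)"
        by (rule sum.cong) (simp_all add: wX)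
      ultimately show ?thesis using Re_ip_le[of X u w] u(3) by simp
    qed
    \<comment> \<open>Summing over all g instead of coset representatives counts every group element
      |X| times, a factor that cancels at the end.\<close>
    have tot: "(\<Sum>g\<in>?C. \<Sum>A\<in>X. V (A ** g)) = real (card X) * (\<Sum>g\<in>?C. V g)" for V :: "'a^'n^'n \<Rightarrow> real"
    proof -
      have "(\<Sum>g\<in>?C. \<Sum>A\<in>X. V (A ** g)) = (\<Sum>A\<in>X. \<Sum>g\<in>?C. V (A ** g))" by (rule sum.swap)
      also have "\<dots> = (\<Sum>A\<in>X. \<Sum>g\<in>?C. V g)"
        by (rule sum.cong[OF refl]) (rule matrix_group_sum_left[OF C XC'])
      finally show ?thesis by simp
    qed
    have "Re (ip ?C ?f h) = H"
    proof -
      have "ip ?C ?f h = ip ?C h h" using h(2) by (simp only: ip_diff_left right_minus_eq)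
      then show ?thesis unfolding ip_self H_def by simp
    qed
    then have H: "(\<Sum>g\<in>?C. Re (?f g * cnj (h g))) = H" by (simp only: ip_def Re_sum)
    have "(\<Sum>g\<in>?C. 2 * Re (ip X (\<lambda>A. ?f (A ** g)) (\<lambda>A. h (A ** g))))
        \<le> (\<Sum>g\<in>?C. ?B * \<epsilon> * (\<Sum>A\<in>X. f (A ** g)) + (\<Sum>A\<in>X. (cmod (h (A ** g)))\<^sup>2))"
      by (rule sum_mono[OF coset])
    also have "\<dots> = ?B * \<epsilon> * (real (card X) * F) + real (card X) * H"
      unfolding sum.distrib sum_distrib_left[symmetric] tot[of f] tot[of "\<lambda>A. (cmod (h A))\<^sup>2"] F_def H_def ..
    finally have le: "(\<Sum>g\<in>?C. 2 * Re (ip X (\<lambda>A. ?f (A ** g)) (\<lambda>A. h (A ** g)))) \<le> ?B * \<epsilon> * (real (card X) * F) + real (card X) * H" .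
    have "(\<Sum>g\<in>?C. 2 * Re (ip X (\<lambda>A. ?f (A ** g)) (\<lambda>A. h (A ** g)))) = 2 * (real (card X) * H)"
      unfolding sum_distrib_left[symmetric] ip_def Re_sum tot[of "\<lambda>g. Re (?f g * cnj (h g))"] H ..
    with le have "real (card X) * H \<le> real (card X) * (?B * \<epsilon> * F)" by (simp add: algebra_simps)
    then have "H \<le> ?B * \<epsilon> * F" by (rule mult_left_le_imp_le[OF _ cX])
    also have "\<dots> \<le> ?K * \<epsilon> * F"
    proof -
      have "26 * (real d * t) \<le> 926 * (real d * t)"
        by (rule mult_right_mono) (use assms(4) in simp_all)
      then have "?B \<le> ?K" by (intro powr_mono q1(1)) (simp only: mult.assoc)
      then have "?B * \<epsilon> \<le> ?K * \<epsilon>" by (rule mult_right_mono) (rule less_imp_le[OF e0])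
      then show ?thesis by (rule mult_right_mono[OF _ F0])
    qed
    finally show ?thesis .
  qed
  then have "H / real (card ?C) \<le> ?K * \<epsilon> * F / real (card ?C)" by (rule divide_right_mono) simp
  also have "\<dots> = ?K * mean ?C f * \<epsilon>" by (simp add: mean_def F_def)
  finally show ?thesis unfolding h_def[symmetric] norm .
qed

end
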